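(* Let $\mathbb{K}$ be a field of characteristic $0$. There exist a cooperad $\mathscr{C}$, an operad $\mathscr{P}$ and a Koszul twisting morphism $\alpha:\mathscr{C}\to\mathscr{P}$ for which there is no bifunctor $$\hom^\alpha:(\mathsf{conil.}\ \infty_\alpha\text{-}\mathscr{C}\text{-}\mathsf{cog})^{op}\times\infty_\alpha\text{-}\mathscr{P}\text{-}\mathsf{alg}\longrightarrow\infty\text{-}\mathcal{s}\mathscr{L}_\infty\text{-}\mathsf{alg}$$ that restricts to the bifunctors $$\hom^\alpha_\ell:(\mathsf{conil.}\ \infty_\alpha\text{-}\mathscr{C}\text{-}\mathsf{cog})^{op}\times\mathscr{P}\text{-}\mathsf{alg}\to\infty\text{-}\mathcal{s}\mathscr{L}_\infty\text{-}\mathsf{alg},\qquad \hom^\alpha_r:(\mathsf{conil.}\ \mathscr{C}\text{-}\mathsf{cog})^{op}\times\infty_\alpha\text{-}\mathscr{P}\text{-}\mathsf{alg}\to\infty\text{-}\mathcal{s}\mathscr{L}_\infty\text{-}\mathsf{alg}$$ (defined in the context) on the respective subcategories.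
   Context: Conventions. Everything is over chain complexes (differentials of degree $-1$) over $\mathbb{K}$, with Koszul signs. Operads and cooperads are symmetric and reduced ($0$ in arity $0$, $\mathbb{K}\,\mathrm{id}$ in arity $1$); all cooperads and coalgebras are conilpotent. For an $\mathbb{S}$-module $M$ put $M(V)=\bigoplus_n M(n)\otimes_{\mathbb{S}_n}V^{\otimes n}$; invariants are identified with coinvariants, so a $\mathscr{C}$-coalgebra $D$ has structure map $\Delta_D:D\to\mathscr{C}(D)$ and a $\mathscr{P}$-algebra $A$ has structure map $\gamma_A:\mathscr{P}(A)\to A$. $\mathrm{proj}_n$ denotes projection to the summand of arity $n$, and $\Delta_D^n=\mathrm{proj}_n\Delta_D$. Twisting morphism: a degree $-1$ $\mathbb{S}$-equivariant map $\alpha:\mathscr{C}\to\mathscr{P}$ with $\partial(\alpha)+\frac12[\alpha,\alpha]=0$, where $[f,g]=f\star g-(-1)^{|f||g|}g\star f$ and $f\star g=\gamma_{(1)}(f\circ_{(1)}g)\Delta_{(1)}$. It is Koszul if the Koszul complex $\mathscr{C}\circ_\alpha\mathscr{P}$ is acyclic. Bar/cobar. $\mathrm{B}_\alpha A$ is the cofree $\mathscr{C}$-coalgebra $\mathscr{C}(A)$ with codifferential $d_1+d_2$, $d_1$ induced by $d_{\mathscr{C}},d_A$ and $d_2$ the unique coderivation extending $\mathscr{C}(A)\xrightarrow{\alpha\circ1}\mathscr{P}(A)\xrightarrow{\gamma_A}A$. $\Omega_\alpha D$ is the free $\mathscr{P}$-algebra $\mathscr{P}(D)$ with differential $d_1+d_2$,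 $d_1$ induced by $d_{\mathscr{P}},d_D$ and $-d_2$ the unique derivation extending $D\xrightarrow{\Delta_D}\mathscr{C}(D)\xrightarrow{\alpha\circ1}\mathscr{P}(D)$. Categories. $\mathscr{P}\text{-}\mathsf{alg}$ and $\mathsf{conil.}\ \mathscr{C}\text{-}\mathsf{cog}$ have strict morphisms. $\infty_\alpha\text{-}\mathscr{P}\text{-}\mathsf{alg}$ has $\mathscr{P}$-algebras as objects, and morphisms $\Psi:A\rightsquigarrow A'$ are dg $\mathscr{C}$-coalgebra morphisms $\Psi:\mathrm{B}_\alpha A\to\mathrm{B}_\alpha A'$ (determined by the projection $\mathscr{C}(A)\to A'$, also denoted $\Psi$). $\mathsf{conil.}\ \infty_\alpha\text{-}\mathscr{C}\text{-}\mathsf{cog}$ has conilpotent $\mathscr{C}$-coalgebras as objects, and morphisms $\Phi:D'\rightsquigarrow D$ are dg $\mathscr{P}$-algebra morphisms $\Phi:\Omega_\alpha D'\to\Omega_\alpha D$ (determined by the restriction $\Phi:D'\to\mathscr{P}(D)$, with components $\phi_n=\mathrm{proj}_n\Phi$). Composition is the usual one; strict morphisms are regarded as $\infty_\alpha$-morphisms via $\mathrm{B}_\alpha$, $\Omega_\alpha$. A shifted $L_\infty$-algebra (algebra over $\mathcal{s}\mathscr{L}_\infty=\Omega\mathrm{Com}^\vee$) is a chain complex $\mathfrak{g}$ with graded symmetric degree $-1$ operations $\ell_n$, $n\ge2$, such that, with $\ell_1=d$, for all $n\ge1$, $\sum_{n_1+n_2=n+1,\ \sigma\in\mathrm{Sh}(n_2,n_1-1)}(\ell_{n_1}\circ_1\ell_{n_2})^\sigma=0$.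 $\mathrm{B}_\iota\mathfrak{g}=\bigoplus_{n\ge1}(\mathfrak{g}^{\otimes n})_{\mathbb{S}_n}$ is the cofree conilpotent cocommutative coalgebra (unshuffle coproduct) with codifferential the coderivation with corestriction $\sum_{n\ge1}\ell_n$; the class of $f_1\otimes\cdots\otimes f_n$ is written $\mu_n^\vee\otimes f_1\otimes\cdots\otimes f_n$. $\infty\text{-}\mathcal{s}\mathscr{L}_\infty\text{-}\mathsf{alg}$ has as morphisms $\mathfrak{g}\rightsquigarrow\mathfrak{h}$ the dg coalgebra morphisms $\mathrm{B}_\iota\mathfrak{g}\to\mathrm{B}_\iota\mathfrak{h}$. Action of $F$. For homogeneous $f_1,\dots,f_n\in\hom(D,A)$ put $F=f_1\otimes\cdots\otimes f_n$. For $M=\mathscr{P}$ or $\mathscr{C}$, $F:M(n)\otimes_{\mathbb{S}_n}D^{\otimes n}\to M(n)\otimes_{\mathbb{S}_n}A^{\otimes n}$ sends $p\otimes x_1\otimes\cdots\otimes x_n$ to $\sum_{\sigma\in\mathbb{S}_n}(-1)^\theta p\otimes f_{\sigma(1)}(x_1)\otimes\cdots\otimes f_{\sigma(n)}(x_n)$, with $\theta=|p||F|+\sigma(F)+\sum_i|x_i|\sum_{j>i}|f_{\sigma(j)}|$, where $(-1)^{\sigma(F)}$ is the Koszul sign of reordering $f_1\otimes\cdots\otimes f_n$ into $f_{\sigma(1)}\otimes\cdots\otimes f_{\sigma(n)}$. Bifunctors. On objects both send $(D,A)$ to $\hom^\alpha(D,A)$, the chain complex $\hom(D,A)$ with $\ell_n(f_1,\dots,f_n)=\gamma_A(\alpha\circ1_A)F\Delta_D^n$,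 $n\ge2$. On strict morphisms they act by pre- and post-composition. For an $\infty_\alpha$-morphism $\Phi:D'\rightsquigarrow D$, $\hom^\alpha_\ell(\Phi,1):\mathrm{B}_\iota\hom^\alpha(D,A)\to\mathrm{B}_\iota\hom^\alpha(D',A)$ is the coalgebra morphism whose projection to $\hom(D',A)$ is $\mu_n^\vee\otimes F\mapsto\gamma_AF\phi_n$. For an $\infty_\alpha$-morphism $\Psi:A\rightsquigarrow A'$, $\hom^\alpha_r(1,\Psi):\mathrm{B}_\iota\hom^\alpha(D,A)\to\mathrm{B}_\iota\hom^\alpha(D,A')$ is the coalgebra morphism whose projection to $\hom(D,A')$ is $\mu_n^\vee\otimes F\mapsto\Psi F\Delta_D^n$. It is known that these define bifunctors with values in $\infty\text{-}\mathcal{s}\mathscr{L}_\infty\text{-}\mathsf{alg}$. *)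

theory Defs
  imports
    "HOL-Library.Function_Algebras"
    "HOL-Library.Infinite_Typeclass"
    "HOL-Combinatorics.Permutations"
begin

section \<open>Vector spaces, chain complexes, signs\<close>

text \<open>
  Every vector space is a linear subspace of a coordinate space \<^typ>\<open>'x \<Rightarrow> 'k\<close>; up to isomorphism
  these are all the vector spaces of dimension at most the cardinality of \<^typ>\<open>'x\<close> (for infinite
  \<^typ>\<open>'x\<close>), and possibly some larger ones.  The coordinate types of tensor constructions and of
  mapping spaces are built from those of the arguments.
\<close>

definition scl :: "'k::field \<Rightarrow> ('x \<Rightarrow> 'k) \<Rightarrow> 'x \<Rightarrow> 'k" where
  "scl a v = (\<lambda>x. a * v x)"

interpretation fv: vector_space "scl :: 'k::field \<Rightarrow> ('x \<Rightarrow> 'k) \<Rightarrow> 'x \<Rightarrow> 'k"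
  by unfold_locales (auto simp: scl_def fun_eq_iff algebra_simps)

text \<open>
  Linear maps are functions on the ambient space that vanish outside the domain, so that two linear
  maps are equal iff they agree on the domain.
\<close>

definition linmap :: "('x \<Rightarrow> 'k::field) set \<Rightarrow> ('y \<Rightarrow> 'k) set \<Rightarrow> (('x \<Rightarrow> 'k) \<Rightarrow> 'y \<Rightarrow> 'k) \<Rightarrow> bool" where
  "linmap U W f \<longleftrightarrow>
     (\<forall>x\<in>U. f x \<in> W) \<and>
     (\<forall>x\<in>U. \<forall>y\<in>U. f (x + y) = f x + f y) \<and>
     (\<forall>a. \<forall>x\<in>U. f (scl a x) = scl a (f x)) \<and>
     (\<forall>x. x \<notin> U \<longrightarrow> f x = 0)"

text \<open>
  Gradings are external: the pieces \<^term>\<open>grd V k\<close> are unrelated subspaces of the ambient space.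
  The differential \<^term>\<open>bd V k\<close> goes from degree \<^term>\<open>k\<close> to degree \<^term>\<open>k - 1\<close>.
\<close>

record ('x, 'k) cplx =
  grd :: "int \<Rightarrow> ('x \<Rightarrow> 'k) set"
  bd :: "int \<Rightarrow> ('x \<Rightarrow> 'k) \<Rightarrow> 'x \<Rightarrow> 'k"

definition chain_complex :: "('x, 'k::field) cplx \<Rightarrow> bool" where
  "chain_complex V \<longleftrightarrow>
     (\<forall>k. fv.subspace (grd V k) \<and> linmap (grd V k) (grd V (k - 1)) (bd V k)) \<and>
     (\<forall>k. \<forall>x\<in>grd V k. bd V (k - 1) (bd V k x) = 0)"

definition gmap :: "int \<Rightarrow> ('x, 'k::field) cplx \<Rightarrow> ('y, 'k) cplx \<Rightarrow>
    (int \<Rightarrow> ('x \<Rightarrow> 'k) \<Rightarrow> 'y \<Rightarrow> 'k) \<Rightarrow> bool" where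
  "gmap r V W f \<longleftrightarrow> (\<forall>k. linmap (grd V k) (grd W (k + r)) (f k))"

definition chain_map :: "('x, 'k::field) cplx \<Rightarrow> ('y, 'k) cplx \<Rightarrow>
    (int \<Rightarrow> ('x \<Rightarrow> 'k) \<Rightarrow> 'y \<Rightarrow> 'k) \<Rightarrow> bool" where
  "chain_map V W f \<longleftrightarrow> gmap 0 V W f \<and> (\<forall>k. \<forall>x\<in>grd V k. bd W k (f k x) = f (k - 1) (bd V k x))"

definition idmap :: "('x, 'k::field) cplx \<Rightarrow> int \<Rightarrow> ('x \<Rightarrow> 'k) \<Rightarrow> 'x \<Rightarrow> 'k" where
  "idmap V k x = (if x \<in> grd V k then x else 0)"

text \<open>A homogeneous element is a vector together with its degree.\<close>

type_synonym ('x, 'k) hvec = "int \<times> ('x \<Rightarrow> 'k)"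

definition mem :: "('x, 'k) cplx \<Rightarrow> ('x, 'k) hvec \<Rightarrow> bool" where
  "mem V x \<longleftrightarrow> snd x \<in> grd V (fst x)"

definition happ :: "int \<Rightarrow> (int \<Rightarrow> ('x \<Rightarrow> 'k) \<Rightarrow> 'y \<Rightarrow> 'k) \<Rightarrow> ('x, 'k) hvec \<Rightarrow> ('y, 'k) hvec" where
  "happ r f x = (fst x + r, f (fst x) (snd x))"

definition hlin :: "('x, 'k::field) cplx \<Rightarrow> (('x, 'k) hvec \<Rightarrow> 'k) \<Rightarrow> bool" where
  "hlin V f \<longleftrightarrow>
     (\<forall>k. \<forall>x\<in>grd V k. (\<forall>y\<in>grd V k. f (k, x + y) = f (k, x) + f (k, y)) \<and>
                       (\<forall>a. f (k, scl a x) = a * f (k, x)))"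

definition ksgn :: "int \<Rightarrow> 'k::field" where
  "ksgn i = (if even i then 1 else - 1)"

text \<open>
  The Koszul sign of reordering symbols of degrees \<^term>\<open>ds ! 0\<close>, \<^term>\<open>ds ! 1\<close>, \dots into the order
  \<^term>\<open>js ! 0\<close>, \<^term>\<open>js ! 1\<close>, \dots of their positions.
\<close>

definition koszul_sign :: "int list \<Rightarrow> nat list \<Rightarrow> 'k::field" where
  "koszul_sign ds js =
     (\<Prod>j<length js. \<Prod>i<j. if js ! j < js ! i then ksgn (ds ! (js ! i) * ds ! (js ! j)) else 1)"


section \<open>S-modules and the composite product\<close>

text \<open>\<^term>\<open>act M n \<sigma> k\<close> is the right action of the permutation \<^term>\<open>\<sigma>\<close> of \<^term>\<open>{..<n}\<close> on degree \<^term>\<open>k\<close>.\<close>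

record ('x, 'k) smod =
  cpx :: "nat \<Rightarrow> ('x, 'k) cplx"
  act :: "nat \<Rightarrow> (nat \<Rightarrow> nat) \<Rightarrow> int \<Rightarrow> ('x \<Rightarrow> 'k) \<Rightarrow> 'x \<Rightarrow> 'k"

definition smodule :: "('x, 'k::field) smod \<Rightarrow> bool" where
  "smodule M \<longleftrightarrow>
     (\<forall>n. chain_complex (cpx M n)) \<and>
     (\<forall>n \<sigma>. \<sigma> permutes {..<n} \<longrightarrow> chain_map (cpx M n) (cpx M n) (act M n \<sigma>)) \<and>
     (\<forall>n k. \<forall>x\<in>grd (cpx M n) k. act M n id k x = x \<and>
       (\<forall>\<sigma> \<tau>. \<sigma> permutes {..<n} \<longrightarrow> \<tau> permutes {..<n} \<longrightarrow>
          act M n (\<sigma> \<circ> \<tau>) k x = act M n \<tau> k (act M n \<sigma> k x)))"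

definition smap :: "int \<Rightarrow> ('x, 'k::field) smod \<Rightarrow> ('y, 'k) smod \<Rightarrow>
    (nat \<Rightarrow> int \<Rightarrow> ('x \<Rightarrow> 'k) \<Rightarrow> 'y \<Rightarrow> 'k) \<Rightarrow> bool" where
  "smap r M N f \<longleftrightarrow> (\<forall>n. gmap r (cpx M n) (cpx N n) (f n) \<and>
     (\<forall>\<sigma> k. \<sigma> permutes {..<n} \<longrightarrow>
        (\<forall>x\<in>grd (cpx M n) k. f n k (act M n \<sigma> k x) = act N n \<sigma> (k + r) (f n k x))))"

definition sid :: "('x, 'k::field) smod \<Rightarrow> nat \<Rightarrow> int \<Rightarrow> ('x \<Rightarrow> 'k) \<Rightarrow> 'x \<Rightarrow> 'k" where
  "sid M n = idmap (cpx M n)"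

text \<open>
  The component \<open>(M \<circ> N)(n)\<close> is generated by symbols \<open>(p; (q\<^sub>1, B\<^sub>1), \<dots>, (q\<^sub>m, B\<^sub>m))\<close>
  with \<open>p \<in> M(m)\<close>, \<open>q\<^sub>i \<in> N(|B\<^sub>i|)\<close>, where the lists \<open>B\<^sub>i\<close> of input labels together use each label in
  \<^term>\<open>{..<n}\<close> exactly once; the \<open>j\<close>-th input of \<open>q\<^sub>i\<close> carries the label \<open>B\<^sub>i ! j\<close>.  They are
  multilinear and subject to
    \<open>(p\<sigma>; permuted by \<sigma>) = \<plusminus> (p; \<dots>)\<close> and \<open>(p; \<dots>, (q\<^sub>i\<sigma>, B\<^sub>i permuted by \<sigma>), \<dots>) = (p; \<dots>, (q\<^sub>i, B\<^sub>i), \<dots>)\<close>.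
  This tensor product over the symmetric groups is realised inside the double dual:
  \<open>gen M N n p qs\<close> is evaluation at \<open>(p; qs)\<close> of those forms that respect these relations.
\<close>

type_synonym ('x, 'y, 'k) form = "('x, 'k) hvec \<Rightarrow> (('y, 'k) hvec \<times> nat list) list \<Rightarrow> 'k"

abbreviation degs :: "(('y, 'k) hvec \<times> nat list) list \<Rightarrow> int list" where
  "degs qs \<equiv> map (\<lambda>q. fst (fst q)) qs"

definition is_gen :: "('x, 'k) smod \<Rightarrow> ('y, 'k) smod \<Rightarrow> nat \<Rightarrow>
    ('x, 'k) hvec \<Rightarrow> (('y, 'k) hvec \<times> nat list) list \<Rightarrow> bool" where
  "is_gen M N n p qs \<longleftrightarrow>
     mem (cpx M (length qs)) p \<and> (\<forall>(q, B) \<in> set qs. mem (cpx N (length B)) q) \<and>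
     distinct (concat (map snd qs)) \<and> set (concat (map snd qs)) = {..<n}"

definition is_form :: "('x, 'k::field) smod \<Rightarrow> ('y, 'k) smod \<Rightarrow> nat \<Rightarrow> ('x, 'y, 'k) form \<Rightarrow> bool" where
  "is_form M N n \<phi> \<longleftrightarrow> (\<forall>p qs. is_gen M N n p qs \<longrightarrow>
     hlin (cpx M (length qs)) (\<lambda>p'. \<phi> p' qs) \<and>
     (\<forall>i<length qs. hlin (cpx N (length (snd (qs ! i)))) (\<lambda>q'. \<phi> p (qs[i := (q', snd (qs ! i))]))) \<and>
     (\<forall>\<sigma>. \<sigma> permutes {..<length qs} \<longrightarrow>
        \<phi> (happ 0 (act M (length qs) \<sigma>) p) (permute_list \<sigma> qs) =
          koszul_sign (degs qs) (map \<sigma> [0..<length qs]) * \<phi> p qs) \<and>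
     (\<forall>i<length qs. \<forall>\<sigma>. \<sigma> permutes {..<length (snd (qs ! i))} \<longrightarrow>
        \<phi> p (qs[i := (happ 0 (act N (length (snd (qs ! i))) \<sigma>) (fst (qs ! i)), permute_list \<sigma> (snd (qs ! i)))])
          = \<phi> p qs))"

definition gen :: "('x, 'k::field) smod \<Rightarrow> ('y, 'k) smod \<Rightarrow> nat \<Rightarrow>
    ('x, 'k) hvec \<Rightarrow> (('y, 'k) hvec \<times> nat list) list \<Rightarrow> ('x, 'y, 'k) form \<Rightarrow> 'k" where
  "gen M N n p qs = (\<lambda>\<phi>. if is_form M N n \<phi> then \<phi> p qs else 0)"

definition cspace :: "('x, 'k::field) smod \<Rightarrow> ('y, 'k) smod \<Rightarrow> nat \<Rightarrow> int \<Rightarrow> (('x, 'y, 'k) form \<Rightarrow> 'k) set" where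
  "cspace M N n k = fv.span {gen M N n p qs | p qs. is_gen M N n p qs \<and> fst p + sum_list (degs qs) = k}"

text \<open>
  If \<^term>\<open>g\<close> respects the relations, then \<^term>\<open>ext U g\<close> is the linear map on the subspace \<^term>\<open>U\<close> of
  \<open>(M \<circ> N)(n)\<close> which sends \<^term>\<open>gen M N n p qs\<close> to \<^term>\<open>g p qs\<close>: a functional \<^term>\<open>u\<close> is evaluated
  at the form \<open>(p; qs) \<mapsto> g p qs z\<close>, for every coordinate \<^term>\<open>z\<close> of the target.
\<close>

definition ext :: "(('x, 'y, 'k::field) form \<Rightarrow> 'k) set \<Rightarrow>
    (('x, 'k) hvec \<Rightarrow> (('y, 'k) hvec \<times> nat list) list \<Rightarrow> 'z \<Rightarrow> 'k) \<Rightarrow>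
    (('x, 'y, 'k) form \<Rightarrow> 'k) \<Rightarrow> 'z \<Rightarrow> 'k" where
  "ext U g u = (if u \<in> U then (\<lambda>z. u (\<lambda>p qs. g p qs z)) else 0)"

lemma ext_gen:
  assumes "is_gen M N n p qs" "fst p + sum_list (degs qs) = k"
    and "\<And>z. is_form M N n (\<lambda>p qs. g p qs z)"
  shows "ext (cspace M N n k) g (gen M N n p qs) = g p qs"
proof -
  have "gen M N n p qs \<in> cspace M N n k"
    unfolding cspace_def using assms(1,2) by (intro fv.span_base) blast
  then show ?thesis using assms(3) by (simp add: ext_def gen_def fun_eq_iff)
qed

definition comp_bd :: "('x, 'k::field) smod \<Rightarrow> ('y, 'k) smod \<Rightarrow> nat \<Rightarrow>
    int \<Rightarrow> (('x, 'y, 'k) form \<Rightarrow> 'k) \<Rightarrow> ('x, 'y, 'k) form \<Rightarrow> 'k" where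
  "comp_bd M N n k = ext (cspace M N n k) (\<lambda>p qs.
     gen M N n (happ (- 1) (bd (cpx M (length qs))) p) qs +
     (\<Sum>i<length qs. scl (ksgn (fst p + sum_list (take i (degs qs))))
        (gen M N n p (qs[i := (happ (- 1) (bd (cpx N (length (snd (qs ! i))))) (fst (qs ! i)), snd (qs ! i))]))))"

definition comp_act :: "('x, 'k::field) smod \<Rightarrow> ('y, 'k) smod \<Rightarrow> nat \<Rightarrow> (nat \<Rightarrow> nat) \<Rightarrow>
    int \<Rightarrow> (('x, 'y, 'k) form \<Rightarrow> 'k) \<Rightarrow> ('x, 'y, 'k) form \<Rightarrow> 'k" where
  "comp_act M N n \<sigma> k = ext (cspace M N n k) (\<lambda>p qs.
     gen M N n p (map (\<lambda>(q, B). (q, map (inv \<sigma>) B)) qs))"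

definition composite :: "('x, 'k::field) smod \<Rightarrow> ('y, 'k) smod \<Rightarrow> (('x, 'y, 'k) form, 'k) smod"
    (infixr \<open>\<circ>\<^sub>S\<close> 70) where
  "M \<circ>\<^sub>S N = \<lparr>cpx = (\<lambda>n. \<lparr>grd = cspace M N n, bd = comp_bd M N n\<rparr>), act = comp_act M N\<rparr>"

text \<open>\<open>f \<circ> g\<close> for \<^term>\<open>f : M \<rightarrow> M'\<close> of degree \<^term>\<open>r\<close> and \<^term>\<open>g : N \<rightarrow> N'\<close> of degree 0.\<close>

definition cmap :: "('x, 'k::field) smod \<Rightarrow> ('y, 'k) smod \<Rightarrow> ('x1, 'k) smod \<Rightarrow> ('y1, 'k) smod \<Rightarrow> int \<Rightarrow>
    (nat \<Rightarrow> int \<Rightarrow> ('x \<Rightarrow> 'k) \<Rightarrow> 'x1 \<Rightarrow> 'k) \<Rightarrow> (nat \<Rightarrow> int \<Rightarrow> ('y \<Rightarrow> 'k) \<Rightarrow> 'y1 \<Rightarrow> 'k) \<Rightarrow>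
    nat \<Rightarrow> int \<Rightarrow> (('x, 'y, 'k) form \<Rightarrow> 'k) \<Rightarrow> ('x1, 'y1, 'k) form \<Rightarrow> 'k" where
  "cmap M N M' N' r f g n k = ext (cspace M N n k) (\<lambda>p qs.
     gen M' N' n (happ r (f (length qs)) p) (map (\<lambda>(q, B). (happ 0 (g (length B)) q, B)) qs))"

text \<open>
  The associativity isomorphism \<open>(M \<circ> N) \<circ> L \<rightarrow> M \<circ> (N \<circ> L)\<close>.  In a generator \<open>(w; rs)\<close>, the element
  \<open>w \<in> (M \<circ> N)(length rs)\<close> is a combination of generators \<open>(m; (n\<^sub>1, E\<^sub>1), \<dots>)\<close> where the labels in \<open>E\<^sub>j\<close>
  are positions in the list \<open>rs\<close>.  \<open>consecutive\<close> replaces the labels by consecutive intervals,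
  which standardises the labels of the inner composite.
\<close>

definition consecutive :: "('b \<times> nat list) list \<Rightarrow> ('b \<times> nat list) list" where
  "consecutive rs = map (\<lambda>i. (fst (rs ! i),
     let s = sum_list (map (\<lambda>r. length (snd r)) (take i rs)) in [s..<s + length (snd (rs ! i))])) [0..<length rs]"

definition assoc :: "('x, 'k::field) smod \<Rightarrow> ('y, 'k) smod \<Rightarrow> ('z, 'k) smod \<Rightarrow> nat \<Rightarrow>
    int \<Rightarrow> ((('x, 'y, 'k) form, 'z, 'k) form \<Rightarrow> 'k) \<Rightarrow> ('x, ('y, 'z, 'k) form, 'k) form \<Rightarrow> 'k" where
  "assoc M N L n k = ext (cspace (M \<circ>\<^sub>S N) L n k) (\<lambda>w rs \<phi>. snd w (\<lambda>m ns.
     koszul_sign (degs ns @ degs rs)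
       (concat (map (\<lambda>j. j # map ((+) (length ns)) (snd (ns ! j))) [0..<length ns])) *
     gen M (N \<circ>\<^sub>S L) n m
       (map (\<lambda>(q, E). let ls = map ((!) rs) E; B = concat (map snd ls)
              in ((fst q + sum_list (degs ls), gen N L (length B) q (consecutive ls)), B)) ns) \<phi>))"

text \<open>
  The inverse isomorphism \<open>M \<circ> (N \<circ> L) \<rightarrow> (M \<circ> N) \<circ> L\<close>.  \<open>expand ws\<close> writes all the
  \<open>w\<^sub>j \<in> N \<circ> L\<close> in the list \<open>ws\<close> as combinations of generators, multilinearly.
\<close>

primrec expand :: "((int \<times> (('y, 'z, 'k) form \<Rightarrow> 'k)) \<times> nat list) list \<Rightarrow>
    ((('y, 'k) hvec \<times> (('z, 'k) hvec \<times> nat list) list \<times> nat list) list \<Rightarrow> 'k) \<Rightarrow> 'k" where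
  "expand [] h = h []"
| "expand (w # ws) h = snd (fst w) (\<lambda>q ls. expand ws (\<lambda>ts. h ((q, ls, snd w) # ts)))"

definition reassoc :: "('x, 'k::field) smod \<Rightarrow> ('y, 'k) smod \<Rightarrow> ('z, 'k) smod \<Rightarrow> nat \<Rightarrow>
    int \<Rightarrow> (('x, ('y, 'z, 'k) form, 'k) form \<Rightarrow> 'k) \<Rightarrow> (('x, 'y, 'k) form, 'z, 'k) form \<Rightarrow> 'k" where
  "reassoc M N L n k = ext (cspace M (N \<circ>\<^sub>S L) n k) (\<lambda>m ws \<phi>. expand ws (\<lambda>ts.
     let qs = consecutive (map (\<lambda>(q, ls, B). (q, [0..<length ls])) ts);
         rs = concat (map (\<lambda>(q, ls, B). map (\<lambda>(l, E). (l, map ((!) B) E)) ls) ts);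
         ds = concat (map (\<lambda>(q, ls, B). fst q # degs ls) ts);
         pos = (\<lambda>j. sum_list (map (\<lambda>(q, ls, B). Suc (length ls)) (take j ts)))
     in koszul_sign ds (map pos [0..<length ts] @
            concat (map (\<lambda>j. [Suc (pos j)..<pos (Suc j)]) [0..<length ts])) *
        gen (M \<circ>\<^sub>S N) L n (fst m + sum_list (degs qs), gen M N (length rs) m qs) rs \<phi>))"

text \<open>A chain complex is regarded as an S-module concentrated in arity 0; \<open>M(V) = (M \<circ> V)(0)\<close>.\<close>

definition zero_cplx :: "('x, 'k::field) cplx" where
  "zero_cplx = \<lparr>grd = (\<lambda>_. {0}), bd = (\<lambda>_ _. 0)\<rparr>"

definition ar0 :: "('x, 'k::field) cplx \<Rightarrow> ('x, 'k) smod" where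
  "ar0 V = \<lparr>cpx = (\<lambda>n. if n = 0 then V else zero_cplx),
            act = (\<lambda>n _. idmap (if n = 0 then V else zero_cplx))\<rparr>"

definition at0 :: "(int \<Rightarrow> ('x \<Rightarrow> 'k::field) \<Rightarrow> 'y \<Rightarrow> 'k) \<Rightarrow> nat \<Rightarrow> int \<Rightarrow> ('x \<Rightarrow> 'k) \<Rightarrow> 'y \<Rightarrow> 'k" where
  "at0 f n = (if n = 0 then f else (\<lambda>_ _. 0))"

abbreviation schur :: "('x, 'k::field) smod \<Rightarrow> ('y, 'k) cplx \<Rightarrow> (('x, 'y, 'k) form, 'k) cplx" where
  "schur M V \<equiv> cpx (M \<circ>\<^sub>S ar0 V) 0"

abbreviation tens :: "('x, 'k::field) smod \<Rightarrow> ('y, 'k) cplx \<Rightarrow> ('x, 'k) hvec \<Rightarrow> ('y, 'k) hvec list \<Rightarrow>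
    ('x, 'y, 'k) form \<Rightarrow> 'k" where
  "tens M V p xs \<equiv> gen M (ar0 V) 0 p (map (\<lambda>x. (x, [])) xs)"

lemma cspace_ar0_pos:
  assumes "n \<noteq> 0" shows "cspace M (ar0 V) n k = {0}"
proof -
  have z: "gen M (ar0 V) n p qs = 0" if G: "is_gen M (ar0 V) n p qs" for p qs
  proof -
    have "set (concat (map snd qs)) = {..<n}" using G by (simp add: is_gen_def)
    with assms have "0 \<in> set (concat (map snd qs))" by auto
    then obtain i where i: "i < length qs" "snd (qs ! i) \<noteq> []"
      by (fastforce simp: in_set_conv_nth)
    have "mem (cpx (ar0 V) (length (snd (qs ! i)))) (fst (qs ! i))"
      using G i(1) unfolding is_gen_def by (metis (no_types, lifting) case_prod_beta nth_mem)
    with i have s: "snd (fst (qs ! i)) = 0" by (simp add: mem_def ar0_def zero_cplx_def)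
    have "\<phi> p qs = 0" if F: "is_form M (ar0 V) n \<phi>" for \<phi>
    proof -
      have "hlin zero_cplx (\<lambda>q'. \<phi> p (qs[i := (q', snd (qs ! i))]))"
        using F[unfolded is_form_def, rule_format, OF G] i by (auto simp: ar0_def)
      then have "\<phi> p (qs[i := ((fst (fst (qs ! i)), scl 0 0), snd (qs ! i))]) = 0"
        unfolding hlin_def zero_cplx_def 
        by (metis (no_types, lifting) cplx.select_convs(1) fv.scale_zero_left insertI1 mult_zero_left)
      moreover have "((fst (fst (qs ! i)), scl 0 0), snd (qs ! i)) = qs ! i"
        using s by (simp add: prod_eq_iff)
      ultimately show ?thesis by simp
    qed
    then show ?thesis by (auto simp: gen_def fun_eq_iff)
  qed
  have "{gen M (ar0 V) n p qs | p qs. is_gen M (ar0 V) n p qs \<and> fst p + sum_list (degs qs) = k} \<subseteq> {0}"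
    using z by auto
  then show ?thesis unfolding cspace_def
    using fv.span_minimal[OF _ fv.subspace_single_0] fv.span_zero by blast
qed

text \<open>
  \<open>M \<circ> V\<close> is again concentrated in arity 0; in particular \<open>M \<circ> (N \<circ> V)\<close> is the S-module
  given by \<open>M(N(V))\<close> in arity 0.
\<close>

lemma composite_ar0: "M \<circ>\<^sub>S ar0 V = ar0 (schur M V)"
proof -
  have lab: "map (\<lambda>(q, B). (q, map (inv \<sigma>) B)) qs = qs" if "is_gen M (ar0 V) 0 p qs" for p qs \<sigma>
    using that by (auto simp: is_gen_def intro!: map_idI)
  have ev: "u (\<lambda>p qs. gen M (ar0 V) 0 p (map (\<lambda>(q, B). (q, map (inv \<sigma>) B)) qs) z) = u z"
    if "u \<in> cspace M (ar0 V) 0 k" for u z \<sigma> k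
    using that unfolding cspace_def
  proof (induction rule: fv.span_induct_alt)
    case base then show ?case by simp
  next
    case (step c x y)
    then obtain p qs where x: "x = gen M (ar0 V) 0 p qs" and G: "is_gen M (ar0 V) 0 p qs" by auto
    let ?\<psi> = "\<lambda>p qs. gen M (ar0 V) 0 p (map (\<lambda>(q, B). (q, map (inv \<sigma>) B)) qs) z"
    have eq: "?\<psi> p qs = (if is_form M (ar0 V) 0 z then z p qs else 0)" if "is_gen M (ar0 V) 0 p qs" for p qs
      using lab[OF that] by (simp add: gen_def)
    have nil: "snd q = []" if "is_gen M (ar0 V) 0 p qs" "q \<in> set qs" for p qs q
      using that by (cases q) (auto simp: is_gen_def)
    have m: "map (\<lambda>(q, B). (q, map (inv \<sigma>) B)) (qs[i := (q', B)]) = qs[i := (q', map (inv \<sigma>) B)]"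
      if "is_gen M (ar0 V) 0 p qs" for p qs i q' and B :: "nat list"
      using lab[OF that] by (simp add: map_update)
    have pm: "map (\<lambda>(q, B). (q, map (inv \<sigma>) B)) (permute_list \<tau> qs) = permute_list \<tau> qs"
      if "is_gen M (ar0 V) 0 p qs" "\<tau> permutes {..<length qs}" for p qs \<tau>
      using lab[OF that(1)] that(2) by (simp add: permute_list_map[symmetric])
    have f: "is_form M (ar0 V) 0 ?\<psi>"
    proof (cases "is_form M (ar0 V) 0 z")
      case True
      show ?thesis
        unfolding is_form_def
      proof (intro allI impI, goal_cases)
        case (1 p qs)
        note n = nil[OF 1] and F = True[unfolded is_form_def, rule_format, OF 1]
        have n': "snd (qs ! i) = []" if "i < length qs" for i using n that by auto
        have g: "gen M (ar0 V) 0 p qs z = z p qs" for p qs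
          using True by (simp add: gen_def)
        show ?case unfolding g
        proof (intro conjI allI impI, goal_cases)
          case 1
          then show ?case using F lab[OF \<open>is_gen M (ar0 V) 0 p qs\<close>] by metis
        next
          case (2 i)
          show ?case using F[THEN conjunct2, THEN conjunct1, rule_format, OF 2] n'[OF 2] unfolding m[OF \<open>is_gen M (ar0 V) 0 p qs\<close>] by simp
        next
          case (3 \<tau>)
          then show ?case using F unfolding pm[OF \<open>is_gen M (ar0 V) 0 p qs\<close> 3] lab[OF \<open>is_gen M (ar0 V) 0 p qs\<close>]
            by blast
        next
          case (4 i \<tau>)
          show ?case using F[THEN conjunct2, THEN conjunct2, THEN conjunct2, rule_format, OF 4] n'[OF 4(1)]
            unfolding m[OF \<open>is_gen M (ar0 V) 0 p qs\<close>] lab[OF \<open>is_gen M (ar0 V) 0 p qs\<close>] by simp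
        qed
      qed
    next
      case False
      then show ?thesis by (auto simp: gen_def is_form_def hlin_def)
    qed
    have "x ?\<psi> = x z" using f eq[OF G] unfolding x by (simp add: gen_def)
    then show ?case using step by (simp add: scl_def)
  qed
  have pos: "cpx (M \<circ>\<^sub>S ar0 V) n = zero_cplx" if "n \<noteq> 0" for n
  proof -
    have "comp_bd M (ar0 V) n k u = 0" for k u
      unfolding comp_bd_def ext_def cspace_ar0_pos[OF that] by (cases "u = 0") (simp_all add: zero_fun_def)
    then have "comp_bd M (ar0 V) n = (\<lambda>_ _. 0)" by blast
    moreover have "cspace M (ar0 V) n = (\<lambda>_. {0})"
      using cspace_ar0_pos[OF that] by blast
    ultimately show ?thesis by (simp add: composite_def zero_cplx_def)
  qed
  then have c: "cpx (M \<circ>\<^sub>S ar0 V) n = cpx (ar0 (schur M V)) n" for n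
    by (cases "n = 0") (simp_all add: pos ar0_def[of "schur M V"])
  have a: "act (M \<circ>\<^sub>S ar0 V) n \<sigma> k u = act (ar0 (schur M V)) n \<sigma> k u" for n \<sigma> k u
  proof (cases "n = 0")
    case True
    have "comp_act M (ar0 V) 0 \<sigma> k u = (if u \<in> cspace M (ar0 V) 0 k then u else 0)"
      unfolding comp_act_def ext_def by (cases "u \<in> cspace M (ar0 V) 0 k") (simp_all add: ev)
    then show ?thesis using True by (simp add: composite_def ar0_def idmap_def)
  next
    case False
    have "comp_act M (ar0 V) n \<sigma> k u = 0"
      unfolding comp_act_def ext_def cspace_ar0_pos[OF False] by (cases "u = 0") (simp_all add: zero_fun_def)
    then show ?thesis using False by (simp add: composite_def ar0_def idmap_def zero_cplx_def)
  qed
  have "cpx (M \<circ>\<^sub>S ar0 V) = cpx (ar0 (schur M V))" by (rule ext) (rule c)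
  moreover have "act (M \<circ>\<^sub>S ar0 V) = act (ar0 (schur M V))" by (rule ext, rule ext, rule ext, rule ext) (rule a)
  ultimately show ?thesis by (intro smod.equality) simp_all
qed

text \<open>\<open>f \<circ> 1 : M(V) \<rightarrow> N(V)\<close> for \<open>f\<close> of degree \<open>r\<close>, and \<open>M(g) : M(V) \<rightarrow> M(W)\<close> for \<open>g\<close> of degree 0.\<close>

abbreviation schur_l :: "int \<Rightarrow> ('x, 'k::field) smod \<Rightarrow> ('x1, 'k) smod \<Rightarrow> ('y, 'k) cplx \<Rightarrow>
    (nat \<Rightarrow> int \<Rightarrow> ('x \<Rightarrow> 'k) \<Rightarrow> 'x1 \<Rightarrow> 'k) \<Rightarrow>
    int \<Rightarrow> (('x, 'y, 'k) form \<Rightarrow> 'k) \<Rightarrow> ('x1, 'y, 'k) form \<Rightarrow> 'k" where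
  "schur_l r M N V f \<equiv> cmap M (ar0 V) N (ar0 V) r f (sid (ar0 V)) 0"

abbreviation schur_r :: "('x, 'k::field) smod \<Rightarrow> ('y, 'k) cplx \<Rightarrow> ('y1, 'k) cplx \<Rightarrow>
    (int \<Rightarrow> ('y \<Rightarrow> 'k) \<Rightarrow> 'y1 \<Rightarrow> 'k) \<Rightarrow>
    int \<Rightarrow> (('x, 'y, 'k) form \<Rightarrow> 'k) \<Rightarrow> ('x, 'y1, 'k) form \<Rightarrow> 'k" where
  "schur_r M V W g \<equiv> cmap M (ar0 V) M (ar0 W) 0 (sid M) (at0 g) 0"


section \<open>Operads and cooperads\<close>

record ('x, 'k) operad =
  opm :: "('x, 'k) smod"
  opcomp :: "nat \<Rightarrow> int \<Rightarrow> (('x, 'x, 'k) form \<Rightarrow> 'k) \<Rightarrow> 'x \<Rightarrow> 'k"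
  opid :: "'x \<Rightarrow> 'k"

definition is_operad :: "('x, 'k::field) operad \<Rightarrow> bool" where
  "is_operad P \<longleftrightarrow> (let M = opm P; \<gamma> = opcomp P in
     smodule M \<and>
     (\<forall>k. grd (cpx M 0) k = {0}) \<and>
     opid P \<noteq> 0 \<and> grd (cpx M 1) 0 = range (\<lambda>a. scl a (opid P)) \<and> (\<forall>k. k \<noteq> 0 \<longrightarrow> grd (cpx M 1) k = {0}) \<and>
     smap 0 (M \<circ>\<^sub>S M) M \<gamma> \<and> (\<forall>n. chain_map (cpx (M \<circ>\<^sub>S M) n) (cpx M n) (\<gamma> n)) \<and>
     (\<forall>n k. \<forall>x\<in>grd (cpx M n) k.
        \<gamma> n k (gen M M n (0, opid P) [((k, x), [0..<n])]) = x \<and>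
        \<gamma> n k (gen M M n (k, x) (map (\<lambda>i. ((0, opid P), [i])) [0..<n])) = x) \<and>
     (\<forall>n k. \<forall>u\<in>grd (cpx ((M \<circ>\<^sub>S M) \<circ>\<^sub>S M) n) k.
        \<gamma> n k (cmap (M \<circ>\<^sub>S M) M M M 0 \<gamma> (sid M) n k u) =
        \<gamma> n k (cmap M (M \<circ>\<^sub>S M) M M 0 (sid M) \<gamma> n k (assoc M M M n k u))))"

text \<open>
  \<open>cocounit\<close> is the counit \<open>C(1)\<^sub>0 \<rightarrow> K\<close>; it is an isomorphism as \<open>C(1) = K id\<close>.
  A reduced cooperad is automatically conilpotent, and so is every coalgebra \<open>D \<rightarrow> C(D)\<close> over it,
  since \<open>C(D)\<close> is the direct sum over the arities.
\<close>

record ('x, 'k) cooperad =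
  com :: "('x, 'k) smod"
  codec :: "nat \<Rightarrow> int \<Rightarrow> ('x \<Rightarrow> 'k) \<Rightarrow> ('x, 'x, 'k) form \<Rightarrow> 'k"
  cocounit :: "('x \<Rightarrow> 'k) \<Rightarrow> 'k"

definition counit :: "('x, 'k::field) cooperad \<Rightarrow> nat \<Rightarrow> ('x, 'k) hvec \<Rightarrow> 'k" where
  "counit C n c = (if n = 1 \<and> fst c = 0 then cocounit C (snd c) else 0)"

text \<open>An element of \<open>M(n)\<close> whose inputs carry the labels \<open>B\<close>, as an element with standard labels.\<close>

definition relabel :: "('x, 'k) smod \<Rightarrow> ('x, 'k) hvec \<Rightarrow> nat list \<Rightarrow> 'x \<Rightarrow> 'k" where
  "relabel M q B = act M (length B) (inv (\<lambda>i. if i < length B then B ! i else i)) (fst q) (snd q)"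

definition is_cooperad :: "('x, 'k::field) cooperad \<Rightarrow> bool" where
  "is_cooperad C \<longleftrightarrow> (let M = com C; \<Delta> = codec C in
     smodule M \<and>
     (\<forall>k. grd (cpx M 0) k = {0}) \<and>
     (\<forall>k. k \<noteq> 0 \<longrightarrow> grd (cpx M 1) k = {0}) \<and>
     hlin (cpx M 1) (\<lambda>c. cocounit C (snd c)) \<and> bij_betw (cocounit C) (grd (cpx M 1) 0) UNIV \<and>
     smap 0 M (M \<circ>\<^sub>S M) \<Delta> \<and> (\<forall>n. chain_map (cpx M n) (cpx (M \<circ>\<^sub>S M) n) (\<Delta> n)) \<and>
     (\<forall>n k. \<forall>x\<in>grd (cpx M n) k.
        ext (cspace M M n k) (\<lambda>c qs. if length qs = 1
            then scl (counit C 1 c) (relabel M (fst (hd qs)) (snd (hd qs))) else 0) (\<Delta> n k x) = x \<and>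
        ext (cspace M M n k) (\<lambda>c qs. if length qs = n \<and> (\<forall>q\<in>set qs. length (snd q) = 1)
            then scl (\<Prod>q\<leftarrow>qs. counit C 1 (fst q)) (relabel M c (concat (map snd qs))) else 0) (\<Delta> n k x) = x \<and>
        assoc M M M n k (cmap M M (M \<circ>\<^sub>S M) M 0 \<Delta> (sid M) n k (\<Delta> n k x)) =
        cmap M M M (M \<circ>\<^sub>S M) 0 (sid M) \<Delta> n k (\<Delta> n k x)))"


section \<open>Twisting morphisms\<close>

text \<open>\<open>(1 \<circ>\<^sub>(\<^sub>1\<^sub>) g) \<Delta>\<^sub>(\<^sub>1\<^sub>) : C \<rightarrow> C \<circ>\<^sub>(\<^sub>1\<^sub>) P \<subseteq> C \<circ> P\<close> for \<open>g : C \<rightarrow> P\<close> of degree \<open>r\<close>.\<close>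

definition inf_dec :: "('c, 'k::field) cooperad \<Rightarrow> ('p, 'k) operad \<Rightarrow> int \<Rightarrow>
    (nat \<Rightarrow> int \<Rightarrow> ('c \<Rightarrow> 'k) \<Rightarrow> 'p \<Rightarrow> 'k) \<Rightarrow> nat \<Rightarrow> int \<Rightarrow> ('c \<Rightarrow> 'k) \<Rightarrow> ('c, 'p, 'k) form \<Rightarrow> 'k" where
  "inf_dec C P r g n k x = ext (cspace (com C) (com C) n k) (\<lambda>c qs. \<Sum>i<length qs.
     scl (ksgn (r * fst c) * (\<Prod>j\<in>{..<length qs} - {i}. counit C (length (snd (qs ! j))) (fst (qs ! j))))
       (gen (com C) (opm P) n c (map (\<lambda>j. (if j = i then happ r (g (length (snd (qs ! j)))) (fst (qs ! j))
                                            else (0, opid P), snd (qs ! j))) [0..<length qs])))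
     (codec C n k x)"

definition star :: "('c, 'k::field) cooperad \<Rightarrow> ('p, 'k) operad \<Rightarrow> int \<Rightarrow> int \<Rightarrow>
    (nat \<Rightarrow> int \<Rightarrow> ('c \<Rightarrow> 'k) \<Rightarrow> 'p \<Rightarrow> 'k) \<Rightarrow> (nat \<Rightarrow> int \<Rightarrow> ('c \<Rightarrow> 'k) \<Rightarrow> 'p \<Rightarrow> 'k) \<Rightarrow>
    nat \<Rightarrow> int \<Rightarrow> ('c \<Rightarrow> 'k) \<Rightarrow> 'p \<Rightarrow> 'k" where
  "star C P r s f g n k x = opcomp P n (k + s + r)
     (cmap (com C) (opm P) (opm P) (opm P) r f (sid (opm P)) n (k + s) (inf_dec C P s g n k x))"

definition lie_bracket :: "('c, 'k::field) cooperad \<Rightarrow> ('p, 'k) operad \<Rightarrow> int \<Rightarrow> int \<Rightarrow>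
    (nat \<Rightarrow> int \<Rightarrow> ('c \<Rightarrow> 'k) \<Rightarrow> 'p \<Rightarrow> 'k) \<Rightarrow> (nat \<Rightarrow> int \<Rightarrow> ('c \<Rightarrow> 'k) \<Rightarrow> 'p \<Rightarrow> 'k) \<Rightarrow>
    nat \<Rightarrow> int \<Rightarrow> ('c \<Rightarrow> 'k) \<Rightarrow> 'p \<Rightarrow> 'k" where
  "lie_bracket C P r s f g n k x = star C P r s f g n k x - scl (ksgn (r * s)) (star C P s r g f n k x)"

definition twisting_morphism :: "('c, 'k::field) cooperad \<Rightarrow> ('p, 'k) operad \<Rightarrow>
    (nat \<Rightarrow> int \<Rightarrow> ('c \<Rightarrow> 'k) \<Rightarrow> 'p \<Rightarrow> 'k) \<Rightarrow> bool" where
  "twisting_morphism C P \<alpha> \<longleftrightarrow> smap (- 1) (com C) (opm P) \<alpha> \<and>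
     (\<forall>n k. \<forall>x\<in>grd (cpx (com C) n) k.
        bd (cpx (opm P) n) (k - 1) (\<alpha> n k x) + \<alpha> n (k - 1) (bd (cpx (com C) n) k x) +
        scl (1 / 2) (lie_bracket C P (- 1) (- 1) \<alpha> \<alpha> n k x) = 0)"

text \<open>
  The twisting term of the differential of \<open>C \<circ>\<^sub>\<alpha> N\<close>, for a left \<open>P\<close>-module \<open>N\<close> with structure map \<open>lam\<close>:
  the composite \<open>C \<circ> N \<rightarrow> (C \<circ>\<^sub>(\<^sub>1\<^sub>) P) \<circ> N \<rightarrow> C \<circ> (P \<circ> N) \<rightarrow> C \<circ> N\<close>.
  With \<open>N = P\<close> this gives the Koszul complex and with \<open>N\<close> a \<open>P\<close>-algebra the bar construction.
\<close>

definition twist_bd :: "('c, 'k::field) cooperad \<Rightarrow> ('p, 'k) operad \<Rightarrow>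
    (nat \<Rightarrow> int \<Rightarrow> ('c \<Rightarrow> 'k) \<Rightarrow> 'p \<Rightarrow> 'k) \<Rightarrow> ('y, 'k) smod \<Rightarrow>
    (nat \<Rightarrow> int \<Rightarrow> (('p, 'y, 'k) form \<Rightarrow> 'k) \<Rightarrow> 'y \<Rightarrow> 'k) \<Rightarrow>
    nat \<Rightarrow> int \<Rightarrow> (('c, 'y, 'k) form \<Rightarrow> 'k) \<Rightarrow> ('c, 'y, 'k) form \<Rightarrow> 'k" where
  "twist_bd C P \<alpha> N lam n k u =
     cmap (com C) (opm P \<circ>\<^sub>S N) (com C) N 0 (sid (com C)) lam n (k - 1)
       (assoc (com C) (opm P) N n (k - 1)
         (cmap (com C) N (com C \<circ>\<^sub>S opm P) N (- 1) (inf_dec C P (- 1) \<alpha>) (sid N) n k u))"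

definition koszul_bd :: "('c, 'k::field) cooperad \<Rightarrow> ('p, 'k) operad \<Rightarrow>
    (nat \<Rightarrow> int \<Rightarrow> ('c \<Rightarrow> 'k) \<Rightarrow> 'p \<Rightarrow> 'k) \<Rightarrow>
    nat \<Rightarrow> int \<Rightarrow> (('c, 'p, 'k) form \<Rightarrow> 'k) \<Rightarrow> ('c, 'p, 'k) form \<Rightarrow> 'k" where
  "koszul_bd C P \<alpha> n k u = bd (cpx (com C \<circ>\<^sub>S opm P) n) k u + twist_bd C P \<alpha> (opm P) (opcomp P) n k u"

text \<open>
  Acyclicity of the (augmented) Koszul complex means that its homology is the unit S-module \<open>I\<close>.
  In arity 1 the complex is \<open>K (id \<circ> id)\<close> with zero differential, so nothing is to be required there.
\<close>

definition koszul_morphism :: "('c, 'k::field) cooperad \<Rightarrow> ('p, 'k) operad \<Rightarrow>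
    (nat \<Rightarrow> int \<Rightarrow> ('c \<Rightarrow> 'k) \<Rightarrow> 'p \<Rightarrow> 'k) \<Rightarrow> bool" where
  "koszul_morphism C P \<alpha> \<longleftrightarrow> twisting_morphism C P \<alpha> \<and>
     (\<forall>n k. n \<noteq> 1 \<longrightarrow>
        (\<forall>u\<in>grd (cpx (com C \<circ>\<^sub>S opm P) n) k. koszul_bd C P \<alpha> n k u = 0 \<longrightarrow>
           (\<exists>v\<in>grd (cpx (com C \<circ>\<^sub>S opm P) n) (k + 1). koszul_bd C P \<alpha> n (k + 1) v = u)))"


section \<open>Algebras, coalgebras, bar and cobar constructions\<close>

record ('p, 'x, 'k) alg =
  acpx :: "('x, 'k) cplx"
  amul :: "int \<Rightarrow> (('p, 'x, 'k) form \<Rightarrow> 'k) \<Rightarrow> 'x \<Rightarrow> 'k"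

definition is_alg :: "('p, 'k::field) operad \<Rightarrow> ('p, 'x, 'k) alg \<Rightarrow> bool" where
  "is_alg P A \<longleftrightarrow> (let M = opm P; V = acpx A; \<gamma> = amul A in
     chain_complex V \<and> chain_map (schur M V) V \<gamma> \<and>
     (\<forall>k. \<forall>x\<in>grd V k. \<gamma> k (tens M V (0, opid P) [(k, x)]) = x) \<and>
     (\<forall>k. \<forall>u\<in>grd (schur (M \<circ>\<^sub>S M) V) k.
        \<gamma> k (schur_l 0 (M \<circ>\<^sub>S M) M V (opcomp P) k u) =
        \<gamma> k (cmap M (M \<circ>\<^sub>S ar0 V) M (ar0 V) 0 (sid M) (at0 \<gamma>) 0 k (assoc M M (ar0 V) 0 k u))))"

record ('c, 'x, 'k) cog =
  ccpx :: "('x, 'k) cplx"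
  cdec :: "int \<Rightarrow> ('x \<Rightarrow> 'k) \<Rightarrow> ('c, 'x, 'k) form \<Rightarrow> 'k"

text \<open>The counit \<open>C(V) \<rightarrow> V\<close>.\<close>

definition cproj :: "('c, 'k::field) cooperad \<Rightarrow> ('x, 'k) cplx \<Rightarrow> int \<Rightarrow> (('c, 'x, 'k) form \<Rightarrow> 'k) \<Rightarrow> 'x \<Rightarrow> 'k" where
  "cproj C V k = ext (grd (schur (com C) V) k) (\<lambda>c xs. if length xs = 1
     then scl (counit C 1 c) (snd (fst (hd xs))) else 0)"

definition is_cog :: "('c, 'k::field) cooperad \<Rightarrow> ('c, 'x, 'k) cog \<Rightarrow> bool" where
  "is_cog C D \<longleftrightarrow> (let M = com C; V = ccpx D; \<Delta> = cdec D in
     chain_complex V \<and> chain_map V (schur M V) \<Delta> \<and>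
     (\<forall>k. \<forall>x\<in>grd V k. cproj C V k (\<Delta> k x) = x \<and>
        assoc M M (ar0 V) 0 k (schur_l 0 M (M \<circ>\<^sub>S M) V (codec C) k (\<Delta> k x)) =
        cmap M (ar0 V) M (M \<circ>\<^sub>S ar0 V) 0 (sid M) (at0 \<Delta>) 0 k (\<Delta> k x)))"

definition alg_mor :: "('p, 'k::field) operad \<Rightarrow> ('p, 'x, 'k) alg \<Rightarrow> ('p, 'y, 'k) alg \<Rightarrow>
    (int \<Rightarrow> ('x \<Rightarrow> 'k) \<Rightarrow> 'y \<Rightarrow> 'k) \<Rightarrow> bool" where
  "alg_mor P A B f \<longleftrightarrow> chain_map (acpx A) (acpx B) f \<and>
     (\<forall>k. \<forall>u\<in>grd (schur (opm P) (acpx A)) k.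
        f k (amul A k u) = amul B k (schur_r (opm P) (acpx A) (acpx B) f k u))"

definition cog_mor :: "('c, 'k::field) cooperad \<Rightarrow> ('c, 'x, 'k) cog \<Rightarrow> ('c, 'y, 'k) cog \<Rightarrow>
    (int \<Rightarrow> ('x \<Rightarrow> 'k) \<Rightarrow> 'y \<Rightarrow> 'k) \<Rightarrow> bool" where
  "cog_mor C D E f \<longleftrightarrow> chain_map (ccpx D) (ccpx E) f \<and>
     (\<forall>k. \<forall>x\<in>grd (ccpx D) k.
        cdec E k (f k x) = schur_r (com C) (ccpx D) (ccpx E) f k (cdec D k x))"

text \<open>
  The cofree coalgebra \<open>C(A)\<close> with differential \<open>d\<^sub>1 + d\<^sub>2\<close>.  \<open>d\<^sub>2\<close> is the coderivation that extends
  \<open>\<gamma>\<^sub>A (\<alpha> \<circ> 1)\<close>, given by its explicit formula \<open>twist_bd\<close>.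
\<close>

definition bar :: "('c, 'k::field) cooperad \<Rightarrow> ('p, 'k) operad \<Rightarrow> (nat \<Rightarrow> int \<Rightarrow> ('c \<Rightarrow> 'k) \<Rightarrow> 'p \<Rightarrow> 'k) \<Rightarrow>
    ('p, 'x, 'k) alg \<Rightarrow> ('c, ('c, 'x, 'k) form, 'k) cog" where
  "bar C P \<alpha> A = (let M = com C; V = acpx A in
     \<lparr>ccpx = \<lparr>grd = grd (schur M V),
              bd = (\<lambda>k u. bd (schur M V) k u + twist_bd C P \<alpha> (ar0 V) (at0 (amul A)) 0 k u)\<rparr>,
      cdec = (\<lambda>k u. assoc M M (ar0 V) 0 k (schur_l 0 M (M \<circ>\<^sub>S M) V (codec C) k u))\<rparr>)"

text \<open>The structure map \<open>P(P(V)) \<rightarrow> P(V)\<close> of the free algebra.\<close>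

definition free_mul :: "('p, 'k::field) operad \<Rightarrow> ('x, 'k) cplx \<Rightarrow>
    int \<Rightarrow> (('p, ('p, 'x, 'k) form, 'k) form \<Rightarrow> 'k) \<Rightarrow> ('p, 'x, 'k) form \<Rightarrow> 'k" where
  "free_mul P V k u = (let M = opm P in
     schur_l 0 (M \<circ>\<^sub>S M) M V (opcomp P) k (reassoc M M (ar0 V) 0 k u))"

text \<open>
  The derivation of degree \<open>-1\<close> of \<open>P(V)\<close> that extends \<open>h : V \<rightarrow> P(V)\<close>.
\<close>

definition free_der :: "('p, 'k::field) operad \<Rightarrow> ('x, 'k) cplx \<Rightarrow>
    (int \<Rightarrow> ('x \<Rightarrow> 'k) \<Rightarrow> ('p, 'x, 'k) form \<Rightarrow> 'k) \<Rightarrow>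
    int \<Rightarrow> (('p, 'x, 'k) form \<Rightarrow> 'k) \<Rightarrow> ('p, 'x, 'k) form \<Rightarrow> 'k" where
  "free_der P V h k u = (let M = opm P in free_mul P V (k - 1)
     (ext (grd (schur M V) k) (\<lambda>p xs. \<Sum>i<length xs. scl (ksgn (fst p + sum_list (take i (degs xs))))
        (tens M (schur M V) p (map (\<lambda>j. let x = fst (xs ! j) in
           if j = i then happ (- 1) h x else (fst x, tens M V (0, opid P) [x])) [0..<length xs]))) u))"

definition cobar :: "('c, 'k::field) cooperad \<Rightarrow> ('p, 'k) operad \<Rightarrow> (nat \<Rightarrow> int \<Rightarrow> ('c \<Rightarrow> 'k) \<Rightarrow> 'p \<Rightarrow> 'k) \<Rightarrow>
    ('c, 'x, 'k) cog \<Rightarrow> ('p, ('p, 'x, 'k) form, 'k) alg" where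
  "cobar C P \<alpha> D = (let M = opm P; V = ccpx D in
     \<lparr>acpx = \<lparr>grd = grd (schur M V),
              bd = (\<lambda>k u. bd (schur M V) k u -
                 free_der P V (\<lambda>j x. schur_l (- 1) (com C) M V \<alpha> j (cdec D j x)) k u)\<rparr>,
      amul = free_mul P V\<rparr>)"


section \<open>Shifted homotopy Lie algebras\<close>

text \<open>\<^term>\<open>lop g [x1, x2]\<close> etc. are the operations of arity at least 2.\<close>

record ('x, 'k) linf =
  lcpx :: "('x, 'k) cplx"
  lop :: "('x, 'k) hvec list \<Rightarrow> 'x \<Rightarrow> 'k"

definition lops :: "('x, 'k) linf \<Rightarrow> ('x, 'k) hvec list \<Rightarrow> 'x \<Rightarrow> 'k" where
  "lops g xs = (if length xs = 1 then bd (lcpx g) (fst (hd xs)) (snd (hd xs)) else lop g xs)"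

text \<open>The Koszul sign of moving the entries at the positions in \<open>S\<close> to the front.\<close>

definition unsh_sign :: "('x, 'k) hvec list \<Rightarrow> nat set \<Rightarrow> 'k::field" where
  "unsh_sign xs S = koszul_sign (map fst xs)
     (filter (\<lambda>i. i \<in> S) [0..<length xs] @ filter (\<lambda>i. i \<notin> S) [0..<length xs])"

text \<open>
  In the defining relation, an (un)shuffle in \<open>Sh(n\<^sub>2, n\<^sub>1 - 1)\<close> is encoded by the nonempty set \<open>S\<close> of the
  \<open>n\<^sub>2\<close> positions whose entries are fed into the inner operation.
\<close>

definition is_linf :: "('x, 'k::field) linf \<Rightarrow> bool" where
  "is_linf g \<longleftrightarrow> chain_complex (lcpx g) \<and>
     (\<forall>xs. \<not> (2 \<le> length xs \<and> (\<forall>x\<in>set xs. mem (lcpx g) x)) \<longrightarrow> lop g xs = 0) \<and>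
     (\<forall>xs. 2 \<le> length xs \<and> (\<forall>x\<in>set xs. mem (lcpx g) x) \<longrightarrow>
        lop g xs \<in> grd (lcpx g) (sum_list (map fst xs) - 1) \<and>
        (\<forall>i<length xs. \<forall>z. hlin (lcpx g) (\<lambda>x. lop g (xs[i := x]) z)) \<and>
        (\<forall>\<sigma>. \<sigma> permutes {..<length xs} \<longrightarrow>
           lop g (permute_list \<sigma> xs) = scl (koszul_sign (map fst xs) (map \<sigma> [0..<length xs])) (lop g xs))) \<and>
     (\<forall>xs. xs \<noteq> [] \<and> (\<forall>x\<in>set xs. mem (lcpx g) x) \<longrightarrow>
        (\<Sum>S\<in>Pow {..<length xs} - {{}}. scl (unsh_sign xs S)
           (lops g ((sum_list (map fst (nths xs S)) - 1, lops g (nths xs S)) # nths xs (- S)))) = 0)"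

text \<open>
  The sum of the symmetric powers \<open>(V\<^bsup>\<otimes>n\<^esup>)\<^bsub>S\<^sub>n\<^esub>\<close>, \<open>n \<ge> 1\<close>, realised in the same way as the composite product;
  \<open>sym V [f\<^sub>1, \<dots>, f\<^sub>n]\<close> is the class of \<open>f\<^sub>1 \<otimes> \<dots> \<otimes> f\<^sub>n\<close>.
\<close>

definition is_sform :: "('x, 'k::field) cplx \<Rightarrow> (('x, 'k) hvec list \<Rightarrow> 'k) \<Rightarrow> bool" where
  "is_sform V \<phi> \<longleftrightarrow> (\<forall>xs. xs \<noteq> [] \<and> (\<forall>x\<in>set xs. mem V x) \<longrightarrow>
     (\<forall>i<length xs. hlin V (\<lambda>x. \<phi> (xs[i := x]))) \<and>
     (\<forall>\<sigma>. \<sigma> permutes {..<length xs} \<longrightarrow>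
        \<phi> (permute_list \<sigma> xs) = koszul_sign (map fst xs) (map \<sigma> [0..<length xs]) * \<phi> xs))"

definition sym :: "('x, 'k::field) cplx \<Rightarrow> ('x, 'k) hvec list \<Rightarrow> (('x, 'k) hvec list \<Rightarrow> 'k) \<Rightarrow> 'k" where
  "sym V xs = (\<lambda>\<phi>. if is_sform V \<phi> then \<phi> xs else 0)"

definition sym_space :: "('x, 'k::field) cplx \<Rightarrow> int \<Rightarrow> ((('x, 'k) hvec list \<Rightarrow> 'k) \<Rightarrow> 'k) set" where
  "sym_space V k = fv.span {sym V xs | xs. xs \<noteq> [] \<and> (\<forall>x\<in>set xs. mem V x) \<and> sum_list (map fst xs) = k}"

definition sym_ext :: "((('x, 'k::field) hvec list \<Rightarrow> 'k) \<Rightarrow> 'k) set \<Rightarrow> (('x, 'k) hvec list \<Rightarrow> 'z \<Rightarrow> 'k) \<Rightarrow>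
    ((('x, 'k) hvec list \<Rightarrow> 'k) \<Rightarrow> 'k) \<Rightarrow> 'z \<Rightarrow> 'k" where
  "sym_ext U h u = (if u \<in> U then (\<lambda>z. u (\<lambda>xs. h xs z)) else 0)"

definition lie_bar :: "('x, 'k::field) linf \<Rightarrow> (('x, 'k) hvec list \<Rightarrow> 'k, 'k) cplx" where
  "lie_bar g = \<lparr>grd = sym_space (lcpx g),
     bd = (\<lambda>k. sym_ext (sym_space (lcpx g) k) (\<lambda>xs. \<Sum>S\<in>Pow {..<length xs} - {{}}. scl (unsh_sign xs S)
        (sym (lcpx g) ((sum_list (map fst (nths xs S)) - 1, lops g (nths xs S)) # nths xs (- S)))))\<rparr>"

text \<open>
  \<open>(T \<otimes> T) \<circ> \<Delta>\<close> for the reduced unshuffle coproduct \<open>\<Delta>\<close> and a map \<open>T\<close> of degree 0.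
  Here \<open>u \<otimes> v\<close> is the function \<open>(\<phi>, \<psi>) \<mapsto> u \<phi> * v \<psi>\<close>.
\<close>

definition unshuffle :: "('x, 'k::field) cplx \<Rightarrow>
    (int \<Rightarrow> ((('x, 'k) hvec list \<Rightarrow> 'k) \<Rightarrow> 'k) \<Rightarrow> 'z \<Rightarrow> 'k) \<Rightarrow>
    int \<Rightarrow> ((('x, 'k) hvec list \<Rightarrow> 'k) \<Rightarrow> 'k) \<Rightarrow> 'z \<times> 'z \<Rightarrow> 'k" where
  "unshuffle V T k = sym_ext (sym_space V k) (\<lambda>xs (\<phi>, \<psi>).
     \<Sum>S\<in>Pow {..<length xs} - {{}, {..<length xs}}. unsh_sign xs S *
       T (sum_list (map fst (nths xs S))) (sym V (nths xs S)) \<phi> *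
       T (sum_list (map fst (nths xs (- S)))) (sym V (nths xs (- S))) \<psi>)"

definition linf_mor :: "('x, 'k::field) linf \<Rightarrow> ('y, 'k) linf \<Rightarrow>
    (int \<Rightarrow> ((('x, 'k) hvec list \<Rightarrow> 'k) \<Rightarrow> 'k) \<Rightarrow> (('y, 'k) hvec list \<Rightarrow> 'k) \<Rightarrow> 'k) \<Rightarrow> bool" where
  "linf_mor g h T \<longleftrightarrow> chain_map (lie_bar g) (lie_bar h) T \<and>
     (\<forall>k. \<forall>u\<in>grd (lie_bar g) k.
        unshuffle (lcpx h) (idmap (lie_bar h)) k (T k u) = unshuffle (lcpx g) T k u)"

definition sym_proj :: "('x, 'k::field) cplx \<Rightarrow> int \<Rightarrow> ((('x, 'k) hvec list \<Rightarrow> 'k) \<Rightarrow> 'k) \<Rightarrow> 'x \<Rightarrow> 'k" where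
  "sym_proj V k = sym_ext (sym_space V k) (\<lambda>xs. if length xs = 1 then snd (hd xs) else 0)"


section \<open>Convolution algebras\<close>

text \<open>
  An element of degree \<open>r\<close> of \<open>hom(D, A)\<close> is a family of linear maps \<open>D\<^sub>k \<rightarrow> A\<^bsub>k+r\<^esub>\<close>, made into a
  function to the scalars by uncurrying.
\<close>

definition uncur :: "(int \<Rightarrow> ('x \<Rightarrow> 'k) \<Rightarrow> 'y \<Rightarrow> 'k) \<Rightarrow> int \<times> ('x \<Rightarrow> 'k) \<times> 'y \<Rightarrow> 'k" where
  "uncur f = (\<lambda>(k, v, y). f k v y)"

definition cur :: "(int \<times> ('x \<Rightarrow> 'k) \<times> 'y \<Rightarrow> 'k) \<Rightarrow> int \<Rightarrow> ('x \<Rightarrow> 'k) \<Rightarrow> 'y \<Rightarrow> 'k" where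
  "cur f = (\<lambda>k v y. f (k, v, y))"

definition hom_cplx :: "('x, 'k::field) cplx \<Rightarrow> ('y, 'k) cplx \<Rightarrow> (int \<times> ('x \<Rightarrow> 'k) \<times> 'y, 'k) cplx" where
  "hom_cplx V W = \<lparr>grd = (\<lambda>r. {f. gmap r V W (cur f)}),
     bd = (\<lambda>r f. if gmap r V W (cur f)
        then uncur (\<lambda>k x. bd W (k + r) (cur f k x) - scl (ksgn r) (cur f (k - 1) (bd V k x))) else 0)\<rparr>"

text \<open>
  The action of \<open>F = f\<^sub>1 \<otimes> \<dots> \<otimes> f\<^sub>n\<close> on \<open>M(n) \<otimes> D\<^bsup>\<otimes>n\<^esup>\<close>, extended by 0 to the other arities.
\<close>

definition F_act :: "('m, 'k::field) smod \<Rightarrow> ('x, 'k) cplx \<Rightarrow> ('y, 'k) cplx \<Rightarrow>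
    (int \<times> ('x \<Rightarrow> 'k) \<times> 'y, 'k) hvec list \<Rightarrow> int \<Rightarrow> (('m, 'x, 'k) form \<Rightarrow> 'k) \<Rightarrow> ('m, 'y, 'k) form \<Rightarrow> 'k" where
  "F_act M V W fs k = ext (grd (schur M V) k) (\<lambda>p xs. let n = length fs in
     if length xs = n
     then \<Sum>\<sigma> | \<sigma> permutes {..<n}.
       scl (ksgn (fst p * sum_list (map fst fs)) * koszul_sign (map fst fs) (map \<sigma> [0..<n]) *
            ksgn (\<Sum>i<n. fst (fst (xs ! i)) * (\<Sum>j\<in>{i<..<n}. fst (fs ! \<sigma> j))))
         (tens M W p (map (\<lambda>i. happ (fst (fs ! \<sigma> i)) (cur (snd (fs ! \<sigma> i))) (fst (xs ! i))) [0..<n]))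
     else 0)"

definition hom_alpha :: "('c, 'k::field) cooperad \<Rightarrow> ('p, 'k) operad \<Rightarrow> (nat \<Rightarrow> int \<Rightarrow> ('c \<Rightarrow> 'k) \<Rightarrow> 'p \<Rightarrow> 'k) \<Rightarrow>
    ('c, 'x, 'k) cog \<Rightarrow> ('p, 'y, 'k) alg \<Rightarrow> (int \<times> ('x \<Rightarrow> 'k) \<times> 'y, 'k) linf" where
  "hom_alpha C P \<alpha> D A = (let V = ccpx D; W = acpx A in
     \<lparr>lcpx = hom_cplx V W,
      lop = (\<lambda>fs. if 2 \<le> length fs \<and> (\<forall>f\<in>set fs. mem (hom_cplx V W) f)
        then let r = sum_list (map fst fs) in
          uncur (\<lambda>k x. amul A (k + r - 1) (schur_l (- 1) (com C) (opm P) W \<alpha> (k + r)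
                          (F_act (com C) V W fs k (cdec D k x))))
        else 0)\<rparr>)"

text \<open>
  \<open>T\<close> is the morphism of dg coalgebras whose projection sends the class of \<open>f\<^sub>1 \<otimes> \<dots> \<otimes> f\<^sub>n\<close> to
  \<open>h [f\<^sub>1, \<dots>, f\<^sub>n]\<close>.
\<close>

definition linf_mor_by :: "('x, 'k::field) linf \<Rightarrow> ('y, 'k) linf \<Rightarrow> (('x, 'k) hvec list \<Rightarrow> 'y \<Rightarrow> 'k) \<Rightarrow>
    (int \<Rightarrow> ((('x, 'k) hvec list \<Rightarrow> 'k) \<Rightarrow> 'k) \<Rightarrow> (('y, 'k) hvec list \<Rightarrow> 'k) \<Rightarrow> 'k) \<Rightarrow> bool" where
  "linf_mor_by g g' h T \<longleftrightarrow> linf_mor g g' T \<and>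
     (\<forall>fs. fs \<noteq> [] \<and> (\<forall>f\<in>set fs. mem (lcpx g) f) \<longrightarrow>
        (let r = sum_list (map fst fs) in sym_proj (lcpx g') r (T r (sym (lcpx g) fs)) = h fs))"

text \<open>
  \<open>T = hom\<^sub>\<ell>(\<Phi>, g) : hom(D, A) \<leadsto> hom(D', A')\<close> for an \<open>\<infinity>\<close>-morphism \<open>\<Phi> : D' \<leadsto> D\<close> and a strict morphism
  \<open>g : A \<rightarrow> A'\<close>; its projection is \<open>F \<mapsto> g \<gamma>\<^sub>A F \<phi>\<^sub>n\<close>.
\<close>

definition is_hom_l :: "('c, 'k::field) cooperad \<Rightarrow> ('p, 'k) operad \<Rightarrow> (nat \<Rightarrow> int \<Rightarrow> ('c \<Rightarrow> 'k) \<Rightarrow> 'p \<Rightarrow> 'k) \<Rightarrow>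
    ('c, 'x, 'k) cog \<Rightarrow> ('c, 'x1, 'k) cog \<Rightarrow> ('p, 'y, 'k) alg \<Rightarrow> ('p, 'y1, 'k) alg \<Rightarrow>
    (int \<Rightarrow> (('p, 'x1, 'k) form \<Rightarrow> 'k) \<Rightarrow> ('p, 'x, 'k) form \<Rightarrow> 'k) \<Rightarrow>
    (int \<Rightarrow> ('y \<Rightarrow> 'k) \<Rightarrow> 'y1 \<Rightarrow> 'k) \<Rightarrow>
    (int \<Rightarrow> (((int \<times> ('x \<Rightarrow> 'k) \<times> 'y, 'k) hvec list \<Rightarrow> 'k) \<Rightarrow> 'k) \<Rightarrow>
      ((int \<times> ('x1 \<Rightarrow> 'k) \<times> 'y1, 'k) hvec list \<Rightarrow> 'k) \<Rightarrow> 'k) \<Rightarrow> bool" where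
  "is_hom_l C P \<alpha> D D' A A' \<Phi> g =
     linf_mor_by (hom_alpha C P \<alpha> D A) (hom_alpha C P \<alpha> D' A') (\<lambda>fs. let r = sum_list (map fst fs) in
       uncur (\<lambda>k x. g (k + r) (amul A (k + r) (F_act (opm P) (ccpx D) (acpx A) fs k
         (\<Phi> k (tens (opm P) (ccpx D') (0, opid P) [(k, x)]))))))"

text \<open>
  \<open>T = hom\<^sub>r(f, \<Psi>) : hom(D, A) \<leadsto> hom(D', A')\<close> for a strict morphism \<open>f : D' \<rightarrow> D\<close> and an \<open>\<infinity>\<close>-morphism
  \<open>\<Psi> : A \<leadsto> A'\<close>; its projection is \<open>F \<mapsto> \<Psi> F \<Delta>\<^sub>D\<^sup>n f\<close>.
\<close>

definition is_hom_r :: "('c, 'k::field) cooperad \<Rightarrow> ('p, 'k) operad \<Rightarrow> (nat \<Rightarrow> int \<Rightarrow> ('c \<Rightarrow> 'k) \<Rightarrow> 'p \<Rightarrow> 'k) \<Rightarrow>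
    ('c, 'x, 'k) cog \<Rightarrow> ('c, 'x1, 'k) cog \<Rightarrow> ('p, 'y, 'k) alg \<Rightarrow> ('p, 'y1, 'k) alg \<Rightarrow>
    (int \<Rightarrow> ('x1 \<Rightarrow> 'k) \<Rightarrow> 'x \<Rightarrow> 'k) \<Rightarrow>
    (int \<Rightarrow> (('c, 'y, 'k) form \<Rightarrow> 'k) \<Rightarrow> ('c, 'y1, 'k) form \<Rightarrow> 'k) \<Rightarrow>
    (int \<Rightarrow> (((int \<times> ('x \<Rightarrow> 'k) \<times> 'y, 'k) hvec list \<Rightarrow> 'k) \<Rightarrow> 'k) \<Rightarrow>
      ((int \<times> ('x1 \<Rightarrow> 'k) \<times> 'y1, 'k) hvec list \<Rightarrow> 'k) \<Rightarrow> 'k) \<Rightarrow> bool" where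
  "is_hom_r C P \<alpha> D D' A A' f \<Psi> =
     linf_mor_by (hom_alpha C P \<alpha> D A) (hom_alpha C P \<alpha> D' A') (\<lambda>fs. let r = sum_list (map fst fs) in
       uncur (\<lambda>k x. cproj C (acpx A') (k + r) (\<Psi> (k + r) (F_act (com C) (ccpx D) (acpx A) fs k
         (cdec D k (f k x))))))"


section \<open>Categories and functors\<close>

record ('o, 'm) cat =
  ob :: "'o set"
  arr :: "'o \<Rightarrow> 'o \<Rightarrow> 'm set"
  ide :: "'o \<Rightarrow> 'm"
  cmp :: "'m \<Rightarrow> 'm \<Rightarrow> 'm"

definition op_cat :: "('o, 'm) cat \<Rightarrow> ('o, 'm) cat" where
  "op_cat \<C> = \<lparr>ob = ob \<C>, arr = (\<lambda>X Y. arr \<C> Y X), ide = ide \<C>, cmp = (\<lambda>g f. cmp \<C> f g)\<rparr>"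

definition prod_cat :: "('o, 'm) cat \<Rightarrow> ('o1, 'm1) cat \<Rightarrow> ('o \<times> 'o1, 'm \<times> 'm1) cat" where
  "prod_cat \<C> \<D> = \<lparr>ob = ob \<C> \<times> ob \<D>, arr = (\<lambda>X Y. arr \<C> (fst X) (fst Y) \<times> arr \<D> (snd X) (snd Y)),
     ide = (\<lambda>X. (ide \<C> (fst X), ide \<D> (snd X))),
     cmp = (\<lambda>g f. (cmp \<C> (fst g) (fst f), cmp \<D> (snd g) (snd f)))\<rparr>"

text \<open>
  Arrows do not determine their source and target, so the arrow part of a functor takes the
  source and the target as additional arguments.
\<close>

definition is_functor :: "('o, 'm) cat \<Rightarrow> ('o1, 'm1) cat \<Rightarrow> ('o \<Rightarrow> 'o1) \<Rightarrow> ('o \<Rightarrow> 'o \<Rightarrow> 'm \<Rightarrow> 'm1) \<Rightarrow> bool" where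
  "is_functor \<C> \<D> Fo Fa \<longleftrightarrow>
     (\<forall>X\<in>ob \<C>. Fo X \<in> ob \<D> \<and> Fa X X (ide \<C> X) = ide \<D> (Fo X)) \<and>
     (\<forall>X\<in>ob \<C>. \<forall>Y\<in>ob \<C>. \<forall>f\<in>arr \<C> X Y. Fa X Y f \<in> arr \<D> (Fo X) (Fo Y)) \<and>
     (\<forall>X\<in>ob \<C>. \<forall>Y\<in>ob \<C>. \<forall>Z\<in>ob \<C>. \<forall>f\<in>arr \<C> X Y. \<forall>g\<in>arr \<C> Y Z.
        Fa X Z (cmp \<C> g f) = cmp \<D> (Fa Y Z g) (Fa X Y f))"

definition inf_alg_cat :: "('c, 'k::field) cooperad \<Rightarrow> ('p, 'k) operad \<Rightarrow> (nat \<Rightarrow> int \<Rightarrow> ('c \<Rightarrow> 'k) \<Rightarrow> 'p \<Rightarrow> 'k) \<Rightarrow>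
    (('p, 'x, 'k) alg, int \<Rightarrow> (('c, 'x, 'k) form \<Rightarrow> 'k) \<Rightarrow> ('c, 'x, 'k) form \<Rightarrow> 'k) cat" where
  "inf_alg_cat C P \<alpha> = \<lparr>ob = {A. is_alg P A},
     arr = (\<lambda>A A'. {\<Psi>. cog_mor C (bar C P \<alpha> A) (bar C P \<alpha> A') \<Psi>}),
     ide = (\<lambda>A. idmap (ccpx (bar C P \<alpha> A))),
     cmp = (\<lambda>\<Psi> \<Phi> k u. \<Psi> k (\<Phi> k u))\<rparr>"

definition inf_cog_cat :: "('c, 'k::field) cooperad \<Rightarrow> ('p, 'k) operad \<Rightarrow> (nat \<Rightarrow> int \<Rightarrow> ('c \<Rightarrow> 'k) \<Rightarrow> 'p \<Rightarrow> 'k) \<Rightarrow>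
    (('c, 'x, 'k) cog, int \<Rightarrow> (('p, 'x, 'k) form \<Rightarrow> 'k) \<Rightarrow> ('p, 'x, 'k) form \<Rightarrow> 'k) cat" where
  "inf_cog_cat C P \<alpha> = \<lparr>ob = {D. is_cog C D},
     arr = (\<lambda>D' D. {\<Phi>. alg_mor P (cobar C P \<alpha> D') (cobar C P \<alpha> D) \<Phi>}),
     ide = (\<lambda>D. idmap (acpx (cobar C P \<alpha> D))),
     cmp = (\<lambda>\<Psi> \<Phi> k u. \<Psi> k (\<Phi> k u))\<rparr>"

definition linf_cat :: "(('x, 'k::field) linf,
    int \<Rightarrow> ((('x, 'k) hvec list \<Rightarrow> 'k) \<Rightarrow> 'k) \<Rightarrow> (('x, 'k) hvec list \<Rightarrow> 'k) \<Rightarrow> 'k) cat" where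
  "linf_cat = \<lparr>ob = {g. is_linf g}, arr = (\<lambda>g h. {T. linf_mor g h T}),
     ide = (\<lambda>g. idmap (lie_bar g)), cmp = (\<lambda>T S k u. T k (S k u))\<rparr>"

text \<open>
  The source category \<open>(conil. \<infinity>\<^sub>\<alpha>-C-cog)\<^sup>o\<^sup>p \<times> \<infinity>\<^sub>\<alpha>-P-alg\<close>; the complexes that underlie its objects have
  coordinates in \<^typ>\<open>'u\<close>.
\<close>

definition source_cat :: "('c, 'k::field) cooperad \<Rightarrow> ('p, 'k) operad \<Rightarrow> (nat \<Rightarrow> int \<Rightarrow> ('c \<Rightarrow> 'k) \<Rightarrow> 'p \<Rightarrow> 'k) \<Rightarrow>
    (('c, 'u, 'k) cog \<times> ('p, 'u, 'k) alg,
     (int \<Rightarrow> (('p, 'u, 'k) form \<Rightarrow> 'k) \<Rightarrow> ('p, 'u, 'k) form \<Rightarrow> 'k) \<times>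
     (int \<Rightarrow> (('c, 'u, 'k) form \<Rightarrow> 'k) \<Rightarrow> ('c, 'u, 'k) form \<Rightarrow> 'k)) cat" where
  "source_cat C P \<alpha> = prod_cat (op_cat (inf_cog_cat C P \<alpha>)) (inf_alg_cat C P \<alpha>)"

text \<open>
  A strict morphism \<open>g\<close> of \<open>P\<close>-algebras is regarded as the \<open>\<infinity>\<close>-morphism \<open>C(g)\<close>, and a strict morphism \<open>f\<close>
  of \<open>C\<close>-coalgebras as the \<open>\<infinity>\<close>-morphism \<open>P(f)\<close>.
\<close>

definition restricts_to_l :: "('c, 'k::field) cooperad \<Rightarrow> ('p, 'k) operad \<Rightarrow> (nat \<Rightarrow> int \<Rightarrow> ('c \<Rightarrow> 'k) \<Rightarrow> 'p \<Rightarrow> 'k) \<Rightarrow>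
    (('c, 'u, 'k) cog \<times> ('p, 'u, 'k) alg \<Rightarrow> (int \<times> ('u \<Rightarrow> 'k) \<times> 'u, 'k) linf) \<Rightarrow>
    (('c, 'u, 'k) cog \<times> ('p, 'u, 'k) alg \<Rightarrow> ('c, 'u, 'k) cog \<times> ('p, 'u, 'k) alg \<Rightarrow>
     (int \<Rightarrow> (('p, 'u, 'k) form \<Rightarrow> 'k) \<Rightarrow> ('p, 'u, 'k) form \<Rightarrow> 'k) \<times>
     (int \<Rightarrow> (('c, 'u, 'k) form \<Rightarrow> 'k) \<Rightarrow> ('c, 'u, 'k) form \<Rightarrow> 'k) \<Rightarrow>
     int \<Rightarrow> (((int \<times> ('u \<Rightarrow> 'k) \<times> 'u, 'k) hvec list \<Rightarrow> 'k) \<Rightarrow> 'k) \<Rightarrow>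
       ((int \<times> ('u \<Rightarrow> 'k) \<times> 'u, 'k) hvec list \<Rightarrow> 'k) \<Rightarrow> 'k) \<Rightarrow> bool" where
  "restricts_to_l C P \<alpha> Ho Ha \<longleftrightarrow>
     (\<forall>D A. is_cog C D \<and> is_alg P A \<longrightarrow> Ho (D, A) = hom_alpha C P \<alpha> D A) \<and>
     (\<forall>D D' A A' \<Phi> g. is_cog C D \<and> is_cog C D' \<and> is_alg P A \<and> is_alg P A' \<and>
        \<Phi> \<in> arr (inf_cog_cat C P \<alpha>) D' D \<and> alg_mor P A A' g \<longrightarrow>
        is_hom_l C P \<alpha> D D' A A' \<Phi> g
          (Ha (D, A) (D', A') (\<Phi>, schur_r (com C) (acpx A) (acpx A') g)))"

definition restricts_to_r :: "('c, 'k::field) cooperad \<Rightarrow> ('p, 'k) operad \<Rightarrow> (nat \<Rightarrow> int \<Rightarrow> ('c \<Rightarrow> 'k) \<Rightarrow> 'p \<Rightarrow> 'k) \<Rightarrow>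
    (('c, 'u, 'k) cog \<times> ('p, 'u, 'k) alg \<Rightarrow> (int \<times> ('u \<Rightarrow> 'k) \<times> 'u, 'k) linf) \<Rightarrow>
    (('c, 'u, 'k) cog \<times> ('p, 'u, 'k) alg \<Rightarrow> ('c, 'u, 'k) cog \<times> ('p, 'u, 'k) alg \<Rightarrow>
     (int \<Rightarrow> (('p, 'u, 'k) form \<Rightarrow> 'k) \<Rightarrow> ('p, 'u, 'k) form \<Rightarrow> 'k) \<times>
     (int \<Rightarrow> (('c, 'u, 'k) form \<Rightarrow> 'k) \<Rightarrow> ('c, 'u, 'k) form \<Rightarrow> 'k) \<Rightarrow>
     int \<Rightarrow> (((int \<times> ('u \<Rightarrow> 'k) \<times> 'u, 'k) hvec list \<Rightarrow> 'k) \<Rightarrow> 'k) \<Rightarrow>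
       ((int \<times> ('u \<Rightarrow> 'k) \<times> 'u, 'k) hvec list \<Rightarrow> 'k) \<Rightarrow> 'k) \<Rightarrow> bool" where
  "restricts_to_r C P \<alpha> Ho Ha \<longleftrightarrow>
     (\<forall>D A. is_cog C D \<and> is_alg P A \<longrightarrow> Ho (D, A) = hom_alpha C P \<alpha> D A) \<and>
     (\<forall>D D' A A' f \<Psi>. is_cog C D \<and> is_cog C D' \<and> is_alg P A \<and> is_alg P A' \<and>
        cog_mor C D' D f \<and> \<Psi> \<in> arr (inf_alg_cat C P \<alpha>) A A' \<longrightarrow>
        is_hom_r C P \<alpha> D D' A A' f \<Psi>
          (Ha (D, A) (D', A') (schur_r (opm P) (ccpx D') (ccpx D) f, \<Psi>)))"

end

theory Submission
  imports Defs
begin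

text \<open>
  Let \<open>T = hom\<^sub>l(\<Phi>, 1)\<close> and \<open>T' = hom\<^sub>r(1, \<Psi>)\<close> for \<open>\<infinity>\<close>-endomorphisms \<open>\<Phi>\<close> of a coalgebra \<open>D\<close> and \<open>\<Psi>\<close> of an
  algebra \<open>A\<close>.  The arrows \<open>(\<Phi>, 1)\<close> and \<open>(1, \<Psi>)\<close> of the product category commute, so a bifunctor that
  restricts to the two given ones forces \<open>T T' = T' T\<close>.  It is therefore enough to find \<open>\<Phi>\<close> and \<open>\<Psi>\<close> for
  which these two composites differ.

  The twisting morphism can be zero.  Take \<open>P = I\<close>, the unit operad, and \<open>C = I \<oplus> C(2)\<close>, where \<open>C(2)\<close> is
  spanned by \<open>\<mu>\<close> of degree 1 and \<open>h\<close> of degree 2 with \<open>d h = \<mu>\<close>, trivial action of the symmetric group and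
  decomposition \<open>x \<mapsto> (id; x) + (x; id, id)\<close>.  Then \<open>\<alpha> = 0\<close> is Koszul because \<open>C \<circ> I = C\<close> is acyclic
  outside arity 1.  For \<open>\<alpha> = 0\<close> the twisted parts of the bar and cobar differentials vanish: an
  \<open>\<infinity>\<close>-morphism of coalgebras \<open>D' \<leadsto> D\<close> is any chain map \<open>D' \<rightarrow> D\<close>, whether or not it respects
  the decompositions, and an \<open>\<infinity>\<close>-morphism of algebras (which are chain complexes) is any morphism of
  \<open>C\<close>-coalgebras \<open>C(A) \<rightarrow> C(A')\<close>.

  Let \<open>\<Phi>\<close> be multiplication by 2.  As \<open>P\<close> is concentrated in arity 1, \<open>T\<close> has only the linear component
  \<open>f \<mapsto> 2 f\<close>.  Let \<open>\<Psi>\<close> be a morphism with only a quadratic component, which gives \<open>T'\<close> the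
  quadratic component \<open>q(f, g) = \<Psi> (f \<otimes> g) \<Delta>\<close>.  On the class of \<open>f \<otimes> f\<close> the
  projection of \<open>T T'\<close> is \<open>2 q(f, f)\<close>, and that of \<open>T' T\<close> is \<open>q(2 f, 2 f) = 4 q(f, f)\<close>.  These differ as
  soon as \<open>q(f, f) \<noteq> 0\<close>, in characteristic 0.  Nonzero values are provided by the cellular chains \<open>D\<close> of
  a disc with one vertex \<open>e\<close>, one edge \<open>b\<close> and one face \<open>d\<close> attached along the edge, with
  \<open>\<Delta> d = (id; d) + (h; e, e)\<close> and \<open>\<Delta> b = (id; b) + (\<mu>; e, e)\<close>, and by \<open>A\<close> with basis \<open>a\<close> of
  degree 0, \<open>a'\<close> of degree 2 and zero differential, with \<open>\<Psi>(h; a, a) = a'\<close>.  With \<open>f(e) = a\<close> one has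
  \<open>q(f, f)(d) = 2 a'\<close>.

  The bulk of the text verifies that these are a cooperad, an operad, a coalgebra and an algebra.  A
  generator of a composite product is evaluation at forms, so a map on generators is well defined
  when it pulls forms back to forms.  The difficult case is the isomorphism \<open>(M \<circ> N) \<circ> L \<cong> M \<circ> (N \<circ> L)\<close>
  (\<open>is_form_assoc\<close>), which rests on the rules for Koszul signs (\<open>koszul_sign_compose\<close>,
  \<open>koszul_sign_blocks\<close>).  The two projections are computed in \<open>proj_l\<close> and \<open>proj_r\<close> and compared in
  \<open>projections_do_not_commute\<close>.
\<close>

section \<open>Koszul signs\<close>

lemma permutes_nat_less: "\<tau> permutes {..<n} \<Longrightarrow> i < n \<Longrightarrow> \<tau> i < (n :: nat)"
  using permutes_in_image[of \<tau> "{..<n}" i] by simp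

lemma ksgn_0 [simp]: "ksgn 0 = (1 :: 'k::field)"
  by (simp add: ksgn_def)

lemma ksgn_add: "ksgn (a + b) = (ksgn a * ksgn b :: 'k::field)"
  by (simp add: ksgn_def)

lemma ksgn_square [simp]: "ksgn a * ksgn a = (1 :: 'k::field)"
  by (simp add: ksgn_def)

lemma ksgn_sum: "finite A \<Longrightarrow> ksgn (\<Sum>i\<in>A. f i) = (\<Prod>i\<in>A. ksgn (f i) :: 'k::field)"
  by (induction A rule: finite_induct) (auto simp: ksgn_add)

lemma ksgn_diff_one_mult: "ksgn ((a - 1) * b) = (ksgn (a * b) * ksgn b :: 'k::field)"
  "ksgn (b * (a - 1)) = (ksgn (b * a) * ksgn b :: 'k::field)"
  by (auto simp: ksgn_def)

text \<open>
  A permutation \<open>\<tau>\<close> carries the pairs \<open>i < j\<close> to all unordered pairs, bijectively.  The factor of a pair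
  changes only if \<open>\<tau>\<close> reverses its order, and then by \<open>S\<close>.  Both the rule for composite reorderings and
  the rule for permuted blocks are instances.
\<close>

lemma prod_pairs_permute:
  fixes X S :: "nat \<Rightarrow> nat \<Rightarrow> 'k::comm_ring_1"
  assumes \<tau>: "bij_betw \<tau> {..<n} {..<n}"
    and XS: "\<And>a b. a < n \<Longrightarrow> b < n \<Longrightarrow> a \<noteq> b \<Longrightarrow> X a b * X b a = S a b"
    and X1: "\<And>a b. X a b * X a b = 1"
  shows "(\<Prod>j<n. \<Prod>i<j. X (\<tau> i) (\<tau> j)) =
    (\<Prod>j<n. \<Prod>i<j. X i j) * (\<Prod>j<n. \<Prod>i<j. if \<tau> j < \<tau> i then S (\<tau> i) (\<tau> j) else 1)"
proof -
  let ?Q = "Sigma {..<n} (\<lambda>j. {..<j})"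
  let ?T = "\<lambda>(j, i). (max (\<tau> i) (\<tau> j), min (\<tau> i) (\<tau> j))"
  have inj: "inj_on \<tau> {..<n}" and lt: "\<And>i. i < n \<Longrightarrow> \<tau> i < n"
    using \<tau> by (auto simp: bij_betw_def)
  have T: "?T ` ?Q \<subseteq> ?Q"
  proof
    fix q assume "q \<in> ?T ` ?Q"
    then obtain j i where a: "j < n" "i < j" and q: "q = ?T (j, i)" by auto
    then show "q \<in> ?Q"
      using lt[of i] lt[of j] inj_onD[OF inj, of i j] by (cases "\<tau> i" "\<tau> j" rule: linorder_cases) auto
  qed
  have "inj_on ?T ?Q"
  proof (rule inj_onI)
    fix q q' assume "q \<in> ?Q" "q' \<in> ?Q" and e: "?T q = ?T q'"
    then obtain j i j' i' where a: "j < n" "i < j" "j' < n" "i' < j'" and q: "q = (j, i)" "q' = (j', i')"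
      by auto
    have "(\<tau> i = \<tau> i' \<and> \<tau> j = \<tau> j') \<or> (\<tau> i = \<tau> j' \<and> \<tau> j = \<tau> i')"
      using e unfolding q by (simp add: max_def min_def split: if_splits)
    then show "q = q'"
      using a inj_onD[OF inj, of i i'] inj_onD[OF inj, of j j'] inj_onD[OF inj, of i j'] inj_onD[OF inj, of j i']
      unfolding q by (elim disjE) simp_all
  qed
  then have bij: "bij_betw ?T ?Q ?Q"
    using T by (simp add: bij_betw_def endo_inj_surj)
  have "(\<Prod>j<n. \<Prod>i<j. X i j) = (\<Prod>q\<in>?Q. X (snd q) (fst q))"
    by (subst prod.Sigma) (auto simp: case_prod_beta)
  also have "\<dots> = (\<Prod>q\<in>?Q. X (snd (?T q)) (fst (?T q)))"
    by (rule prod.reindex_bij_betw[OF bij, symmetric])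
  finally have 1: "(\<Prod>j<n. \<Prod>i<j. X i j) = (\<Prod>q\<in>?Q. X (snd (?T q)) (fst (?T q)))" .
  have 2: "(\<Prod>j<n. \<Prod>i<j. if \<tau> j < \<tau> i then S (\<tau> i) (\<tau> j) else 1) =
      (\<Prod>(j, i)\<in>?Q. if \<tau> j < \<tau> i then S (\<tau> i) (\<tau> j) else 1)"
    by (subst prod.Sigma) auto
  have "(\<Prod>j<n. \<Prod>i<j. X (\<tau> i) (\<tau> j)) = (\<Prod>(j, i)\<in>?Q. X (\<tau> i) (\<tau> j))"
    by (subst prod.Sigma) auto
  also have "\<dots> = (\<Prod>q\<in>?Q. X (snd (?T q)) (fst (?T q)) *
      (case q of (j, i) \<Rightarrow> if \<tau> j < \<tau> i then S (\<tau> i) (\<tau> j) else 1))"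
  proof (rule prod.cong[OF refl])
    fix q assume "q \<in> ?Q"
    then obtain j i where q: "q = (j, i)" and a: "j < n" "i < j" by auto
    then have l: "\<tau> i < n" "\<tau> j < n" "\<tau> i \<noteq> \<tau> j"
      using lt[of i] lt[of j] inj_onD[OF inj, of i j] by auto
    have "X (\<tau> i) (\<tau> j) = X (\<tau> j) (\<tau> i) * S (\<tau> i) (\<tau> j)"
      using XS[OF l] X1[of "\<tau> j" "\<tau> i"] by (metis mult.commute mult.left_commute mult.right_neutral)
    then show "(case q of (j, i) \<Rightarrow> X (\<tau> i) (\<tau> j)) = X (snd (?T q)) (fst (?T q)) *
        (case q of (j, i) \<Rightarrow> if \<tau> j < \<tau> i then S (\<tau> i) (\<tau> j) else 1)"
      unfolding q using l(3) by (auto simp: max_def min_def)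
  qed
  finally show ?thesis unfolding 1 2 by (simp add: prod.distrib)
qed

text \<open>
  Reordering by \<open>js\<close> and then by \<open>ks\<close> multiplies the signs; the second sign is computed with the degrees
  in the order that the first reordering has produced.
\<close>

lemma koszul_sign_compose:
  assumes js: "distinct js" and ks: "distinct ks" "set ks = {..<length js}"
  shows "koszul_sign ds (map ((!) js) ks) = (koszul_sign ds js * koszul_sign (map ((!) ds) js) ks :: 'k::field)"
proof -
  let ?n = "length js"
  let ?s = "\<lambda>a b. ksgn (ds ! (js ! a) * ds ! (js ! b)) :: 'k"
  have len: "length ks = ?n"
    using ks by (metis card_lessThan distinct_card)
  have "bij_betw ((!) ks) {..<?n} {..<?n}"
    by (rule bij_betw_nth[OF ks(1)]) (simp_all add: ks(2) len)
  note P = prod_pairs_permute[OF this, of "\<lambda>a b. if js ! b < js ! a then ?s a b else 1" ?s]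
  have lt: "ks ! i < ?n" if "i < ?n" for i
    using nth_mem[of i ks] that ks(2) len by simp
  have "koszul_sign ds (map ((!) js) ks) =
      (\<Prod>j<?n. \<Prod>i<j. if js ! (ks ! j) < js ! (ks ! i) then ?s (ks ! i) (ks ! j) else 1)"
    unfolding koszul_sign_def using len by (auto intro!: prod.cong)
  also have "\<dots> = (\<Prod>j<?n. \<Prod>i<j. if js ! j < js ! i then ?s i j else 1) *
      (\<Prod>j<?n. \<Prod>i<j. if ks ! j < ks ! i then ?s (ks ! i) (ks ! j) else 1)"
  proof (rule P)
    fix a b assume "a < ?n" "b < ?n" "a \<noteq> b"
    then have "js ! a \<noteq> js ! b" using js by (simp add: nth_eq_iff_index_eq)
    then show "(if js ! b < js ! a then ?s a b else 1) * (if js ! a < js ! b then ?s b a else 1) = ?s a b"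
      by (auto simp: mult.commute)
  qed simp
  also have "(\<Prod>j<?n. \<Prod>i<j. if ks ! j < ks ! i then ?s (ks ! i) (ks ! j) else 1) = koszul_sign (map ((!) ds) js) ks"
    unfolding koszul_sign_def using len lt by (auto intro!: prod.cong)
  finally show ?thesis by (simp add: koszul_sign_def)
qed

lemma koszul_sign_square [simp]: "koszul_sign ds js * koszul_sign ds js = (1 :: 'k::field)"
  unfolding koszul_sign_def prod.distrib[symmetric] by (intro prod.neutral ballI) simp

lemma koszul_sign_square_left: "koszul_sign ds js * (koszul_sign ds js * x) = (x :: 'k::field)"
  by (simp add: mult.assoc[symmetric])

lemma koszul_sign_sorted:
  assumes "sorted js" shows "koszul_sign ds js = 1"
proof -
  have "\<not> js ! j < js ! i" if "j < length js" "i < j" for i j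
    using sorted_nth_mono[OF assms, of i j] that by simp
  then show ?thesis unfolding koszul_sign_def by (intro prod.neutral ballI) auto
qed

lemma koszul_sign_even:
  "(\<And>j. j \<in> set js \<Longrightarrow> even (ds ! j)) \<Longrightarrow> koszul_sign ds js = 1"
  unfolding koszul_sign_def by (intro prod.neutral ballI) (auto simp: ksgn_def)

text \<open>The part of the Koszul sign of a concatenation that is due to pairs across the two parts.\<close>

definition cross_sign :: "int list \<Rightarrow> nat list \<Rightarrow> nat list \<Rightarrow> 'k::field" where
  "cross_sign ds xs ys = (\<Prod>x\<leftarrow>xs. \<Prod>y\<leftarrow>ys. if y < x then ksgn (ds ! x * ds ! y) else 1)"

lemma prod_list_mult: "(\<Prod>x\<leftarrow>xs. f x * g x) = (\<Prod>x\<leftarrow>xs. f x) * (\<Prod>x\<leftarrow>xs. g x :: 'k::comm_monoid_mult)"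
  by (induction xs) (auto simp: ac_simps)

lemma prod_list_one: "(\<And>x. x \<in> set xs \<Longrightarrow> f x = 1) \<Longrightarrow> (\<Prod>x\<leftarrow>xs. f x) = (1 :: 'k::comm_monoid_mult)"
  by (induction xs) auto

lemma cross_sign_Nil [simp]: "cross_sign ds [] ys = 1" "cross_sign ds xs [] = 1"
  by (simp_all add: cross_sign_def prod_list_one)

lemma cross_sign_append:
  "cross_sign ds (xs @ xs') ys = cross_sign ds xs ys * cross_sign ds xs' ys"
  "cross_sign ds xs (ys @ ys') = cross_sign ds xs ys * cross_sign ds xs ys'"
  by (simp_all add: cross_sign_def prod_list_mult)

lemma cross_sign_concat:
  "cross_sign ds xs (concat yss) = (\<Prod>ys\<leftarrow>yss. cross_sign ds xs ys)"
  "cross_sign ds (concat yss) xs = (\<Prod>ys\<leftarrow>yss. cross_sign ds ys xs)"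
  by (induction yss) (simp_all add: cross_sign_append)

lemma cross_sign_square [simp]: "cross_sign ds xs ys * cross_sign ds xs ys = 1"
  unfolding cross_sign_def prod_list_mult[symmetric] by (intro prod_list_one) simp

lemma cross_sign_mset:
  assumes "mset xs = mset xs'" "mset ys = mset ys'"
  shows "cross_sign ds xs ys = cross_sign ds xs' ys'"
proof -
  have "(\<Prod>y\<leftarrow>ys. f y) = (\<Prod>y\<leftarrow>ys'. f y)" for f :: "nat \<Rightarrow> 'a"
    using arg_cong[OF assms(2), of "\<lambda>m. prod_mset (image_mset f m)"]
    by (simp only: mset_map[symmetric] prod_mset_prod_list)
  moreover have "(\<Prod>y\<leftarrow>xs. f y) = (\<Prod>y\<leftarrow>xs'. f y)" for f :: "nat \<Rightarrow> 'a"
    using arg_cong[OF assms(1), of "\<lambda>m. prod_mset (image_mset f m)"]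
    by (simp only: mset_map[symmetric] prod_mset_prod_list)
  ultimately show ?thesis unfolding cross_sign_def by simp
qed

text \<open>
  Every pair \<open>x\<close>, \<open>y\<close> is inverted in exactly one of the two arrangements, so the product of the signs is
  that of exchanging two symbols which carry the total degrees.
\<close>

lemma cross_sign_swap:
  assumes "set xs \<inter> set ys = {}"
  shows "cross_sign ds xs ys * cross_sign ds ys xs =
    (ksgn (sum_list (map ((!) ds) xs) * sum_list (map ((!) ds) ys)) :: 'k::field)"
proof -
  have one: "cross_sign ds [x] ys * cross_sign ds ys [x] = (ksgn (ds ! x * sum_list (map ((!) ds) ys)) :: 'k)"
    if "x \<notin> set ys" for x ys
    using that
  proof (induction ys)
    case (Cons y ys)
    have "cross_sign ds [x] (y # ys) * cross_sign ds (y # ys) [x] =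
      ((cross_sign ds [x] [y] * cross_sign ds [y] [x]) * (cross_sign ds [x] ys * cross_sign ds ys [x]) :: 'k)"
      by (simp add: cross_sign_def ac_simps)
    also have "cross_sign ds [x] [y] * cross_sign ds [y] [x] = (ksgn (ds ! x * ds ! y) :: 'k)"
      using Cons.prems by (auto simp: cross_sign_def mult.commute)
    finally show ?case using Cons by (simp add: ksgn_add distrib_left)
  qed simp
  show ?thesis using assms
  proof (induction xs)
    case (Cons x xs)
    have "cross_sign ds (x # xs) ys = (cross_sign ds [x] ys * cross_sign ds xs ys :: 'k)"
      "cross_sign ds ys (x # xs) = (cross_sign ds ys [x] * cross_sign ds ys xs :: 'k)"
      using cross_sign_append(1)[of ds "[x]" xs ys] cross_sign_append(2)[of ds ys "[x]" xs] by simp_all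
    then have "cross_sign ds (x # xs) ys * cross_sign ds ys (x # xs) =
      ((cross_sign ds [x] ys * cross_sign ds ys [x]) * (cross_sign ds xs ys * cross_sign ds ys xs) :: 'k)"
      by simp
    then show ?case using Cons one[of x ys] by (simp add: ksgn_add distrib_right)
  qed simp
qed

lemma koszul_sign_snoc: "koszul_sign ds (js @ [x]) = (koszul_sign ds js * cross_sign ds js [x] :: 'k::field)"
proof -
  have "cross_sign ds js [x] = (\<Prod>i<length js. if x < js ! i then ksgn (ds ! (js ! i) * ds ! x) else 1 :: 'k)"
    unfolding cross_sign_def prod.list_conv_set_nth by (auto simp: atLeast0LessThan intro!: prod.cong)
  moreover have "(\<Prod>j<length js. \<Prod>i<j. if (js @ [x]) ! j < (js @ [x]) ! i
      then ksgn (ds ! ((js @ [x]) ! i) * ds ! ((js @ [x]) ! j)) else 1) = (koszul_sign ds js :: 'k)"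
    unfolding koszul_sign_def by (auto intro!: prod.cong simp: nth_append)
  moreover have "(\<Prod>i<length js. if x < (js @ [x]) ! i then ksgn (ds ! ((js @ [x]) ! i) * ds ! ((js @ [x]) ! length js)) else 1) =
      (\<Prod>i<length js. if x < js ! i then ksgn (ds ! (js ! i) * ds ! x) else 1 :: 'k)"
    by (auto intro!: prod.cong simp: nth_append)
  ultimately show ?thesis
    unfolding koszul_sign_def[of ds "js @ [x]"] by simp
qed

lemma koszul_sign_append:
  "koszul_sign ds (xs @ ys) = (koszul_sign ds xs * koszul_sign ds ys * cross_sign ds xs ys :: 'k::field)"
proof (induction ys rule: rev_induct)
  case Nil
  show ?case by (simp add: koszul_sign_def)
next
  case (snoc y ys)
  have "koszul_sign ds (xs @ ys @ [y]) = (koszul_sign ds (xs @ ys) * cross_sign ds (xs @ ys) [y] :: 'k)"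
    using koszul_sign_snoc[of ds "xs @ ys" y] by simp
  then show ?case using snoc
    by (simp add: koszul_sign_snoc cross_sign_append ac_simps)
qed

lemma koszul_sign_concat:
  "koszul_sign ds (concat bs) = ((\<Prod>b\<leftarrow>bs. koszul_sign ds b) *
     (\<Prod>j<length bs. \<Prod>i<j. cross_sign ds (bs ! i) (bs ! j)) :: 'k::field)"
proof (induction bs rule: rev_induct)
  case Nil
  show ?case by (simp add: koszul_sign_def)
next
  case (snoc b bs)
  have "cross_sign ds (concat bs) b = (\<Prod>i<length bs. cross_sign ds (bs ! i) b :: 'k)"
    unfolding cross_sign_concat prod.list_conv_set_nth by (auto simp: atLeast0LessThan intro!: prod.cong)
  moreover have "(\<Prod>j<length bs. \<Prod>i<j. cross_sign ds ((bs @ [b]) ! i) ((bs @ [b]) ! j)) =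
      (\<Prod>j<length bs. \<Prod>i<j. cross_sign ds (bs ! i) (bs ! j) :: 'k)"
    by (auto intro!: prod.cong simp: nth_append)
  moreover have "(\<Prod>i<length bs. cross_sign ds ((bs @ [b]) ! i) b) = (\<Prod>i<length bs. cross_sign ds (bs ! i) b :: 'k)"
    by (auto intro!: prod.cong simp: nth_append)
  ultimately show ?case using snoc
    by (simp add: koszul_sign_append ac_simps)
qed

text \<open>
  Disjoint blocks behave like single symbols of degree the sum of the degrees in the block; the order
  inside the blocks contributes the same factor on both sides.
\<close>

lemma koszul_sign_blocks:
  fixes Bl :: "nat \<Rightarrow> nat list"
  assumes \<tau>: "\<tau> permutes {..<n}"
    and disj: "\<And>i j. i < n \<Longrightarrow> j < n \<Longrightarrow> i \<noteq> j \<Longrightarrow> set (Bl i) \<inter> set (Bl j) = {}"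
  shows "koszul_sign ds (concat (map (\<lambda>i. Bl (\<tau> i)) [0..<n])) =
    koszul_sign ds (concat (map Bl [0..<n])) *
    (koszul_sign (map (\<lambda>i. sum_list (map ((!) ds) (Bl i))) [0..<n]) (map \<tau> [0..<n]) :: 'k::field)"
proof -
  let ?S = "\<lambda>a b. ksgn (sum_list (map ((!) ds) (Bl a)) * sum_list (map ((!) ds) (Bl b))) :: 'k"
  have bij: "bij_betw \<tau> {..<n} {..<n}" using \<tau> by (rule permutes_imp_bij)
  have P: "(\<Prod>j<n. \<Prod>i<j. cross_sign ds (Bl (\<tau> i)) (Bl (\<tau> j)) :: 'k) =
    (\<Prod>j<n. \<Prod>i<j. cross_sign ds (Bl i) (Bl j)) *
    (\<Prod>j<n. \<Prod>i<j. if \<tau> j < \<tau> i then ?S (\<tau> i) (\<tau> j) else 1)"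
    by (rule prod_pairs_permute[OF bij]) (simp_all add: cross_sign_swap disj)
  have "(\<Prod>j<n. \<Prod>i<j. if \<tau> j < \<tau> i then ?S (\<tau> i) (\<tau> j) else 1) =
      koszul_sign (map (\<lambda>i. sum_list (map ((!) ds) (Bl i))) [0..<n]) (map \<tau> [0..<n])"
    unfolding koszul_sign_def using permutes_nat_less[OF \<tau>] by (auto intro!: prod.cong)
  moreover have "(\<Prod>i\<leftarrow>[0..<n]. koszul_sign ds (Bl (\<tau> i)) :: 'k) = (\<Prod>i\<leftarrow>[0..<n]. koszul_sign ds (Bl i))"
    unfolding prod.list_conv_set_nth
    using prod.reindex_bij_betw[OF bij, of "\<lambda>i. koszul_sign ds (Bl i)"] by (simp add: atLeast0LessThan)
  ultimately show ?thesis
    unfolding koszul_sign_concat using P by (simp add: o_def)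
qed

lemma koszul_sign_map_add:
  assumes "\<And>j. j \<in> set js \<Longrightarrow> ds ! (a + j) = ds' ! j"
  shows "koszul_sign ds (map ((+) a) js) = koszul_sign ds' js"
  unfolding koszul_sign_def using assms by (auto intro!: prod.cong)

lemma koszul_sign_cong:
  assumes "\<And>j. j \<in> set js \<Longrightarrow> ds ! j = ds' ! j"
  shows "koszul_sign ds js = koszul_sign ds' js"
  unfolding koszul_sign_def using assms by (auto intro!: prod.cong)

text \<open>
  The sign rule behind the equivariance of differentials: a symbol of degree -1 may be moved past the
  entries before position \<open>\<sigma> i\<close> and merged with the entry there, and the list permuted afterwards, or
  the list may be permuted first.
\<close>

lemma koszul_sign_lower_entry:
  assumes \<sigma>: "\<sigma> permutes {..<length ds}" and i: "i < length ds"
  shows "koszul_sign (ds[\<sigma> i := ds ! \<sigma> i - 1]) (map \<sigma> [0..<length ds]) * ksgn (\<Sum>j<i. ds ! \<sigma> j) =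
    (koszul_sign ds (map \<sigma> [0..<length ds]) * ksgn (\<Sum>j<\<sigma> i. ds ! j) :: 'k::field)"
proof -
  let ?n = "length ds" let ?c = "\<sigma> i" let ?ds = "ds[?c := ds ! ?c - 1]"
  define pre post where "pre = map \<sigma> [0..<i]" and "post = map \<sigma> [Suc i..<?n]"
  have split: "map \<sigma> [0..<?n] = pre @ [?c] @ post"
    using i upt_add_eq_append[of 0 i "?n - i"] unfolding pre_def post_def
    by (simp add: upt_conv_Cons)
  have dist: "distinct (pre @ [?c] @ post)"
    unfolding split[symmetric] using \<sigma> by (simp add: distinct_map permutes_inj_on)
  have set: "set (pre @ [?c] @ post) = {..<?n}"
    unfolding split[symmetric] using permutes_image[OF \<sigma>] by (simp add: atLeast0LessThan)
  have c: "?c < ?n" using set by auto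
  have ne: "?ds ! x = ds ! x" if "x \<in> set pre \<union> set post" for x
    using that dist by (metis IntI UnE append_Cons append_Nil distinct.simps(2) distinct_append nth_list_update_neq
        insert_iff list.set(2) empty_iff)
  have cc: "?ds ! ?c = ds ! ?c - 1" using c by simp
  have k: "koszul_sign ds' (pre @ [?c] @ post) = koszul_sign ds' pre * koszul_sign ds' post *
      cross_sign ds' pre post * cross_sign ds' pre [?c] * (cross_sign ds' [?c] post :: 'k)" for ds'
    by (simp add: koszul_sign_append cross_sign_append koszul_sign_sorted del: append_Cons)
  have e: "koszul_sign ?ds pre = (koszul_sign ds pre :: 'k)" "koszul_sign ?ds post = (koszul_sign ds post :: 'k)"
    using ne by (auto intro!: koszul_sign_cong)
  have e3: "cross_sign ?ds pre post = (cross_sign ds pre post :: 'k)"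
    unfolding cross_sign_def by (intro arg_cong[of _ _ prod_list] map_cong refl) (simp add: ne)
  \<comment> \<open>Lowering the degree of the entry changes the sign by the degrees of those entries that it crosses.\<close>
  define f where "f x = (ksgn (ds ! x) :: 'k)" for x
  have e4: "cross_sign ?ds pre [?c] = cross_sign ds pre [?c] * (\<Prod>x\<leftarrow>pre. if ?c < x then f x else 1)"
    unfolding cross_sign_def prod_list_mult[symmetric]
    by (intro arg_cong[of _ _ prod_list] map_cong refl) (simp add: ne cc ksgn_diff_one_mult f_def)
  have e5: "cross_sign ?ds [?c] post = cross_sign ds [?c] post * (\<Prod>x\<leftarrow>post. if x < ?c then f x else 1)"
  proof -
    have s: "cross_sign ds' [?c] post = (\<Prod>x\<leftarrow>post. if x < ?c then ksgn (ds' ! ?c * ds' ! x) else 1 :: 'k)" for ds'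
      by (simp add: cross_sign_def)
    show ?thesis unfolding s prod_list_mult[symmetric]
      by (intro arg_cong[of _ _ prod_list] map_cong refl) (simp add: ne cc ksgn_diff_one_mult f_def)
  qed
  have s1: "ksgn (\<Sum>j<i. ds ! \<sigma> j) = (\<Prod>x\<leftarrow>pre. f x)"
    unfolding pre_def f_def by (simp add: ksgn_sum prod.list_conv_set_nth atLeast0LessThan)
  have s2: "ksgn (\<Sum>j<?c. ds ! j) = (\<Prod>x\<leftarrow>pre. if x < ?c then f x else 1) * (\<Prod>x\<leftarrow>post. if x < ?c then f x else 1)"
  proof -
    have "(\<Prod>x\<leftarrow>pre @ [?c] @ post. if x < ?c then f x else 1) = (\<Prod>x\<in>{..<?n}. if x < ?c then f x else 1)"
      using prod.distinct_set_conv_list[OF dist, of "\<lambda>x. if x < ?c then f x else 1"] set by simp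
    also have "\<dots> = (\<Prod>x<?c. f x)"
      using c by (intro prod.mono_neutral_cong_right) auto
    finally show ?thesis by (simp add: ksgn_sum f_def)
  qed
  have s3: "(\<Prod>x\<leftarrow>pre. if ?c < x then f x else 1) * (\<Prod>x\<leftarrow>pre. f x) = (\<Prod>x\<leftarrow>pre. if x < ?c then f x else 1)"
    unfolding prod_list_mult[symmetric] using dist
    by (intro arg_cong[of _ _ prod_list] map_cong) (auto simp: f_def not_less)
  show ?thesis
    unfolding split k e e3 e4 e5 s1 s2 s3[symmetric] by (simp add: ac_simps)
qed

section \<open>Forms, generators and linear extension\<close>

lemma scl_apply: "scl a v x = a * v x"
  by (simp add: scl_def)

text \<open>
  Linearity without a condition on the target and on values outside \<open>U\<close>, so that composites and sums
  of maps that are given by formulas can be handled directly.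
\<close>

definition lin_on :: "('x \<Rightarrow> 'k::field) set \<Rightarrow> (('x \<Rightarrow> 'k) \<Rightarrow> 'y \<Rightarrow> 'k) \<Rightarrow> bool" where
  "lin_on U f \<longleftrightarrow> (\<forall>x\<in>U. \<forall>y\<in>U. f (x + y) = f x + f y) \<and> (\<forall>a. \<forall>x\<in>U. f (scl a x) = scl a (f x))"

lemma lin_on_compose:
  "lin_on U f \<Longrightarrow> (\<And>x. x \<in> U \<Longrightarrow> f x \<in> W) \<Longrightarrow> lin_on W g \<Longrightarrow> lin_on U (\<lambda>x. g (f x))"
  by (simp add: lin_on_def)

lemma lin_on_id: "lin_on U (\<lambda>x. x)"
  by (simp add: lin_on_def)

lemma lin_on_add: "lin_on U f \<Longrightarrow> lin_on U g \<Longrightarrow> lin_on U (\<lambda>x. f x + g x)"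
  by (auto simp: lin_on_def scl_def fun_eq_iff algebra_simps)

lemma lin_on_scl: "lin_on U f \<Longrightarrow> lin_on U (\<lambda>x. scl a (f x))"
  by (auto simp: lin_on_def scl_def fun_eq_iff algebra_simps)

lemma linmap_lin_on: "linmap U W f \<Longrightarrow> lin_on U f"
  by (simp add: linmap_def lin_on_def)

lemma lin_on_addD: "lin_on U f \<Longrightarrow> x \<in> U \<Longrightarrow> y \<in> U \<Longrightarrow> f (x + y) = f x + f y"
  by (simp add: lin_on_def)

lemma lin_on_sclD: "lin_on U f \<Longrightarrow> x \<in> U \<Longrightarrow> f (scl a x) = scl a (f x)"
  by (simp add: lin_on_def)

lemma lin_on_zero: "lin_on U f \<Longrightarrow> x \<in> U \<Longrightarrow> f 0 = 0"
  unfolding lin_on_def by (metis fv.scale_zero_left)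

lemma linmap_in: "linmap U W f \<Longrightarrow> x \<in> U \<Longrightarrow> f x \<in> W"
  by (simp add: linmap_def)

lemma gmap_in: "gmap r V W f \<Longrightarrow> x \<in> grd V k \<Longrightarrow> f k x \<in> grd W (k + r)"
  by (simp add: gmap_def linmap_def)

lemma gmap_add: "gmap r V W f \<Longrightarrow> x \<in> grd V k \<Longrightarrow> y \<in> grd V k \<Longrightarrow> f k (x + y) = f k x + f k y"
  by (simp add: gmap_def linmap_def)

lemma gmap_scl: "gmap r V W f \<Longrightarrow> x \<in> grd V k \<Longrightarrow> f k (scl a x) = scl a (f k x)"
  by (simp add: gmap_def linmap_def)

lemma chain_map_gmap: "chain_map V W f \<Longrightarrow> gmap 0 V W f"
  by (simp add: chain_map_def)

lemma happ_simps [simp]: "fst (happ r f x) = fst x + r" "snd (happ r f x) = f (fst x) (snd x)"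
  by (simp_all add: happ_def)

lemma mem_pair [simp]: "mem V (k, x) \<longleftrightarrow> x \<in> grd V k"
  by (simp add: mem_def)

lemma chain_complex_subspace: "chain_complex V \<Longrightarrow> fv.subspace (grd V k)"
  by (simp add: chain_complex_def)

lemma chain_complex_bd: "chain_complex V \<Longrightarrow> gmap (- 1) V V (bd V)"
  by (simp add: chain_complex_def gmap_def)

lemma smodule_chain_complex: "smodule M \<Longrightarrow> chain_complex (cpx M n)"
  by (simp add: smodule_def)

lemma smodule_act: "smodule M \<Longrightarrow> \<sigma> permutes {..<n} \<Longrightarrow> chain_map (cpx M n) (cpx M n) (act M n \<sigma>)"
  by (simp add: smodule_def)

lemma smodule_act_mem:
  "smodule M \<Longrightarrow> \<sigma> permutes {..<n} \<Longrightarrow> x \<in> grd (cpx M n) k \<Longrightarrow> act M n \<sigma> k x \<in> grd (cpx M n) k"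
  using gmap_in[OF chain_map_gmap[OF smodule_act]] by fastforce

lemma smodule_act_bd:
  "smodule M \<Longrightarrow> \<sigma> permutes {..<n} \<Longrightarrow> x \<in> grd (cpx M n) k \<Longrightarrow>
    bd (cpx M n) k (act M n \<sigma> k x) = act M n \<sigma> (k - 1) (bd (cpx M n) k x)"
  using smodule_act[of M \<sigma> n] by (auto simp: chain_map_def)

lemma smodule_bd_mem: "smodule M \<Longrightarrow> x \<in> grd (cpx M n) k \<Longrightarrow> bd (cpx M n) k x \<in> grd (cpx M n) (k - 1)"
  using gmap_in[OF chain_complex_bd[OF smodule_chain_complex]] by fastforce

lemma sum_list_update_int: "i < length xs \<Longrightarrow> sum_list (xs[i := y]) = sum_list xs - xs ! i + (y :: int)"
  by (induction xs arbitrary: i) (auto split: nat.split)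

lemma sum_list_permute: "\<sigma> permutes {..<length xs} \<Longrightarrow> sum_list (permute_list \<sigma> xs) = sum_list (xs :: int list)"
  by (simp add: sum_mset_sum_list[symmetric] del: sum_mset_sum_list)

lemma permute_list_update:
  assumes "\<sigma> permutes {..<length xs}" "i < length xs"
  shows "(permute_list \<sigma> xs)[i := y] = permute_list \<sigma> (xs[\<sigma> i := y])"
proof (rule nth_equalityI)
  fix j assume "j < length ((permute_list \<sigma> xs)[i := y])"
  then have j: "j < length xs" by simp
  have "\<sigma> j = \<sigma> i \<longleftrightarrow> j = i" using permutes_inj[OF assms(1)] by (auto dest: injD)
  then show "(permute_list \<sigma> xs)[i := y] ! j = permute_list \<sigma> (xs[\<sigma> i := y]) ! j"
    using j assms permutes_nat_less[OF assms(1)] by (auto simp: nth_list_update permute_list_nth)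
qed simp

lemma concat_permute_mset:
  "\<sigma> permutes {..<length xs} \<Longrightarrow> mset (concat (map f (permute_list \<sigma> xs))) = mset (concat (map f xs))"
  by (simp add: mset_concat sum_mset_sum_list[symmetric] del: sum_mset_sum_list)

lemma is_gen_mem:
  "is_gen M N n p qs \<Longrightarrow> mem (cpx M (length qs)) p"
  "is_gen M N n p qs \<Longrightarrow> i < length qs \<Longrightarrow> mem (cpx N (length (snd (qs ! i)))) (fst (qs ! i))"
  unfolding is_gen_def by (auto simp: case_prod_beta)

lemma is_gen_head: "is_gen M N n p qs \<Longrightarrow> mem (cpx M (length qs)) p' \<Longrightarrow> is_gen M N n p' qs"
  by (simp add: is_gen_def)

lemma is_gen_update:
  assumes "is_gen M N n p qs" "i < length qs" "qs ! i = (q, B)" "mem (cpx N (length B)) q'" "mset B' = mset B"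
  shows "is_gen M N n p (qs[i := (q', B')])"
proof -
  have s: "snd (qs ! i) = B" using assms by simp
  have "map (\<lambda>q. mset (snd q)) (qs[i := (q', B')]) = map (\<lambda>q. mset (snd q)) qs"
    using assms(5) s by (simp add: map_update) (metis assms(2) list_update_id map_update nth_map)
  then have 1: "mset (concat (map snd (qs[i := (q', B')]))) = mset (concat (map snd qs))"
    by (simp add: mset_concat o_def)
  then have "distinct (concat (map snd (qs[i := (q', B')]))) = distinct (concat (map snd qs))"
    "set (concat (map snd (qs[i := (q', B')]))) = set (concat (map snd qs))"
    using mset_eq_imp_distinct_iff mset_eq_setD by blast+
  moreover have "length B' = length B" using assms(5) by (metis size_mset)
  ultimately show ?thesis using assms unfolding is_gen_def
    by (auto dest!: set_update_subset_insert[THEN subsetD])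
qed

lemma is_gen_permute:
  assumes "is_gen M N n p qs" "smodule M" "\<sigma> permutes {..<length qs}"
  shows "is_gen M N n (happ 0 (act M (length qs) \<sigma>) p) (permute_list \<sigma> qs)"
proof -
  have 1: "mset (concat (map snd (permute_list \<sigma> qs))) = mset (concat (map snd qs))"
    using concat_permute_mset[OF assms(3)] .
  then have "distinct (concat (map snd (permute_list \<sigma> qs))) = distinct (concat (map snd qs))"
    "set (concat (map snd (permute_list \<sigma> qs))) = set (concat (map snd qs))"
    using mset_eq_imp_distinct_iff mset_eq_setD by blast+
  then show ?thesis using assms smodule_act_mem[OF assms(2,3)]
    by (auto simp: is_gen_def mem_def)
qed

lemma is_gen_act:
  assumes "is_gen M N n p qs" "smodule N" "i < length qs" "qs ! i = (q, B)" "\<sigma> permutes {..<length B}"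
  shows "is_gen M N n p (qs[i := (happ 0 (act N (length B) \<sigma>) q, permute_list \<sigma> B)])"
proof (rule is_gen_update[OF assms(1,3,4)])
  show "mem (cpx N (length B)) (happ 0 (act N (length B) \<sigma>) q)"
    using is_gen_mem(2)[OF assms(1,3)] assms(4) smodule_act_mem[OF assms(2,5)] by (simp add: mem_def)
qed (simp add: assms(5))

lemma is_gen_relabel:
  assumes "is_gen M N n p qs" "\<rho> permutes {..<n}"
  shows "is_gen M N n p (map (\<lambda>(q, B). (q, map \<rho> B)) qs)"
proof -
  have "concat (map snd (map (\<lambda>(q, B). (q, map \<rho> B)) qs)) = map \<rho> (concat (map snd qs))"
    by (simp add: map_concat o_def case_prod_beta)
  then show ?thesis using assms permutes_image[OF assms(2)]
    by (auto simp: is_gen_def distinct_map permutes_inj_on case_prod_beta)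
qed

text \<open>
  The multilinearity, symmetry and equivariance conditions in the shape in which they are checked, with
  the entry that varies named explicitly.
\<close>

lemma is_formI:
  assumes "\<And>k x y qs. is_gen M N n (k, x) qs \<Longrightarrow> y \<in> grd (cpx M (length qs)) k \<Longrightarrow>
      \<phi> (k, x + y) qs = \<phi> (k, x) qs + \<phi> (k, y) qs"
    and "\<And>k x a qs. is_gen M N n (k, x) qs \<Longrightarrow> \<phi> (k, scl a x) qs = a * \<phi> (k, x) qs"
    and "\<And>p qs i k x y B. is_gen M N n p qs \<Longrightarrow> i < length qs \<Longrightarrow> qs ! i = ((k, x), B) \<Longrightarrow>
      y \<in> grd (cpx N (length B)) k \<Longrightarrow> \<phi> p (qs[i := ((k, x + y), B)]) = \<phi> p qs + \<phi> p (qs[i := ((k, y), B)])"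
    and "\<And>p qs i k x a B. is_gen M N n p qs \<Longrightarrow> i < length qs \<Longrightarrow> qs ! i = ((k, x), B) \<Longrightarrow>
      \<phi> p (qs[i := ((k, scl a x), B)]) = a * \<phi> p qs"
    and "\<And>p qs \<sigma>. is_gen M N n p qs \<Longrightarrow> \<sigma> permutes {..<length qs} \<Longrightarrow>
      \<phi> (happ 0 (act M (length qs) \<sigma>) p) (permute_list \<sigma> qs) =
        koszul_sign (degs qs) (map \<sigma> [0..<length qs]) * \<phi> p qs"
    and "\<And>p qs i q B \<sigma>. is_gen M N n p qs \<Longrightarrow> i < length qs \<Longrightarrow> qs ! i = (q, B) \<Longrightarrow>
      \<sigma> permutes {..<length B} \<Longrightarrow>
      \<phi> p (qs[i := (happ 0 (act N (length B) \<sigma>) q, permute_list \<sigma> B)]) = \<phi> p qs"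
  shows "is_form M N n \<phi>"
  unfolding is_form_def
proof (intro allI impI conjI, goal_cases)
  case (1 p qs)
  then show ?case unfolding hlin_def
    using assms(1)[OF is_gen_head[OF 1]] assms(2)[OF is_gen_head[OF 1]] by simp
next
  case (2 p qs i)
  obtain q B where q: "qs ! i = (q, B)" by fastforce
  have g: "is_gen M N n p (qs[i := ((k, x), B)])" if "x \<in> grd (cpx N (length B)) k" for k x
    using is_gen_update[OF 2 q, of "(k, x)" B] that by simp
  show ?case unfolding hlin_def
    using assms(3)[OF g, of _ _ i] assms(4)[OF g, of _ _ i] 2(2) by (simp add: q)
next
  case (3 p qs \<sigma>)
  then show ?case using assms(5) by simp
next
  case (4 p qs i \<sigma>)
  then show ?case using assms(6)[of p qs i "fst (qs ! i)" "snd (qs ! i)" \<sigma>] by simp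
qed

context
  fixes M :: "('x, 'k::field) smod" and N :: "('y, 'k) smod" and n \<phi>
  assumes \<phi>: "is_form M N n \<phi>"
begin

lemma form_add_head: "is_gen M N n (k, x) qs \<Longrightarrow> y \<in> grd (cpx M (length qs)) k \<Longrightarrow>
    \<phi> (k, x + y) qs = \<phi> (k, x) qs + \<phi> (k, y) qs"
  using \<phi> is_gen_mem(1)[of M N n "(k, x)" qs] unfolding is_form_def hlin_def by force

lemma form_scl_head: "is_gen M N n (k, x) qs \<Longrightarrow> \<phi> (k, scl a x) qs = a * \<phi> (k, x) qs"
  using \<phi> is_gen_mem(1)[of M N n "(k, x)" qs] unfolding is_form_def hlin_def by force

lemma form_add_arg: "is_gen M N n p qs \<Longrightarrow> i < length qs \<Longrightarrow> qs ! i = ((k, x), B) \<Longrightarrow>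
    y \<in> grd (cpx N (length B)) k \<Longrightarrow> \<phi> p (qs[i := ((k, x + y), B)]) = \<phi> p qs + \<phi> p (qs[i := ((k, y), B)])"
  using \<phi> is_gen_mem(2)[of M N n p qs i] unfolding is_form_def hlin_def
  by (metis (no_types, lifting) fst_conv list_update_id mem_pair snd_conv)

lemma form_scl_arg: "is_gen M N n p qs \<Longrightarrow> i < length qs \<Longrightarrow> qs ! i = ((k, x), B) \<Longrightarrow>
    \<phi> p (qs[i := ((k, scl a x), B)]) = a * \<phi> p qs"
  using \<phi> is_gen_mem(2)[of M N n p qs i] unfolding is_form_def hlin_def
  by (metis (no_types, lifting) fst_conv list_update_id mem_pair snd_conv)

lemma form_permute: "is_gen M N n p qs \<Longrightarrow> \<sigma> permutes {..<length qs} \<Longrightarrow>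
    \<phi> (happ 0 (act M (length qs) \<sigma>) p) (permute_list \<sigma> qs) =
      koszul_sign (degs qs) (map \<sigma> [0..<length qs]) * \<phi> p qs"
  using \<phi> unfolding is_form_def by blast

lemma form_act: "is_gen M N n p qs \<Longrightarrow> i < length qs \<Longrightarrow> qs ! i = (q, B) \<Longrightarrow> \<sigma> permutes {..<length B} \<Longrightarrow>
    \<phi> p (qs[i := (happ 0 (act N (length B) \<sigma>) q, permute_list \<sigma> B)]) = \<phi> p qs"
  using \<phi> unfolding is_form_def by (metis fst_conv snd_conv)

lemma form_zero_head: "is_gen M N n p qs \<Longrightarrow> snd p = 0 \<Longrightarrow> \<phi> p qs = 0"
  using form_scl_head[of "fst p" "snd p" qs 0] by (cases p) simp

lemma form_zero_arg: "is_gen M N n p qs \<Longrightarrow> i < length qs \<Longrightarrow> snd (fst (qs ! i)) = 0 \<Longrightarrow> \<phi> p qs = 0"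
  using form_scl_arg[of p qs i "fst (fst (qs ! i))" "snd (fst (qs ! i))" "snd (qs ! i)" 0]
  by (metis fv.scale_zero_left list_update_id mult_zero_left prod.collapse)

end

lemma gen_form: "is_form M N n \<phi> \<Longrightarrow> gen M N n p qs \<phi> = \<phi> p qs"
  by (simp add: gen_def)

lemma gen_eqI: "(\<And>\<phi>. is_form M N n \<phi> \<Longrightarrow> \<phi> p qs = \<phi> p' qs') \<Longrightarrow> gen M N n p qs = gen M N n p' qs'"
  by (simp add: gen_def fun_eq_iff)

lemma gen_in: "is_gen M N n p qs \<Longrightarrow> fst p + sum_list (degs qs) = k \<Longrightarrow> gen M N n p qs \<in> cspace M N n k"
  unfolding cspace_def by (intro fv.span_base) blast

lemma gen_zero_head: "is_gen M N n p qs \<Longrightarrow> snd p = 0 \<Longrightarrow> gen M N n p qs = 0"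
  by (auto simp: gen_def fun_eq_iff intro: form_zero_head)

lemma gen_zero_arg: "is_gen M N n p qs \<Longrightarrow> i < length qs \<Longrightarrow> snd (fst (qs ! i)) = 0 \<Longrightarrow> gen M N n p qs = 0"
  by (auto simp: gen_def fun_eq_iff intro: form_zero_arg)

lemma gen_add_head: "is_gen M N n (k, x) qs \<Longrightarrow> y \<in> grd (cpx M (length qs)) k \<Longrightarrow>
    gen M N n (k, x + y) qs = gen M N n (k, x) qs + gen M N n (k, y) qs"
  by (auto simp: gen_def fun_eq_iff intro: form_add_head)

lemma gen_scl_head: "is_gen M N n (k, x) qs \<Longrightarrow> gen M N n (k, scl a x) qs = scl a (gen M N n (k, x) qs)"
  by (auto simp: gen_def fun_eq_iff scl_apply intro: form_scl_head)

lemma gen_add_arg: "is_gen M N n p qs \<Longrightarrow> i < length qs \<Longrightarrow> qs ! i = ((k, x), B) \<Longrightarrow>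
    y \<in> grd (cpx N (length B)) k \<Longrightarrow>
    gen M N n p (qs[i := ((k, x + y), B)]) = gen M N n p qs + gen M N n p (qs[i := ((k, y), B)])"
  by (auto simp: gen_def fun_eq_iff intro: form_add_arg)

lemma gen_scl_arg: "is_gen M N n p qs \<Longrightarrow> i < length qs \<Longrightarrow> qs ! i = ((k, x), B) \<Longrightarrow>
    gen M N n p (qs[i := ((k, scl a x), B)]) = scl a (gen M N n p qs)"
  by (auto simp: gen_def fun_eq_iff scl_apply intro: form_scl_arg)

lemma subspace_cspace: "fv.subspace (cspace M N n k)"
  by (simp add: cspace_def)

lemma cspace_induct [consumes 1, case_names zero add scl gen]:
  assumes "u \<in> cspace M N n k"
    and "P 0" "\<And>u v. u \<in> cspace M N n k \<Longrightarrow> v \<in> cspace M N n k \<Longrightarrow> P u \<Longrightarrow> P v \<Longrightarrow> P (u + v)"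
    and "\<And>a u. u \<in> cspace M N n k \<Longrightarrow> P u \<Longrightarrow> P (scl a u)"
    and "\<And>p qs. is_gen M N n p qs \<Longrightarrow> fst p + sum_list (degs qs) = k \<Longrightarrow> P (gen M N n p qs)"
  shows "P u"
proof -
  have "fv.subspace {u. u \<in> cspace M N n k \<and> P u}"
    unfolding fv.subspace_def using assms(2-4) subspace_cspace[of M N n k]
    by (auto simp: fv.subspace_def)
  moreover have "x \<in> cspace M N n k \<and> P x"
    if "x \<in> {gen M N n p qs | p qs. is_gen M N n p qs \<and> fst p + sum_list (degs qs) = k}" for x
    using that assms(5) gen_in[of M N n _ _ k] by blast
  ultimately have "u \<in> cspace M N n k \<and> P u"
    using fv.span_induct[OF assms(1)[unfolded cspace_def], of "\<lambda>u. u \<in> cspace M N n k \<and> P u"] by blast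
  then show ?thesis ..
qed

text \<open>
  The composite product is spanned by the generators; most identities below are proved by comparing two
  linear maps on them.
\<close>

lemma cspace_eqI:
  assumes "u \<in> cspace M N n k" "lin_on (cspace M N n k) f" "lin_on (cspace M N n k) g"
    and "\<And>p qs. is_gen M N n p qs \<Longrightarrow> fst p + sum_list (degs qs) = k \<Longrightarrow> f (gen M N n p qs) = g (gen M N n p qs)"
  shows "f u = g u"
  using assms(1)
proof (induction rule: cspace_induct)
  case zero
  show ?case using lin_on_zero[OF assms(2,1)] lin_on_zero[OF assms(3,1)] by (rule trans[OF _ sym])
next
  case (add u v)
  show ?case unfolding lin_on_addD[OF assms(2) add(1,2)] lin_on_addD[OF assms(3) add(1,2)] add(3,4) ..
next
  case (scl a u)
  show ?case unfolding lin_on_sclD[OF assms(2) scl(1)] lin_on_sclD[OF assms(3) scl(1)] scl(2) ..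
qed (rule assms(4))

text \<open>
  A generator takes the value 0 at every function that is not a form, so vanishing on the generators is
  enough, whether or not \<open>\<phi>\<close> is a form.
\<close>

lemma cspace_eval_zero:
  assumes "u \<in> cspace M N n k"
    and "\<And>p qs. is_gen M N n p qs \<Longrightarrow> fst p + sum_list (degs qs) = k \<Longrightarrow> \<phi> p qs = 0"
  shows "u \<phi> = 0"
  using assms(1) by (induction rule: cspace_induct) (auto simp: gen_def scl_def assms(2))

lemma lin_on_ext: "lin_on (cspace M N n k) (ext (cspace M N n k) g)"
  using subspace_cspace[of M N n k] by (auto simp: lin_on_def ext_def fv.subspace_def fun_eq_iff scl_def)

lemma ext_outside: "u \<notin> U \<Longrightarrow> ext U g u = 0"
  by (simp add: ext_def)

lemma ext_zero:
  assumes "\<And>p qs. is_gen M N n p qs \<Longrightarrow> fst p + sum_list (degs qs) = k \<Longrightarrow> g p qs = 0"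
  shows "ext (cspace M N n k) g u = 0"
proof (cases "u \<in> cspace M N n k")
  case True
  have "u (\<lambda>p qs. g p qs z) = 0" for z
    by (rule cspace_eval_zero[OF True]) (simp only: assms zero_fun_apply)
  then show ?thesis using True by (simp add: ext_def fun_eq_iff)
qed (simp add: ext_outside)

lemma ext_in:
  assumes u: "u \<in> cspace M N n k" and W: "fv.subspace W"
    and f: "\<And>z. is_form M N n (\<lambda>p qs. g p qs z)"
    and g: "\<And>p qs. is_gen M N n p qs \<Longrightarrow> fst p + sum_list (degs qs) = k \<Longrightarrow> g p qs \<in> W"
  shows "ext (cspace M N n k) g u \<in> W"
  using u
proof (induction rule: cspace_induct)
  case zero
  show ?case unfolding lin_on_zero[OF lin_on_ext u] by (rule fv.subspace_0[OF W])
next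
  case (add u v)
  show ?case unfolding lin_on_addD[OF lin_on_ext add(1,2)] by (rule fv.subspace_add[OF W add(3,4)])
next
  case (scl a u)
  show ?case unfolding lin_on_sclD[OF lin_on_ext scl(1)] by (rule fv.subspace_scale[OF W scl(2)])
next
  case (gen p qs)
  show ?case unfolding ext_gen[where g = g, OF gen f] by (rule g[OF gen])
qed

lemma linmap_ext:
  assumes "fv.subspace W" "\<And>z. is_form M N n (\<lambda>p qs. g p qs z)"
    and "\<And>p qs. is_gen M N n p qs \<Longrightarrow> fst p + sum_list (degs qs) = k \<Longrightarrow> g p qs \<in> W"
  shows "linmap (cspace M N n k) W (ext (cspace M N n k) g)"
  using lin_on_ext[of M N n k g] ext_in[OF _ assms] by (auto simp: linmap_def lin_on_def ext_outside)

lemma is_form_0 [simp]: "is_form M N n (\<lambda>_ _. 0)"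
  by (simp add: is_form_def hlin_def)

text \<open>
  A map of generators is well defined if it pulls forms back to forms.  At a function \<open>z\<close> that is not a
  form both sides are 0.
\<close>

lemma is_form_gen:
  assumes "is_form M' N' n' z \<Longrightarrow> is_form M N n (\<lambda>p qs. z (F p qs) (G p qs))"
  shows "is_form M N n (\<lambda>p qs. gen M' N' n' (F p qs) (G p qs) z)"
  using assms by (cases "is_form M' N' n' z") (simp_all add: gen_def)


section \<open>Functoriality, differential and symmetry of the composite product\<close>

lemma smap_gmap: "smap r M N f \<Longrightarrow> gmap r (cpx M n) (cpx N n) (f n)"
  by (simp add: smap_def)

lemma smap_act: "smap r M N f \<Longrightarrow> \<sigma> permutes {..<n} \<Longrightarrow> x \<in> grd (cpx M n) k \<Longrightarrow>
    f n k (act M n \<sigma> k x) = act N n \<sigma> (k + r) (f n k x)"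
  by (simp add: smap_def)

abbreviation map_args :: "(nat \<Rightarrow> int \<Rightarrow> ('y \<Rightarrow> 'k) \<Rightarrow> 'z \<Rightarrow> 'k) \<Rightarrow>
    (('y, 'k) hvec \<times> nat list) list \<Rightarrow> (('z, 'k) hvec \<times> nat list) list" where
  "map_args g qs \<equiv> map (\<lambda>(q, B). (happ 0 (g (length B)) q, B)) qs"

lemma degs_map_args: "degs (map_args g qs) = degs qs"
  by (simp add: case_prod_beta)

lemma is_gen_cmap:
  assumes "is_gen M N n p qs" "smap r M M' f" "smap 0 N N' g"
  shows "is_gen M' N' n (happ r (f (length qs)) p) (map_args g qs)"
proof -
  have s: "map snd (map_args g qs) = map snd qs" by (simp add: case_prod_beta)
  have "mem (cpx N' (length B)) (happ 0 (g (length B)) q)" if "(q, B) \<in> set qs" for q B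
    using assms(1) that gmap_in[OF smap_gmap[OF assms(3)], of "snd q" "length B" "fst q"]
    by (auto simp: is_gen_def mem_def)
  moreover have "mem (cpx M' (length qs)) (happ r (f (length qs)) p)"
    using assms(1) gmap_in[OF smap_gmap[OF assms(2)], of "snd p" "length qs" "fst p"]
    by (auto simp: is_gen_def mem_def)
  ultimately show ?thesis using assms(1) unfolding is_gen_def s by auto
qed

lemma is_form_cmap:
  assumes f: "smap r M M' f" and g: "smap 0 N N' g" and z: "is_form M' N' n z"
  shows "is_form M N n (\<lambda>p qs. z (happ r (f (length qs)) p) (map_args g qs))"
proof (rule is_formI, goal_cases)
  case (1 k x y qs)
  have y: "is_gen M N n (k, y) qs" using 1 by (simp add: is_gen_head)
  show ?case using form_add_head[OF z is_gen_cmap[OF 1(1) f g, unfolded happ_def fst_conv snd_conv]]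
      is_gen_mem(1)[OF is_gen_cmap[OF y f g]] is_gen_mem(1)[OF 1(1)] 1(2)
    by (simp add: happ_def gmap_add[OF smap_gmap[OF f]])
next
  case (2 k x a qs)
  show ?case using form_scl_head[OF z is_gen_cmap[OF 2 f g, unfolded happ_def fst_conv snd_conv]]
      is_gen_mem(1)[OF 2] by (simp add: happ_def gmap_scl[OF smap_gmap[OF f]])
next
  case (3 p qs i k x y B)
  have x: "x \<in> grd (cpx N (length B)) k" using is_gen_mem(2)[OF 3(1,2)] 3(3) by simp
  have i: "i < length (map_args g qs)" "map_args g qs ! i = ((k, g (length B) k x), B)"
    using 3 by (simp_all add: happ_def)
  have y: "g (length B) k y \<in> grd (cpx N' (length B)) k"
    using gmap_in[OF smap_gmap[OF g] 3(4)] by simp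
  show ?case using form_add_arg[OF z is_gen_cmap[OF 3(1) f g] i y]
    by (simp add: map_update happ_def gmap_add[OF smap_gmap[OF g] x 3(4)])
next
  case (4 p qs i k x a B)
  have x: "x \<in> grd (cpx N (length B)) k" using is_gen_mem(2)[OF 4(1,2)] 4(3) by simp
  have i: "i < length (map_args g qs)" "map_args g qs ! i = ((k, g (length B) k x), B)"
    using 4 by (simp_all add: happ_def)
  show ?case using form_scl_arg[OF z is_gen_cmap[OF 4(1) f g] i]
    by (simp add: map_update happ_def gmap_scl[OF smap_gmap[OF g] x])
next
  case (5 p qs \<sigma>)
  have x: "snd p \<in> grd (cpx M (length qs)) (fst p)" using is_gen_mem(1)[OF 5(1)] by (simp add: mem_def)
  show ?case using form_permute[OF z is_gen_cmap[OF 5(1) f g], of \<sigma>] 5(2) smap_act[OF f 5(2) x]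
    unfolding degs_map_args by (simp add: permute_list_map happ_def)
next
  case (6 p qs i q B \<sigma>)
  have x: "snd q \<in> grd (cpx N (length B)) (fst q)" using is_gen_mem(2)[OF 6(1,2)] 6(3) by (simp add: mem_def)
  have i: "i < length (map_args g qs)" "map_args g qs ! i = (happ 0 (g (length B)) q, B)"
    using 6 by simp_all
  show ?case using form_act[OF z is_gen_cmap[OF 6(1) f g] i 6(4)] smap_act[OF g 6(4) x]
    by (simp add: map_update happ_def)
qed

lemma cmap_gen:
  assumes "smap r M M' f" "smap 0 N N' g" "is_gen M N n p qs" "fst p + sum_list (degs qs) = k"
  shows "cmap M N M' N' r f g n k (gen M N n p qs) = gen M' N' n (happ r (f (length qs)) p) (map_args g qs)"
  unfolding cmap_def by (rule ext_gen[OF assms(3,4)]) (rule is_form_gen, rule is_form_cmap[OF assms(1,2)])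

lemma linmap_cmap:
  assumes "smap r M M' f" "smap 0 N N' g"
  shows "linmap (cspace M N n k) (cspace M' N' n (k + r)) (cmap M N M' N' r f g n k)"
  unfolding cmap_def
proof (rule linmap_ext)
  fix p qs assume g: "is_gen M N n p qs" and k: "fst p + sum_list (degs qs) = k"
  show "gen M' N' n (happ r (f (length qs)) p) (map_args g qs) \<in> cspace M' N' n (k + r)"
    by (rule gen_in[OF is_gen_cmap[OF g assms]]) (use k in \<open>simp only: degs_map_args; simp\<close>)
qed (rule subspace_cspace, rule is_form_gen, rule is_form_cmap[OF assms])

lemma lin_on_cmap: "lin_on (cspace M N n k) (cmap M N M' N' r f g n k)"
  by (simp add: cmap_def lin_on_ext)

lemma is_form_relabel:
  assumes z: "is_form M N n z" and \<rho>: "\<rho> permutes {..<n}"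
  shows "is_form M N n (\<lambda>p qs. z p (map (\<lambda>(q, B). (q, map \<rho> B)) qs))"
proof (rule is_formI, goal_cases)
  case (1 k x y qs)
  then show ?case using form_add_head[OF z is_gen_relabel[OF 1(1) \<rho>]] by simp
next
  case (2 k x a qs)
  then show ?case using form_scl_head[OF z is_gen_relabel[OF 2 \<rho>]] by simp
next
  case (3 p qs i k x y B)
  then show ?case using form_add_arg[OF z is_gen_relabel[OF 3(1) \<rho>], of i k x "map \<rho> B" y]
    by (simp add: map_update)
next
  case (4 p qs i k x a B)
  then show ?case using form_scl_arg[OF z is_gen_relabel[OF 4(1) \<rho>], of i k x "map \<rho> B" a]
    by (simp add: map_update)
next
  case (5 p qs \<sigma>)
  then show ?case using form_permute[OF z is_gen_relabel[OF 5(1) \<rho>], of \<sigma>]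
    by (simp add: permute_list_map case_prod_beta o_def)
next
  case (6 p qs i q B \<sigma>)
  then show ?case using form_act[OF z is_gen_relabel[OF 6(1) \<rho>], of i q "map \<rho> B" \<sigma>]
    by (simp add: map_update permute_list_map)
qed

lemma comp_act_gen:
  assumes "\<sigma> permutes {..<n}" "is_gen M N n p qs" "fst p + sum_list (degs qs) = k"
  shows "comp_act M N n \<sigma> k (gen M N n p qs) = gen M N n p (map (\<lambda>(q, B). (q, map (inv \<sigma>) B)) qs)"
  unfolding comp_act_def
  by (rule ext_gen[OF assms(2,3)]) (rule is_form_gen, rule is_form_relabel[OF _ permutes_inv[OF assms(1)]])

lemma lin_on_comp_act: "lin_on (cspace M N n k) (comp_act M N n \<sigma> k)"
  by (simp add: comp_act_def lin_on_ext)

lemma sum_fun_apply: "(\<Sum>i\<in>A. f i) x = (\<Sum>i\<in>A. f i x)"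
  by (induction A rule: infinite_finite_induct) auto

abbreviation bd_arg :: "('y, 'k::field) smod \<Rightarrow> ('y, 'k) hvec \<times> nat list \<Rightarrow> ('y, 'k) hvec \<times> nat list" where
  "bd_arg N q \<equiv> (happ (- 1) (bd (cpx N (length (snd q)))) (fst q), snd q)"

lemma is_gen_bd_head:
  assumes "smodule M" "is_gen M N n p qs"
  shows "is_gen M N n (happ (- 1) (bd (cpx M (length qs))) p) qs"
  by (rule is_gen_head[OF assms(2)])
    (use is_gen_mem(1)[OF assms(2)] smodule_bd_mem[OF assms(1)] in \<open>simp add: mem_def\<close>)

lemma is_gen_bd_arg:
  assumes "smodule N" "is_gen M N n p qs" "i < length qs"
  shows "is_gen M N n p (qs[i := bd_arg N (qs ! i)])"
  by (rule is_gen_update[OF assms(2,3) prod.collapse[symmetric]])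
    (use is_gen_mem(2)[OF assms(2,3)] smodule_bd_mem[OF assms(1)] in \<open>simp_all add: mem_def\<close>)

lemma degs_update: "degs (qs[i := q]) = (degs qs)[i := fst (fst q)]"
  by (simp add: map_update)

lemma degs_update_same: "i < length qs \<Longrightarrow> fst (fst q) = fst (fst (qs ! i)) \<Longrightarrow> degs (qs[i := q]) = degs qs"
  by (simp add: map_update list_update_same_conv)

lemma sum_list_take_permute:
  assumes "\<sigma> permutes {..<length xs}" "i \<le> length xs"
  shows "sum_list (take i (permute_list \<sigma> xs)) = (\<Sum>j<i. xs ! \<sigma> j :: int)"
proof -
  have "take i (permute_list \<sigma> xs) = map (\<lambda>j. xs ! \<sigma> j) [0..<i]"
    using assms(2) by (intro nth_equalityI) (auto simp: permute_list_nth[OF assms(1)])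
  then show ?thesis by (simp add: sum_list_sum_nth atLeast0LessThan)
qed

lemma sum_list_take: "i \<le> length xs \<Longrightarrow> sum_list (take i xs) = (\<Sum>j<i. xs ! j :: int)"
  by (simp add: sum_list_sum_nth atLeast0LessThan min_def)

text \<open>
  The differential respects the relations.  Linearity is termwise; under a permutation of the arguments
  the \<open>i\<close>-th summand goes to the summand \<open>\<sigma> i\<close>, with the sign of \<open>koszul_sign_lower_entry\<close>.
\<close>

lemma is_form_comp_bd:
  assumes M: "smodule M" and N: "smodule N" and z: "is_form M N n z"
  shows "is_form M N n (\<lambda>p qs. z (happ (- 1) (bd (cpx M (length qs))) p) qs +
    (\<Sum>i<length qs. ksgn (fst p + sum_list (take i (degs qs))) * z p (qs[i := bd_arg N (qs ! i)])))"
proof (rule is_formI, goal_cases)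
  case (1 k x y qs)
  let ?d = "bd (cpx M (length qs)) k"
  have y: "is_gen M N n (k, y) qs" using 1 by (simp add: is_gen_head)
  have x: "x \<in> grd (cpx M (length qs)) k" using is_gen_mem(1)[OF 1(1)] by simp
  have b: "?d (x + y) = ?d x + ?d y"
    by (rule gmap_add[OF chain_complex_bd[OF smodule_chain_complex[OF M]] x 1(2)])
  have h: "z (k - 1, ?d x + ?d y) qs = z (k - 1, ?d x) qs + z (k - 1, ?d y) qs"
    using form_add_head[OF z, of "k - 1" "?d x" qs "?d y"] is_gen_bd_head[OF M 1(1)]
      smodule_bd_mem[OF M 1(2)] by (simp add: happ_def)
  have s: "z (k, x + y) (qs[i := bd_arg N (qs ! i)]) =
      z (k, x) (qs[i := bd_arg N (qs ! i)]) + z (k, y) (qs[i := bd_arg N (qs ! i)])" if "i < length qs" for i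
    using form_add_head[OF z is_gen_bd_arg[OF N 1(1) that]] 1(2) by simp
  show ?case using h s by (simp add: happ_def b sum.distrib distrib_left)
next
  case (2 k x a qs)
  let ?d = "bd (cpx M (length qs)) k"
  have x: "x \<in> grd (cpx M (length qs)) k" using is_gen_mem(1)[OF 2] by simp
  have b: "?d (scl a x) = scl a (?d x)"
    by (rule gmap_scl[OF chain_complex_bd[OF smodule_chain_complex[OF M]] x])
  have h: "z (k - 1, scl a (?d x)) qs = a * z (k - 1, ?d x) qs"
    using form_scl_head[OF z, of "k - 1" "?d x" qs] is_gen_bd_head[OF M 2] by (simp add: happ_def)
  have s: "z (k, scl a x) (qs[i := bd_arg N (qs ! i)]) = a * z (k, x) (qs[i := bd_arg N (qs ! i)])"
    if "i < length qs" for i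
    using form_scl_head[OF z is_gen_bd_arg[OF N 2 that]] by simp
  show ?case using h s by (simp add: happ_def b sum_distrib_left distrib_left mult.left_commute)
next
  case (3 p qs j k x y B)
  let ?d = "bd (cpx N (length B)) k"
  have x: "x \<in> grd (cpx N (length B)) k" using is_gen_mem(2)[OF 3(1,2)] 3(3) by simp
  have b: "?d (x + y) = ?d x + ?d y"
    by (rule gmap_add[OF chain_complex_bd[OF smodule_chain_complex[OF N]] x 3(4)])
  have h: "z (happ (- 1) (bd (cpx M (length qs))) p) (qs[j := ((k, x + y), B)]) =
      z (happ (- 1) (bd (cpx M (length qs))) p) qs + z (happ (- 1) (bd (cpx M (length qs))) p) (qs[j := ((k, y), B)])"
    by (rule form_add_arg[OF z is_gen_bd_head[OF M 3(1)] 3(2-4)])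
  have s: "z p ((qs[j := ((k, x + y), B)])[i := bd_arg N (qs[j := ((k, x + y), B)] ! i)]) =
      z p (qs[i := bd_arg N (qs ! i)]) + z p ((qs[j := ((k, y), B)])[i := bd_arg N (qs[j := ((k, y), B)] ! i)])"
    if i: "i < length qs" for i
  proof (cases "i = j")
    case True
    have g: "is_gen M N n p (qs[j := ((k - 1, ?d x), B)])"
      using is_gen_bd_arg[OF N 3(1,2)] 3(3) by (simp add: happ_def)
    show ?thesis using form_add_arg[OF z g, of j "k - 1" "?d x" B "?d y"] 3(2,3) smodule_bd_mem[OF N 3(4)]
      by (simp add: True happ_def b)
  next
    case False
    then show ?thesis using form_add_arg[OF z is_gen_bd_arg[OF N 3(1) i], of j k x B y] 3(2-4)
      by (simp add: list_update_swap)
  qed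
  have dg: "degs (qs[j := ((k, v), B)]) = degs qs" for v
    by (rule degs_update_same[OF 3(2)]) (simp add: 3(3))
  show ?case unfolding dg using h s by (simp add: sum.distrib distrib_left)
next
  case (4 p qs j k x a B)
  let ?d = "bd (cpx N (length B)) k"
  have x: "x \<in> grd (cpx N (length B)) k" using is_gen_mem(2)[OF 4(1,2)] 4(3) by simp
  have b: "?d (scl a x) = scl a (?d x)"
    by (rule gmap_scl[OF chain_complex_bd[OF smodule_chain_complex[OF N]] x])
  have h: "z (happ (- 1) (bd (cpx M (length qs))) p) (qs[j := ((k, scl a x), B)]) =
      a * z (happ (- 1) (bd (cpx M (length qs))) p) qs"
    by (rule form_scl_arg[OF z is_gen_bd_head[OF M 4(1)] 4(2,3)])
  have s: "z p ((qs[j := ((k, scl a x), B)])[i := bd_arg N (qs[j := ((k, scl a x), B)] ! i)]) =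
      a * z p (qs[i := bd_arg N (qs ! i)])" if i: "i < length qs" for i
  proof (cases "i = j")
    case True
    have g: "is_gen M N n p (qs[j := ((k - 1, ?d x), B)])"
      using is_gen_bd_arg[OF N 4(1,2)] 4(3) by (simp add: happ_def)
    show ?thesis using form_scl_arg[OF z g, of j "k - 1" "?d x" B a] 4(2,3)
      by (simp add: True happ_def b)
  next
    case False
    then show ?thesis using form_scl_arg[OF z is_gen_bd_arg[OF N 4(1) i], of j k x B a] 4(2,3)
      by (simp add: list_update_swap)
  qed
  have dg: "degs (qs[j := ((k, v), B)]) = degs qs" for v
    by (rule degs_update_same[OF 4(2)]) (simp add: 4(3))
  show ?case unfolding dg using h s by (simp add: sum_distrib_left distrib_left mult.left_commute)
next
  case (5 p qs \<sigma>)
  let ?n = "length qs" let ?ps = "permute_list \<sigma> qs" let ?p = "happ 0 (act M ?n \<sigma>) p"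
  let ?K = "koszul_sign (degs qs) (map \<sigma> [0..<?n]) :: 'b"
  have pm: "snd p \<in> grd (cpx M ?n) (fst p)" using is_gen_mem(1)[OF 5(1)] by (simp add: mem_def)
  have "happ (- 1) (bd (cpx M ?n)) ?p = happ 0 (act M ?n \<sigma>) (happ (- 1) (bd (cpx M ?n)) p)"
    by (simp add: happ_def smodule_act_bd[OF M 5(2) pm])
  then have h: "z (happ (- 1) (bd (cpx M ?n)) ?p) ?ps = ?K * z (happ (- 1) (bd (cpx M ?n)) p) qs"
    using form_permute[OF z is_gen_bd_head[OF M 5(1)] 5(2)] by simp
  have s: "ksgn (fst p + sum_list (take i (degs ?ps))) * z ?p (?ps[i := bd_arg N (?ps ! i)]) =
      ?K * (ksgn (fst p + sum_list (take (\<sigma> i) (degs qs))) * z p (qs[\<sigma> i := bd_arg N (qs ! \<sigma> i)]))"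
    if i: "i < ?n" for i
  proof -
    have si: "\<sigma> i < ?n" using permutes_nat_less[OF 5(2) i] .
    have pi: "?ps ! i = qs ! \<sigma> i" using permute_list_nth[OF 5(2) i] .
    have dg: "degs (qs[\<sigma> i := bd_arg N (qs ! \<sigma> i)]) = (degs qs)[\<sigma> i := degs qs ! \<sigma> i - 1]"
      unfolding degs_update using si by simp
    have zp: "z ?p (?ps[i := bd_arg N (?ps ! i)]) = koszul_sign ((degs qs)[\<sigma> i := degs qs ! \<sigma> i - 1]) (map \<sigma> [0..<?n]) *
        z p (qs[\<sigma> i := bd_arg N (qs ! \<sigma> i)])"
      unfolding pi permute_list_update[OF 5(2) i]
      using form_permute[OF z is_gen_bd_arg[OF N 5(1) si], of \<sigma>] 5(2) unfolding dg by simp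
    have sa: "sum_list (take i (degs ?ps)) = (\<Sum>j<i. degs qs ! \<sigma> j)"
      using sum_list_take_permute[of \<sigma> "degs qs" i] 5(2) i by (simp add: permute_list_map)
    have sb: "sum_list (take (\<sigma> i) (degs qs)) = (\<Sum>j<\<sigma> i. degs qs ! j)"
      by (rule sum_list_take) (use si in simp)
    have kk: "koszul_sign ((degs qs)[\<sigma> i := degs qs ! \<sigma> i - 1]) (map \<sigma> [0..<?n]) * ksgn (\<Sum>j<i. degs qs ! \<sigma> j) =
        (?K * ksgn (\<Sum>j<\<sigma> i. degs qs ! j) :: 'b)"
      using koszul_sign_lower_entry[of \<sigma> "degs qs" i] 5(2) i by simp
    have "ksgn (fst p + (\<Sum>j<i. degs qs ! \<sigma> j)) * (koszul_sign ((degs qs)[\<sigma> i := degs qs ! \<sigma> i - 1]) (map \<sigma> [0..<?n]) * w) =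
      ksgn (fst p) * (koszul_sign ((degs qs)[\<sigma> i := degs qs ! \<sigma> i - 1]) (map \<sigma> [0..<?n]) * ksgn (\<Sum>j<i. degs qs ! \<sigma> j)) * w"
      for w :: 'b
      by (simp add: ksgn_add)
    then show ?thesis unfolding zp sa sb kk by (simp add: ksgn_add)
  qed
  have "(\<Sum>i<?n. ksgn (fst p + sum_list (take i (degs ?ps))) * z ?p (?ps[i := bd_arg N (?ps ! i)])) =
      ?K * (\<Sum>i<?n. ksgn (fst p + sum_list (take (\<sigma> i) (degs qs))) * z p (qs[\<sigma> i := bd_arg N (qs ! \<sigma> i)]))"
    unfolding sum_distrib_left by (rule sum.cong[OF refl]) (rule s, simp)
  also have "(\<Sum>i<?n. ksgn (fst p + sum_list (take (\<sigma> i) (degs qs))) * z p (qs[\<sigma> i := bd_arg N (qs ! \<sigma> i)])) =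
      (\<Sum>i<?n. ksgn (fst p + sum_list (take i (degs qs))) * z p (qs[i := bd_arg N (qs ! i)]))"
    by (rule sum.reindex_bij_betw[OF permutes_imp_bij[OF 5(2)]])
  finally show ?case using h by (simp add: distrib_left)
next
  case (6 p qs j q B \<sigma>)
  let ?q = "(happ 0 (act N (length B) \<sigma>) q, permute_list \<sigma> B)"
  have qm: "snd q \<in> grd (cpx N (length B)) (fst q)" using is_gen_mem(2)[OF 6(1,2)] 6(3) by (simp add: mem_def)
  have h: "z (happ (- 1) (bd (cpx M (length qs))) p) (qs[j := ?q]) = z (happ (- 1) (bd (cpx M (length qs))) p) qs"
    by (rule form_act[OF z is_gen_bd_head[OF M 6(1)] 6(2-4)])
  have s: "z p ((qs[j := ?q])[i := bd_arg N (qs[j := ?q] ! i)]) = z p (qs[i := bd_arg N (qs ! i)])"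
    if i: "i < length qs" for i
  proof (cases "i = j")
    case True
    show ?thesis using form_act[OF z is_gen_bd_arg[OF N 6(1,2)], of j "happ (- 1) (bd (cpx N (length B))) q" B \<sigma>] 6(2-4)
      by (simp add: True happ_def smodule_act_bd[OF N 6(4) qm])
  next
    case False
    then show ?thesis using form_act[OF z is_gen_bd_arg[OF N 6(1) i], of j q B \<sigma>] 6(2-4)
      by (simp add: list_update_swap)
  qed
  have dg: "degs (qs[j := ?q]) = degs qs"
    by (rule degs_update_same[OF 6(2)]) (simp add: 6(3))
  show ?case unfolding dg using h s by simp
qed

lemma is_form_comp_bd_gen:
  assumes M: "smodule M" and N: "smodule N"
  shows "is_form M N n (\<lambda>p qs. (gen M N n (happ (- 1) (bd (cpx M (length qs))) p) qs +
     (\<Sum>i<length qs. scl (ksgn (fst p + sum_list (take i (degs qs)))) (gen M N n p (qs[i := bd_arg N (qs ! i)])))) z)"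
proof (cases "is_form M N n z")
  case True
  then show ?thesis using is_form_comp_bd[OF M N True] by (simp add: sum_fun_apply scl_apply gen_form)
next
  case False
  then show ?thesis by (simp add: sum_fun_apply scl_apply gen_def)
qed

lemma comp_bd_gen:
  assumes M: "smodule M" and N: "smodule N" and g: "is_gen M N n p qs" and k: "fst p + sum_list (degs qs) = k"
  shows "comp_bd M N n k (gen M N n p qs) = gen M N n (happ (- 1) (bd (cpx M (length qs))) p) qs +
     (\<Sum>i<length qs. scl (ksgn (fst p + sum_list (take i (degs qs)))) (gen M N n p (qs[i := bd_arg N (qs ! i)])))"
  unfolding comp_bd_def by (rule ext_gen[OF g k]) (rule is_form_comp_bd_gen[OF M N])

lemma linmap_comp_bd:
  assumes M: "smodule M" and N: "smodule N"
  shows "linmap (cspace M N n k) (cspace M N n (k - 1)) (comp_bd M N n k)"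
  unfolding comp_bd_def
proof (rule linmap_ext[OF subspace_cspace is_form_comp_bd_gen[OF M N]])
  fix p qs assume g: "is_gen M N n p qs" and k: "fst p + sum_list (degs qs) = k"
  have "gen M N n (happ (- 1) (bd (cpx M (length qs))) p) qs \<in> cspace M N n (k - 1)"
    by (rule gen_in[OF is_gen_bd_head[OF M g]]) (use k in simp)
  moreover have "gen M N n p (qs[i := bd_arg N (qs ! i)]) \<in> cspace M N n (k - 1)" if "i < length qs" for i
    by (rule gen_in[OF is_gen_bd_arg[OF N g that]])
      (use k that in \<open>simp only: degs_update; simp add: sum_list_update_int\<close>)
  ultimately show "gen M N n (happ (- 1) (bd (cpx M (length qs))) p) qs +
     (\<Sum>i<length qs. scl (ksgn (fst p + sum_list (take i (degs qs)))) (gen M N n p (qs[i := bd_arg N (qs ! i)])))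
      \<in> cspace M N n (k - 1)"
    by (intro fv.subspace_add[OF subspace_cspace] fv.subspace_sum[OF subspace_cspace]
        fv.subspace_scale[OF subspace_cspace]) auto
qed

section \<open>The associativity isomorphism\<close>

text \<open>
  The order in which \<open>assoc\<close> writes the symbols \<open>n\<^sub>1, \<dots>, n\<^sub>a, r\<^sub>1, \<dots>, r\<^sub>m\<close>: each \<open>n\<^sub>j\<close> is followed
  by the \<open>r\<^sub>i\<close> that are plugged into it.
\<close>

definition assoc_word :: "nat list list \<Rightarrow> nat list" where
  "assoc_word Es = concat (map (\<lambda>j. j # map ((+) (length Es)) (Es ! j)) [0..<length Es])"

lemma mset_assoc_word: "mset (assoc_word Es) = mset ([0..<length Es] @ map ((+) (length Es)) (concat Es))"
proof -
  have "mset (concat (map (\<lambda>j. j # f (Es ! j)) [0..<l])) = mset ([0..<l] @ concat (map f (take l Es)))"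
    if "l \<le> length Es" for l and f :: "nat list \<Rightarrow> nat list"
    using that by (induction l) (auto simp: take_Suc_conv_app_nth)
  from this[of "length Es" "map ((+) (length Es))"] show ?thesis
    by (simp add: assoc_word_def map_concat)
qed

lemma
  assumes "distinct (concat Es)" "set (concat Es) = {..<m}"
  shows distinct_assoc_word: "distinct (assoc_word Es)"
    and set_assoc_word: "set (assoc_word Es) = {..<length Es + m}"
proof -
  have "distinct ([0..<length Es] @ map ((+) (length Es)) (concat Es))"
    using assms(1) by (auto simp: distinct_map)
  then show "distinct (assoc_word Es)" using mset_eq_imp_distinct_iff[OF mset_assoc_word[of Es]] by simp
  have "x \<in> (+) (length Es) ` {..<m}" if "\<not> x < length Es" "x < length Es + m" for x
    using that by (intro image_eqI[of _ _ "x - length Es"]) auto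
  then have "{..<length Es} \<union> (+) (length Es) ` {..<m} = {..<length Es + m}" by auto
  then show "set (assoc_word Es) = {..<length Es + m}"
    using mset_eq_setD[OF mset_assoc_word[of Es]] assms(2) by (simp add: atLeast0LessThan)
qed

context
  fixes Es :: "nat list list" and m :: nat
  assumes dist: "distinct (concat Es)" and set: "set (concat Es) = {..<m}"
begin

private abbreviation "a \<equiv> length Es"
private abbreviation "Bl j \<equiv> j # map ((+) a) (Es ! j)"

private lemma Es_less: "j < a \<Longrightarrow> e \<in> set (Es ! j) \<Longrightarrow> e < m"
  using set nth_mem[of j Es] by auto

private lemma Es_disjoint_less:
  assumes "i < j" "j < a" shows "set (Es ! i) \<inter> set (Es ! j) = {}"
proof -
  have "concat Es = concat (take j Es) @ Es ! j @ concat (drop (Suc j) Es)"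
    using id_take_nth_drop[OF assms(2)] by (metis concat.simps(2) concat_append)
  then have "set (concat (take j Es)) \<inter> set (Es ! j) = {}" using dist by auto
  moreover have "Es ! i \<in> set (take j Es)" using assms by (auto simp: in_set_conv_nth)
  ultimately show ?thesis by auto
qed

lemma disjoint_nth_distinct_concat: "i < a \<Longrightarrow> j < a \<Longrightarrow> i \<noteq> j \<Longrightarrow> set (Es ! i) \<inter> set (Es ! j) = {}"
  using Es_disjoint_less[of i j] Es_disjoint_less[of j i] by (cases i j rule: linorder_cases) auto

private lemma Bl_disjoint: "i < a \<Longrightarrow> j < a \<Longrightarrow> i \<noteq> j \<Longrightarrow> set (Bl i) \<inter> set (Bl j) = {}"
  using disjoint_nth_distinct_concat[of i j] by auto

text \<open>
  The words of the two sides differ by a reordering of the \<open>n\<^sub>j\<close>, which gives the first factor, and by a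
  permutation of the blocks formed by \<open>n\<^sub>j\<close> and its arguments, which gives the second.
\<close>

lemma koszul_sign_assoc_permute_outer:
  fixes ds es :: "int list"
  assumes ds: "length ds = length Es" and es: "length es = m" and \<tau>: "\<tau> permutes {..<length Es}"
  shows "koszul_sign (permute_list \<tau> ds @ es) (assoc_word (permute_list \<tau> Es)) =
    koszul_sign ds (map \<tau> [0..<length ds]) *
    koszul_sign (map (\<lambda>j. ds ! j + sum_list (map ((!) es) (Es ! j))) [0..<length ds]) (map \<tau> [0..<length ds]) *
    (koszul_sign (ds @ es) (assoc_word Es) :: 'k::field)"
proof -
  let ?js = "map \<tau> [0..<a] @ [a..<a + m]" let ?J' = "assoc_word (permute_list \<tau> Es)"
  have t: "\<tau> i < a" if "i < a" for i using permutes_nat_less[OF \<tau> that] .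
  have c: "mset (concat (permute_list \<tau> Es)) = mset (concat Es)"
    using concat_permute_mset[OF \<tau>, of "\<lambda>x. x"] by simp
  have J': "?J' = concat (map (\<lambda>j. j # map ((+) a) (Es ! \<tau> j)) [0..<a])"
    unfolding assoc_word_def by (intro arg_cong[of _ _ concat] map_cong) (auto simp: permute_list_nth[OF \<tau>])
  have js: "?js ! j = \<tau> j" if "j < a" for j using that by (simp add: nth_append)
  have js2: "?js ! (a + e) = a + e" if "e < m" for e using that by (simp add: nth_append)
  have w: "map ((!) ?js) ?J' = concat (map (\<lambda>j. Bl (\<tau> j)) [0..<a])"
    unfolding J' map_concat map_map
    by (intro arg_cong[of _ _ concat] map_cong) (auto simp del: map_append intro!: js js2 Es_less[OF t])
  have d: "map ((!) (ds @ es)) ?js = permute_list \<tau> ds @ es"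
    using t ds es by (auto simp: permute_list_def nth_append intro!: nth_equalityI)
  have c0: "koszul_sign (ds @ es) (map ((!) ?js) ?J') = koszul_sign (ds @ es) ?js * (koszul_sign (permute_list \<tau> ds @ es) ?J' :: 'k)"
    unfolding d[symmetric]
  proof (rule koszul_sign_compose)
    have "\<not> a \<le> \<tau> x" if "x < a" for x using t[OF that] by simp
    then show "distinct ?js" using permutes_inj_on[OF \<tau>] by (auto simp: distinct_map)
    have L: "length (permute_list \<tau> Es) = a" by simp
    have D: "distinct (concat (permute_list \<tau> Es))" and S: "set (concat (permute_list \<tau> Es)) = {..<m}"
      using mset_eq_imp_distinct_iff[OF c] mset_eq_setD[OF c] dist set by auto
    show "distinct ?J'" by (rule distinct_assoc_word[OF D S])
    show "set ?J' = {..<length ?js}" using set_assoc_word[OF D S] by simp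
  qed
  have c1: "koszul_sign (ds @ es) ?js = (koszul_sign ds (map \<tau> [0..<a]) :: 'k)"
  proof -
    have "cross_sign (ds @ es) (map \<tau> [0..<a]) [a..<a + m] = (1 :: 'k)"
      unfolding cross_sign_def by (intro prod_list_one) (use t in fastforce)
    moreover have "koszul_sign (ds @ es) (map \<tau> [0..<a]) = (koszul_sign ds (map \<tau> [0..<a]) :: 'k)"
      by (rule koszul_sign_cong) (use ds in \<open>auto simp: nth_append t\<close>)
    ultimately show ?thesis by (simp add: koszul_sign_append koszul_sign_sorted)
  qed
  have c2: "koszul_sign (ds @ es) (concat (map (\<lambda>j. Bl (\<tau> j)) [0..<a])) =
    koszul_sign (ds @ es) (concat (map Bl [0..<a])) *
    (koszul_sign (map (\<lambda>j. sum_list (map ((!) (ds @ es)) (Bl j))) [0..<a]) (map \<tau> [0..<a]) :: 'k)"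
    by (rule koszul_sign_blocks[OF \<tau> Bl_disjoint])
  have c3: "map (\<lambda>j. sum_list (map ((!) (ds @ es)) (Bl j))) [0..<a] =
      map (\<lambda>j. ds ! j + sum_list (map ((!) es) (Es ! j))) [0..<a]"
    using ds by (auto simp: nth_append o_def)
  have c4: "koszul_sign ds (map \<tau> [0..<a]) * koszul_sign (permute_list \<tau> ds @ es) ?J' =
     koszul_sign (ds @ es) (assoc_word Es) *
     (koszul_sign (map (\<lambda>j. ds ! j + sum_list (map ((!) es) (Es ! j))) [0..<a]) (map \<tau> [0..<a]) :: 'k)"
    using c0 unfolding w c1 c2 c3 assoc_word_def[of Es] by (rule sym)
  have "koszul_sign (permute_list \<tau> ds @ es) ?J' =
      koszul_sign ds (map \<tau> [0..<a]) * (koszul_sign ds (map \<tau> [0..<a]) * koszul_sign (permute_list \<tau> ds @ es) ?J' :: 'k)"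
    by (simp add: koszul_sign_square_left)
  then show ?thesis unfolding c4 ds by (simp only: ac_simps)
qed

text \<open>Only the letters within the \<open>i\<close>-th block move, so the pairs across blocks contribute the same signs.\<close>

lemma koszul_sign_assoc_permute_block:
  assumes i: "i < length Es" and \<sigma>: "\<sigma> permutes {..<length (Es ! i)}"
    and ds: "length ds = length Es" and es: "length es = m"
  shows "koszul_sign (ds @ es) (assoc_word (Es[i := permute_list \<sigma> (Es ! i)])) =
    koszul_sign (map ((!) es) (Es ! i)) (map \<sigma> [0..<length (Es ! i)]) * (koszul_sign (ds @ es) (assoc_word Es) :: 'k::field)"
proof -
  let ?E = "Es ! i" let ?E' = "permute_list \<sigma> (Es ! i)" let ?d = "ds @ es"
  have s: "[0..<a] = [0..<i] @ i # [Suc i..<a]"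
    using i upt_add_eq_append[of 0 i "a - i"] by (simp add: upt_conv_Cons)
  define pre post where "pre = concat (map Bl [0..<i])" and "post = concat (map Bl [Suc i..<a])"
  have w: "assoc_word (Es[i := E]) = pre @ (i # map ((+) a) E) @ post" for E
  proof -
    have c: "concat (map (\<lambda>j. j # map ((+) a) (Es[i := E] ! j)) [0..<i]) = pre"
      "concat (map (\<lambda>j. j # map ((+) a) (Es[i := E] ! j)) [Suc i..<a]) = post"
      unfolding pre_def post_def by (intro arg_cong[of _ _ concat] map_cong; auto)+
    show ?thesis unfolding assoc_word_def length_list_update s map_append concat_append c list.map concat.simps
      using i by simp
  qed
  have m: "mset (i # map ((+) a) ?E') = mset (i # map ((+) a) ?E)" using \<sigma> by simp
  have kE: "koszul_sign ?d (map ((+) a) ?E') =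
      koszul_sign ?d (map ((+) a) ?E) * (koszul_sign (map ((!) es) ?E) (map \<sigma> [0..<length ?E]) :: 'k)"
  proof -
    have "map ((+) a) ?E' = map ((!) (map ((+) a) ?E)) (map \<sigma> [0..<length ?E])"
      using permutes_nat_less[OF \<sigma>] by (auto simp: permute_list_def)
    moreover have "koszul_sign ?d (map ((!) (map ((+) a) ?E)) (map \<sigma> [0..<length ?E])) =
       koszul_sign ?d (map ((+) a) ?E) * (koszul_sign (map ((!) ?d) (map ((+) a) ?E)) (map \<sigma> [0..<length ?E]) :: 'k)"
    proof (rule koszul_sign_compose)
      have "distinct ?E" using i dist by (simp add: distinct_concat_iff)
      then show "distinct (map ((+) a) ?E)" by (simp add: distinct_map)
      show "distinct (map \<sigma> [0..<length ?E])" using permutes_inj_on[OF \<sigma>] by (simp add: distinct_map)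
      show "set (map \<sigma> [0..<length ?E]) = {..<length (map ((+) a) ?E)}"
        using permutes_image[OF \<sigma>] by (simp add: atLeast0LessThan)
    qed
    moreover have "map ((!) ?d) (map ((+) a) ?E) = map ((!) es) ?E"
      using ds by (simp add: nth_append)
    ultimately show ?thesis by (simp only:)
  qed
  have k: "koszul_sign ?d (i # map ((+) a) E) = koszul_sign ?d (map ((+) a) E) * (cross_sign ?d [i] (map ((+) a) E) :: 'k)" for E
    using koszul_sign_append[of ?d "[i]" "map ((+) a) E"] by (simp add: koszul_sign_sorted)
  have "cross_sign ?d [i] (map ((+) a) ?E') = (cross_sign ?d [i] (map ((+) a) ?E) :: 'k)"
    by (rule cross_sign_mset) (use \<sigma> in simp_all)
  moreover have "cross_sign ?d (i # map ((+) a) ?E') post = (cross_sign ?d (i # map ((+) a) ?E) post :: 'k)"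
    "cross_sign ?d pre (i # map ((+) a) ?E') = (cross_sign ?d pre (i # map ((+) a) ?E) :: 'k)"
    by (rule cross_sign_mset[OF m refl], rule cross_sign_mset[OF refl m])
  moreover have w0: "assoc_word Es = pre @ (i # map ((+) a) ?E) @ post" using w[of ?E] by simp
  ultimately show ?thesis
    unfolding w w0 koszul_sign_append cross_sign_append k kE by (simp add: ac_simps)
qed

text \<open>Relabelling by the inverse of \<open>\<sigma>\<close> compensates the reordering of the inner symbols, so the word spells the same sequence of symbols.\<close>

lemma koszul_sign_assoc_permute_inner:
  assumes \<sigma>: "\<sigma> permutes {..<m}" and ds: "length ds = length Es" and es: "length es = m"
  shows "koszul_sign (ds @ permute_list \<sigma> es) (assoc_word (map (map (inv \<sigma>)) Es)) =
    koszul_sign es (map \<sigma> [0..<m]) * (koszul_sign (ds @ es) (assoc_word Es) :: 'k::field)"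
proof -
  let ?js = "[0..<a] @ map (\<lambda>i. a + \<sigma> i) [0..<m]" let ?J' = "assoc_word (map (map (inv \<sigma>)) Es)"
  have si: "inv \<sigma> e < m" if "e < m" for e using permutes_nat_less[OF permutes_inv[OF \<sigma>] that] .
  have js: "?js ! j = j" if "j < a" for j using that by (simp add: nth_append)
  have js2: "?js ! (a + inv \<sigma> e) = a + e" if "e < m" for e
    using that si[OF that] permutes_inverses(1)[OF \<sigma>] by (simp add: nth_append)
  have w: "map ((!) ?js) ?J' = assoc_word Es"
    unfolding assoc_word_def map_concat map_map length_map
    by (intro arg_cong[of _ _ concat] map_cong) (auto simp del: map_append intro!: js js2 Es_less)
  have d: "map ((!) (ds @ es)) ?js = ds @ permute_list \<sigma> es"
    using ds es by (auto simp: permute_list_def nth_append intro!: nth_equalityI)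
  have cm: "concat (map (map (inv \<sigma>)) Es) = map (inv \<sigma>) (concat Es)" by (simp add: map_concat)
  have "koszul_sign (ds @ es) (map ((!) ?js) ?J') = koszul_sign (ds @ es) ?js * (koszul_sign (ds @ permute_list \<sigma> es) ?J' :: 'k)"
    unfolding d[symmetric]
  proof (rule koszul_sign_compose)
    show "distinct ?js" using permutes_inj_on[OF \<sigma>] by (auto simp: distinct_map comp_inj_on_iff inj_on_def)
    have D: "distinct (concat (map (map (inv \<sigma>)) Es))" and S: "set (concat (map (map (inv \<sigma>)) Es)) = {..<m}"
      unfolding cm using dist set permutes_inj_on[OF permutes_inv[OF \<sigma>]] permutes_image[OF permutes_inv[OF \<sigma>]]
      by (simp_all add: distinct_map del: set_concat distinct_concat_iff)
    show "distinct ?J'" by (rule distinct_assoc_word[OF D S])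
    show "set ?J' = {..<length ?js}" using set_assoc_word[OF D S] by simp
  qed
  moreover have "koszul_sign (ds @ es) ?js = (koszul_sign es (map \<sigma> [0..<m]) :: 'k)"
  proof -
    have "cross_sign (ds @ es) [0..<a] (map (\<lambda>i. a + \<sigma> i) [0..<m]) = (1 :: 'k)"
      unfolding cross_sign_def by (intro prod_list_one) auto
    moreover have "koszul_sign (ds @ es) (map (\<lambda>i. a + \<sigma> i) [0..<m]) = (koszul_sign es (map \<sigma> [0..<m]) :: 'k)"
      using koszul_sign_map_add[of "map \<sigma> [0..<m]" "ds @ es" a es, where 'a = 'k] ds by (simp add: nth_append o_def)
    ultimately show ?thesis by (simp add: koszul_sign_append koszul_sign_sorted)
  qed
  ultimately show ?thesis unfolding w by (simp add: koszul_sign_square_left)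
qed

end

lemma consecutive_snoc:
  "consecutive (rs @ [r]) = consecutive rs @
    [(fst r, let s = sum_list (map (\<lambda>r. length (snd r)) rs) in [s..<s + length (snd r)])]"
  unfolding consecutive_def by (simp add: nth_append Let_def)

lemma length_consecutive [simp]: "length (consecutive rs) = length rs"
  by (simp add: consecutive_def)

lemma consecutive_Nil [simp]: "consecutive [] = []"
  by (simp add: consecutive_def)

lemma fst_consecutive: "map fst (consecutive rs) = map fst rs"
  by (rule nth_equalityI) (simp_all add: consecutive_def)

lemma degs_consecutive [simp]: "degs (consecutive rs) = degs rs"
  using arg_cong[OF fst_consecutive[of rs], of "map fst"] by (simp add: o_def)

lemma length_concat_snd: "length (concat (map snd rs)) = sum_list (map (\<lambda>r. length (snd r)) rs)"
  by (simp add: length_concat o_def)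

lemma concat_consecutive: "concat (map snd (consecutive rs)) = [0..<length (concat (map snd rs))]"
proof (induction rs rule: rev_induct)
  case (snoc r rs)
  show ?case unfolding consecutive_snoc map_append concat_append snoc
    using upt_add_eq_append[of 0 "length (concat (map snd rs))" "length (snd r)"]
    by (simp add: length_concat_snd Let_def)
qed simp

lemma consecutive_nth:
  assumes "i < length rs"
  obtains s where "consecutive rs ! i = (fst (rs ! i), [s..<s + length (snd (rs ! i))])"
  using assms by (simp add: consecutive_def Let_def)

text \<open>The relabelling of the inputs of a list of operations along the list of labels \<open>B\<close>.\<close>

abbreviation relabel_args :: "nat list \<Rightarrow> ('b \<times> nat list) list \<Rightarrow> ('b \<times> nat list) list" where
  "relabel_args B \<equiv> map (\<lambda>(r, E). (r, map ((!) B) E))"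

lemma relabel_args_consecutive: "relabel_args (concat (map snd rs)) (consecutive rs) = rs"
proof (induction rs rule: rev_induct)
  case (snoc r rs)
  let ?B = "concat (map snd rs)"
  have "relabel_args (?B @ snd r) (consecutive rs) = relabel_args ?B (consecutive rs)"
  proof (rule map_cong[OF refl], clarsimp)
    fix c E e assume "(c, E) \<in> set (consecutive rs)" "e \<in> set E"
    then have "e \<in> set (concat (map snd (consecutive rs)))" by force
    then have "e < length ?B" unfolding concat_consecutive by simp
    then show "(?B @ snd r) ! e = ?B ! e" by (simp add: nth_append)
  qed
  moreover have "map ((!) (?B @ snd r)) [length ?B..<length ?B + length (snd r)] = snd r"
    by (intro nth_equalityI) (auto simp: nth_append)
  ultimately show ?case using snoc
    by (simp add: consecutive_snoc Let_def length_concat_snd)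
qed simp

lemma consecutive_update:
  assumes "t < length ls" "length (snd r) = length (snd (ls ! t))"
  shows "consecutive (ls[t := r]) = (consecutive ls)[t := (fst r, snd (consecutive ls ! t))]"
proof -
  have "map (\<lambda>r. length (snd r)) (take i (ls[t := r])) = map (\<lambda>r. length (snd r)) (take i ls)" for i
    using assms by (intro nth_equalityI) (auto simp: nth_list_update)
  then show ?thesis using assms
    by (auto simp: consecutive_def Let_def nth_list_update intro!: nth_equalityI)
qed


subsection \<open>Operations plugged into an operation\<close>

text \<open>
  The argument of an element of \<open>M \<circ> (N \<circ> L)\<close> which \<open>q \<in> N\<close> and the labelled elements \<open>ls\<close> of \<open>L\<close> form.
\<close>

definition nested_arg :: "('y, 'k::field) smod \<Rightarrow> ('z, 'k) smod \<Rightarrow> ('y, 'k) hvec \<Rightarrow>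
    (('z, 'k) hvec \<times> nat list) list \<Rightarrow> (int \<times> (('y, 'z, 'k) form \<Rightarrow> 'k)) \<times> nat list" where
  "nested_arg N L q ls = ((fst q + sum_list (degs ls),
     gen N L (length (concat (map snd ls))) q (consecutive ls)), concat (map snd ls))"

definition nested_ok :: "('y, 'k::field) smod \<Rightarrow> ('z, 'k) smod \<Rightarrow> ('y, 'k) hvec \<Rightarrow>
    (('z, 'k) hvec \<times> nat list) list \<Rightarrow> bool" where
  "nested_ok N L q ls \<longleftrightarrow> mem (cpx N (length ls)) q \<and> (\<forall>(r, B)\<in>set ls. mem (cpx L (length B)) r)"

lemma is_gen_consecutive:
  assumes "nested_ok N L q ls"
  shows "is_gen N L (length (concat (map snd ls))) q (consecutive ls)"
proof -
  have "mem (cpx L (length B)) r" if rB: "(r, B) \<in> set (consecutive ls)" for r B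
  proof -
    obtain t where t: "t < length ls" "consecutive ls ! t = (r, B)"
      using rB by (auto simp: in_set_conv_nth)
    obtain s where "consecutive ls ! t = (fst (ls ! t), [s..<s + length (snd (ls ! t))])"
      using consecutive_nth[OF t(1)] .
    then have "r = fst (ls ! t)" "length B = length (snd (ls ! t))" using t(2) by auto
    moreover have "(fst (ls ! t), snd (ls ! t)) \<in> set ls" using t(1) by simp
    ultimately show ?thesis using assms unfolding nested_ok_def by auto
  qed
  then show ?thesis using assms
    unfolding is_gen_def concat_consecutive nested_ok_def by (auto simp: atLeast0LessThan)
qed

lemma mem_nested_arg:
  "nested_ok N L q ls \<Longrightarrow> mem (cpx (N \<circ>\<^sub>S L) (length (snd (nested_arg N L q ls)))) (fst (nested_arg N L q ls))"
  using gen_in[OF is_gen_consecutive] by (fastforce simp: nested_arg_def composite_def)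

lemma cpx_composite: "cpx (M \<circ>\<^sub>S N) n = \<lparr>grd = cspace M N n, bd = comp_bd M N n\<rparr>"
  by (simp add: composite_def)

lemma act_composite: "act (M \<circ>\<^sub>S N) = comp_act M N"
  by (simp add: composite_def)

context
  fixes M :: "('x, 'k::field) smod" and N :: "('y, 'k) smod" and L :: "('z, 'k) smod"
    and n :: nat and z :: "('x, ('y, 'z, 'k) form, 'k) form" and m :: "('x, 'k) hvec"
    and ws :: "((int \<times> (('y, 'z, 'k) form \<Rightarrow> 'k)) \<times> nat list) list" and j :: nat
  assumes z: "is_form M (N \<circ>\<^sub>S L) n z" and j: "j < length ws"
begin

private abbreviation "Z v \<equiv> z m (ws[j := v])"
private abbreviation "ok v \<equiv> is_gen M (N \<circ>\<^sub>S L) n m (ws[j := v])"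

text \<open>
  An argument of a form is a pair of an element of \<open>N \<circ> L\<close> with standard labels and a list of actual
  labels.  If the actual labels of the two descriptions agree, the descriptions differ by the action of
  a permutation on the standard labels, which a form ignores.
\<close>

lemma form_nested_relabel:
  assumes X1: "is_gen N L (length B1) q X1" and X2: "length X2 = length X1" "map fst X2 = map fst X1"
    and d: "d = fst q + sum_list (degs X1)"
    and B: "mset B1 = mset B2" and eq: "relabel_args B1 X1 = relabel_args B2 X2"
    and less: "\<And>r E e. (r, E) \<in> set X2 \<Longrightarrow> e \<in> set E \<Longrightarrow> e < length B2"
    and g: "ok ((d, gen N L (length B1) q X1), B1)"
  shows "Z ((d, gen N L (length B2) q X2), B2) = Z ((d, gen N L (length B1) q X1), B1)"
proof -
  obtain \<pi> where \<pi>: "\<pi> permutes {..<length B1}" and B2: "B2 = permute_list \<pi> B1"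
    using mset_eq_permutation[OF B[symmetric]] by auto
  have len: "length B2 = length B1" using B2 by simp
  have dB: "distinct B1"
  proof -
    have "B1 \<in> set (map snd (ws[j := ((d, gen N L (length B1) q X1), B1)]))"
      using j by (auto simp: map_update intro: set_update_memI)
    then show ?thesis using g unfolding is_gen_def by (auto simp: distinct_concat_iff)
  qed
  have e: "map (\<lambda>(r, E). (r, map (inv \<pi>) E)) X1 = X2"
  proof (rule nth_equalityI)
    fix i assume "i < length (map (\<lambda>(r, E). (r, map (inv \<pi>) E)) X1)"
    then have i: "i < length X1" by simp
    obtain r E where rE: "X1 ! i = (r, E)" by fastforce
    obtain r' E' where rE': "X2 ! i = (r', E')" by fastforce
    have r: "r' = r" using X2 i rE rE' by (metis fst_conv nth_map)
    have "relabel_args B1 X1 ! i = relabel_args B2 X2 ! i" using eq by simp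
    then have E: "map ((!) B1) E = map ((!) B2) E'" using i X2 rE rE' by simp
    have l: "e < length B1" if "e \<in> set E" for e
    proof -
      have "E \<in> set (map snd X1)" using i rE by (metis nth_mem nth_map length_map snd_conv)
      then show ?thesis using that X1 unfolding is_gen_def by auto
    qed
    have l': "e < length B1" if "e \<in> set E'" for e
      using less[of r' E' e] that rE' i X2 len by (metis nth_mem)
    have "map (inv \<pi>) E = E'"
    proof (rule nth_equalityI)
      show len': "length (map (inv \<pi>) E) = length E'" using arg_cong[OF E, of length] by simp
      fix t assume t: "t < length (map (inv \<pi>) E)"
      have "B1 ! (E ! t) = B2 ! (E' ! t)" using arg_cong[OF E, of "\<lambda>xs. xs ! t"] t len' by simp
      also have "\<dots> = B1 ! \<pi> (E' ! t)"
        unfolding B2 using l' t len' by (intro permute_list_nth[OF \<pi>]) simp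
      finally have "E ! t = \<pi> (E' ! t)"
        using dB l[of "E ! t"] permutes_nat_less[OF \<pi>, of "E' ! t"] l'[of "E' ! t"] t len'
        by (simp add: nth_eq_iff_index_eq)
      then show "map (inv \<pi>) E ! t = E' ! t" using t permutes_inverses(2)[OF \<pi>] by simp
    qed
    then show "map (\<lambda>(r, E). (r, map (inv \<pi>) E)) X1 ! i = X2 ! i" using i rE rE' r by simp
  qed (use X2 in simp)
  have a: "comp_act N L (length B1) \<pi> d (gen N L (length B1) q X1) = gen N L (length B1) q X2"
    using comp_act_gen[OF \<pi> X1 d[symmetric]] unfolding e .
  show ?thesis
    using form_act[OF z g, of j "(d, gen N L (length B1) q X1)" B1 \<pi>] j \<pi> a
    by (simp add: B2 happ_def act_composite)
qed

lemma form_nested_add_op: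
  assumes "nested_ok N L (k, x) ls" "y \<in> grd (cpx N (length ls)) k" "ok (nested_arg N L (k, x) ls)"
  shows "Z (nested_arg N L (k, x + y) ls) = Z (nested_arg N L (k, x) ls) + Z (nested_arg N L (k, y) ls)"
proof -
  have y: "nested_ok N L (k, y) ls" using assms by (simp add: nested_ok_def)
  have "gen N L (length (concat (map snd ls))) (k, x + y) (consecutive ls) =
      gen N L (length (concat (map snd ls))) (k, x) (consecutive ls) +
      gen N L (length (concat (map snd ls))) (k, y) (consecutive ls)"
    using gen_add_head[OF is_gen_consecutive[OF assms(1)]] assms(2) by simp
  then show ?thesis
    using form_add_arg[OF z assms(3)[unfolded nested_arg_def], of j] j
      mem_nested_arg[OF y] by (simp add: nested_arg_def)
qed

lemma form_nested_scl_op: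
  assumes "nested_ok N L (k, x) ls" "ok (nested_arg N L (k, x) ls)"
  shows "Z (nested_arg N L (k, scl a x) ls) = a * Z (nested_arg N L (k, x) ls)"
proof -
  have "gen N L (length (concat (map snd ls))) (k, scl a x) (consecutive ls) =
      scl a (gen N L (length (concat (map snd ls))) (k, x) (consecutive ls))"
    using gen_scl_head[OF is_gen_consecutive[OF assms(1)]] by simp
  then show ?thesis
    using form_scl_arg[OF z assms(2)[unfolded nested_arg_def], of j] j by (simp add: nested_arg_def)
qed

text \<open>
  Permuting the inputs of \<open>q\<close> also changes the concatenated list of labels; \<open>form_nested_relabel\<close>
  identifies the result with a generator in which only the symmetry of \<open>N \<circ> L\<close> has to be applied.
\<close>

lemma form_nested_permute:
  assumes ok: "nested_ok N L q ls" and \<sigma>: "\<sigma> permutes {..<length ls}" and N: "smodule N"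
    and g: "ok (nested_arg N L q ls)"
  shows "Z (nested_arg N L (happ 0 (act N (length ls) \<sigma>) q) (permute_list \<sigma> ls)) =
    koszul_sign (degs ls) (map \<sigma> [0..<length ls]) * Z (nested_arg N L q ls)"
proof -
  let ?q = "happ 0 (act N (length ls) \<sigma>) q" and ?B = "concat (map snd ls)"
  let ?ls = "permute_list \<sigma> ls" let ?B' = "concat (map snd ?ls)" let ?X = "permute_list \<sigma> (consecutive ls)"
  let ?K = "koszul_sign (degs ls) (map \<sigma> [0..<length ls]) :: 'k"
  have mB: "mset ?B = mset ?B'" using concat_permute_mset[OF \<sigma>, of snd] by simp
  have lB: "length ?B' = length ?B" using mset_eq_length[OF mB] by simp
  have gc: "is_gen N L (length ?B) q (consecutive ls)" by (rule is_gen_consecutive[OF ok])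
  have gX: "is_gen N L (length ?B) ?q ?X" using is_gen_permute[OF gc N] \<sigma> by simp
  have "gen N L (length ?B) ?q ?X = scl ?K (gen N L (length ?B) q (consecutive ls))"
    using form_permute[OF _ gc, of _ \<sigma>] \<sigma> by (simp add: gen_def fun_eq_iff scl_apply)
  moreover have ok': "nested_ok N L ?q ?ls"
    using ok \<sigma> smodule_act_mem[OF N \<sigma>] by (auto simp: nested_ok_def mem_def)
  have sd: "sum_list (degs ?ls) = sum_list (degs ls)"
    using sum_list_permute[of \<sigma> "degs ls"] \<sigma> by (simp add: permute_list_map)
  have "Z ((fst q + sum_list (degs ls), gen N L (length ?B') ?q (consecutive ?ls)), ?B') =
    Z ((fst q + sum_list (degs ls), gen N L (length ?B) ?q ?X), ?B)"
  proof (rule form_nested_relabel[OF gX])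
    show "map fst (consecutive ?ls) = map fst ?X"
      using \<sigma> by (simp add: fst_consecutive permute_list_map[symmetric])
    show "fst q + sum_list (degs ls) = fst ?q + sum_list (degs ?X)"
      using sum_list_permute[of \<sigma> "degs (consecutive ls)"] \<sigma> by (simp add: permute_list_map[symmetric])
    show "relabel_args ?B ?X = relabel_args ?B' (consecutive ?ls)"
      using \<sigma> relabel_args_consecutive[of ls] relabel_args_consecutive[of ?ls]
      by (simp add: permute_list_map[symmetric])
    show "e < length ?B'" if "(r, E) \<in> set (consecutive ?ls)" "e \<in> set E" for r E e
      using that is_gen_consecutive[OF ok'] unfolding is_gen_def by force
    have "mem (cpx (N \<circ>\<^sub>S L) (length ?B)) (fst q + sum_list (degs ls), gen N L (length ?B) ?q ?X)"
      using gen_in[OF gX] sum_list_permute[of \<sigma> "degs (consecutive ls)"] \<sigma>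
      by (simp add: cpx_composite permute_list_map[symmetric])
    then show "ok ((fst q + sum_list (degs ls), gen N L (length ?B) ?q ?X), ?B)"
      using is_gen_update[OF g, of j "fst (nested_arg N L q ls)" ?B] j by (simp add: nested_arg_def)
  qed (use \<sigma> mB in simp_all)
  ultimately show ?thesis
    using form_scl_arg[OF z g[unfolded nested_arg_def], of j] j sd by (simp add: nested_arg_def)
qed

lemma form_nested_add_input:
  assumes ok: "nested_ok N L q ls" and t: "t < length ls" "ls ! t = ((k, x), B)"
    and y: "y \<in> grd (cpx L (length B)) k" and g: "ok (nested_arg N L q ls)"
  shows "Z (nested_arg N L q (ls[t := ((k, x + y), B)])) =
    Z (nested_arg N L q ls) + Z (nested_arg N L q (ls[t := ((k, y), B)]))"
proof -
  obtain s where s: "consecutive ls ! t = ((k, x), [s..<s + length B])"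
    using consecutive_nth[OF t(1)] t(2) by auto
  have c: "consecutive (ls[t := ((k, v), B)]) = (consecutive ls)[t := ((k, v), [s..<s + length B])]" for v
    using consecutive_update[OF t(1), of "((k, v), B)"] t(2) s by simp
  have B: "map snd (ls[t := ((k, v), B)]) = map snd ls" for v
    using t by (simp add: map_update list_update_same_conv)
  have d: "degs (ls[t := ((k, v), B)]) = degs ls" for v
    by (rule degs_update_same[OF t(1)]) (simp add: t(2))
  have ok': "nested_ok N L q (ls[t := ((k, y), B)])"
    using ok y by (auto simp: nested_ok_def dest!: set_update_subset_insert[THEN subsetD])
  show ?thesis
    using gen_add_arg[OF is_gen_consecutive[OF ok], of t k x "[s..<s + length B]" y] t(1) s y
      form_add_arg[OF z g[unfolded nested_arg_def], of j] j mem_nested_arg[OF ok']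
    by (simp add: nested_arg_def c B d)
qed

lemma form_nested_scl_input:
  assumes ok: "nested_ok N L q ls" and t: "t < length ls" "ls ! t = ((k, x), B)"
    and g: "ok (nested_arg N L q ls)"
  shows "Z (nested_arg N L q (ls[t := ((k, scl a x), B)])) = a * Z (nested_arg N L q ls)"
proof -
  obtain s where s: "consecutive ls ! t = ((k, x), [s..<s + length B])"
    using consecutive_nth[OF t(1)] t(2) by auto
  have c: "consecutive (ls[t := ((k, v), B)]) = (consecutive ls)[t := ((k, v), [s..<s + length B])]" for v
    using consecutive_update[OF t(1), of "((k, v), B)"] t(2) s by simp
  have B: "map snd (ls[t := ((k, v), B)]) = map snd ls" for v
    using t by (simp add: map_update list_update_same_conv)
  have d: "degs (ls[t := ((k, v), B)]) = degs ls" for v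
    by (rule degs_update_same[OF t(1)]) (simp add: t(2))
  show ?thesis
    using gen_scl_arg[OF is_gen_consecutive[OF ok], of t k x "[s..<s + length B]" a] t(1) s
      form_scl_arg[OF z g[unfolded nested_arg_def], of j] j
    by (simp add: nested_arg_def c B d)
qed

text \<open>
  The action on an input permutes its labels inside the concatenated list.  This is undone by
  permuting the corresponding interval of standard labels, where the equivariance of \<open>N \<circ> L\<close> in its
  second factor applies.
\<close>

lemma form_nested_act_input:
  assumes ok: "nested_ok N L q ls" and L: "smodule L" and t: "t < length ls" "ls ! t = (r, B)"
    and \<tau>: "\<tau> permutes {..<length B}" and g: "ok (nested_arg N L q ls)"
  shows "Z (nested_arg N L q (ls[t := (happ 0 (act L (length B) \<tau>) r, permute_list \<tau> B)])) =
    Z (nested_arg N L q ls)"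
proof -
  let ?r = "happ 0 (act L (length B) \<tau>) r"
  let ?ls = "ls[t := (?r, permute_list \<tau> B)]"
  let ?B = "concat (map snd ls)" let ?B' = "concat (map snd ?ls)"
  obtain s where s: "consecutive ls ! t = (r, [s..<s + length B])"
    using consecutive_nth[OF t(1)] t(2) by auto
  let ?I = "[s..<s + length B]" let ?I' = "permute_list (inv \<tau>) ?I"
  let ?X = "(consecutive ls)[t := (r, ?I')]"
  have \<tau>': "inv \<tau> permutes {..<length B}" by (rule permutes_inv[OF \<tau>])
  have inv: "permute_list \<tau> (permute_list (inv \<tau>) xs) = xs" "permute_list (inv \<tau>) (permute_list \<tau> xs) = xs"
    if "length xs = length B" for xs :: "nat list"
    using permute_list_compose[of \<tau> xs "inv \<tau>"] permute_list_compose[of "inv \<tau>" xs \<tau>] \<tau> \<tau>' that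
      permutes_inv_o[OF \<tau>] by simp_all
  have mB: "mset ?B = mset ?B'"
  proof -
    have "map (\<lambda>q. mset (snd q)) ?ls = map (\<lambda>q. mset (snd q)) ls"
      using t \<tau> by (simp add: map_update list_update_same_conv)
    then show ?thesis by (simp add: mset_concat o_def)
  qed
  have lB: "length ?B' = length ?B" using mset_eq_length[OF mB] by simp
  have c: "consecutive ?ls = (consecutive ls)[t := (?r, ?I)]"
    using consecutive_update[OF t(1), of "(?r, permute_list \<tau> B)"] t(2) s by simp
  have gc: "is_gen N L (length ?B) q (consecutive ls)" by (rule is_gen_consecutive[OF ok])
  have rm: "mem (cpx L (length B)) r" using is_gen_mem(2)[OF gc, of t] t s by simp
  have gX: "is_gen N L (length ?B) q ?X"
    by (rule is_gen_update[OF gc, of t r ?I]) (use t s \<tau>' rm in simp_all)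
  have XX: "?X[t := (?r, permute_list \<tau> ?I')] = consecutive ?ls" unfolding c using inv(1)[of ?I] by simp
  have geq: "gen N L (length ?B) q (consecutive ?ls) = gen N L (length ?B) q ?X"
    using form_act[OF _ gX, of _ t r ?I' \<tau>] t \<tau> XX by (intro gen_eqI) simp
  have d: "degs ?ls = degs ls" by (rule degs_update_same[OF t(1)]) (simp add: t(2))
  have dX: "degs ?X = degs ls"
    using degs_update_same[of t "consecutive ls" "(r, ?I')"] t s by simp
  have rr: "relabel_args ?B' (consecutive ?ls) = ?ls" by (rule relabel_args_consecutive)
  have "map ((!) ?B') ?I = permute_list \<tau> B"
    using arg_cong[OF rr, of "\<lambda>xs. snd (xs ! t)"] t unfolding c by simp
  then have "map ((!) ?B') ?I' = B"
    using inv(2)[of B] \<tau>' by (simp add: permute_list_map[symmetric])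
  moreover have "relabel_args ?B' ?X = (relabel_args ?B' (consecutive ?ls))[t := (r, map ((!) ?B') ?I')]"
    unfolding c by (simp add: map_update)
  moreover have "ls[t := (r, B)] = ls" using t by (simp add: list_update_same_conv)
  ultimately have rX: "relabel_args ?B' ?X = ls" unfolding rr by simp
  have "Z ((fst q + sum_list (degs ls), gen N L (length ?B') q ?X), ?B') =
    Z ((fst q + sum_list (degs ls), gen N L (length ?B) q (consecutive ls)), ?B)"
  proof (rule form_nested_relabel[OF gc])
    show "map fst ?X = map fst (consecutive ls)" using t s by (simp add: map_update list_update_same_conv)
    show "relabel_args ?B (consecutive ls) = relabel_args ?B' ?X"
      unfolding rX by (rule relabel_args_consecutive)
    show "e < length ?B'" if "(r', E) \<in> set ?X" "e \<in> set E" for r' E e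
      using that gX unfolding is_gen_def lB by force
    show "ok ((fst q + sum_list (degs ls), gen N L (length ?B) q (consecutive ls)), ?B)"
      using g by (simp add: nested_arg_def)
  qed (simp_all add: mB)
  moreover have "gen N L (length ?B') q (consecutive ?ls) = gen N L (length ?B') q ?X"
    unfolding lB by (rule geq)
  ultimately show ?thesis unfolding nested_arg_def d by (simp only:)
qed

end

abbreviation nested_args :: "('y, 'k::field) smod \<Rightarrow> ('z, 'k) smod \<Rightarrow> (('z, 'k) hvec \<times> nat list) list \<Rightarrow>
    (('y, 'k) hvec \<times> nat list) list \<Rightarrow> ((int \<times> (('y, 'z, 'k) form \<Rightarrow> 'k)) \<times> nat list) list" where
  "nested_args N L rs ns \<equiv> map (\<lambda>(q, E). nested_arg N L q (map ((!) rs) E)) ns"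

definition assoc_sign :: "(('y, 'k) hvec \<times> nat list) list \<Rightarrow> (('z, 'k) hvec \<times> nat list) list \<Rightarrow> 'k::field" where
  "assoc_sign ns rs = koszul_sign (degs ns @ degs rs) (assoc_word (map snd ns))"

lemma assoc_word_map_snd:
  "assoc_word (map snd ns) = concat (map (\<lambda>j. j # map ((+) (length ns)) (snd (ns ! j))) [0..<length ns])"
  unfolding assoc_word_def length_map by (intro arg_cong[of _ _ concat] map_cong refl) simp

lemma assoc_sign_update_op:
  assumes "i < length ns" "ns ! i = ((k, x), E)"
  shows "assoc_sign (ns[i := ((k, v), E)]) rs = assoc_sign ns rs"
proof -
  have "degs (ns[i := ((k, v), E)]) = degs ns" by (rule degs_update_same) (use assms in simp_all)
  moreover have "map snd (ns[i := ((k, v), E)]) = map snd ns"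
    using assms by (simp add: map_update list_update_same_conv)
  ultimately show ?thesis by (simp only: assoc_sign_def)
qed

lemma assoc_sign_update_input:
  "i < length rs \<Longrightarrow> fst (fst r) = fst (fst (rs ! i)) \<Longrightarrow> assoc_sign ns (rs[i := r]) = assoc_sign ns rs"
  by (simp only: assoc_sign_def degs_update_same)

lemma assoc_eq: "assoc M N L n k = ext (cspace (M \<circ>\<^sub>S N) L n k)
    (\<lambda>w rs \<phi>. snd w (\<lambda>m ns. assoc_sign ns rs * gen M (N \<circ>\<^sub>S L) n m (nested_args N L rs ns) \<phi>))"
  by (simp add: assoc_def assoc_sign_def assoc_word_map_snd nested_arg_def Let_def case_prod_beta)

lemma cspace_eval_lin:
  assumes "u \<in> cspace M N n k" "is_form M N n \<psi>" "is_form M N n \<psi>1" "is_form M N n \<psi>2"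
    and "\<And>p qs. is_gen M N n p qs \<Longrightarrow> \<psi> p qs = a * \<psi>1 p qs + b * \<psi>2 p qs"
  shows "u \<psi> = a * u \<psi>1 + b * u \<psi>2"
  using assms(1) by (induction rule: cspace_induct)
    (simp_all add: gen_form[OF assms(2)] gen_form[OF assms(3)] gen_form[OF assms(4)] assms(5) scl_apply distrib_left mult.left_commute)

lemma is_gen_label_less:
  assumes "is_gen M N n p qs" "q \<in> set qs" "e \<in> set (snd q)" shows "e < n"
proof -
  have "e \<in> set (concat (map snd qs))" using assms(2,3) by auto
  then show ?thesis using assms(1) unfolding is_gen_def by (simp only: lessThan_iff)
qed

lemma nested_ok_args:
  assumes rs: "is_gen W L n w rs" and ns: "is_gen M N (length rs) m ns" and j: "j < length ns"
  shows "nested_ok N L (fst (ns ! j)) (map ((!) rs) (snd (ns ! j)))"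
proof -
  have "e < length rs" if "e \<in> set (snd (ns ! j))" for e
    by (rule is_gen_label_less[OF ns nth_mem[OF j] that])
  then have "mem (cpx L (length (snd (rs ! e)))) (fst (rs ! e))" if "e \<in> set (snd (ns ! j))" for e
    using is_gen_mem(2)[OF rs] that by blast
  then show ?thesis using is_gen_mem(2)[OF ns j] by (auto simp: nested_ok_def case_prod_beta)
qed

lemma is_gen_nested:
  assumes rs: "is_gen W L n w rs" and ns: "is_gen M N (length rs) m ns"
  shows "is_gen M (N \<circ>\<^sub>S L) n m (nested_args N L rs ns)"
proof -
  let ?f = "\<lambda>i. snd (rs ! i)"
  have "concat (map snd (nested_args N L rs ns)) = concat (map (\<lambda>q. concat (map ?f (snd q))) ns)"
    by (intro arg_cong[of _ _ concat]) (simp add: nested_arg_def case_prod_beta o_def)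
  also have "\<dots> = concat (map ?f (concat (map snd ns)))"
    by (induction ns) auto
  finally have c: "concat (map snd (nested_args N L rs ns)) = concat (map ?f (concat (map snd ns)))" .
  have "mset (concat (map snd ns)) = mset [0..<length rs]"
    using ns unfolding is_gen_def by (intro set_eq_iff_mset_eq_distinct[THEN iffD1]) (auto simp: atLeast0LessThan)
  then have "mset (map ?f (concat (map snd ns))) = mset (map ?f [0..<length rs])"
    by (simp only: mset_map)
  also have "map ?f [0..<length rs] = map snd rs" by (rule nth_equalityI) auto
  finally have "mset (concat (map ?f (concat (map snd ns)))) = mset (concat (map snd rs))"
    by (simp only: mset_concat sum_mset_sum_list[symmetric] mset_map)
  then have D: "distinct (concat (map ?f (concat (map snd ns)))) \<and> set (concat (map ?f (concat (map snd ns)))) = {..<n}"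
    using rs mset_eq_imp_distinct_iff mset_eq_setD unfolding is_gen_def by metis
  have V: "mem (cpx (N \<circ>\<^sub>S L) (length B)) v" if "(v, B) \<in> set (nested_args N L rs ns)" for v B
  proof -
    have "(v, B) \<in> (\<lambda>p. nested_arg N L (fst p) (map ((!) rs) (snd p))) ` set ns"
      using that by (simp add: case_prod_beta)
    then obtain p where "p \<in> set ns" "(v, B) = nested_arg N L (fst p) (map ((!) rs) (snd p))"
      by (rule imageE)
    then obtain j where j: "j < length ns" "(v, B) = nested_arg N L (fst (ns ! j)) (map ((!) rs) (snd (ns ! j)))"
      by (metis in_set_conv_nth)
    show ?thesis using mem_nested_arg[OF nested_ok_args[OF rs ns j(1)]] j(2) by (metis fst_conv snd_conv)
  qed
  have "mem (cpx M (length (nested_args N L rs ns))) m" using is_gen_mem(1)[OF ns] by simp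
  moreover have "\<forall>(v, B)\<in>set (nested_args N L rs ns). mem (cpx (N \<circ>\<^sub>S L) (length B)) v" using V by blast
  ultimately show ?thesis unfolding is_gen_def[of M "N \<circ>\<^sub>S L"] c using D by blast
qed

text \<open>Each input \<open>r\<^sub>i\<close> is plugged into exactly one operation \<open>n\<^sub>j\<close>, at one place \<open>t\<close>.\<close>

lemma nested_args_update_input:
  assumes ns: "is_gen M N (length rs) m ns" and i: "i < length rs"
  obtains j t where "j < length ns" "t < length (snd (ns ! j))" "snd (ns ! j) ! t = i"
    "\<forall>r. nested_args N L (rs[i := r]) ns =
      (nested_args N L rs ns)[j := nested_arg N L (fst (ns ! j)) ((map ((!) rs) (snd (ns ! j)))[t := r])]"
proof -
  have d: "distinct (concat (map snd ns))" and s: "set (concat (map snd ns)) = {..<length rs}"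
    using ns by (auto simp: is_gen_def)
  have "i \<in> set (concat (map snd ns))" using s i by simp
  then obtain q where "q \<in> set ns" "i \<in> set (snd q)" by auto
  then obtain j where j: "j < length ns" "i \<in> set (snd (ns ! j))" by (metis in_set_conv_nth)
  then obtain t where t: "t < length (snd (ns ! j))" "snd (ns ! j) ! t = i" by (auto simp: in_set_conv_nth)
  have lt: "e < length rs" if "e \<in> set (snd (ns ! l))" "l < length ns" for e l
    using s that by (auto simp: set_conv_nth[of ns])
  have dE: "distinct (snd (ns ! j))" using d j by (auto simp: distinct_concat_iff)
  have other: "i \<notin> set (snd (ns ! l))" if "l < length ns" "l \<noteq> j" for l
    using disjoint_nth_distinct_concat[OF d s, of l j] that j by auto
  have "nested_args N L (rs[i := r]) ns =
      (nested_args N L rs ns)[j := nested_arg N L (fst (ns ! j)) ((map ((!) rs) (snd (ns ! j)))[t := r])]" for r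
  proof (rule nth_equalityI)
    fix l assume "l < length (nested_args N L (rs[i := r]) ns)"
    then have l: "l < length ns" by simp
    have "map ((!) (rs[i := r])) (snd (ns ! l)) =
      (if l = j then (map ((!) rs) (snd (ns ! j)))[t := r] else map ((!) rs) (snd (ns ! l)))"
    proof (cases "l = j")
      case True
      then show ?thesis using t dE lt[OF _ j(1)] i
        by (auto intro!: nth_equalityI simp: nth_list_update nth_eq_iff_index_eq)
    next
      case False
      have "rs[i := r] ! x = rs ! x" if "x \<in> set (snd (ns ! l))" for x
        by (rule nth_list_update_neq) (use other[OF l False] that in auto)
      then show ?thesis using False by simp
    qed
    then show "nested_args N L (rs[i := r]) ns ! l =
        (nested_args N L rs ns)[j := nested_arg N L (fst (ns ! j)) ((map ((!) rs) (snd (ns ! j)))[t := r])] ! l"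
      using l by (simp add: case_prod_beta nth_list_update)
  qed simp
  then show ?thesis using that j(1) t by blast
qed

context
  fixes M :: "('x, 'k::field) smod" and N :: "('y, 'k) smod" and L :: "('z, 'k) smod"
    and n :: nat and z :: "('x, ('y, 'z, 'k) form, 'k) form"
  assumes N: "smodule N" and L: "smodule L" and z: "is_form M (N \<circ>\<^sub>S L) n z"
begin

text \<open>
  The pull-back of the form \<open>z\<close> along the associativity map, as a function of the generator
  \<open>(m; ns)\<close> of \<open>M \<circ> N\<close> for fixed \<open>rs\<close>.
\<close>

private definition "H rs m ns = assoc_sign ns rs * z m (nested_args N L rs ns)"

private lemma is_form_H:
  assumes rs: "is_gen W L n w rs"
  shows "is_form M N (length rs) (H rs)"
proof (rule is_formI, goal_cases)
  case (1 k x y ns)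
  then show ?case using form_add_head[OF z is_gen_nested[OF rs 1(1)]] by (simp add: H_def distrib_left)
next
  case (2 k x a ns)
  then show ?case using form_scl_head[OF z is_gen_nested[OF rs 2]] by (simp add: H_def)
next
  case (3 m ns i k x y E)
  let ?ls = "map ((!) rs) E"
  have ok: "nested_ok N L (k, x) ?ls" using nested_ok_args[OF rs 3(1,2)] 3(3) by simp
  have u: "nested_args N L rs (ns[i := ((k, v), E)]) = (nested_args N L rs ns)[i := nested_arg N L (k, v) ?ls]" for v
    by (simp add: map_update)
  have same: "(nested_args N L rs ns)[i := nested_arg N L (k, x) ?ls] = nested_args N L rs ns"
    using 3(2,3) by (simp add: list_update_same_conv)
  have s: "assoc_sign (ns[i := ((k, v), E)]) rs = (assoc_sign ns rs :: 'k)" for v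
    by (rule assoc_sign_update_op[OF 3(2,3)])
  show ?case unfolding H_def u s
    using form_nested_add_op[OF z, of i "nested_args N L rs ns" k x ?ls y] 3 ok is_gen_nested[OF rs 3(1)]
    by (simp add: same distrib_left)
next
  case (4 m ns i k x a E)
  let ?ls = "map ((!) rs) E"
  have ok: "nested_ok N L (k, x) ?ls" using nested_ok_args[OF rs 4(1,2)] 4(3) by simp
  have u: "nested_args N L rs (ns[i := ((k, v), E)]) = (nested_args N L rs ns)[i := nested_arg N L (k, v) ?ls]" for v
    by (simp add: map_update)
  have same: "(nested_args N L rs ns)[i := nested_arg N L (k, x) ?ls] = nested_args N L rs ns"
    using 4(2,3) by (simp add: list_update_same_conv)
  have s: "assoc_sign (ns[i := ((k, v), E)]) rs = (assoc_sign ns rs :: 'k)" for v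
    by (rule assoc_sign_update_op[OF 4(2,3)])
  show ?case unfolding H_def u s
    using form_nested_scl_op[OF z, of i "nested_args N L rs ns" k x ?ls m a] 4 ok is_gen_nested[OF rs 4(1)]
    by (simp add: same mult.left_commute)
next
  case (5 m ns \<tau>)
  let ?E = "map snd ns" let ?K = "koszul_sign (degs (nested_args N L rs ns)) (map \<tau> [0..<length ns]) :: 'k"
  have d: "distinct (concat ?E)" "set (concat ?E) = {..<length rs}" using 5(1) by (auto simp: is_gen_def)
  have lt: "e < length rs" if "e \<in> set (snd (ns ! j))" "j < length ns" for e j
    using d(2) that by (auto simp: set_conv_nth[of ns])
  have "map (\<lambda>j. degs ns ! j + sum_list (map ((!) (degs rs)) (?E ! j))) [0..<length (degs ns)] = degs (nested_args N L rs ns)"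
    by (rule nth_equalityI) (auto simp: nested_arg_def case_prod_beta o_def lt intro!: arg_cong[of _ _ sum_list])
  then have "assoc_sign (permute_list \<tau> ns) rs =
      koszul_sign (degs ns) (map \<tau> [0..<length ns]) * ?K * (assoc_sign ns rs :: 'k)"
    using koszul_sign_assoc_permute_outer[OF d, of "degs ns" "degs rs" \<tau>, where 'k = 'k] 5(2)
    by (simp add: assoc_sign_def permute_list_map)
  moreover have "z (happ 0 (act M (length ns) \<tau>) m) (nested_args N L rs (permute_list \<tau> ns)) =
      ?K * z m (nested_args N L rs ns)"
    using form_permute[OF z is_gen_nested[OF rs 5(1)], of \<tau>] 5(2) by (simp add: permute_list_map)
  moreover have "c * ?K * a * (?K * b) = c * (a * b)" for a b c
  proof -
    have "c * ?K * a * (?K * b) = ?K * ?K * (c * (a * b))" by (simp only: ac_simps)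
    then show ?thesis by simp
  qed
  ultimately show ?case unfolding H_def by (simp only:)
next
  case (6 m ns i q E \<sigma>)
  let ?ls = "map ((!) rs) E" let ?q = "happ 0 (act N (length E) \<sigma>) q"
  let ?K = "koszul_sign (degs ?ls) (map \<sigma> [0..<length E]) :: 'k"
  have ok: "nested_ok N L q ?ls" using nested_ok_args[OF rs 6(1,2)] 6(3) by simp
  have d: "distinct (concat (map snd ns))" "set (concat (map snd ns)) = {..<length rs}"
    using 6(1) by (auto simp: is_gen_def)
  have "e < length rs" if "e \<in> set E" for e
    by (rule is_gen_label_less[OF 6(1) nth_mem[OF 6(2)]]) (simp add: 6(3) that)
  then have de: "map ((!) (degs rs)) E = degs ?ls" by simp
  have u: "nested_args N L rs (ns[i := (?q, permute_list \<sigma> E)]) =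
      (nested_args N L rs ns)[i := nested_arg N L ?q (permute_list \<sigma> ?ls)]"
    using 6(4) by (simp add: map_update permute_list_map)
  have same: "(nested_args N L rs ns)[i := nested_arg N L q ?ls] = nested_args N L rs ns"
    using 6(2,3) by (simp add: list_update_same_conv)
  have "degs (ns[i := (?q, permute_list \<sigma> E)]) = degs ns"
    by (rule degs_update_same[OF 6(2)]) (simp add: 6(3))
  then have "assoc_sign (ns[i := (?q, permute_list \<sigma> E)]) rs = ?K * (assoc_sign ns rs :: 'k)"
    using koszul_sign_assoc_permute_block[OF d, of i \<sigma> "degs ns" "degs rs", where 'k = 'k] 6(2-4) de
    by (simp add: assoc_sign_def map_update)
  moreover have "z m ((nested_args N L rs ns)[i := nested_arg N L ?q (permute_list \<sigma> ?ls)]) =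
      ?K * z m (nested_args N L rs ns)"
    using form_nested_permute[OF z, of i "nested_args N L rs ns" q ?ls \<sigma> m] 6 ok N is_gen_nested[OF rs 6(1)]
    by (simp add: same)
  moreover have "?K * a * (?K * b) = a * b" for a b
  proof -
    have "?K * a * (?K * b) = ?K * ?K * (a * b)" by (simp only: ac_simps)
    then show ?thesis by simp
  qed
  ultimately show ?case unfolding H_def u by (simp only:)
qed

lemma is_form_assoc_inner:
  "is_gen W L n w rs \<Longrightarrow> is_form M N (length rs) (\<lambda>m ns. assoc_sign ns rs * z m (nested_args N L rs ns))"
  using is_form_H unfolding H_def .

text \<open>
  The associativity map is well defined: the pull-back of \<open>z\<close> is a form in the outer variables.  An
  element \<open>w\<close> of \<open>M \<circ> N\<close> is a functional on forms, so by \<open>cspace_eval_lin\<close> each identity only needs to be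
  verified on the generators of \<open>M \<circ> N\<close>.
\<close>

lemma is_form_assoc:
  "is_form (M \<circ>\<^sub>S N) L n (\<lambda>w rs. snd w (\<lambda>m ns. assoc_sign ns rs * z m (nested_args N L rs ns)))"
  unfolding H_def[symmetric]
proof (rule is_formI, goal_cases)
  case (1 k x y rs)
  then show ?case by simp
next
  case (2 k x a rs)
  then show ?case by (simp add: scl_apply)
next
  case (3 w rs i k x y B)
  let ?r = "\<lambda>v. rs[i := ((k, v), B)]"
  have w: "snd w \<in> cspace M N (length rs) (fst w)"
    using is_gen_mem(1)[OF 3(1)] by (simp add: mem_def cpx_composite)
  have x: "x \<in> grd (cpx L (length B)) k" using is_gen_mem(2)[OF 3(1,2)] 3(3) by simp
  have g: "is_gen (M \<circ>\<^sub>S N) L n w (?r v)" if "v \<in> grd (cpx L (length B)) k" for v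
    using is_gen_update[OF 3(1-3), of "(k, v)" B] that by simp
  have s: "assoc_sign ns (?r v) = (assoc_sign ns rs :: 'k)" for ns :: "(('y, 'k) hvec \<times> nat list) list" and v
    by (rule assoc_sign_update_input[OF 3(2)]) (simp add: 3(3))
  have xy: "x + y \<in> grd (cpx L (length B)) k"
    using fv.subspace_add[OF chain_complex_subspace[OF smodule_chain_complex[OF L]] x 3(4)] .
  have "snd w (H (?r (x + y))) = 1 * snd w (H rs) + 1 * snd w (H (?r y))"
  proof (rule cspace_eval_lin[OF w])
    show "is_form M N (length rs) (H (?r (x + y)))" using is_form_H[OF g[OF xy]] by simp
    show "is_form M N (length rs) (H rs)" using is_form_H[OF 3(1)] .
    show "is_form M N (length rs) (H (?r y))" using is_form_H[OF g[OF 3(4)]] by simp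
    fix m ns assume ns: "is_gen M N (length rs) m ns"
    obtain j t where j: "j < length ns" and t: "t < length (snd (ns ! j))" "snd (ns ! j) ! t = i"
      and u0: "\<forall>r. nested_args N L (rs[i := r]) ns =
      (nested_args N L rs ns)[j := nested_arg N L (fst (ns ! j)) ((map ((!) rs) (snd (ns ! j)))[t := r])]"
      by (rule nested_args_update_input[where L = L, OF ns 3(2)])
    note u = u0[rule_format]
    have same: "(nested_args N L rs ns)[j := nested_arg N L (fst (ns ! j)) (map ((!) rs) (snd (ns ! j)))] = nested_args N L rs ns"
      using j by (simp add: list_update_same_conv case_prod_beta)
    show "H (?r (x + y)) m ns = 1 * H rs m ns + 1 * H (?r y) m ns"
      unfolding H_def s u
      using form_nested_add_input[OF z, of j "nested_args N L rs ns" "fst (ns ! j)" "map ((!) rs) (snd (ns ! j))" t k x B y m]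
        nested_ok_args[OF 3(1) ns j] j t 3(3,4) is_gen_nested[OF 3(1) ns]
      by (simp add: same distrib_left)
  qed
  then show ?case by simp
next
  case (4 w rs i k x a B)
  let ?r = "\<lambda>v. rs[i := ((k, v), B)]"
  have w: "snd w \<in> cspace M N (length rs) (fst w)"
    using is_gen_mem(1)[OF 4(1)] by (simp add: mem_def cpx_composite)
  have x: "x \<in> grd (cpx L (length B)) k" using is_gen_mem(2)[OF 4(1,2)] 4(3) by simp
  have g: "is_gen (M \<circ>\<^sub>S N) L n w (?r (scl a x))"
    using is_gen_update[OF 4(1-3), of "(k, scl a x)" B]
      fv.subspace_scale[OF chain_complex_subspace[OF smodule_chain_complex[OF L]] x] by simp
  have s: "assoc_sign ns (?r v) = (assoc_sign ns rs :: 'k)" for ns :: "(('y, 'k) hvec \<times> nat list) list" and v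
    by (rule assoc_sign_update_input[OF 4(2)]) (simp add: 4(3))
  have "snd w (H (?r (scl a x))) = a * snd w (H rs) + 0 * snd w (H rs)"
  proof (rule cspace_eval_lin[OF w])
    show "is_form M N (length rs) (H (?r (scl a x)))" using is_form_H[OF g] by simp
    show "is_form M N (length rs) (H rs)" using is_form_H[OF 4(1)] .
    then show "is_form M N (length rs) (H rs)" .
    fix m ns assume ns: "is_gen M N (length rs) m ns"
    obtain j t where j: "j < length ns" and t: "t < length (snd (ns ! j))" "snd (ns ! j) ! t = i"
      and u0: "\<forall>r. nested_args N L (rs[i := r]) ns =
      (nested_args N L rs ns)[j := nested_arg N L (fst (ns ! j)) ((map ((!) rs) (snd (ns ! j)))[t := r])]"
      by (rule nested_args_update_input[where L = L, OF ns 4(2)])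
    note u = u0[rule_format]
    have same: "(nested_args N L rs ns)[j := nested_arg N L (fst (ns ! j)) (map ((!) rs) (snd (ns ! j)))] = nested_args N L rs ns"
      using j by (simp add: list_update_same_conv case_prod_beta)
    show "H (?r (scl a x)) m ns = a * H rs m ns + 0 * H rs m ns"
      unfolding H_def s u
      using form_nested_scl_input[OF z, of j "nested_args N L rs ns" "fst (ns ! j)" "map ((!) rs) (snd (ns ! j))" t k x B m a]
        nested_ok_args[OF 4(1) ns j] j t 4(3) is_gen_nested[OF 4(1) ns]
      by (simp add: same mult.left_commute)
  qed
  then show ?case by simp
next
  case (5 w rs \<sigma>)
  let ?K = "koszul_sign (degs rs) (map \<sigma> [0..<length rs]) :: 'k" let ?rs = "permute_list \<sigma> rs"
  let ?rel = "\<lambda>ns :: (('y, 'k) hvec \<times> nat list) list. map (\<lambda>(q, E). (q, map (inv \<sigma>) E)) ns"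
  have w: "snd w \<in> cspace M N (length rs) (fst w)"
    using is_gen_mem(1)[OF 5(1)] by (simp add: mem_def cpx_composite)
  have mb: "mset (concat (map snd ?rs)) = mset (concat (map snd rs))"
    using concat_permute_mset[OF 5(2)] .
  \<comment> \<open>The form property of \<open>H\<close> needs some generator with arguments \<open>?rs\<close>; the zero element of the zero module always provides one.\<close>
  have "is_gen zmod L n (0, 0) ?rs" if "zmod = ar0 zero_cplx" for zmod :: "('x, 'k) smod"
  proof -
    have "distinct (concat (map snd ?rs))" "set (concat (map snd ?rs)) = {..<n}"
      using mset_eq_imp_distinct_iff[OF mb] mset_eq_setD[OF mb] 5(1) by (auto simp: is_gen_def)
    then show ?thesis using 5 that by (auto simp: is_gen_def mem_def ar0_def zero_cplx_def)
  qed
  then have F: "is_form M N (length rs) (H ?rs)" using is_form_H[of "ar0 zero_cplx" "(0, 0)" ?rs] by auto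
  then have F': "is_form M N (length rs) (\<lambda>m ns. H ?rs m (?rel ns))"
    using is_form_relabel[OF _ permutes_inv[OF 5(2)]] by blast
  have "snd (happ 0 (act (M \<circ>\<^sub>S N) (length rs) \<sigma>) w) (H ?rs) = snd w (\<lambda>m ns. gen M N (length rs) m (?rel ns) (H ?rs))"
    using w by (simp add: act_composite comp_act_def ext_def)
  also have "\<dots> = snd w (\<lambda>m ns. H ?rs m (?rel ns))"
    by (simp add: gen_form[OF F])
  also have "\<dots> = ?K * snd w (H rs) + 0 * snd w (H rs)"
  proof (rule cspace_eval_lin[OF w F' is_form_H[OF 5(1)] is_form_H[OF 5(1)]])
    fix m ns assume ns: "is_gen M N (length rs) m ns"
    have d: "distinct (concat (map snd ns))" "set (concat (map snd ns)) = {..<length rs}"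
      using ns by (auto simp: is_gen_def)
    have "nested_args N L ?rs (?rel ns) = nested_args N L rs ns"
    proof -
      have "?rs ! inv \<sigma> e = rs ! e" if "e \<in> set E" "(q, E) \<in> set ns" for e q E
      proof -
        have "e < length rs" using d(2) that by force
        then show ?thesis
          using permute_list_nth[OF 5(2)] permutes_nat_less[OF permutes_inv[OF 5(2)]] permutes_inverses(1)[OF 5(2)]
          by simp
      qed
      then show ?thesis by (auto intro!: arg_cong[of _ _ "nested_arg N L _"])
    qed
    moreover have "assoc_sign (?rel ns) ?rs = ?K * (assoc_sign ns rs :: 'k)"
      using koszul_sign_assoc_permute_inner[OF d 5(2), of "degs ns" "degs rs", where 'k = 'k] 5(2)
      by (simp add: assoc_sign_def permute_list_map case_prod_beta o_def)
    ultimately have "H ?rs m (?rel ns) = ?K * assoc_sign ns rs * z m (nested_args N L rs ns)"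
      unfolding H_def by (simp only:)
    then show "H ?rs m (?rel ns) = ?K * H rs m ns + 0 * H rs m ns" by (simp add: H_def)
  qed
  finally show ?case by simp
next
  case (6 w rs i r B \<tau>)
  let ?r = "(happ 0 (act L (length B) \<tau>) r, permute_list \<tau> B)"
  have w: "snd w \<in> cspace M N (length rs) (fst w)"
    using is_gen_mem(1)[OF 6(1)] by (simp add: mem_def cpx_composite)
  have g: "is_gen (M \<circ>\<^sub>S N) L n w (rs[i := ?r])" by (rule is_gen_act[OF 6(1) L 6(2-4)])
  have s: "assoc_sign ns (rs[i := ?r]) = (assoc_sign ns rs :: 'k)" for ns :: "(('y, 'k) hvec \<times> nat list) list"
    by (rule assoc_sign_update_input[OF 6(2)]) (simp add: 6(3))
  have "snd w (H (rs[i := ?r])) = 1 * snd w (H rs) + 0 * snd w (H rs)"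
  proof (rule cspace_eval_lin[OF w])
    show "is_form M N (length rs) (H (rs[i := ?r]))" using is_form_H[OF g] by simp
    show "is_form M N (length rs) (H rs)" using is_form_H[OF 6(1)] .
    then show "is_form M N (length rs) (H rs)" .
    fix m ns assume ns: "is_gen M N (length rs) m ns"
    obtain j t where j: "j < length ns" and t: "t < length (snd (ns ! j))" "snd (ns ! j) ! t = i"
      and u0: "\<forall>r. nested_args N L (rs[i := r]) ns =
      (nested_args N L rs ns)[j := nested_arg N L (fst (ns ! j)) ((map ((!) rs) (snd (ns ! j)))[t := r])]"
      by (rule nested_args_update_input[where L = L, OF ns 6(2)])
    note u = u0[rule_format]
    have same: "(nested_args N L rs ns)[j := nested_arg N L (fst (ns ! j)) (map ((!) rs) (snd (ns ! j)))] = nested_args N L rs ns"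
      using j by (simp add: list_update_same_conv case_prod_beta)
    show "H (rs[i := ?r]) m ns = 1 * H rs m ns + 0 * H rs m ns"
      unfolding H_def s u
      using form_nested_act_input[OF z, of j "nested_args N L rs ns" "fst (ns ! j)" "map ((!) rs) (snd (ns ! j))" t r B \<tau> m]
        nested_ok_args[OF 6(1) ns j] j t 6(3,4) is_gen_nested[OF 6(1) ns] L
      by (simp add: same)
  qed
  then show ?case by simp
qed

end

lemma is_form_assoc_gen:
  assumes N: "smodule N" and L: "smodule L"
  shows "is_form (M \<circ>\<^sub>S N) L n (\<lambda>w rs. snd w (\<lambda>m ns. assoc_sign ns rs * gen M (N \<circ>\<^sub>S L) n m (nested_args N L rs ns) z))"
proof (cases "is_form M (N \<circ>\<^sub>S L) n z")
  case True
  then show ?thesis using is_form_assoc[OF N L True] by (simp add: gen_form)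
next
  case False
  then show ?thesis using is_form_assoc[OF N L is_form_0, of M n] by (simp add: gen_def)
qed

lemma assoc_gen:
  assumes N: "smodule N" and L: "smodule L"
    and ns: "is_gen M N (length rs) m ns" and w: "fst m + sum_list (degs ns) = d"
    and rs: "is_gen (M \<circ>\<^sub>S N) L n (d, gen M N (length rs) m ns) rs" and k: "d + sum_list (degs rs) = k"
  shows "assoc M N L n k (gen (M \<circ>\<^sub>S N) L n (d, gen M N (length rs) m ns) rs) =
    scl (assoc_sign ns rs) (gen M (N \<circ>\<^sub>S L) n m (nested_args N L rs ns))"
proof -
  have "assoc M N L n k (gen (M \<circ>\<^sub>S N) L n (d, gen M N (length rs) m ns) rs) =
     (\<lambda>\<phi>. gen M N (length rs) m ns (\<lambda>m ns. assoc_sign ns rs * gen M (N \<circ>\<^sub>S L) n m (nested_args N L rs ns) \<phi>))"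
    unfolding assoc_eq by (subst ext_gen[OF rs _ is_form_assoc_gen[OF N L]]) (use k in simp_all)
  also have "\<dots> = scl (assoc_sign ns rs) (gen M (N \<circ>\<^sub>S L) n m (nested_args N L rs ns))"
  proof
    fix \<phi>
    show "gen M N (length rs) m ns (\<lambda>m ns. assoc_sign ns rs * gen M (N \<circ>\<^sub>S L) n m (nested_args N L rs ns) \<phi>) =
      scl (assoc_sign ns rs) (gen M (N \<circ>\<^sub>S L) n m (nested_args N L rs ns)) \<phi>"
    proof (cases "is_form M (N \<circ>\<^sub>S L) n \<phi>")
      case True
      then show ?thesis using is_form_assoc_inner[OF N L True rs] by (simp add: gen_form scl_apply)
    next
      case False
      then show ?thesis using gen_form[OF is_form_0] by (simp add: gen_def[of M "N \<circ>\<^sub>S L"] scl_apply)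
    qed
  qed
  finally show ?thesis .
qed

lemma linmap_assoc:
  assumes N: "smodule N" and L: "smodule L"
  shows "linmap (cspace (M \<circ>\<^sub>S N) L n k) (cspace M (N \<circ>\<^sub>S L) n k) (assoc M N L n k)"
  unfolding assoc_eq
proof (rule linmap_ext[OF subspace_cspace is_form_assoc_gen[OF N L]])
  fix w rs assume rs: "is_gen (M \<circ>\<^sub>S N) L n w rs" and k: "fst w + sum_list (degs rs) = k"
  let ?T = "\<lambda>v \<phi>. v (\<lambda>m ns. assoc_sign ns rs * gen M (N \<circ>\<^sub>S L) n m (nested_args N L rs ns) \<phi>)"
  have "snd w \<in> cspace M N (length rs) (fst w)"
    using is_gen_mem(1)[OF rs] by (simp add: mem_def cpx_composite)
  then show "?T (snd w) \<in> cspace M (N \<circ>\<^sub>S L) n k"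
  proof (induction rule: cspace_induct)
    case zero
    have z: "?T 0 = 0" by (simp add: fun_eq_iff)
    show ?case unfolding z by (rule fv.subspace_0[OF subspace_cspace])
  next
    case (add u v)
    have z: "?T (u + v) = ?T u + ?T v" by (simp add: fun_eq_iff)
    show ?case unfolding z by (rule fv.subspace_add[OF subspace_cspace add(3,4)])
  next
    case (scl a u)
    have z: "?T (scl a u) = scl a (?T u)" by (simp add: fun_eq_iff scl_apply)
    show ?case unfolding z by (rule fv.subspace_scale[OF subspace_cspace scl(2)])
  next
    case (gen m ns)
    have gr: "is_gen (M \<circ>\<^sub>S N) L n (fst w, gen M N (length rs) m ns) rs"
      by (rule is_gen_head[OF rs]) (use gen_in[OF gen] in \<open>simp add: cpx_composite\<close>)
    have "?T (gen M N (length rs) m ns) = assoc M N L n k (gen (M \<circ>\<^sub>S N) L n (fst w, gen M N (length rs) m ns) rs)"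
      unfolding assoc_eq by (subst ext_gen[OF gr _ is_form_assoc_gen[OF N L]]) (use k in simp_all)
    also have "\<dots> = scl (assoc_sign ns rs) (gen M (N \<circ>\<^sub>S L) n m (nested_args N L rs ns))"
      by (rule assoc_gen[OF N L gen(1,2) gr k])
    also have "\<dots> \<in> cspace M (N \<circ>\<^sub>S L) n k"
    proof (rule fv.subspace_scale[OF subspace_cspace gen_in[OF is_gen_nested[OF rs gen(1)]]])
      have lt: "e < length rs" if "e \<in> set (snd q)" "q \<in> set ns" for e q
        using is_gen_label_less[OF gen(1) that(2,1)] .
      have d: "distinct (concat (map snd ns))" "set (concat (map snd ns)) = {..<length rs}"
        using gen(1) by (auto simp: is_gen_def)
      have "mset (concat (map snd ns)) = mset [0..<length rs]"
        using d by (intro set_eq_iff_mset_eq_distinct[THEN iffD1]) (auto simp: atLeast0LessThan)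
      then have "mset (map (\<lambda>e. fst (fst (rs ! e))) (concat (map snd ns))) = mset (map (\<lambda>e. fst (fst (rs ! e))) [0..<length rs])"
        by (simp only: mset_map)
      also have "map (\<lambda>e. fst (fst (rs ! e))) [0..<length rs] = degs rs" by (rule nth_equalityI) auto
      finally have "sum_list (map (\<lambda>e. fst (fst (rs ! e))) (concat (map snd ns))) = sum_list (degs rs)"
        by (metis sum_mset_sum_list)
      moreover have "sum_list (degs (nested_args N L rs ns)) =
          sum_list (degs ns) + sum_list (map (\<lambda>e. fst (fst (rs ! e))) (concat (map snd ns)))" for ns
        by (induction ns) (auto simp: nested_arg_def o_def)
      ultimately show "fst m + sum_list (degs (nested_args N L rs ns)) = k"
        using gen(2) k by simp
    qed
    finally show ?case .
  qed
qed

text \<open>Forms are constrained on generators only.\<close>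

lemma is_form_cong:
  assumes M: "smodule M" and N: "smodule N" and \<psi>: "is_form M N n \<psi>"
    and eq: "\<And>p qs. is_gen M N n p qs \<Longrightarrow> \<phi> p qs = \<psi> p qs"
  shows "is_form M N n \<phi>"
proof (rule is_formI, goal_cases)
  case (1 k x y qs)
  have x: "x \<in> grd (cpx M (length qs)) k" using is_gen_mem(1)[OF 1(1)] by simp
  have "x + y \<in> grd (cpx M (length qs)) k"
    by (rule fv.subspace_add[OF chain_complex_subspace[OF smodule_chain_complex[OF M]] x 1(2)])
  then show ?case using form_add_head[OF \<psi> 1] eq[OF 1(1)] eq[OF is_gen_head[OF 1(1)]] 1(2) by simp
next
  case (2 k x a qs)
  have "scl a x \<in> grd (cpx M (length qs)) k"
    using fv.subspace_scale[OF chain_complex_subspace[OF smodule_chain_complex[OF M]]] is_gen_mem(1)[OF 2] by simp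
  then show ?case using form_scl_head[OF \<psi> 2] eq[OF 2] eq[OF is_gen_head[OF 2]] by simp
next
  case (3 p qs i k x y B)
  have x: "x \<in> grd (cpx N (length B)) k" using is_gen_mem(2)[OF 3(1,2)] 3(3) by simp
  have xy: "x + y \<in> grd (cpx N (length B)) k"
    by (rule fv.subspace_add[OF chain_complex_subspace[OF smodule_chain_complex[OF N]] x 3(4)])
  have "is_gen M N n p (qs[i := ((k, v), B)])" if "v \<in> grd (cpx N (length B)) k" for v
    using is_gen_update[OF 3(1-3)] that by simp
  then show ?case using form_add_arg[OF \<psi> 3] eq 3(1,4) xy by simp
next
  case (4 p qs i k x a B)
  have x: "x \<in> grd (cpx N (length B)) k" using is_gen_mem(2)[OF 4(1,2)] 4(3) by simp
  have xy: "scl a x \<in> grd (cpx N (length B)) k"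
    by (rule fv.subspace_scale[OF chain_complex_subspace[OF smodule_chain_complex[OF N]] x])
  have "is_gen M N n p (qs[i := ((k, v), B)])" if "v \<in> grd (cpx N (length B)) k" for v
    using is_gen_update[OF 4(1-3)] that by simp
  then show ?case using form_scl_arg[OF \<psi> 4] eq 4(1) xy by simp
next
  case (5 p qs \<sigma>)
  then show ?case using form_permute[OF \<psi> 5] eq[OF 5(1)] eq[OF is_gen_permute[OF 5(1) M 5(2)]] by simp
next
  case (6 p qs i q B \<sigma>)
  then show ?case using form_act[OF \<psi> 6] eq[OF 6(1)] eq[OF is_gen_act[OF 6(1) N 6(2-4)]] by simp
qed

lemma gen_permute:
  "is_gen M N n p qs \<Longrightarrow> \<sigma> permutes {..<length qs} \<Longrightarrow>
    gen M N n (happ 0 (act M (length qs) \<sigma>) p) (permute_list \<sigma> qs) =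
      scl (koszul_sign (degs qs) (map \<sigma> [0..<length qs])) (gen M N n p qs)"
  by (auto simp: gen_def fun_eq_iff scl_apply intro: form_permute)

lemma gen_act:
  "is_gen M N n p qs \<Longrightarrow> i < length qs \<Longrightarrow> qs ! i = (q, B) \<Longrightarrow> \<sigma> permutes {..<length B} \<Longrightarrow>
    gen M N n p (qs[i := (happ 0 (act N (length B) \<sigma>) q, permute_list \<sigma> B)]) = gen M N n p qs"
  by (rule gen_eqI) (rule form_act)

lemma cspace_eqI_nonzero:
  assumes "u \<in> cspace M N n k" "lin_on (cspace M N n k) f" "lin_on (cspace M N n k) g"
    and "\<And>p qs. is_gen M N n p qs \<Longrightarrow> fst p + sum_list (degs qs) = k \<Longrightarrow> snd p \<noteq> 0 \<Longrightarrow>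
      f (gen M N n p qs) = g (gen M N n p qs)"
  shows "f u = g u"
proof (rule cspace_eqI[OF assms(1-3)])
  fix p qs assume g: "is_gen M N n p qs" and k: "fst p + sum_list (degs qs) = k"
  show "f (gen M N n p qs) = g (gen M N n p qs)"
  proof (cases "snd p = 0")
    case True
    show ?thesis unfolding gen_zero_head[OF g True]
      using lin_on_zero[OF assms(2,1)] lin_on_zero[OF assms(3,1)] by (rule trans[OF _ sym])
  qed (rule assms(4)[OF g k])
qed


section \<open>Modules whose graded pieces are lines\<close>

text \<open>
  The one-dimensional subspace of functions supported at \<open>undefined\<close>, the one point that is available in
  every type.
\<close>

definition line :: "'k::field \<Rightarrow> 'x \<Rightarrow> 'k" where
  "line a = (\<lambda>x. if x = undefined then a else 0)"

lemma line_undefined [simp]: "line a undefined = a"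
  by (simp add: line_def)

lemma line_0 [simp]: "line 0 = 0"
  by (simp add: line_def fun_eq_iff)

lemma line_eq_0 [simp]: "line a = 0 \<longleftrightarrow> a = 0"
  by (auto simp: line_def fun_eq_iff)

lemma line_add: "line (a + b) = line a + line b"
  by (simp add: line_def fun_eq_iff)

lemma line_scl: "scl c (line a) = line (c * a)"
  by (simp add: line_def fun_eq_iff scl_apply)

lemma line_inj [simp]: "line a = line b \<longleftrightarrow> a = b"
  by (auto simp: line_def fun_eq_iff)

lemma subspace_range_line: "fv.subspace (range line)"
  unfolding fv.subspace_def by (auto simp: line_add[symmetric] line_scl intro: range_eqI[of _ _ 0])

text \<open>
  The complex with a line in the degrees in \<open>S\<close> and the identity as differential out of the degrees
  in \<open>\<delta>\<close>.
\<close>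

definition line_cplx :: "(int \<Rightarrow> bool) \<Rightarrow> (int \<Rightarrow> bool) \<Rightarrow> ('x, 'k::field) cplx" where
  "line_cplx S \<delta> = \<lparr>grd = (\<lambda>k. if S k then range line else {0}),
     bd = (\<lambda>k x. if \<delta> k \<and> x \<in> range line then x else 0)\<rparr>"

lemma grd_line_cplx: "grd (line_cplx S \<delta>) k = (if S k then range line else {0})"
  by (simp add: line_cplx_def)

lemma line_in_line_cplx [simp]: "line a \<in> grd (line_cplx S \<delta>) k \<longleftrightarrow> S k \<or> a = 0"
  by (simp add: grd_line_cplx)

lemma in_line_cplxE:
  assumes "x \<in> grd (line_cplx S \<delta>) k"
  obtains a where "x = line a" "S k \<or> a = 0"
proof -
  have "x = line (x undefined)" "S k \<or> x = 0"
    using assms by (auto simp: grd_line_cplx split: if_splits)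
  then show ?thesis using that[of "x undefined"] by (metis line_eq_0)
qed

lemma bd_line_cplx: "bd (line_cplx S \<delta>) k (line a) = (if \<delta> k then line a else 0)"
  by (simp add: line_cplx_def)

lemma bd_line_cplx_0 [simp]: "bd (line_cplx S \<delta>) k 0 = 0"
  by (simp add: line_cplx_def)

definition line_differential :: "(int \<Rightarrow> bool) \<Rightarrow> (int \<Rightarrow> bool) \<Rightarrow> bool" where
  "line_differential S \<delta> \<longleftrightarrow> (\<forall>k. \<delta> k \<longrightarrow> S k \<and> S (k - 1) \<and> \<not> \<delta> (k - 1))"

lemma chain_complex_line_cplx:
  assumes "line_differential S \<delta>"
  shows "chain_complex (line_cplx S \<delta> :: ('x, 'k::field) cplx)"
  unfolding chain_complex_def
proof (intro allI conjI ballI)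
  fix k
  show sub: "fv.subspace (grd (line_cplx S \<delta> :: ('x, 'k) cplx) k)"
    by (simp add: grd_line_cplx subspace_range_line)
  show "linmap (grd (line_cplx S \<delta> :: ('x, 'k) cplx) k) (grd (line_cplx S \<delta>) (k - 1)) (bd (line_cplx S \<delta>) k)"
    unfolding linmap_def
  proof (intro conjI allI ballI impI)
    fix x y :: "'x \<Rightarrow> 'k" and a assume x: "x \<in> grd (line_cplx S \<delta>) k"
    obtain b where b: "x = line b" "S k \<or> b = 0" using x by (rule in_line_cplxE)
    show "bd (line_cplx S \<delta>) k x \<in> grd (line_cplx S \<delta>) (k - 1)"
      using assms b unfolding line_differential_def b(1) bd_line_cplx by (auto simp: grd_line_cplx)
    show "bd (line_cplx S \<delta>) k (scl a x) = scl a (bd (line_cplx S \<delta>) k x)"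
      by (auto simp: b(1) bd_line_cplx line_scl)
    assume "y \<in> grd (line_cplx S \<delta>) k"
    then obtain c where c: "y = line c" by (rule in_line_cplxE)
    show "bd (line_cplx S \<delta>) k (x + y) = bd (line_cplx S \<delta>) k x + bd (line_cplx S \<delta>) k y"
      by (simp add: b(1) c bd_line_cplx line_add[symmetric])
  next
    fix x :: "'x \<Rightarrow> 'k" assume "x \<notin> grd (line_cplx S \<delta>) k"
    then show "bd (line_cplx S \<delta>) k x = 0"
      using assms unfolding line_differential_def by (auto simp: line_cplx_def split: if_splits)
  qed
  fix x :: "'x \<Rightarrow> 'k" assume "x \<in> grd (line_cplx S \<delta>) k"
  then obtain b where b: "x = line b" by (rule in_line_cplxE)
  show "bd (line_cplx S \<delta>) (k - 1) (bd (line_cplx S \<delta>) k x) = 0"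
    using assms unfolding line_differential_def b by (cases "\<delta> k") (simp_all add: bd_line_cplx)
qed

definition line_smod :: "(nat \<Rightarrow> int \<Rightarrow> bool) \<Rightarrow> (nat \<Rightarrow> int \<Rightarrow> bool) \<Rightarrow> ('x, 'k::field) smod" where
  "line_smod S \<delta> = \<lparr>cpx = (\<lambda>n. line_cplx (S n) (\<delta> n)), act = (\<lambda>n _. idmap (line_cplx (S n) (\<delta> n)))\<rparr>"

definition trivial_action :: "('x, 'k::field) smod \<Rightarrow> bool" where
  "trivial_action M \<longleftrightarrow> (\<forall>n \<sigma> k. \<forall>x\<in>grd (cpx M n) k. act M n \<sigma> k x = x)"

lemma trivial_actionD: "trivial_action M \<Longrightarrow> x \<in> grd (cpx M n) k \<Longrightarrow> act M n \<sigma> k x = x"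
  by (simp add: trivial_action_def)

lemma linmap_idmap: "fv.subspace (grd V k) \<Longrightarrow> linmap (grd V k) (grd V k) (idmap V k)"
  by (auto simp: linmap_def idmap_def fv.subspace_add fv.subspace_scale)

lemma gmap_idmap: "chain_complex V \<Longrightarrow> gmap 0 V V (idmap V)"
  by (simp add: gmap_def linmap_idmap chain_complex_subspace)

lemma chain_map_idmap: "chain_complex V \<Longrightarrow> chain_map V V (idmap V)"
  using gmap_in[OF chain_complex_bd[of V]] by (force simp: chain_map_def gmap_idmap idmap_def)

lemma smodule_trivial:
  assumes "\<And>n. chain_complex (cpx M n)" "\<And>n \<sigma>. act M n \<sigma> = idmap (cpx M n)"
  shows "smodule M"
  unfolding smodule_def using assms(1) chain_map_idmap[OF assms(1)] by (simp add: assms(2)) (simp add: idmap_def)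

lemma smodule_line_smod:
  "(\<And>n. line_differential (S n) (\<delta> n)) \<Longrightarrow> smodule (line_smod S \<delta>)"
  by (rule smodule_trivial) (simp_all add: line_smod_def chain_complex_line_cplx)

lemma trivial_action_line_smod: "trivial_action (line_smod S \<delta>)"
  by (simp add: trivial_action_def line_smod_def idmap_def)

lemma chain_complex_zero_cplx: "chain_complex zero_cplx"
  by (auto simp: chain_complex_def zero_cplx_def linmap_def fv.subspace_def)

lemma smodule_ar0: "chain_complex V \<Longrightarrow> smodule (ar0 V)"
  by (rule smodule_trivial) (simp_all add: ar0_def chain_complex_zero_cplx)

lemma trivial_action_ar0: "trivial_action (ar0 V)"
  by (simp add: trivial_action_def ar0_def idmap_def)

lemma cpx_ar0_0 [simp]: "cpx (ar0 V) 0 = V"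
  by (simp add: ar0_def)

lemma smap_sid: "smodule M \<Longrightarrow> smap 0 M M (sid M)"
  unfolding smap_def sid_def
  using gmap_idmap[OF smodule_chain_complex] by (auto simp: idmap_def smodule_act_mem)

lemma smap_at0:
  assumes "gmap 0 V W f"
  shows "smap 0 (ar0 V) (ar0 W) (at0 f)"
  unfolding smap_def
proof (intro allI conjI impI ballI)
  fix n
  show "gmap 0 (cpx (ar0 V) n) (cpx (ar0 W) n) (at0 f n)"
    using assms(1) by (simp add: ar0_def at0_def gmap_def linmap_def zero_cplx_def)
  fix \<sigma> k x assume x: "x \<in> grd (cpx (ar0 V) n) k"
  show "at0 f n k (act (ar0 V) n \<sigma> k x) = act (ar0 W) n \<sigma> (k + 0) (at0 f n k x)"
    using x gmap_in[OF assms(1), of x k] by (cases "n = 0") (auto simp: ar0_def at0_def idmap_def zero_cplx_def)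
qed

lemma at0_idmap: "at0 (idmap V) = sid (ar0 V)"
  by (auto simp: at0_def sid_def ar0_def idmap_def zero_cplx_def fun_eq_iff)

lemma map_args_sid:
  assumes "is_gen M N n p qs" shows "map_args (sid N) qs = qs"
  by (rule map_idI) (use assms in \<open>auto simp: is_gen_def sid_def idmap_def happ_def\<close>)

lemma happ_sid: "mem (cpx M n) p \<Longrightarrow> happ 0 (sid M n) p = p"
  by (simp add: happ_def sid_def idmap_def mem_def)

lemma cmap_sid:
  assumes "smodule M" "smodule N" "u \<in> cspace M N n k"
  shows "cmap M N M N 0 (sid M) (sid N) n k u = u"
proof (rule cspace_eqI[OF assms(3) lin_on_cmap lin_on_id])
  fix p qs assume g: "is_gen M N n p qs" "fst p + sum_list (degs qs) = k"
  show "cmap M N M N 0 (sid M) (sid N) n k (gen M N n p qs) = gen M N n p qs"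
    unfolding cmap_gen[OF smap_sid[OF assms(1)] smap_sid[OF assms(2)] g] map_args_sid[OF g(1)]
      happ_sid[OF is_gen_mem(1)[OF g(1)]] ..
qed

lemma permutes_1: "\<sigma> permutes {..<Suc 0} \<Longrightarrow> \<sigma> = id"
  by (metis One_nat_def lessThan_0 lessThan_Suc permutes_sing)

text \<open>The pattern of the counits and unit isomorphisms below: a functional on the arity 1 part, times the single argument.\<close>

lemma is_form_single:
  assumes M: "smodule M" and c: "hlin (cpx M 1) c" and N: "trivial_action N"
  shows "is_form M N n (\<lambda>p qs. if length qs = 1 then c p * snd (fst (hd qs)) z else 0)"
proof (rule is_formI, goal_cases)
  case (1 k x y qs)
  show ?case
  proof (cases "length qs = 1")
    case True
    then show ?thesis using c 1(2) is_gen_mem(1)[OF 1(1)] by (simp add: hlin_def distrib_right)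
  qed simp
next
  case (2 k x a qs)
  show ?case
  proof (cases "length qs = 1")
    case True
    then show ?thesis using c is_gen_mem(1)[OF 2] by (simp add: hlin_def)
  qed simp
next
  case (3 p qs i k x y B)
  then show ?case by (auto simp: length_Suc_conv distrib_left)
next
  case (4 p qs i k x a B)
  then show ?case by (auto simp: length_Suc_conv scl_apply)
next
  case (5 p qs \<sigma>)
  show ?case
  proof (cases "length qs = 1")
    case True
    then have "\<sigma> = id" using 5(2) permutes_1 by simp
    moreover have "act M 1 id (fst p) (snd p) = snd p"
      using M is_gen_mem(1)[OF 5(1)] True by (simp add: smodule_def mem_def)
    ultimately show ?thesis using True by (simp add: happ_def koszul_sign_sorted)
  qed simp
next
  case (6 p qs i q B \<sigma>)
  have "snd q \<in> grd (cpx N (length B)) (fst q)" using is_gen_mem(2)[OF 6(1,2)] 6(3) by (simp add: mem_def)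
  then show ?case using 6 trivial_actionD[OF N] by (auto simp: length_Suc_conv)
qed

section \<open>The unit operad\<close>

definition unit_smod :: "(nat, 'k::field) smod" where
  "unit_smod = line_smod (\<lambda>n k. n = 1 \<and> k = 0) (\<lambda>_ _. False)"

lemma smodule_unit: "smodule unit_smod"
  unfolding unit_smod_def by (rule smodule_line_smod) (simp add: line_differential_def)

lemma trivial_unit: "trivial_action unit_smod"
  by (simp add: unit_smod_def trivial_action_line_smod)

lemma grd_unit: "grd (cpx unit_smod n) k = (if n = 1 \<and> k = 0 then range line else {0})"
  by (simp add: unit_smod_def line_smod_def grd_line_cplx)

lemma bd_unit: "bd (cpx unit_smod n) k x = 0"
  by (simp add: unit_smod_def line_smod_def line_cplx_def)

abbreviation id_op :: "('x, 'k::field) hvec" where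
  "id_op \<equiv> (0, line 1)"

text \<open>The image of \<open>x \<in> N(n)\<close> in \<open>(M \<circ> N)(n)\<close>, for \<open>M\<close> with identity operation.\<close>

abbreviation unit_gen :: "('x, 'k::field) smod \<Rightarrow> ('y, 'k) smod \<Rightarrow> nat \<Rightarrow> ('y, 'k) hvec \<Rightarrow> ('x, 'y, 'k) form \<Rightarrow> 'k" where
  "unit_gen M N n x \<equiv> gen M N n id_op [(x, [0..<n])]"

text \<open>The modules with identity operation \<open>id_op\<close> that spans the degree 0 part of arity 1.\<close>

definition has_id_line :: "('x, 'k::field) smod \<Rightarrow> bool" where
  "has_id_line M \<longleftrightarrow> grd (cpx M 1) 0 = range line"

lemma is_gen_unit: "has_id_line M \<Longrightarrow> mem (cpx N n) x \<Longrightarrow> is_gen M N n id_op [(x, [0..<n])]"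
  by (auto simp: is_gen_def has_id_line_def)

lemma unit_gen_in: "has_id_line M \<Longrightarrow> x \<in> grd (cpx N n) k \<Longrightarrow> unit_gen M N n (k, x) \<in> cspace M N n k"
  by (rule gen_in[OF is_gen_unit]) simp_all

lemma unit_gen_add: "has_id_line M \<Longrightarrow> x \<in> grd (cpx N n) k \<Longrightarrow> y \<in> grd (cpx N n) k \<Longrightarrow>
    unit_gen M N n (k, x + y) = unit_gen M N n (k, x) + unit_gen M N n (k, y)"
  using gen_add_arg[OF is_gen_unit[of M N n "(k, x)"], of 0 k x "[0..<n]" y] by simp

lemma unit_gen_scl: "has_id_line M \<Longrightarrow> x \<in> grd (cpx N n) k \<Longrightarrow>
    unit_gen M N n (k, scl a x) = scl a (unit_gen M N n (k, x))"
  using gen_scl_arg[OF is_gen_unit[of M N n "(k, x)"], of 0 k x "[0..<n]" a] by simp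

lemma unit_gen_0: "has_id_line M \<Longrightarrow> chain_complex (cpx N n) \<Longrightarrow> unit_gen M N n (k, 0) = 0"
  using gen_zero_arg[OF is_gen_unit[of M N n "(k, 0)"], of 0] fv.subspace_0[OF chain_complex_subspace] by force

lemma single_label: "is_gen M N n p [(q, B)] \<Longrightarrow> length B = n \<and> mset B = mset [0..<n]"
proof -
  assume g: "is_gen M N n p [(q, B)]"
  then have B: "distinct B" "set B = {..<n}" by (auto simp: is_gen_def)
  then have "mset B = mset [0..<n]"
    by (intro set_eq_iff_mset_eq_distinct[THEN iffD1]) (auto simp: atLeast0LessThan)
  then show ?thesis using mset_eq_length by fastforce
qed

text \<open>With trivial symmetric group actions the labels of a generator with a single argument can be sorted.\<close>

lemma gen_single:
  assumes M: "has_id_line M" and N: "trivial_action N" and g: "is_gen M N n (0, line a) [((k, x), B)]"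
  shows "gen M N n (0, line a) [((k, x), B)] = unit_gen M N n (k, scl a x)" "x \<in> grd (cpx N n) k"
proof -
  have B: "length B = n" "mset B = mset [0..<n]" using single_label[OF g] by auto
  show x: "x \<in> grd (cpx N n) k" using g B(1) by (auto simp: is_gen_def)
  obtain \<sigma> where \<sigma>: "\<sigma> permutes {..<n}" "permute_list \<sigma> [0..<n] = B"
    using mset_eq_permutation[OF B(2)] by auto
  have g1: "is_gen M N n id_op [((k, x), [0..<n])]" by (rule is_gen_unit[OF M]) (simp add: x)
  have "gen M N n id_op [((k, x), B)] = unit_gen M N n (k, x)"
    using gen_act[OF g1, of 0 "(k, x)" "[0..<n]" \<sigma>] \<sigma> trivial_actionD[OF N x] by (simp add: happ_def)
  moreover have "gen M N n (0, line a) [((k, x), B)] = scl a (gen M N n id_op [((k, x), B)])"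
    using gen_scl_head[of M N n 0 "line 1" "[((k, x), B)]" a] is_gen_head[OF g, of id_op] M
    by (simp add: line_scl has_id_line_def)
  ultimately show "gen M N n (0, line a) [((k, x), B)] = unit_gen M N n (k, scl a x)"
    using unit_gen_scl[OF M x] by simp
qed

lemma has_id_unit: "has_id_line unit_smod"
  by (simp add: has_id_line_def grd_unit)

text \<open>The unit isomorphism \<open>N \<cong> I \<circ> N\<close> is onto.\<close>

lemma cspace_unitE:
  assumes N: "smodule N" "trivial_action N" and u: "u \<in> cspace unit_smod N n k"
  obtains x where "x \<in> grd (cpx N n) k" "u = unit_gen unit_smod N n (k, x)"
proof -
  let ?U = "\<lambda>x. unit_gen unit_smod N n (k, x)"
  note N1 = smodule_chain_complex[OF N(1), of n]
  have "\<exists>x\<in>grd (cpx N n) k. u = ?U x"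
    using u
  proof (induction rule: cspace_induct)
    case zero
    show ?case by (rule bexI, rule unit_gen_0[OF has_id_unit N1, symmetric], rule fv.subspace_0[OF chain_complex_subspace[OF N1]])
  next
    case (add u v)
    then obtain x y where "x \<in> grd (cpx N n) k" "u = ?U x" "y \<in> grd (cpx N n) k" "v = ?U y" by blast
    then show ?case using unit_gen_add[OF has_id_unit] fv.subspace_add[OF chain_complex_subspace[OF N1]] by metis
  next
    case (scl a u)
    then obtain x where "x \<in> grd (cpx N n) k" "u = ?U x" by blast
    then show ?case using unit_gen_scl[OF has_id_unit] fv.subspace_scale[OF chain_complex_subspace[OF N1]] by metis
  next
    case (gen p qs)
    show ?case
    proof (cases "snd p = 0")
      case True
      then show ?thesis unfolding gen_zero_head[OF gen(1) True]
        using unit_gen_0[OF has_id_unit N1] fv.subspace_0[OF chain_complex_subspace[OF N1]] by metis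
    next
      case False
      then have l: "length qs = 1" "fst p = 0" "snd p \<in> range line"
        using is_gen_mem(1)[OF gen(1)] by (auto simp: mem_def grd_unit split: if_splits)
      then obtain a j x B where e: "p = (0, line a)" "qs = [((j, x), B)]"
        by (cases p) (auto simp: length_Suc_conv)
      have j: "j = k" using gen(2) e by simp
      have "gen unit_smod N n p qs = ?U (scl a x)" "x \<in> grd (cpx N n) k"
        using gen_single[OF has_id_unit N(2)] gen(1) unfolding e j by blast+
      then show ?thesis using fv.subspace_scale[OF chain_complex_subspace[OF N1]] by blast
    qed
  qed
  then show ?thesis using that by blast
qed

text \<open>The unit isomorphism \<open>I \<circ> N \<cong> N\<close>.  It is the structure map of both the operad and its algebras.\<close>

definition unit_mul :: "('y, 'k::field) smod \<Rightarrow> nat \<Rightarrow> int \<Rightarrow> ((nat, 'y, 'k) form \<Rightarrow> 'k) \<Rightarrow> 'y \<Rightarrow> 'k" where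
  "unit_mul N n k = ext (cspace unit_smod N n k) (\<lambda>p qs. if length qs = 1
     then scl (snd p undefined) (snd (fst (hd qs))) else 0)"

lemma hlin_undefined: "hlin V (\<lambda>p. snd p undefined)"
  by (simp add: hlin_def scl_apply)

lemma unit_mul_gen:
  assumes N: "trivial_action N" and g: "is_gen unit_smod N n p [(q, B)]" and k: "fst p + fst q = k"
  shows "unit_mul N n k (gen unit_smod N n p [(q, B)]) = scl (snd p undefined) (snd q)"
proof -
  have f: "is_form unit_smod N n (\<lambda>p qs. (if length qs = 1 then scl (snd p undefined) (snd (fst (hd qs))) else 0) z)" for z
    using is_form_single[OF smodule_unit hlin_undefined N, of n z]
    by (auto simp: scl_apply if_distrib[of "\<lambda>f. f z"] cong: if_cong)
  show ?thesis unfolding unit_mul_def using ext_gen[OF g _ f, of k] k by simp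
qed

lemma unit_mul_unit_gen:
  assumes "trivial_action N" "x \<in> grd (cpx N n) k"
  shows "unit_mul N n k (unit_gen unit_smod N n (k, x)) = x"
  using unit_mul_gen[OF assms(1) is_gen_unit[OF has_id_unit, of N n "(k, x)"]] assms(2) by simp

lemma linmap_unit_mul:
  assumes N: "smodule N" "trivial_action N"
  shows "linmap (cspace unit_smod N n k) (grd (cpx N n) k) (unit_mul N n k)"
proof -
  have "unit_mul N n k u \<in> grd (cpx N n) k" if "u \<in> cspace unit_smod N n k" for u
    using cspace_unitE[OF N that] unit_mul_unit_gen[OF N(2)] by metis
  moreover have "lin_on (cspace unit_smod N n k) (unit_mul N n k)"
    unfolding unit_mul_def by (rule lin_on_ext)
  moreover have "unit_mul N n k u = 0" if "u \<notin> cspace unit_smod N n k" for u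
    using that by (simp add: unit_mul_def ext_def)
  ultimately show ?thesis by (simp add: linmap_def lin_on_def)
qed

lemma grd_composite [simp]: "grd (cpx (M \<circ>\<^sub>S N) n) = cspace M N n" "bd (cpx (M \<circ>\<^sub>S N) n) = comp_bd M N n"
  by (simp_all add: composite_def)

lemma gmap_unit_mul: "smodule N \<Longrightarrow> trivial_action N \<Longrightarrow> gmap 0 (cpx (unit_smod \<circ>\<^sub>S N) n) (cpx N n) (unit_mul N n)"
  by (simp add: gmap_def linmap_unit_mul)

lemma comp_act_unit_gen:
  assumes M: "has_id_line M" and N: "trivial_action N" and x: "x \<in> grd (cpx N n) k" and \<sigma>: "\<sigma> permutes {..<n}"
  shows "comp_act M N n \<sigma> k (unit_gen M N n (k, x)) = unit_gen M N n (k, x)"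
proof -
  have g: "is_gen M N n id_op [((k, x), [0..<n])]" by (rule is_gen_unit[OF M]) (simp add: x)
  have "comp_act M N n \<sigma> k (unit_gen M N n (k, x)) = gen M N n id_op [((k, x), map (inv \<sigma>) [0..<n])]"
    using comp_act_gen[OF \<sigma> g, of k] by simp
  also have "\<dots> = unit_gen M N n (k, scl 1 x)"
    by (rule gen_single(1)[OF M N]) (use is_gen_relabel[OF g permutes_inv[OF \<sigma>]] in simp)
  finally show ?thesis by simp
qed

lemma smap_unit_mul:
  assumes N: "smodule N" "trivial_action N"
  shows "smap 0 (unit_smod \<circ>\<^sub>S N) N (unit_mul N)"
  unfolding smap_def
proof (intro allI conjI impI ballI)
  fix n \<sigma> k u assume \<sigma>: "\<sigma> permutes {..<n}" and "u \<in> grd (cpx (unit_smod \<circ>\<^sub>S N) n) k"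
  then obtain x where x: "x \<in> grd (cpx N n) k" "u = unit_gen unit_smod N n (k, x)"
    using cspace_unitE[OF N] by (metis grd_composite(1))
  then show "unit_mul N n k (act (unit_smod \<circ>\<^sub>S N) n \<sigma> k u) = act N n \<sigma> (k + 0) (unit_mul N n k u)"
    by (simp add: act_composite comp_act_unit_gen[OF has_id_unit N(2) x(1) \<sigma>] unit_mul_unit_gen[OF N(2)] trivial_actionD[OF N(2)])
qed (rule gmap_unit_mul[OF N])

lemma comp_bd_unit_gen:
  assumes M: "smodule M" "has_id_line M" "bd (cpx M 1) 0 (line 1) = 0" and N: "smodule N" and x: "x \<in> grd (cpx N n) k"
  shows "comp_bd M N n k (unit_gen M N n (k, x)) = unit_gen M N n (k - 1, bd (cpx N n) k x)"
proof -
  have g: "is_gen M N n id_op [((k, x), [0..<n])]" by (rule is_gen_unit[OF M(2)]) (simp add: x)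
  have "is_gen M N n (happ (- 1) (bd (cpx M 1)) id_op) [((k, x), [0..<n])]"
    using is_gen_bd_head[OF M(1) g] by simp
  then have "gen M N n (happ (- 1) (bd (cpx M 1)) id_op) [((k, x), [0..<n])] = 0"
    by (rule gen_zero_head) (simp only: happ_simps fst_conv snd_conv M(3))
  then show ?thesis
    using comp_bd_gen[OF M(1) N g, of k] by (simp add: happ_def)
qed

lemma chain_map_unit_mul:
  assumes N: "smodule N" "trivial_action N"
  shows "chain_map (cpx (unit_smod \<circ>\<^sub>S N) n) (cpx N n) (unit_mul N n)"
  unfolding chain_map_def
proof (intro conjI allI ballI)
  fix k u assume "u \<in> grd (cpx (unit_smod \<circ>\<^sub>S N) n) k"
  then obtain x where x: "x \<in> grd (cpx N n) k" "u = unit_gen unit_smod N n (k, x)"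
    using cspace_unitE[OF N] by (metis grd_composite(1))
  then show "bd (cpx N n) k (unit_mul N n k u) = unit_mul N n (k - 1) (bd (cpx (unit_smod \<circ>\<^sub>S N) n) k u)"
    using comp_bd_unit_gen[OF smodule_unit has_id_unit bd_unit N(1) x(1)] unit_mul_unit_gen[OF N(2)]
      smodule_bd_mem[OF N(1) x(1)] by simp
qed (rule gmap_unit_mul[OF N])

lemma unit_gen_unit: "x \<in> grd (cpx unit_smod n) k \<Longrightarrow> n \<noteq> 1 \<or> k \<noteq> 0 \<Longrightarrow> unit_gen unit_smod unit_smod n (k, x) = 0"
  using unit_gen_0[OF has_id_unit smodule_chain_complex[OF smodule_unit]] by (auto simp: grd_unit)

text \<open>The single operation already precedes its arguments, so nothing is reordered.\<close>

lemma assoc_sign_single: "assoc_sign [(q, [0..<length rs])] rs = 1"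
proof -
  have "sorted (assoc_word [[0..<length rs]])" by (simp add: assoc_word_def sorted_map)
  then show ?thesis by (simp add: assoc_sign_def koszul_sign_sorted)
qed

lemma assoc_unit_gen:
  assumes M: "has_id_line M" and N: "smodule N" and L: "smodule L"
    and q: "q \<in> grd (cpx N (length rs)) d"
    and rs: "is_gen (M \<circ>\<^sub>S N) L n (d, unit_gen M N (length rs) (d, q)) rs" and k: "d + sum_list (degs rs) = k"
  shows "assoc M N L n k (gen (M \<circ>\<^sub>S N) L n (d, unit_gen M N (length rs) (d, q)) rs) =
    gen M (N \<circ>\<^sub>S L) n id_op [nested_arg N L (d, q) rs]"
  using assoc_gen[OF N L is_gen_unit[OF M, of N _ "(d, q)"] _ rs k] q
  by (simp add: assoc_sign_single map_nth)

text \<open>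
  Both sides evaluate a generator \<open>((a id; id); x)\<close> to \<open>a x\<close>.  With the unit module \<open>L = I\<close> this is the
  associativity of the operad, with \<open>L\<close> a complex it is that of algebras.
\<close>

lemma unit_mul_assoc:
  assumes L: "smodule L" "trivial_action L" and u: "u \<in> cspace (unit_smod \<circ>\<^sub>S unit_smod) L n k"
  shows "unit_mul L n k (cmap (unit_smod \<circ>\<^sub>S unit_smod) L unit_smod L 0 (unit_mul unit_smod) (sid L) n k u) =
    unit_mul L n k (cmap unit_smod (unit_smod \<circ>\<^sub>S L) unit_smod L 0 (sid unit_smod) (unit_mul L) n k
      (assoc unit_smod unit_smod L n k u))"
proof -
  let ?I = "unit_smod :: (nat, 'b) smod"
  note U = smodule_unit trivial_unit
  note s1 = smap_unit_mul[OF U] and s2 = smap_sid[OF L(1)] and s3 = smap_sid[OF smodule_unit] and s4 = smap_unit_mul[OF L]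
  note l1 = linmap_cmap[OF s1 s2] and l2 = linmap_cmap[OF s3 s4] and l3 = linmap_assoc[OF smodule_unit L(1)]
  have lin: "lin_on (cspace ?I L n k) (unit_mul L n k)" unfolding unit_mul_def by (rule lin_on_ext)
  show ?thesis
  proof (rule cspace_eqI_nonzero[OF u])
    show "lin_on (cspace (?I \<circ>\<^sub>S ?I) L n k) (\<lambda>u. unit_mul L n k (cmap (?I \<circ>\<^sub>S ?I) L ?I L 0 (unit_mul ?I) (sid L) n k u))"
      by (rule lin_on_compose[OF lin_on_cmap _ lin]) (use linmap_in[OF l1] in simp)
    show "lin_on (cspace (?I \<circ>\<^sub>S ?I) L n k) (\<lambda>u. unit_mul L n k (cmap ?I (?I \<circ>\<^sub>S L) ?I L 0 (sid ?I) (unit_mul L) n k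
      (assoc ?I ?I L n k u)))"
      by (rule lin_on_compose[OF lin_on_compose[OF linmap_lin_on[OF l3] _ lin_on_cmap] _ lin])
        (rule linmap_in[OF l3], assumption, rule linmap_in[OF l2[unfolded add_0_right]], erule linmap_in[OF l3])
  next
    fix w rs assume g: "is_gen (?I \<circ>\<^sub>S ?I) L n w rs" and d: "fst w + sum_list (degs rs) = k" and nz: "snd w \<noteq> 0"
    obtain q where q: "q \<in> grd (cpx ?I (length rs)) (fst w)" "snd w = unit_gen ?I ?I (length rs) (fst w, q)"
      using cspace_unitE[OF U] is_gen_mem(1)[OF g] by (metis grd_composite(1) mem_def)
    then have l: "length rs = 1" "fst w = 0" using nz unit_gen_unit[OF q(1)] by auto
    obtain a where a: "q = line a" using q(1) l by (auto simp: grd_unit)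
    obtain j x B where rs: "rs = [((j, x), B)]" using l(1) by (auto simp: length_Suc_conv)
    have j: "j = k" using d rs l by simp
    have w: "w = (0, unit_gen ?I ?I 1 (0, line a))" using q(2) l a by (simp add: prod_eq_iff)
    have B: "length B = n" using single_label g rs by blast
    have x: "x \<in> grd (cpx L n) k" using is_gen_mem(2)[OF g, of 0] rs B j by simp
    have aI: "line a \<in> grd (cpx ?I 1) 0" by (simp add: grd_unit)
    have wI: "unit_mul ?I 1 0 (unit_gen ?I ?I 1 (0, line a)) = line a"
      by (rule unit_mul_unit_gen[OF trivial_unit aI])
    have "cmap (?I \<circ>\<^sub>S ?I) L ?I L 0 (unit_mul ?I) (sid L) n k (gen (?I \<circ>\<^sub>S ?I) L n w rs) =
        gen ?I L n (0, line a) [((k, x), B)]"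
      unfolding cmap_gen[OF s1 s2 g d] map_args_sid[OF g] unfolding l w by (simp add: happ_def wI[simplified] rs j)
    moreover have ga: "is_gen ?I L n (0, line a) [((k, x), B)]"
      using is_gen_cmap[OF g s1 s2] unfolding map_args_sid[OF g] unfolding l w
      by (simp add: happ_def wI[simplified] rs j)
    ultimately have lhs: "unit_mul L n k (cmap (?I \<circ>\<^sub>S ?I) L ?I L 0 (unit_mul ?I) (sid L) n k (gen (?I \<circ>\<^sub>S ?I) L n w rs)) = scl a x"
      using unit_mul_gen[OF L(2) ga, of k] by simp
    have as: "assoc ?I ?I L n k (gen (?I \<circ>\<^sub>S ?I) L n w rs) = gen ?I (?I \<circ>\<^sub>S L) n id_op [nested_arg ?I L (0, line a) rs]"
      using assoc_unit_gen[OF has_id_unit smodule_unit L(1), of "line a" rs 0 n k] aI g d l by (simp add: w)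
    have na: "nested_arg ?I L (0, line a) rs = ((k, gen ?I L n (0, line a) [((k, x), [0..<n])]), B)"
      using B by (simp add: nested_arg_def rs j consecutive_def Let_def)
    have g2: "is_gen ?I L n (0, line a) [((k, x), [0..<n])]" using x by (auto simp: is_gen_def grd_unit)
    have m2: "unit_mul L n k (gen ?I L n (0, line a) [((k, x), [0..<n])]) = scl a x"
      using unit_mul_gen[OF L(2) g2, of k] by simp
    have g3: "is_gen ?I (?I \<circ>\<^sub>S L) n id_op [((k, gen ?I L n (0, line a) [((k, x), [0..<n])]), B)]"
      using g gen_in[OF g2] B by (auto simp: is_gen_def rs grd_unit)
    have "cmap ?I (?I \<circ>\<^sub>S L) ?I L 0 (sid ?I) (unit_mul L) n k (gen ?I (?I \<circ>\<^sub>S L) n id_op [nested_arg ?I L (0, line a) rs]) =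
       gen ?I L n id_op [((k, scl a x), B)]"
      unfolding na using cmap_gen[OF s3 s4 g3, of k] happ_sid[of ?I 1 id_op] B m2
      by (simp add: happ_def grd_unit)
    moreover have "is_gen ?I L n id_op [((k, scl a x), B)]"
      using is_gen_cmap[OF g3 s3 s4] happ_sid[of ?I 1 id_op] B m2 by (simp add: happ_def grd_unit)
    ultimately have "unit_mul L n k (cmap ?I (?I \<circ>\<^sub>S L) ?I L 0 (sid ?I) (unit_mul L) n k
        (gen ?I (?I \<circ>\<^sub>S L) n id_op [nested_arg ?I L (0, line a) rs])) = scl a x"
      using unit_mul_gen[OF L(2), of n id_op "(k, scl a x)" B k] by simp
    then show "unit_mul L n k (cmap (?I \<circ>\<^sub>S ?I) L ?I L 0 (unit_mul ?I) (sid L) n k (gen (?I \<circ>\<^sub>S ?I) L n w rs)) =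
      unit_mul L n k (cmap ?I (?I \<circ>\<^sub>S L) ?I L 0 (sid ?I) (unit_mul L) n k (assoc ?I ?I L n k (gen (?I \<circ>\<^sub>S ?I) L n w rs)))"
      unfolding lhs as ..
  qed
qed

definition unit_operad :: "(nat, 'k::field) operad" where
  "unit_operad = \<lparr>opm = unit_smod, opcomp = unit_mul unit_smod, opid = line 1\<rparr>"

lemma is_operad_unit: "is_operad unit_operad"
  unfolding is_operad_def Let_def
proof (intro conjI allI impI ballI; (simp only: unit_operad_def operad.simps)?)
  show "smodule unit_smod" by (rule smodule_unit)
  show "grd (cpx unit_smod 1) 0 = range (\<lambda>a. scl a (line 1))" by (simp add: grd_unit line_scl)
  show "smap 0 (unit_smod \<circ>\<^sub>S unit_smod) unit_smod (unit_mul unit_smod)"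
    by (rule smap_unit_mul[OF smodule_unit trivial_unit])
  show "chain_map (cpx (unit_smod \<circ>\<^sub>S unit_smod) n) (cpx unit_smod n) (unit_mul unit_smod n)" for n
    by (rule chain_map_unit_mul[OF smodule_unit trivial_unit])
  fix n k and x :: "nat \<Rightarrow> 'a" assume x: "x \<in> grd (cpx unit_smod n) k"
  show "unit_mul unit_smod n k (gen unit_smod unit_smod n (0, line 1) [((k, x), [0..<n])]) = x"
    by (rule unit_mul_unit_gen[OF trivial_unit x])
  show "unit_mul unit_smod n k (gen unit_smod unit_smod n (k, x) (map (\<lambda>i. ((0, line 1), [i])) [0..<n])) = x"
  proof (cases "n = 1")
    case True
    have "is_gen unit_smod unit_smod 1 (k, x) [((0, line 1), [0])]"
      using x True by (auto simp: is_gen_def grd_unit)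
    from unit_mul_gen[OF trivial_unit this, of k] show ?thesis
      using x True by (auto simp: line_scl grd_unit split: if_splits)
  next
    case False
    have g: "is_gen unit_smod unit_smod n (k, x) (map (\<lambda>i. ((0, line 1), [i])) [0..<n])"
      using x by (auto simp: is_gen_def grd_unit o_def atLeast0LessThan)
    have "x = 0" using x False by (auto simp: grd_unit)
    then show ?thesis using gen_zero_head[OF g]
        lin_on_zero[OF linmap_lin_on[OF linmap_unit_mul[OF smodule_unit trivial_unit]] fv.subspace_0[OF subspace_cspace]]
      by simp
  qed
next
  fix n k u assume "u \<in> grd (cpx ((unit_smod \<circ>\<^sub>S unit_smod) \<circ>\<^sub>S unit_smod) n) k"
  then show "unit_mul unit_smod n k (cmap (unit_smod \<circ>\<^sub>S unit_smod) unit_smod unit_smod unit_smod 0 (unit_mul unit_smod) (sid unit_smod) n k u) =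
    unit_mul unit_smod n k (cmap unit_smod (unit_smod \<circ>\<^sub>S unit_smod) unit_smod unit_smod 0 (sid unit_smod) (unit_mul unit_smod) n k
      (assoc unit_smod unit_smod unit_smod n k u))"
    using unit_mul_assoc[OF smodule_unit trivial_unit] by simp
qed (simp_all add: grd_unit)

text \<open>An algebra over the unit operad is just a chain complex.\<close>

definition unit_alg :: "('x, 'k::field) cplx \<Rightarrow> (nat, 'x, 'k) alg" where
  "unit_alg V = \<lparr>acpx = V, amul = unit_mul (ar0 V) 0\<rparr>"

lemma at0_unit_mul: "at0 (unit_mul (ar0 V) 0) = unit_mul (ar0 V)"
proof (intro ext)
  fix n k u x
  show "at0 (unit_mul (ar0 V) 0) n k u x = unit_mul (ar0 V) n k u x"
  proof (cases "n = 0")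
    case False
    have "unit_mul (ar0 V) n k u = 0"
      unfolding unit_mul_def ext_def cspace_ar0_pos[OF False] by (cases "u = 0") (simp_all add: zero_fun_def)
    then show ?thesis using False by (simp add: at0_def)
  qed (simp add: at0_def)
qed

lemma is_alg_unit:
  assumes V: "chain_complex V" shows "is_alg unit_operad (unit_alg V)"
  unfolding is_alg_def Let_def
proof (intro conjI allI ballI; (simp only: unit_operad_def operad.simps unit_alg_def alg.simps at0_unit_mul)?)
  note A = smodule_ar0[OF V] trivial_action_ar0[of V]
  show "chain_complex V" by (rule V)
  show "chain_map (schur unit_smod V) V (unit_mul (ar0 V) 0)"
    using chain_map_unit_mul[OF A, of 0] by simp
  show "unit_mul (ar0 V) 0 k (tens unit_smod V (0, line 1) [(k, x)]) = x" if "x \<in> grd V k" for k x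
    using unit_mul_unit_gen[OF A(2), of x 0 k] that by simp
  show "unit_mul (ar0 V) 0 k (schur_l 0 (unit_smod \<circ>\<^sub>S unit_smod) unit_smod V (unit_mul unit_smod) k u) =
    unit_mul (ar0 V) 0 k (cmap unit_smod (unit_smod \<circ>\<^sub>S ar0 V) unit_smod (ar0 V) 0 (sid unit_smod) (unit_mul (ar0 V)) 0 k
      (assoc unit_smod unit_smod (ar0 V) 0 k u))"
    if "u \<in> grd (schur (unit_smod \<circ>\<^sub>S unit_smod) V) k" for k u
    using unit_mul_assoc[OF A] that by simp
qed

section \<open>The acyclic extension of the unit cooperad\<close>

text \<open>
  Arity 2 is spanned by \<open>\<mu> = (1, line 1)\<close> and \<open>h = (2, line 1)\<close> with \<open>d h = \<mu>\<close>: the cone of the identity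
  of a line.
\<close>

definition cone_smod :: "(nat, 'k::field) smod" where
  "cone_smod = line_smod (\<lambda>n k. n = 1 \<and> k = 0 \<or> n = 2 \<and> (k = 1 \<or> k = 2)) (\<lambda>n k. n = 2 \<and> k = 2)"

lemma smodule_cone: "smodule cone_smod"
  unfolding cone_smod_def by (rule smodule_line_smod) (simp add: line_differential_def)

lemma trivial_cone: "trivial_action cone_smod"
  by (simp add: cone_smod_def trivial_action_line_smod)

lemma grd_cone: "grd (cpx cone_smod n) k = (if n = 1 \<and> k = 0 \<or> n = 2 \<and> (k = 1 \<or> k = 2) then range line else {0})"
  by (simp add: cone_smod_def line_smod_def grd_line_cplx)

lemma bd_cone: "bd (cpx cone_smod n) k (line a) = (if n = 2 \<and> k = 2 then line a else 0)"
  by (simp add: cone_smod_def line_smod_def bd_line_cplx)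

lemma has_id_cone: "has_id_line cone_smod"
  by (simp add: has_id_line_def grd_cone)

lemma cone_nonzero:
  assumes "is_gen cone_smod N n p qs" "snd p \<noteq> 0"
  obtains (one) a q B where "p = (0, line a)" "qs = [(q, B)]"
  | (two) j a q1 B1 q2 B2 where "p = (j, line a)" "j = 1 \<or> j = 2" "qs = [(q1, B1), (q2, B2)]"
proof -
  have m: "snd p \<in> grd (cpx cone_smod (length qs)) (fst p)" using is_gen_mem(1)[OF assms(1)] by (simp add: mem_def)
  then obtain a where a: "snd p = line a" using assms(2) by (auto simp: grd_cone split: if_splits)
  have "(length qs = 1 \<and> fst p = 0) \<or> (length qs = 2 \<and> (fst p = 1 \<or> fst p = 2))"
    using m assms(2) by (auto simp: grd_cone split: if_splits)
  then show ?thesis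
  proof (elim disjE conjE)
    assume "length qs = 1" "fst p = 0"
    then show ?thesis using one a by (metis One_nat_def length_0_conv length_Suc_conv prod.collapse)
  next
    assume l: "length qs = 2" and "fst p = 1"
    then show ?thesis using two[of 1 a] a by (auto simp: numeral_2_eq_2 length_Suc_conv prod_eq_iff)
  next
    assume l: "length qs = 2" and "fst p = 2"
    then show ?thesis using two[of 2 a] a by (auto simp: numeral_2_eq_2 length_Suc_conv prod_eq_iff)
  qed
qed

abbreviation id_pair :: "(('x, 'k::field) hvec \<times> nat list) list" where
  "id_pair \<equiv> [(id_op, [0]), (id_op, [1])]"

text \<open>Binary operations are primitive: \<open>x \<mapsto> (id; x) + (x; id, id)\<close>, while \<open>id \<mapsto> (id; id)\<close>.\<close>

definition cone_dec :: "nat \<Rightarrow> int \<Rightarrow> (nat \<Rightarrow> 'k::field) \<Rightarrow> (nat, nat, 'k) form \<Rightarrow> 'k" where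
  "cone_dec n k x = (if x \<in> grd (cpx cone_smod n) k then
     (if n = 1 then unit_gen cone_smod cone_smod 1 (k, x)
      else if n = 2 then unit_gen cone_smod cone_smod 2 (k, x) + gen cone_smod cone_smod 2 (k, x) id_pair
      else 0) else 0)"

definition cone_cooperad :: "(nat, 'k::field) cooperad" where
  "cone_cooperad = \<lparr>com = cone_smod, codec = cone_dec, cocounit = (\<lambda>v. v undefined)\<rparr>"

lemma is_gen_id_pair: "x \<in> grd (cpx cone_smod 2) k \<Longrightarrow> is_gen cone_smod cone_smod 2 (k, x) id_pair"
  by (auto simp: is_gen_def grd_cone numeral_2_eq_2 lessThan_Suc)

lemma linmap_cone_dec: "linmap (grd (cpx cone_smod n) k) (cspace cone_smod cone_smod n k) (cone_dec n k)"
  unfolding linmap_def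
proof (intro conjI ballI allI impI)
  note sp = chain_complex_subspace[OF smodule_chain_complex[OF smodule_cone], of n k]
  fix x :: "nat \<Rightarrow> 'a" assume x: "x \<in> grd (cpx cone_smod n) k"
  show "cone_dec n k x \<in> cspace cone_smod cone_smod n k"
  proof -
    have "gen cone_smod cone_smod 2 (k, x) id_pair \<in> cspace cone_smod cone_smod 2 k" if "n = 2"
      by (rule gen_in[OF is_gen_id_pair]) (use x that in simp_all)
    then show ?thesis using x unit_gen_in[OF has_id_cone, of x cone_smod n k] fv.subspace_0[OF subspace_cspace]
      by (auto simp: cone_dec_def intro: fv.subspace_add[OF subspace_cspace])
  qed
  {
    fix a
    have "scl a x \<in> grd (cpx cone_smod n) k" using fv.subspace_scale[OF sp x] .
    then show "cone_dec n k (scl a x) = scl a (cone_dec n k x)"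
      using x unit_gen_scl[OF has_id_cone, of x cone_smod n k a] gen_scl_head[OF is_gen_id_pair[of x k], of a]
      by (auto simp: cone_dec_def fv.scale_right_distrib)
  }
  fix y :: "nat \<Rightarrow> 'a" assume y: "y \<in> grd (cpx cone_smod n) k"
  have "x + y \<in> grd (cpx cone_smod n) k" using fv.subspace_add[OF sp x y] .
  moreover have "gen cone_smod cone_smod 2 (k, x + y) id_pair =
      gen cone_smod cone_smod 2 (k, x) id_pair + gen cone_smod cone_smod 2 (k, y) id_pair" if "n = 2"
    by (rule gen_add_head[OF is_gen_id_pair]) (use that x y in \<open>simp_all add: numeral_2_eq_2\<close>)
  ultimately show "cone_dec n k (x + y) = cone_dec n k x + cone_dec n k y"
    using x y unit_gen_add[OF has_id_cone x y] by (cases "n = 2"; cases "n = 1") (simp_all add: cone_dec_def)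
qed (simp add: cone_dec_def)

lemma gmap_cone_dec: "gmap 0 (cpx cone_smod n) (cpx (cone_smod \<circ>\<^sub>S cone_smod) n) (cone_dec n)"
  by (simp add: gmap_def linmap_cone_dec)

lemma comp_act_id_pair:
  assumes x: "x \<in> grd (cpx cone_smod 2) k" and \<sigma>: "\<sigma> permutes {..<2}"
  shows "comp_act cone_smod cone_smod 2 \<sigma> k (gen cone_smod cone_smod 2 (k, x) id_pair) = gen cone_smod cone_smod 2 (k, x) id_pair"
proof -
  let ?\<rho> = "inv \<sigma>"
  have \<rho>: "?\<rho> permutes {..<2}" by (rule permutes_inv[OF \<sigma>])
  have lt: "?\<rho> 0 < 2" "?\<rho> 1 < 2" using permutes_nat_less[OF \<rho>] by auto
  have nth: "(id_pair :: ((nat, 'a) hvec \<times> nat list) list) ! i = (id_op, [i])" if "i < 2" for i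
    using that by (auto simp: numeral_2_eq_2 less_Suc_eq)
  have "permute_list ?\<rho> (id_pair :: ((nat, 'a) hvec \<times> nat list) list) = [(id_op, [?\<rho> 0]), (id_op, [?\<rho> 1])]"
    using nth[OF lt(1)] nth[OF lt(2)] by (simp add: permute_list_def upt_rec numeral_2_eq_2)
  moreover have "koszul_sign (degs (id_pair :: ((nat, 'a) hvec \<times> nat list) list)) (map ?\<rho> [0..<2]) = (1 :: 'a)"
  proof (rule koszul_sign_even)
    fix j assume "j \<in> set (map ?\<rho> [0..<2])"
    then have "j < 2" using permutes_nat_less[OF \<rho>] by auto
    then show "even (degs (id_pair :: ((nat, 'a) hvec \<times> nat list) list) ! j)"
      by (auto simp: numeral_2_eq_2 less_Suc_eq)
  qed
  ultimately have "gen cone_smod cone_smod 2 (k, x) [(id_op, [?\<rho> 0]), (id_op, [?\<rho> 1])] = gen cone_smod cone_smod 2 (k, x) id_pair"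
    using gen_permute[OF is_gen_id_pair[OF x], of ?\<rho>] \<rho> trivial_actionD[OF trivial_cone x]
    by (simp add: happ_def numeral_2_eq_2)
  then show ?thesis using comp_act_gen[OF \<sigma> is_gen_id_pair[OF x], of k] by simp
qed

lemma smap_cone_dec: "smap 0 cone_smod (cone_smod \<circ>\<^sub>S cone_smod) cone_dec"
  unfolding smap_def
proof (intro allI conjI impI ballI)
  fix n \<sigma> k and x :: "nat \<Rightarrow> 'a" assume \<sigma>: "\<sigma> permutes {..<n}" and x: "x \<in> grd (cpx cone_smod n) k"
  have z: "comp_act cone_smod cone_smod n \<sigma> k (0 :: (nat, nat, 'a) form \<Rightarrow> 'a) = 0"
    using lin_on_zero[OF lin_on_comp_act fv.subspace_0[OF subspace_cspace]] .
  have "comp_act cone_smod cone_smod n \<sigma> k (cone_dec n k x) = cone_dec n k x"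
  proof (cases "n = 2")
    case True
    have "gen cone_smod cone_smod 2 (k, x) id_pair \<in> cspace cone_smod cone_smod 2 k"
      by (rule gen_in[OF is_gen_id_pair]) (use x True in simp_all)
    then show ?thesis
      using True x \<sigma> lin_on_addD[OF lin_on_comp_act unit_gen_in[OF has_id_cone, of x cone_smod 2 k]]
        comp_act_unit_gen[OF has_id_cone trivial_cone, of x 2 k \<sigma>] comp_act_id_pair[of x k \<sigma>]
      by (simp add: cone_dec_def)
  next
    case False
    then show ?thesis using x \<sigma> comp_act_unit_gen[OF has_id_cone trivial_cone, of x 1 k \<sigma>] z
      by (auto simp: cone_dec_def)
  qed
  then show "cone_dec n k (act cone_smod n \<sigma> k x) = act (cone_smod \<circ>\<^sub>S cone_smod) n \<sigma> (k + 0) (cone_dec n k x)"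
    by (simp add: act_composite trivial_actionD[OF trivial_cone x])
qed (rule gmap_cone_dec)

lemma comp_bd_cycles:
  assumes M: "smodule M" and N: "smodule N" and g: "is_gen M N n p qs" and k: "fst p + sum_list (degs qs) = k"
    and c: "\<And>q B. (q, B) \<in> set qs \<Longrightarrow> bd (cpx N (length B)) (fst q) (snd q) = 0"
  shows "comp_bd M N n k (gen M N n p qs) = gen M N n (happ (- 1) (bd (cpx M (length qs))) p) qs"
proof -
  have "gen M N n p (qs[i := bd_arg N (qs ! i)]) = 0" if i: "i < length qs" for i
  proof -
    have z: "bd (cpx N (length (snd (qs ! i)))) (fst (fst (qs ! i))) (snd (fst (qs ! i))) = 0"
      by (rule c) (use i in simp)
    show ?thesis
      by (rule gen_zero_arg[OF is_gen_bd_arg[OF N g i], of i]) (use i in simp, simp only: nth_list_update_eq i fst_conv happ_simps z)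
  qed
  then show ?thesis using comp_bd_gen[OF M N g k] by simp
qed

lemma chain_map_cone_dec: "chain_map (cpx cone_smod n) (cpx (cone_smod \<circ>\<^sub>S cone_smod) n) (cone_dec n)"
  unfolding chain_map_def
proof (intro conjI allI ballI)
  fix k and x :: "nat \<Rightarrow> 'a" assume x: "x \<in> grd (cpx cone_smod n) k"
  let ?d = "bd (cpx cone_smod n) k x"
  have d: "?d \<in> grd (cpx cone_smod n) (k - 1)" by (rule smodule_bd_mem[OF smodule_cone x])
  have u1: "bd (cpx cone_smod 1) 0 (line 1) = (0 :: nat \<Rightarrow> 'a)" by (simp add: bd_cone)
  have u: "comp_bd cone_smod cone_smod n k (unit_gen cone_smod cone_smod n (k, x)) = unit_gen cone_smod cone_smod n (k - 1, ?d)"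
    by (rule comp_bd_unit_gen[OF smodule_cone has_id_cone u1 smodule_cone x])
  note l = linmap_lin_on[OF linmap_comp_bd[OF smodule_cone smodule_cone]]
  have z: "comp_bd cone_smod cone_smod n k (0 :: (nat, nat, 'a) form \<Rightarrow> 'a) = 0"
    using lin_on_zero[OF l fv.subspace_0[OF subspace_cspace]] .
  show "bd (cpx (cone_smod \<circ>\<^sub>S cone_smod) n) k (cone_dec n k x) = cone_dec n (k - 1) ?d"
  proof (cases "n = 2")
    case True
    have g: "is_gen cone_smod cone_smod 2 (k, x) id_pair" by (rule is_gen_id_pair) (use x True in simp)
    have "comp_bd cone_smod cone_smod 2 k (gen cone_smod cone_smod 2 (k, x) id_pair) =
        gen cone_smod cone_smod 2 (happ (- 1) (bd (cpx cone_smod (length (id_pair :: ((nat, 'a) hvec \<times> nat list) list)))) (k, x)) id_pair"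
      by (rule comp_bd_cycles[OF smodule_cone smodule_cone g]) (auto simp: bd_cone)
    then have "comp_bd cone_smod cone_smod 2 k (gen cone_smod cone_smod 2 (k, x) id_pair) =
        gen cone_smod cone_smod 2 (k - 1, ?d) id_pair"
      by (simp add: happ_def True numeral_2_eq_2)
    moreover have "gen cone_smod cone_smod 2 (k, x) id_pair \<in> cspace cone_smod cone_smod 2 k"
      by (rule gen_in[OF g]) simp
    ultimately show ?thesis
      using True x d u lin_on_addD[OF l unit_gen_in[OF has_id_cone, of x cone_smod 2 k]] by (simp add: cone_dec_def)
  next
    case False
    then show ?thesis using x d u z by (auto simp: cone_dec_def)
  qed
qed (rule gmap_cone_dec)


subsection \<open>Coassociativity\<close>

text \<open>
  The map \<open>C \<circ> L \<rightarrow> (C \<circ> C) \<circ> L \<rightarrow> C \<circ> (C \<circ> L)\<close>, evaluated on generators.  It is computed for general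
  \<open>L\<close>, as it occurs in the coassociativity of \<open>C\<close>, in that of \<open>C\<close>-coalgebras and in the decomposition of the
  cofree coalgebras.
\<close>

lemma cone_decompose_single:
  assumes L: "smodule L" and g: "is_gen cone_smod L n (0, line a) [(q, B)]" and k: "fst q = k"
  shows "assoc cone_smod cone_smod L n k (cmap cone_smod L (cone_smod \<circ>\<^sub>S cone_smod) L 0 cone_dec (sid L) n k
      (gen cone_smod L n (0, line a) [(q, B)])) =
    gen cone_smod (cone_smod \<circ>\<^sub>S L) n id_op [((k, gen cone_smod L n (0, line a) [(q, [0..<n])]), B)]"
proof -
  have a: "line a \<in> grd (cpx cone_smod 1) 0" by (simp add: grd_cone)
  have B: "length B = n" using single_label[OF g] by simp
  note c = smap_cone_dec and s = smap_sid[OF L]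
  have g': "is_gen (cone_smod \<circ>\<^sub>S cone_smod) L n (0, unit_gen cone_smod cone_smod 1 (0, line a)) [(q, B)]"
    using is_gen_cmap[OF g c s] unfolding map_args_sid[OF g] using a by (simp add: happ_def cone_dec_def)
  have "cmap cone_smod L (cone_smod \<circ>\<^sub>S cone_smod) L 0 cone_dec (sid L) n k (gen cone_smod L n (0, line a) [(q, B)]) =
      gen (cone_smod \<circ>\<^sub>S cone_smod) L n (0, unit_gen cone_smod cone_smod 1 (0, line a)) [(q, B)]"
    using cmap_gen[OF c s g, of k] k a unfolding map_args_sid[OF g] by (simp add: happ_def cone_dec_def)
  then show ?thesis
    using assoc_unit_gen[OF has_id_cone smodule_cone L, of "line a" "[(q, B)]" 0 n k] a g' k
    by (simp add: nested_arg_def consecutive_def B)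
qed

lemma assoc_sign_id_pair: "assoc_sign id_pair [r1, r2] = 1"
proof -
  \<comment> \<open>The word \<open>id r\<^sub>1 id r\<^sub>2\<close>: only symbols of degree 0 are moved past others.\<close>
  have "assoc_word [[0], [1]] = [0, 2, 1, 3]" by (simp add: assoc_word_def upt_rec)
  then show ?thesis by (simp add: assoc_sign_def koszul_sign_def lessThan_Suc numeral_eq_Suc)
qed

lemma cone_decompose_pair:
  assumes L: "smodule L" and g: "is_gen cone_smod L n (j, x) [(q1, B1), (q2, B2)]" and k: "j + fst q1 + fst q2 = k"
  shows "assoc cone_smod cone_smod L n k (cmap cone_smod L (cone_smod \<circ>\<^sub>S cone_smod) L 0 cone_dec (sid L) n k
      (gen cone_smod L n (j, x) [(q1, B1), (q2, B2)])) =
    gen cone_smod (cone_smod \<circ>\<^sub>S L) n id_op [nested_arg cone_smod L (j, x) [(q1, B1), (q2, B2)]] +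
    gen cone_smod (cone_smod \<circ>\<^sub>S L) n (j, x)
      [((fst q1, unit_gen cone_smod L (length B1) q1), B1), ((fst q2, unit_gen cone_smod L (length B2) q2), B2)]"
proof -
  let ?rs = "[(q1, B1), (q2, B2)]"
  let ?A = "unit_gen cone_smod cone_smod 2 (j, x)" let ?B = "gen cone_smod cone_smod 2 (j, x) id_pair"
  have x: "x \<in> grd (cpx cone_smod 2) j" using is_gen_mem(1)[OF g] by (simp add: numeral_2_eq_2)
  note c = smap_cone_dec and s = smap_sid[OF L]
  have A: "?A \<in> cspace cone_smod cone_smod 2 j" by (rule unit_gen_in[OF has_id_cone x])
  have B: "?B \<in> cspace cone_smod cone_smod 2 j" by (rule gen_in[OF is_gen_id_pair[OF x]]) simp
  have l2: "length ?rs = 2" by simp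
  have g0: "is_gen (cone_smod \<circ>\<^sub>S cone_smod) L n (j, ?A + ?B) ?rs"
    using is_gen_cmap[OF g c s] unfolding map_args_sid[OF g] l2 using x by (simp add: happ_def cone_dec_def)
  have gA: "is_gen (cone_smod \<circ>\<^sub>S cone_smod) L n (j, ?A) ?rs" by (rule is_gen_head[OF g0]) (use A in \<open>simp add: numeral_2_eq_2\<close>)
  have gB: "is_gen (cone_smod \<circ>\<^sub>S cone_smod) L n (j, ?B) ?rs" by (rule is_gen_head[OF g0]) (use B in \<open>simp add: numeral_2_eq_2\<close>)
  have "cmap cone_smod L (cone_smod \<circ>\<^sub>S cone_smod) L 0 cone_dec (sid L) n k (gen cone_smod L n (j, x) ?rs) =
      gen (cone_smod \<circ>\<^sub>S cone_smod) L n (j, ?A + ?B) ?rs"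
    using cmap_gen[OF c s g, of k] k x unfolding map_args_sid[OF g] l2 by (simp add: happ_def cone_dec_def)
  also have "\<dots> = gen (cone_smod \<circ>\<^sub>S cone_smod) L n (j, ?A) ?rs + gen (cone_smod \<circ>\<^sub>S cone_smod) L n (j, ?B) ?rs"
    by (rule gen_add_head[OF gA]) (use B in \<open>simp add: numeral_2_eq_2\<close>)
  finally have e: "cmap cone_smod L (cone_smod \<circ>\<^sub>S cone_smod) L 0 cone_dec (sid L) n k (gen cone_smod L n (j, x) ?rs) =
    gen (cone_smod \<circ>\<^sub>S cone_smod) L n (j, ?A) ?rs + gen (cone_smod \<circ>\<^sub>S cone_smod) L n (j, ?B) ?rs" .
  have dk: "j + sum_list (degs ?rs) = k" using k by simp
  have a: "assoc cone_smod cone_smod L n k (gen (cone_smod \<circ>\<^sub>S cone_smod) L n (j, ?A) ?rs) =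
      gen cone_smod (cone_smod \<circ>\<^sub>S L) n id_op [nested_arg cone_smod L (j, x) ?rs]"
    using assoc_unit_gen[OF has_id_cone smodule_cone L _ _ dk, of x n] x gA unfolding l2 by simp
  have ib: "is_gen cone_smod cone_smod (length ?rs) (j, x) id_pair" unfolding l2 by (rule is_gen_id_pair[OF x])
  have gB': "is_gen (cone_smod \<circ>\<^sub>S cone_smod) L n (j, gen cone_smod cone_smod (length ?rs) (j, x) id_pair) ?rs"
    unfolding l2 by (rule gB)
  have "assoc cone_smod cone_smod L n k (gen (cone_smod \<circ>\<^sub>S cone_smod) L n (j, ?B) ?rs) =
     gen cone_smod (cone_smod \<circ>\<^sub>S L) n (j, x) (nested_args cone_smod L ?rs id_pair)"
    using assoc_gen[OF smodule_cone L ib _ gB' dk] unfolding assoc_sign_id_pair l2 by simp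
  also have "nested_args cone_smod L ?rs id_pair =
     [((fst q1, unit_gen cone_smod L (length B1) q1), B1), ((fst q2, unit_gen cone_smod L (length B2) q2), B2)]"
    by (simp add: nested_arg_def consecutive_def)
  finally have b: "assoc cone_smod cone_smod L n k (gen (cone_smod \<circ>\<^sub>S cone_smod) L n (j, ?B) ?rs) =
    gen cone_smod (cone_smod \<circ>\<^sub>S L) n (j, x)
     [((fst q1, unit_gen cone_smod L (length B1) q1), B1), ((fst q2, unit_gen cone_smod L (length B2) q2), B2)]" .
  have "gen (cone_smod \<circ>\<^sub>S cone_smod) L n (j, ?A) ?rs \<in> cspace (cone_smod \<circ>\<^sub>S cone_smod) L n k"
    "gen (cone_smod \<circ>\<^sub>S cone_smod) L n (j, ?B) ?rs \<in> cspace (cone_smod \<circ>\<^sub>S cone_smod) L n k"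
    by (rule gen_in[OF gA], use dk in simp, rule gen_in[OF gB], use dk in simp)
  then show ?thesis unfolding e
    using lin_on_addD[OF linmap_lin_on[OF linmap_assoc[OF smodule_cone L]]] a b by metis
qed

lemma cone_decompose_lin:
  assumes L: "smodule L"
  shows "lin_on (cspace cone_smod L n k) (\<lambda>u. assoc cone_smod cone_smod L n k
    (cmap cone_smod L (cone_smod \<circ>\<^sub>S cone_smod) L 0 cone_dec (sid L) n k u))"
  by (rule lin_on_compose[OF lin_on_cmap _ linmap_lin_on[OF linmap_assoc[OF smodule_cone L]]])
    (rule linmap_in[OF linmap_cmap[OF smap_cone_dec smap_sid[OF L], unfolded add_0_right]])

lemma counit_cone: "counit cone_cooperad n c = (if n = 1 \<and> fst c = 0 then snd c undefined else 0)"
  by (simp add: counit_def cone_cooperad_def)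

lemma hlin_counit_cone: "hlin V (counit cone_cooperad n)"
  by (auto simp: hlin_def counit_cone scl_apply)

lemma is_form_counit_left:
  "is_form cone_smod cone_smod n (\<lambda>c qs. (if length qs = 1
     then scl (counit cone_cooperad 1 c) (relabel cone_smod (fst (hd qs)) (snd (hd qs))) else 0) z)"
proof (rule is_form_cong[OF smodule_cone smodule_cone])
  show "is_form cone_smod cone_smod n (\<lambda>c qs. if length qs = 1 then counit cone_cooperad 1 c * snd (fst (hd qs)) z else 0)"
    by (rule is_form_single[OF smodule_cone hlin_counit_cone trivial_cone])
  fix c :: "(nat, 'a) hvec" and qs :: "((nat, 'a) hvec \<times> nat list) list"
  assume g: "is_gen cone_smod cone_smod n c qs"
  show "(if length qs = 1 then scl (counit cone_cooperad 1 c) (relabel cone_smod (fst (hd qs)) (snd (hd qs))) else 0) z =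
      (if length qs = 1 then counit cone_cooperad 1 c * snd (fst (hd qs)) z else 0)"
  proof (cases "length qs = 1")
    case True
    then have "snd (fst (hd qs)) \<in> grd (cpx cone_smod (length (snd (hd qs)))) (fst (fst (hd qs)))"
      using is_gen_mem(2)[OF g, of 0] by (simp add: mem_def hd_conv_nth[of qs] del: length_0_conv flip: length_greater_0_conv)
    then show ?thesis using True by (simp add: relabel_def trivial_actionD[OF trivial_cone] scl_apply)
  qed simp
qed

text \<open>
  The counit is nonzero only on elements of degree 0, so whenever the product is nonzero all Koszul
  signs are 1.
\<close>

lemma is_form_counit_right_trivial:
  "is_form cone_smod cone_smod n (\<lambda>c qs. if length qs = n \<and> (\<forall>q\<in>set qs. length (snd q) = 1)
     then (\<Prod>q\<leftarrow>qs. counit cone_cooperad 1 (fst q)) * snd c z else 0)"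
proof (rule is_formI, goal_cases)
  case (1 k x y qs)
  then show ?case by (simp add: distrib_left)
next
  case (2 k x a qs)
  then show ?case by (simp add: scl_apply)
next
  case (3 p qs i k x y B)
  have P: "(\<Prod>q\<leftarrow>qs[i := ((k, v), B)]. counit cone_cooperad 1 (fst q)) =
     counit cone_cooperad 1 (k, v) * (\<Prod>j\<in>{..<length qs} - {i}. counit cone_cooperad 1 (fst (qs ! j)))" for v
    using 3(2) by (simp add: prod.list_conv_set_nth atLeast0LessThan prod.remove[of "{..<length qs}" i])
  have S: "(\<forall>q\<in>set (qs[i := ((k, v), B)]). length (snd q) = 1) \<longleftrightarrow> (\<forall>q\<in>set qs. length (snd q) = 1)" for v
    using 3(2,3) by (metis (no_types, lifting) length_list_update in_set_conv_nth nth_list_update snd_conv)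
  have "qs = qs[i := ((k, x), B)]" using 3(3) by (metis list_update_id)
  then have "(\<Prod>q\<leftarrow>qs. counit cone_cooperad 1 (fst q)) =
     counit cone_cooperad 1 (k, x) * (\<Prod>j\<in>{..<length qs} - {i}. counit cone_cooperad 1 (fst (qs ! j)))"
    using P by metis
  then show ?case unfolding S P by (simp add: counit_cone distrib_right)
next
  case (4 p qs i k x a B)
  have P: "(\<Prod>q\<leftarrow>qs[i := ((k, v), B)]. counit cone_cooperad 1 (fst q)) =
     counit cone_cooperad 1 (k, v) * (\<Prod>j\<in>{..<length qs} - {i}. counit cone_cooperad 1 (fst (qs ! j)))" for v
    using 4(2) by (simp add: prod.list_conv_set_nth atLeast0LessThan prod.remove[of "{..<length qs}" i])
  have S: "(\<forall>q\<in>set (qs[i := ((k, v), B)]). length (snd q) = 1) \<longleftrightarrow> (\<forall>q\<in>set qs. length (snd q) = 1)" for v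
    using 4(2,3) by (metis (no_types, lifting) length_list_update in_set_conv_nth nth_list_update snd_conv)
  have "qs = qs[i := ((k, x), B)]" using 4(3) by (metis list_update_id)
  then have "(\<Prod>q\<leftarrow>qs. counit cone_cooperad 1 (fst q)) =
     counit cone_cooperad 1 (k, x) * (\<Prod>j\<in>{..<length qs} - {i}. counit cone_cooperad 1 (fst (qs ! j)))"
    using P by metis
  then show ?case unfolding S P by (simp add: counit_cone scl_apply)
next
  case (5 p qs \<sigma>)
  let ?K = "koszul_sign (degs qs) (map \<sigma> [0..<length qs]) :: 'a"
  have p: "act cone_smod (length qs) \<sigma> (fst p) (snd p) = snd p"
    using is_gen_mem(1)[OF 5(1)] by (simp add: mem_def trivial_actionD[OF trivial_cone])
  have m: "(\<Prod>q\<leftarrow>permute_list \<sigma> qs. counit cone_cooperad 1 (fst q)) = (\<Prod>q\<leftarrow>qs. counit cone_cooperad 1 (fst q) :: 'a)"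
    using 5(2) by (simp add: prod_mset_prod_list[symmetric] del: prod_mset_prod_list)
  show ?case
  proof (cases "\<forall>q\<in>set qs. fst (fst q) = 0")
    case True
    have "?K = 1"
      by (rule koszul_sign_even) (use True permutes_nat_less[OF 5(2)] in auto)
    then show ?thesis using 5(2) p unfolding m by auto
  next
    case False
    then have "(\<Prod>q\<leftarrow>qs. counit cone_cooperad 1 (fst q) :: 'a) = 0"
      by (force simp: prod_list_zero_iff counit_cone)
    then show ?thesis unfolding m by simp
  qed
next
  case (6 p qs i q B \<sigma>)
  have q: "act cone_smod (length B) \<sigma> (fst q) (snd q) = snd q"
    using is_gen_mem(2)[OF 6(1,2)] 6(3) by (simp add: mem_def trivial_actionD[OF trivial_cone])
  have "map fst (qs[i := (q, permute_list \<sigma> B)]) = map fst qs"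
    using 6(2,3) by (simp add: map_update list_update_same_conv)
  then have "map (counit cone_cooperad 1) (map fst (qs[i := (q, permute_list \<sigma> B)])) = map (counit cone_cooperad 1) (map fst qs)"
    by (simp only:)
  moreover have "(\<forall>q\<in>set (qs[i := (q, permute_list \<sigma> B)]). length (snd q) = 1) \<longleftrightarrow> (\<forall>q\<in>set qs. length (snd q) = 1)"
    using 6(2,3) by (metis (no_types, lifting) length_list_update in_set_conv_nth nth_list_update snd_conv length_permute_list)
  ultimately show ?case by (simp add: happ_def q o_def)
qed

lemma is_form_counit_right:
  "is_form cone_smod cone_smod n (\<lambda>c qs. (if length qs = n \<and> (\<forall>q\<in>set qs. length (snd q) = 1)
     then scl (\<Prod>q\<leftarrow>qs. counit cone_cooperad 1 (fst q)) (relabel cone_smod c (concat (map snd qs))) else 0) z)"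
proof (rule is_form_cong[OF smodule_cone smodule_cone is_form_counit_right_trivial[of n z]])
  fix c :: "(nat, 'a) hvec" and qs :: "((nat, 'a) hvec \<times> nat list) list"
  assume g: "is_gen cone_smod cone_smod n c qs"
  have "length (concat (map snd qs)) = length qs" if "\<forall>q\<in>set qs. length (snd q) = 1"
    using that by (induction qs) auto
  then show "(if length qs = n \<and> (\<forall>q\<in>set qs. length (snd q) = 1)
     then scl (\<Prod>q\<leftarrow>qs. counit cone_cooperad 1 (fst q)) (relabel cone_smod c (concat (map snd qs))) else 0) z =
     (if length qs = n \<and> (\<forall>q\<in>set qs. length (snd q) = 1)
     then (\<Prod>q\<leftarrow>qs. counit cone_cooperad 1 (fst q)) * snd c z else 0)"
    using is_gen_mem(1)[OF g] by (auto simp: relabel_def trivial_actionD[OF trivial_cone] scl_apply mem_def)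
qed

lemma cone_dec_cases:
  assumes "x \<in> grd (cpx cone_smod n) k"
  obtains (one) a where "n = 1" "x = line a" "k = 0 \<or> a = 0" "cone_dec n k x = unit_gen cone_smod cone_smod 1 (k, x)"
  | (two) a where "n = 2" "x = line a" "k = 1 \<or> k = 2 \<or> a = 0"
      "cone_dec n k x = unit_gen cone_smod cone_smod 2 (k, x) + gen cone_smod cone_smod 2 (k, x) id_pair"
  | (zero) "x = 0" "cone_dec n k x = 0" "n \<noteq> 1" "n \<noteq> 2"
proof -
  have "\<exists>a. x = line a" using assms by (auto simp: grd_cone split: if_splits intro: exI[of _ 0])
  then obtain a where a: "x = line a" ..
  show ?thesis
  proof (cases "n = 1")
    case True
    then show ?thesis using one[of a] a assms by (auto simp: cone_dec_def grd_cone split: if_splits)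
  next
    case F: False
    show ?thesis
    proof (cases "n = 2")
      case True
      then show ?thesis using two[of a] a assms by (auto simp: cone_dec_def grd_cone split: if_splits)
    next
      case False
      then show ?thesis using zero F assms by (auto simp: cone_dec_def grd_cone split: if_splits)
    qed
  qed
qed

lemma cone_counit_left:
  assumes x: "x \<in> grd (cpx cone_smod n) k"
  shows "ext (cspace cone_smod cone_smod n k) (\<lambda>c qs. if length qs = 1
     then scl (counit cone_cooperad 1 c) (relabel cone_smod (fst (hd qs)) (snd (hd qs))) else 0) (cone_dec n k x) = x"
    (is "ext ?U ?\<phi> _ = x")
proof -
  have u: "ext ?U ?\<phi> (unit_gen cone_smod cone_smod n (k, x)) = x"
    using ext_gen[where g = ?\<phi>, OF is_gen_unit[OF has_id_cone, of cone_smod n "(k, x)"] _ is_form_counit_left, of k] x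
    by (simp add: counit_cone relabel_def trivial_actionD[OF trivial_cone])
  from x show ?thesis
  proof (cases rule: cone_dec_cases)
    case one then show ?thesis using u by simp
  next
    case two
    have g: "is_gen cone_smod cone_smod 2 (k, x) id_pair" by (rule is_gen_id_pair) (use x two in simp)
    have gz: "ext ?U ?\<phi> (gen cone_smod cone_smod 2 (k, x) id_pair) = 0"
      using ext_gen[where g = ?\<phi>, OF g _ is_form_counit_left, of k] two(1) by simp
    have "ext ?U ?\<phi> (unit_gen cone_smod cone_smod 2 (k, x) + gen cone_smod cone_smod 2 (k, x) id_pair) =
        ext ?U ?\<phi> (unit_gen cone_smod cone_smod 2 (k, x)) + ext ?U ?\<phi> (gen cone_smod cone_smod 2 (k, x) id_pair)"
      unfolding two(1)
      by (rule lin_on_addD[OF lin_on_ext unit_gen_in[OF has_id_cone] gen_in[OF g]]) (use x two(1) in simp_all)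
    then show ?thesis using two(4) gz u unfolding two(1) by (simp only: add_0_right)
  next
    case zero
    show ?thesis unfolding zero(2)
      unfolding zero(1) by (rule lin_on_zero[OF lin_on_ext fv.subspace_0[OF subspace_cspace]])
  qed
qed

lemma cone_counit_right:
  assumes x: "x \<in> grd (cpx cone_smod n) k"
  shows "ext (cspace cone_smod cone_smod n k) (\<lambda>c qs. if length qs = n \<and> (\<forall>q\<in>set qs. length (snd q) = 1)
     then scl (\<Prod>q\<leftarrow>qs. counit cone_cooperad 1 (fst q)) (relabel cone_smod c (concat (map snd qs))) else 0) (cone_dec n k x) = x"
    (is "ext ?U ?\<phi> _ = x")
  using x
proof (cases rule: cone_dec_cases)
  case (one a)
  have g: "is_gen cone_smod cone_smod 1 id_op [((k, x), [0..<1])]" by (rule is_gen_unit[OF has_id_cone]) (use x one in simp)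
  have "ext ?U ?\<phi> (unit_gen cone_smod cone_smod 1 (k, x)) = scl (counit cone_cooperad 1 (k, x)) (line 1)"
    using ext_gen[where g = ?\<phi>, OF g[folded one(1)] _ is_form_counit_right, of k] one(1)
    by (simp add: relabel_def trivial_actionD[OF trivial_cone] grd_cone)
  then show ?thesis using one by (auto simp: counit_cone line_scl)
next
  case (two a)
  have g: "is_gen cone_smod cone_smod 2 (k, x) id_pair" by (rule is_gen_id_pair) (use x two in simp)
  have a: "act cone_smod (Suc (Suc 0)) \<tau> k x = x" for \<tau>
    using trivial_actionD[OF trivial_cone, of x 2 k \<tau>] x two(1) by (simp add: numeral_2_eq_2)
  have gx: "ext ?U ?\<phi> (gen cone_smod cone_smod 2 (k, x) id_pair) = x"
    using ext_gen[where g = ?\<phi>, OF g[folded two(1)] _ is_form_counit_right, of k] two(1) x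
    by (simp add: counit_cone relabel_def a)
  have uz: "ext ?U ?\<phi> (unit_gen cone_smod cone_smod 2 (k, x)) = 0"
    using ext_gen[where g = ?\<phi>, OF is_gen_unit[OF has_id_cone, of cone_smod n "(k, x)"] _ is_form_counit_right, of k] x two(1) by simp
  have "ext ?U ?\<phi> (unit_gen cone_smod cone_smod 2 (k, x) + gen cone_smod cone_smod 2 (k, x) id_pair) =
      ext ?U ?\<phi> (unit_gen cone_smod cone_smod 2 (k, x)) + ext ?U ?\<phi> (gen cone_smod cone_smod 2 (k, x) id_pair)"
    unfolding two(1)
    by (rule lin_on_addD[OF lin_on_ext unit_gen_in[OF has_id_cone] gen_in[OF g]]) (use x two(1) in simp_all)
  then show ?thesis using two(4) gx uz unfolding two(1) by (simp only: add_0_left)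
next
  case zero
  show ?thesis unfolding zero(2)
      unfolding zero(1) by (rule lin_on_zero[OF lin_on_ext fv.subspace_0[OF subspace_cspace]])
qed

text \<open>Both sides of the binary case are \<open>(id; (id; x)) + (id; (x; id, id)) + (x; (id; id), (id; id))\<close>.\<close>

lemma cone_coassoc:
  assumes x: "x \<in> grd (cpx cone_smod n) k"
  shows "assoc cone_smod cone_smod cone_smod n k
      (cmap cone_smod cone_smod (cone_smod \<circ>\<^sub>S cone_smod) cone_smod 0 cone_dec (sid cone_smod) n k (cone_dec n k x)) =
    cmap cone_smod cone_smod cone_smod (cone_smod \<circ>\<^sub>S cone_smod) 0 (sid cone_smod) cone_dec n k (cone_dec n k x)"
    (is "?A (cone_dec n k x) = ?C (cone_dec n k x)")
proof -
  let ?M = "cone_smod :: (nat, 'a) smod"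
  note s = smap_sid[OF smodule_cone] and c = smap_cone_dec
  have linC: "lin_on (cspace ?M ?M n k) ?C" by (rule lin_on_cmap)
  note linA = cone_decompose_lin[OF smodule_cone, of n k]
  have gu: "is_gen ?M ?M n id_op [((k, x), [0..<n])]" by (rule is_gen_unit[OF has_id_cone]) (simp add: x)
  have Cu: "?C (unit_gen ?M ?M n (k, x)) = unit_gen ?M (?M \<circ>\<^sub>S ?M) n (k, cone_dec n k x)"
    using cmap_gen[OF s c gu, of k] happ_sid[of ?M 1 id_op] by (simp add: happ_def grd_cone)
  have Au: "?A (unit_gen ?M ?M n (k, x)) = unit_gen ?M (?M \<circ>\<^sub>S ?M) n (k, unit_gen ?M ?M n (k, x))"
    using cone_decompose_single[OF smodule_cone gu, of k] by simp
  from x show ?thesis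
  proof (cases rule: cone_dec_cases)
    case one
    then show ?thesis using Au Cu by simp
  next
    case (two a)
    let ?u = "unit_gen ?M ?M 2 (k, x)" and ?g = "gen ?M ?M 2 (k, x) id_pair"
    have x2: "x \<in> grd (cpx ?M 2) k" using x two by simp
    have g: "is_gen ?M ?M 2 (k, x) id_pair" by (rule is_gen_id_pair[OF x2])
    have gin: "?g \<in> cspace ?M ?M 2 k" by (rule gen_in[OF g]) simp
    have uin: "?u \<in> cspace ?M ?M 2 k" by (rule unit_gen_in[OF has_id_cone x2])
    have one1: "line 1 \<in> grd (cpx ?M 1) 0" by (simp add: grd_cone)
    have d1: "cone_dec 1 0 (line 1) = unit_gen ?M ?M 1 id_op" using one1 by (simp add: cone_dec_def)
    let ?uu = "[((0, unit_gen ?M ?M 1 id_op), [0]), ((0, unit_gen ?M ?M 1 id_op), [1])] ::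
      ((int \<times> ((nat, nat, 'a) form \<Rightarrow> 'a)) \<times> nat list) list"
    have na: "nested_arg ?M ?M (k, x) id_pair = ((k, ?g), [0..<2])"
      by (simp add: nested_arg_def consecutive_def numeral_2_eq_2)
    have k0: "k + fst (id_op :: (nat, 'a) hvec) + fst (id_op :: (nat, 'a) hvec) = k" by simp
    have Ag: "?A ?g = unit_gen ?M (?M \<circ>\<^sub>S ?M) 2 (k, ?g) + gen ?M (?M \<circ>\<^sub>S ?M) 2 (k, x) ?uu"
      unfolding two(1) cone_decompose_pair[OF smodule_cone g k0] na by (simp del: plus_fun_apply)
    have Cg: "?C ?g = gen ?M (?M \<circ>\<^sub>S ?M) 2 (k, x) ?uu"
      using cmap_gen[OF s c g, of k] happ_sid[of ?M 2 "(k, x)"] x2 two(1) d1 by (simp add: happ_def numeral_2_eq_2)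
    have "?A (?u + ?g) = unit_gen ?M (?M \<circ>\<^sub>S ?M) 2 (k, ?u) + (unit_gen ?M (?M \<circ>\<^sub>S ?M) 2 (k, ?g) + gen ?M (?M \<circ>\<^sub>S ?M) 2 (k, x) ?uu)"
      using lin_on_addD[OF linA[unfolded two(1)] uin gin] Au Ag unfolding two(1) by (simp only:)
    also have "\<dots> = unit_gen ?M (?M \<circ>\<^sub>S ?M) 2 (k, ?u + ?g) + gen ?M (?M \<circ>\<^sub>S ?M) 2 (k, x) ?uu"
      using unit_gen_add[OF has_id_cone, of ?u "?M \<circ>\<^sub>S ?M" 2 k ?g] uin gin by (simp add: add.assoc del: plus_fun_apply)
    also have "\<dots> = ?C (?u + ?g)"
      using lin_on_addD[OF linC[unfolded two(1)] uin gin] Cu Cg two(4) unfolding two(1) by (simp only:)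
    finally show ?thesis using two(4) unfolding two(1) by (simp only:)
  next
    case zero
    have "(0 :: (nat, nat, 'a) form \<Rightarrow> 'a) \<in> cspace ?M ?M n k" by (rule fv.subspace_0[OF subspace_cspace])
    from lin_on_zero[OF linA this] lin_on_zero[OF linC this] show ?thesis
      unfolding zero(2) by (rule trans[OF _ sym])
  qed
qed

lemma cone_cooperad_simps [simp]:
  "com cone_cooperad = cone_smod" "codec cone_cooperad = cone_dec" "cocounit cone_cooperad = (\<lambda>v. v undefined)"
  by (simp_all add: cone_cooperad_def)

lemma is_cooperad_cone: "is_cooperad cone_cooperad"
  unfolding is_cooperad_def Let_def
proof (intro conjI allI impI ballI)
  show "bij_betw (cocounit cone_cooperad) (grd (cpx (com cone_cooperad) 1) 0) UNIV"
    by (rule bij_betwI[of _ _ _ line]) (auto simp: grd_cone)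
  fix n k x assume "x \<in> grd (cpx (com cone_cooperad) n) k"
  then have x: "x \<in> grd (cpx cone_smod n) k" by simp
  show "ext (cspace (com cone_cooperad) (com cone_cooperad) n k) (\<lambda>c qs. if length qs = 1
      then scl (counit cone_cooperad 1 c) (relabel (com cone_cooperad) (fst (hd qs)) (snd (hd qs))) else 0)
      (codec cone_cooperad n k x) = x"
    unfolding cone_cooperad_simps by (rule cone_counit_left[OF x])
  show "ext (cspace (com cone_cooperad) (com cone_cooperad) n k) (\<lambda>c qs. if length qs = n \<and> (\<forall>q\<in>set qs. length (snd q) = 1)
      then scl (\<Prod>q\<leftarrow>qs. counit cone_cooperad 1 (fst q)) (relabel (com cone_cooperad) c (concat (map snd qs))) else 0)
      (codec cone_cooperad n k x) = x"
    unfolding cone_cooperad_simps by (rule cone_counit_right[OF x])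
qed (simp_all add: smodule_cone grd_cone hlin_undefined smap_cone_dec chain_map_cone_dec cone_coassoc)

section \<open>The zero twisting morphism\<close>

abbreviation zero_map :: "nat \<Rightarrow> int \<Rightarrow> ('x \<Rightarrow> 'k::field) \<Rightarrow> 'y \<Rightarrow> 'k" where
  "zero_map \<equiv> (\<lambda>_ _ _. 0)"

lemma smap_zero:
  assumes "\<And>n k. 0 \<in> grd (cpx N n) k" "\<And>n \<sigma> k. \<sigma> permutes {..<n} \<Longrightarrow> act N n \<sigma> k 0 = 0"
  shows "smap r M N zero_map"
  unfolding smap_def gmap_def linmap_def using assms by simp

lemma smap_zero_smodule:
  assumes N: "smodule N" shows "smap r M N zero_map"
proof -
  have z: "0 \<in> grd (cpx N n) k" for n k
    by (rule fv.subspace_0[OF chain_complex_subspace[OF smodule_chain_complex[OF N]]])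
  have "act N n \<sigma> k 0 = 0" if "\<sigma> permutes {..<n}" for n \<sigma> k
    using gmap_scl[OF chain_map_gmap[OF smodule_act[OF N that]] z, of k 0] by simp
  from smap_zero[OF z this] show ?thesis .
qed

lemma smap_zero_composite: "smap r M (N \<circ>\<^sub>S L) zero_map"
proof -
  have z: "0 \<in> grd (cpx (N \<circ>\<^sub>S L) n) k" for n k
    unfolding grd_composite by (rule fv.subspace_0[OF subspace_cspace])
  have "act (N \<circ>\<^sub>S L) n \<sigma> k 0 = 0" for n \<sigma> k
    unfolding act_composite by (rule lin_on_zero[OF lin_on_comp_act fv.subspace_0[OF subspace_cspace]])
  from smap_zero[OF z this] show ?thesis .
qed

lemma cmap_zero:
  assumes "smap r M M' zero_map" "smap 0 N N' g"
  shows "cmap M N M' N' r zero_map g n k u = 0"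
  unfolding cmap_def
proof (rule ext_zero)
  fix p qs assume "is_gen M N n p qs"
  from gen_zero_head[OF is_gen_cmap[OF this assms]]
  show "gen M' N' n (happ r (\<lambda>_ _. 0) p) (map_args g qs) = 0" by (simp add: happ_def)
qed

lemma ext_0: "ext (cspace M N n k) g 0 = 0"
  by (rule lin_on_zero[OF lin_on_ext fv.subspace_0[OF subspace_cspace]])

text \<open>Each summand has a zero argument in position \<open>i\<close>, unless its coefficient, a product of counits, vanishes.\<close>

lemma inf_dec_zero: "inf_dec cone_cooperad unit_operad r zero_map n k x = 0"
  unfolding inf_dec_def
proof (rule ext_zero)
  fix c qs assume g: "is_gen (com cone_cooperad) (com cone_cooperad) n c (qs :: ((nat, 'a) hvec \<times> nat list) list)"
  then have g: "is_gen cone_smod cone_smod n c qs" by simp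
  show "(\<Sum>i<length qs. scl (ksgn (r * fst c) *
      (\<Prod>j\<in>{..<length qs} - {i}. counit cone_cooperad (length (snd (qs ! j))) (fst (qs ! j))))
      (gen (com cone_cooperad) (opm unit_operad) n c (map (\<lambda>j. (if j = i then happ r (\<lambda>_ _. 0) (fst (qs ! j))
         else (0, opid unit_operad), snd (qs ! j))) [0..<length qs]))) = 0"
  proof (rule sum.neutral, rule ballI)
    fix i assume "i \<in> {..<length qs}"
    then have i: "i < length qs" by simp
    let ?P = "\<Prod>j\<in>{..<length qs} - {i}. counit cone_cooperad (length (snd (qs ! j))) (fst (qs ! j)) :: 'a"
    let ?qs = "map (\<lambda>j. (if j = i then happ r (\<lambda>_ _. 0) (fst (qs ! j)) else (0, opid unit_operad), snd (qs ! j))) [0..<length qs]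
       :: ((nat, 'a) hvec \<times> nat list) list"
    show "scl (ksgn (r * fst c) * ?P) (gen (com cone_cooperad) (opm unit_operad) n c ?qs) = 0"
    proof (cases "?P = 0")
      case False
      then have "length (snd (qs ! j)) = 1" if "j < length qs" "j \<noteq> i" for j
        using that by (auto simp: counit_cone split: if_splits)
      moreover have s: "map snd ?qs = map snd qs" by (rule nth_equalityI) auto
      moreover have "(0 :: nat \<Rightarrow> 'a) \<in> range line" by (rule range_eqI[of _ _ 0]) simp
      ultimately have "is_gen cone_smod unit_smod n c ?qs"
        using g unfolding is_gen_def s by (auto simp: mem_def unit_operad_def grd_unit simp del: zero_fun_apply)
      from gen_zero_arg[OF this, of i] i have "gen cone_smod unit_smod n c ?qs = 0" by (simp del: zero_fun_apply)
      then show ?thesis by (simp add: unit_operad_def)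
    qed simp
  qed
qed

lemma twist_bd_zero:
  assumes N: "smodule N"
  shows "twist_bd cone_cooperad unit_operad zero_map N lam n k u = 0"
proof -
  have i: "inf_dec cone_cooperad unit_operad (- 1) zero_map = zero_map"
    by (intro ext) (simp add: inf_dec_zero)
  show ?thesis unfolding twist_bd_def i cmap_zero[OF smap_zero_composite smap_sid[OF N]]
    by (simp only: assoc_def cmap_def ext_0)
qed

lemma twisting_morphism_zero:
  "twisting_morphism cone_cooperad unit_operad (zero_map :: nat \<Rightarrow> int \<Rightarrow> (nat \<Rightarrow> 'k::field) \<Rightarrow> nat \<Rightarrow> 'k)"
proof -
  have s: "star cone_cooperad unit_operad r s zero_map zero_map n k x = 0" for r s n k and x :: "nat \<Rightarrow> 'k"
    unfolding star_def unit_operad_def operad.simps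
    by (simp only: cmap_zero[OF smap_zero_smodule[OF smodule_unit] smap_sid[OF smodule_unit]] unit_mul_def ext_0)
  then show ?thesis
    unfolding twisting_morphism_def lie_bracket_def
    by (simp add: unit_operad_def smap_zero_smodule[OF smodule_unit] bd_unit)
qed

text \<open>
  The contracting homotopy of \<open>C \<circ> I\<close> in arities other than 1: it is induced by the degree 1 map on
  \<open>C(2)\<close> that inverts the differential.
\<close>

definition cone_contraction :: "nat \<Rightarrow> int \<Rightarrow> (nat \<Rightarrow> 'k::field) \<Rightarrow> nat \<Rightarrow> 'k" where
  "cone_contraction n k x = (if n = 2 \<and> k = 1 \<and> x \<in> range line then x else 0)"

lemma bd_cone_0: "bd (cpx cone_smod n) k 0 = 0"
  by (simp add: cone_smod_def line_smod_def)

lemma smap_cone_contraction: "smap 1 (cone_smod :: (nat, 'k::field) smod) cone_smod cone_contraction"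
proof -
  have "linmap (grd (cpx (cone_smod :: (nat, 'k) smod) n) k) (grd (cpx cone_smod n) (k + 1)) (cone_contraction n k)" for n k
    unfolding linmap_def by (auto simp: grd_cone cone_contraction_def line_add[symmetric] line_scl)
  note l = this
  have "act cone_smod n \<sigma> (k + 1) (cone_contraction n k x) = cone_contraction n k x"
    if "x \<in> grd (cpx cone_smod n) k" for n \<sigma> k and x :: "nat \<Rightarrow> 'k"
    by (rule trivial_actionD[OF trivial_cone linmap_in[OF l that]])
  then show ?thesis unfolding smap_def gmap_def using l by (simp add: trivial_actionD[OF trivial_cone])
qed

text \<open>
  All elements of the unit module are cycles, so the differential of \<open>C \<circ> I\<close> is induced by that of \<open>C\<close> and
  the identity can be checked on \<open>\<mu>\<close> and \<open>h\<close>.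
\<close>

lemma cone_contraction_homotopy:
  fixes u :: "(nat, nat, 'k::field) form \<Rightarrow> 'k"
  assumes n: "n \<noteq> 1" and u: "u \<in> cspace cone_smod unit_smod n k"
  defines "s \<equiv> cmap cone_smod unit_smod cone_smod unit_smod 1 cone_contraction (sid unit_smod)"
  shows "comp_bd cone_smod unit_smod n (k + 1) (s n k u) + s n (k - 1) (comp_bd cone_smod unit_smod n k u) = u"
proof -
  note c = smap_cone_contraction and i = smap_sid[OF smodule_unit]
  note lb = linmap_comp_bd[OF smodule_cone smodule_unit]
  have ls: "lin_on (cspace cone_smod unit_smod n k) (s n k)" for k unfolding s_def by (rule lin_on_cmap)
  have sin: "s n k v \<in> cspace cone_smod unit_smod n (k + 1)" if "v \<in> cspace cone_smod unit_smod n k" for v k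
    unfolding s_def using linmap_in[OF linmap_cmap[OF c i] that] .
  have s0: "s n k 0 = 0" for k unfolding s_def cmap_def by (rule ext_0)
  have b0: "comp_bd cone_smod unit_smod n k 0 = 0" for k unfolding comp_bd_def by (rule ext_0)
  have bc: "comp_bd cone_smod unit_smod n l (gen cone_smod unit_smod n p qs) =
      gen cone_smod unit_smod n (happ (- 1) (bd (cpx cone_smod (length qs))) p) qs"
    if "is_gen cone_smod unit_smod n p qs" "fst p + sum_list (degs qs) = l" for p :: "(nat, 'k) hvec" and qs :: "((nat, 'k) hvec \<times> nat list) list" and l
    by (rule comp_bd_cycles[OF smodule_cone smodule_unit that]) (simp add: bd_unit)
  have sg: "s n l (gen cone_smod unit_smod n p qs) = gen cone_smod unit_smod n (happ 1 (cone_contraction (length qs)) p) qs"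
    if "is_gen cone_smod unit_smod n p qs" "fst p + sum_list (degs qs) = l" for p :: "(nat, 'k) hvec" and qs :: "((nat, 'k) hvec \<times> nat list) list" and l
    unfolding s_def cmap_gen[OF c i that] map_args_sid[OF that(1)] ..
  show ?thesis
  proof (rule cspace_eqI_nonzero[OF u _ lin_on_id])
    show "lin_on (cspace cone_smod unit_smod n k) (\<lambda>u. comp_bd cone_smod unit_smod n (k + 1) (s n k u) +
        s n (k - 1) (comp_bd cone_smod unit_smod n k u))"
      by (rule lin_on_add[OF lin_on_compose[OF ls sin linmap_lin_on[OF lb]]
            lin_on_compose[OF linmap_lin_on[OF lb] linmap_in[OF lb] ls]])
    fix p :: "(nat, 'k) hvec" and qs :: "((nat, 'k) hvec \<times> nat list) list"
    assume g: "is_gen cone_smod unit_smod n p qs" and k: "fst p + sum_list (degs qs) = k" and nz: "snd p \<noteq> 0"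
    from g nz show "comp_bd cone_smod unit_smod n (k + 1) (s n k (gen cone_smod unit_smod n p qs)) +
        s n (k - 1) (comp_bd cone_smod unit_smod n k (gen cone_smod unit_smod n p qs)) = gen cone_smod unit_smod n p qs"
    proof (cases rule: cone_nonzero)
      case (one a q B)
      \<comment> \<open>An element \<open>(id; q)\<close> lives in the arity of \<open>q\<close>, which is 1 unless \<open>q = 0\<close>.\<close>
      have "snd q = 0" using g single_label[of cone_smod unit_smod n p q B] n is_gen_mem(2)[OF g, of 0]
        unfolding one by (auto simp: mem_def grd_unit)
      then have "gen cone_smod unit_smod n p qs = 0" using gen_zero_arg[OF g, of 0] one by simp
      then show ?thesis by (simp only: s0 b0 add_0_left)
    next
      case (two j a q1 B1 q2 B2)
      have l2: "length qs = 2" using two by simp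
      let ?p = "happ (- 1) (bd (cpx cone_smod 2)) p" let ?p' = "happ 1 (cone_contraction 2) p"
      have g1: "is_gen cone_smod unit_smod n ?p qs" using is_gen_bd_head[OF smodule_cone g] l2 by simp
      have g2: "is_gen cone_smod unit_smod n ?p' qs"
        using is_gen_cmap[OF g c i] unfolding map_args_sid[OF g] l2 .
      have k1: "fst ?p + sum_list (degs qs) = k - 1" "fst ?p' + sum_list (degs qs) = k + 1" using k by simp_all
      have e: "comp_bd cone_smod unit_smod n (k + 1) (s n k (gen cone_smod unit_smod n p qs)) =
          gen cone_smod unit_smod n (happ (- 1) (bd (cpx cone_smod 2)) ?p') qs"
        "s n (k - 1) (comp_bd cone_smod unit_smod n k (gen cone_smod unit_smod n p qs)) =
          gen cone_smod unit_smod n (happ 1 (cone_contraction 2) ?p) qs"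
        using bc[OF g2 k1(2)] sg[OF g1 k1(1)] unfolding bc[OF g k] sg[OF g k] l2 by simp_all
      have g3: "is_gen cone_smod unit_smod n (happ (- 1) (bd (cpx cone_smod 2)) ?p') qs"
        using is_gen_bd_head[OF smodule_cone g2] l2 by simp
      have g4: "is_gen cone_smod unit_smod n (happ 1 (cone_contraction 2) ?p) qs"
        using is_gen_cmap[OF g1 c i] unfolding map_args_sid[OF g1] l2 .
      from two(2) show ?thesis
      proof
        assume j: "j = 1"
        have "gen cone_smod unit_smod n (happ 1 (cone_contraction 2) ?p) qs = 0"
        proof (rule gen_zero_head[OF g4])
          show "snd (happ 1 (cone_contraction 2) ?p) = 0"
            unfolding happ_simps two(1) j fst_conv snd_conv cone_contraction_def by (rule if_not_P) simp
        qed
        moreover have "happ (- 1) (bd (cpx cone_smod 2)) ?p' = p"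
          by (simp add: happ_def two(1) j bd_cone cone_contraction_def)
        ultimately show ?thesis unfolding e by (simp only: add_0_right)
      next
        assume j: "j = 2"
        have "gen cone_smod unit_smod n (happ (- 1) (bd (cpx cone_smod 2)) ?p') qs = 0"
        proof (rule gen_zero_head[OF g3])
          have "cone_contraction 2 2 (line a :: nat \<Rightarrow> 'k) = 0" unfolding cone_contraction_def by (rule if_not_P) simp
          then show "snd (happ (- 1) (bd (cpx cone_smod 2)) ?p') = 0"
            by (simp only: happ_simps two(1) j fst_conv snd_conv bd_cone_0)
        qed
        moreover have "happ 1 (cone_contraction 2) ?p = p"
          by (simp add: happ_def two(1) j bd_cone cone_contraction_def)
        ultimately show ?thesis unfolding e by (simp only: add_0_left)
      qed
    qed
  qed
qed

lemma koszul_morphism_zero: "koszul_morphism cone_cooperad unit_operad zero_map"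
  unfolding koszul_morphism_def
proof (intro conjI allI impI ballI)
  show "twisting_morphism cone_cooperad unit_operad zero_map" by (rule twisting_morphism_zero)
  fix n :: nat and k and u :: "(nat, nat, 'a) form \<Rightarrow> 'a"
  assume n: "n \<noteq> 1" and "u \<in> grd (cpx (com cone_cooperad \<circ>\<^sub>S opm unit_operad) n) k"
    and z: "koszul_bd cone_cooperad unit_operad zero_map n k u = 0"
  then have u: "u \<in> cspace cone_smod unit_smod n k" by (simp add: unit_operad_def)
  have kb: "koszul_bd cone_cooperad unit_operad zero_map n k u = comp_bd cone_smod unit_smod n k u"
    for n k and u :: "(nat, nat, 'a) form \<Rightarrow> 'a"
    using twist_bd_zero[OF smodule_unit, of "opcomp unit_operad" n k u] by (simp add: koszul_bd_def unit_operad_def)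
  let ?s = "cmap cone_smod unit_smod cone_smod unit_smod 1 cone_contraction (sid unit_smod)"
  have "comp_bd cone_smod unit_smod n (k + 1) (?s n k u) + ?s n (k - 1) 0 = u"
    using cone_contraction_homotopy[OF n u] z unfolding kb by simp
  then have "comp_bd cone_smod unit_smod n (k + 1) (?s n k u) = u"
    unfolding cmap_def[of _ _ _ _ _ _ _ n "k - 1"] ext_0 by (simp only: add_0_right)
  moreover have "?s n k u \<in> cspace cone_smod unit_smod n (k + 1)"
    by (rule linmap_in[OF linmap_cmap[OF smap_cone_contraction smap_sid[OF smodule_unit]] u])
  ultimately show "\<exists>v\<in>grd (cpx (com cone_cooperad \<circ>\<^sub>S opm unit_operad) n) (k + 1).
      koszul_bd cone_cooperad unit_operad zero_map n (k + 1) v = u"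
    unfolding kb by (auto simp: unit_operad_def)
qed


section \<open>Bar and cobar constructions for the zero twisting morphism\<close>

lemma bar_zero:
  assumes "chain_complex (acpx A)"
  shows "ccpx (bar cone_cooperad unit_operad zero_map A) = schur cone_smod (acpx A)"
  unfolding bar_def Let_def using twist_bd_zero[OF smodule_ar0[OF assms]]
  by (simp add: cpx_composite)

lemma cdec_bar: "cdec (bar cone_cooperad unit_operad zero_map A) = (\<lambda>k u. assoc cone_smod cone_smod (ar0 (acpx A)) 0 k
    (schur_l 0 cone_smod (cone_smod \<circ>\<^sub>S cone_smod) (acpx A) cone_dec k u))"
  by (simp add: bar_def Let_def)

lemma free_mul_in: "chain_complex V \<Longrightarrow> free_mul unit_operad V k u \<in> cspace unit_smod (ar0 V) 0 k"
proof -
  assume V: "chain_complex V"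
  have l: "linmap (cspace (unit_smod \<circ>\<^sub>S unit_smod) (ar0 V) 0 k) (cspace unit_smod (ar0 V) 0 (k + 0))
      (schur_l 0 (unit_smod \<circ>\<^sub>S unit_smod) unit_smod V (unit_mul unit_smod) k)"
    by (rule linmap_cmap[OF smap_unit_mul[OF smodule_unit trivial_unit] smap_sid[OF smodule_ar0[OF V]]])
  have "schur_l 0 (unit_smod \<circ>\<^sub>S unit_smod) unit_smod V (unit_mul unit_smod) k v \<in> cspace unit_smod (ar0 V) 0 k" for v
    using l fv.subspace_0[OF subspace_cspace, of unit_smod "ar0 V" 0 k] unfolding linmap_def
    by (cases "v \<in> cspace (unit_smod \<circ>\<^sub>S unit_smod) (ar0 V) 0 k") auto
  then show ?thesis by (simp add: free_mul_def unit_operad_def)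
qed

text \<open>Compatibility with nonzero scalars holds on the whole ambient space, and so passes to every map that is composed of such extensions.\<close>

lemma ext_scl:
  assumes "a \<noteq> 0" shows "ext (cspace M N n k) g (scl a u) = scl a (ext (cspace M N n k) g u)"
proof (cases "u \<in> cspace M N n k")
  case True
  then show ?thesis by (rule lin_on_sclD[OF lin_on_ext])
next
  case False
  have "scl a u \<notin> cspace M N n k"
  proof
    assume "scl a u \<in> cspace M N n k"
    then have "scl (1 / a) (scl a u) \<in> cspace M N n k" by (rule fv.subspace_scale[OF subspace_cspace])
    then show False using False assms by simp
  qed
  then show ?thesis using False by (simp add: ext_outside)
qed

lemma free_mul_scl:
  assumes "a \<noteq> 0" shows "free_mul unit_operad V k (scl a u) = scl a (free_mul unit_operad V k u)"
  unfolding free_mul_def Let_def reassoc_def cmap_def by (simp only: ext_scl[OF assms])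

lemma free_der_zero:
  assumes V: "chain_complex V"
  shows "free_der unit_operad V (\<lambda>_ _. 0) k u = 0"
proof -
  have h: "ext (cspace unit_smod (ar0 V) 0 k) (\<lambda>p xs. \<Sum>i<length xs. scl (ksgn (fst p + sum_list (take i (degs xs))))
        (tens unit_smod (schur unit_smod V) p (map (\<lambda>j. let x = fst (xs ! j) in
           if j = i then happ (- 1) (\<lambda>_ _. 0) x else (fst x, tens unit_smod V id_op [x])) [0..<length xs]))) u = 0"
  proof (rule ext_zero, rule sum.neutral, rule ballI)
    fix p xs i assume g: "is_gen unit_smod (ar0 V) 0 p xs" and "i \<in> {..<length xs}"
    then have i: "i < length xs" by simp
    let ?ws = "map (\<lambda>j. let x = fst (xs ! j) in
           if j = i then happ (- 1) (\<lambda>_ _. 0) x else (fst x, tens unit_smod V id_op [x])) [0..<length xs]"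
    have nil: "snd (xs ! j) = []" if "j < length xs" for j
      using g that unfolding is_gen_def by (auto dest: nth_mem)
    have "tens unit_smod V id_op [fst (xs ! j)] \<in> cspace unit_smod (ar0 V) 0 (fst (fst (xs ! j)))" if "j < length xs" for j
      using unit_gen_in[OF has_id_unit, of "snd (fst (xs ! j))" "ar0 V" 0 "fst (fst (xs ! j))"]
        is_gen_mem(2)[OF g that] nil[OF that] by (simp add: mem_def)
    then have "mem (schur unit_smod V) w" if "w \<in> set ?ws" for w
      using that fv.subspace_0[OF subspace_cspace] by (auto simp: mem_def Let_def simp del: zero_fun_apply)
    moreover have s: "map snd (map (\<lambda>x. (x, [] :: nat list)) ?ws) = replicate (length xs) []"
      by (rule nth_equalityI) simp_all
    ultimately have "is_gen unit_smod (ar0 (schur unit_smod V)) 0 p (map (\<lambda>x. (x, [])) ?ws)"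
      using is_gen_mem(1)[OF g] unfolding is_gen_def s by auto
    from gen_zero_arg[OF this, of i] i
    have "tens unit_smod (schur unit_smod V) p ?ws = 0" by (simp add: Let_def del: zero_fun_apply)
    then show "scl (ksgn (fst p + sum_list (take i (degs xs)))) (tens unit_smod (schur unit_smod V) p ?ws) = 0"
      by simp
  qed
  have o: "opm unit_operad = unit_smod" "opid unit_operad = line 1" by (simp_all add: unit_operad_def)
  have "free_mul unit_operad V (k - 1) 0 = 0"
    by (simp only: free_mul_def Let_def reassoc_def cmap_def ext_0)
  then show ?thesis unfolding free_der_def o Let_def grd_composite h[unfolded Let_def] .
qed

lemma cobar_zero:
  assumes V: "chain_complex (ccpx D)"
  shows "acpx (cobar cone_cooperad unit_operad zero_map D) = schur unit_smod (ccpx D)"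
proof -
  have "(\<lambda>j x. schur_l (- 1) (com cone_cooperad) unit_smod (ccpx D) zero_map j (cdec D j x)) = (\<lambda>_ _. 0)"
    by (intro ext) (simp add: cmap_zero[OF smap_zero_smodule[OF smodule_unit] smap_sid[OF smodule_ar0[OF V]]])
  then show ?thesis unfolding cobar_def Let_def
    using free_der_zero[OF V] by (simp add: unit_operad_def cpx_composite)
qed

lemma amul_cobar: "amul (cobar cone_cooperad unit_operad zero_map D) = free_mul unit_operad (ccpx D)"
  by (simp add: cobar_def Let_def)

lemma chain_complex_unit_composite:
  assumes N: "smodule N" "trivial_action N"
  shows "chain_complex (cpx (unit_smod \<circ>\<^sub>S N) n)"
  unfolding chain_complex_def
proof (intro allI conjI ballI)
  fix k u assume "u \<in> grd (cpx (unit_smod \<circ>\<^sub>S N) n) k"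
  then obtain x where x: "x \<in> grd (cpx N n) k" "u = unit_gen unit_smod N n (k, x)"
    using cspace_unitE[OF N] by (metis grd_composite(1))
  have "bd (cpx N n) (k - 1) (bd (cpx N n) k x) = 0"
    using smodule_chain_complex[OF N(1)] x(1) by (simp add: chain_complex_def)
  then show "bd (cpx (unit_smod \<circ>\<^sub>S N) n) (k - 1) (bd (cpx (unit_smod \<circ>\<^sub>S N) n) k u) = 0"
    using comp_bd_unit_gen[OF smodule_unit has_id_unit bd_unit N(1) x(1)]
      comp_bd_unit_gen[OF smodule_unit has_id_unit bd_unit N(1) smodule_bd_mem[OF N(1) x(1)]]
      unit_gen_0[OF has_id_unit smodule_chain_complex[OF N(1)]] x(2) by simp
qed (simp_all add: subspace_cspace linmap_comp_bd[OF smodule_unit N(1)])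

lemma chain_complex_composite_cycles:
  assumes M: "smodule M" and N: "smodule N" and z: "\<And>n k x. bd (cpx N n) k x = 0"
  shows "chain_complex (cpx (M \<circ>\<^sub>S N) n)"
  unfolding chain_complex_def
proof (intro allI conjI ballI)
  fix k u assume "u \<in> grd (cpx (M \<circ>\<^sub>S N) n) k"
  then have u: "u \<in> cspace M N n k" by simp
  note lb = linmap_comp_bd[OF M N]
  have "comp_bd M N n (k - 1) (comp_bd M N n k u) = (\<lambda>u. 0) u"
  proof (rule cspace_eqI[OF u lin_on_compose[OF linmap_lin_on[OF lb] linmap_in[OF lb] linmap_lin_on[OF lb]]])
    show "lin_on (cspace M N n k) (\<lambda>u. 0)" by (simp add: lin_on_def)
    fix p qs assume g: "is_gen M N n p qs" and k: "fst p + sum_list (degs qs) = k"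
    let ?p = "happ (- 1) (bd (cpx M (length qs))) p"
    have g1: "is_gen M N n ?p qs" by (rule is_gen_bd_head[OF M g])
    have k1: "fst ?p + sum_list (degs qs) = k - 1" using k by simp
    have g2: "is_gen M N n (happ (- 1) (bd (cpx M (length qs))) ?p) qs" by (rule is_gen_bd_head[OF M g1])
    have "snd (happ (- 1) (bd (cpx M (length qs))) ?p) = 0"
      using smodule_chain_complex[OF M, of "length qs"] is_gen_mem(1)[OF g] by (simp add: chain_complex_def mem_def del: zero_fun_apply)
    from gen_zero_head[OF g2 this] show "comp_bd M N n (k - 1) (comp_bd M N n k (gen M N n p qs)) = 0"
      unfolding comp_bd_cycles[OF M N g k z] comp_bd_cycles[OF M N g1 k1 z] .
  qed
  then show "bd (cpx (M \<circ>\<^sub>S N) n) (k - 1) (bd (cpx (M \<circ>\<^sub>S N) n) k u) = 0" by simp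
qed (simp_all add: subspace_cspace linmap_comp_bd[OF M N])

section \<open>Identity maps\<close>

lemma cmap_sid_eq:
  assumes "smodule M" "smodule N"
  shows "cmap M N M N 0 (sid M) (sid N) n = idmap (cpx (M \<circ>\<^sub>S N) n)"
proof (intro ext)
  fix k u x
  have "cmap M N M N 0 (sid M) (sid N) n k u = 0" if "u \<notin> cspace M N n k"
    using that by (simp add: cmap_def ext_def)
  then show "cmap M N M N 0 (sid M) (sid N) n k u x = idmap (cpx (M \<circ>\<^sub>S N) n) k u x"
    using cmap_sid[OF assms, of u n k] by (cases "u \<in> cspace M N n k") (simp_all add: idmap_def)
qed

lemma schur_r_idmap:
  assumes "smodule M" "chain_complex V"
  shows "schur_r M V V (idmap V) = idmap (schur M V)"
  unfolding at0_idmap by (rule cmap_sid_eq[OF assms(1) smodule_ar0[OF assms(2)]])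


section \<open>The coalgebra\<close>

text \<open>The cellular chains of a disc with one cell in each of the degrees 0, 1, 2; the vertex is the only nontrivial cycle up to boundaries.\<close>

definition cell_cplx :: "('x, 'k::field) cplx" where
  "cell_cplx = line_cplx (\<lambda>k. k = 0 \<or> k = 1 \<or> k = 2) (\<lambda>k. k = 2)"

lemma chain_complex_cell: "chain_complex cell_cplx"
  unfolding cell_cplx_def by (rule chain_complex_line_cplx) (simp add: line_differential_def)

lemma grd_cell: "grd cell_cplx k = (if k = 0 \<or> k = 1 \<or> k = 2 then range line else {0})"
  by (simp add: cell_cplx_def grd_line_cplx)

lemma bd_cell: "bd cell_cplx k (line a) = (if k = 2 then line a else 0)"
  by (simp add: cell_cplx_def bd_line_cplx)

abbreviation "cell \<equiv> ar0 cell_cplx"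

lemma smodule_cell: "smodule cell"
  by (rule smodule_ar0[OF chain_complex_cell])

abbreviation vertex_pair :: "(('x, 'k::field) hvec \<times> nat list) list" where
  "vertex_pair \<equiv> [(id_op, []), (id_op, [])]"

definition cell_dec :: "int \<Rightarrow> ('x \<Rightarrow> 'k::field) \<Rightarrow> (nat, 'x, 'k) form \<Rightarrow> 'k" where
  "cell_dec k x = (if x \<in> grd cell_cplx k then unit_gen cone_smod cell 0 (k, x) +
     (if k = 1 \<or> k = 2 then gen cone_smod cell 0 (k, line (x undefined)) vertex_pair else 0) else 0)"

definition cell_cog :: "(nat, 'x, 'k::field) cog" where
  "cell_cog = \<lparr>ccpx = cell_cplx, cdec = cell_dec\<rparr>"

lemma is_gen_vertex_pair: "k = 1 \<or> k = 2 \<Longrightarrow> is_gen cone_smod cell 0 (k, line a) vertex_pair"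
  by (auto simp: is_gen_def grd_cone grd_cell numeral_2_eq_2)

lemma vertex_pair_in: "k = 1 \<or> k = 2 \<Longrightarrow> gen cone_smod cell 0 (k, line a) vertex_pair \<in> cspace cone_smod cell 0 k"
  by (rule gen_in[OF is_gen_vertex_pair]) simp_all

lemma linmap_cell_dec: "linmap (grd cell_cplx k) (cspace cone_smod cell 0 k) (cell_dec k)"
  unfolding linmap_def
proof (intro conjI ballI allI impI)
  note sp = chain_complex_subspace[OF chain_complex_cell, of k]
  fix x :: "'a \<Rightarrow> 'b" assume x: "x \<in> grd cell_cplx k"
  have u: "unit_gen cone_smod cell 0 (k, x) \<in> cspace cone_smod cell 0 k"
    by (rule unit_gen_in[OF has_id_cone]) (simp add: x)
  show "cell_dec k x \<in> cspace cone_smod cell 0 k"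
    using x fv.subspace_add[OF subspace_cspace u] u vertex_pair_in[of k]
    by (cases "k = 1 \<or> k = 2") (auto simp: cell_dec_def simp del: plus_fun_apply)
  {
    fix a
    have "scl a x \<in> grd cell_cplx k" using fv.subspace_scale[OF sp x] .
    moreover have "unit_gen cone_smod cell 0 (k, scl a x) = scl a (unit_gen cone_smod cell 0 (k, x))"
      by (rule unit_gen_scl[OF has_id_cone]) (simp add: x)
    moreover have "gen cone_smod cell 0 (k, line (a * b)) vertex_pair = scl a (gen cone_smod cell 0 (k, line b) vertex_pair)"
      if "k = 1 \<or> k = 2" for b
      using gen_scl_head[OF is_gen_vertex_pair[OF that], of a] by (simp add: line_scl)
    ultimately show "cell_dec k (scl a x) = scl a (cell_dec k x)"
      using x by (cases "k = 1 \<or> k = 2") (auto simp: cell_dec_def scl_apply fv.scale_right_distrib)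
  }
  fix y :: "'a \<Rightarrow> 'b" assume y: "y \<in> grd cell_cplx k"
  have xy: "x + y \<in> grd cell_cplx k" using fv.subspace_add[OF sp x y] .
  have ua: "unit_gen cone_smod cell 0 (k, x + y) = unit_gen cone_smod cell 0 (k, x) + unit_gen cone_smod cell 0 (k, y)"
    by (rule unit_gen_add[OF has_id_cone]) (simp_all add: x y)
  have "gen cone_smod cell 0 (k, line (b + c)) vertex_pair =
      gen cone_smod cell 0 (k, line b) vertex_pair + gen cone_smod cell 0 (k, line c) vertex_pair"
    if "k = 1 \<or> k = 2" for b c
    unfolding line_add by (rule gen_add_head[OF is_gen_vertex_pair[OF that]]) (use that in \<open>auto simp: grd_cone numeral_2_eq_2\<close>)
  then show "cell_dec k (x + y) = cell_dec k x + cell_dec k y"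
    using x y xy ua plus_fun_apply[of x y undefined]
    by (cases "k = 1 \<or> k = 2") (auto simp: cell_dec_def ac_simps simp del: plus_fun_apply)
qed (simp add: cell_dec_def)

lemma gmap_cell_dec: "gmap 0 cell_cplx (schur cone_smod cell_cplx) cell_dec"
  by (simp add: gmap_def linmap_cell_dec)

text \<open>The differential of \<open>(h; e, e)\<close> is \<open>(\<mu>; e, e)\<close>, which matches \<open>d\<close> having boundary \<open>b\<close>.\<close>

lemma chain_map_cell_dec: "chain_map cell_cplx (schur cone_smod (cell_cplx :: ('x, 'k::field) cplx)) cell_dec"
  unfolding chain_map_def
proof (intro conjI allI ballI)
  fix k and x :: "'x \<Rightarrow> 'k" assume x: "x \<in> grd cell_cplx k"
  then obtain a where a: "x = line a" by (auto simp: grd_cell split: if_splits intro: that[of 0])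
  let ?V = "cell :: ('x, 'k) smod"
  note l = linmap_lin_on[OF linmap_comp_bd[OF smodule_cone smodule_cell]]
  have u1: "bd (cpx cone_smod 1) 0 (line 1) = (0 :: nat \<Rightarrow> 'k)" by (simp add: bd_cone)
  have xc: "x \<in> grd (cpx cell 0) k" using x by simp
  have d: "bd cell_cplx k x \<in> grd cell_cplx (k - 1)" using smodule_bd_mem[OF smodule_cell xc] by simp
  have u: "comp_bd cone_smod ?V 0 k (unit_gen cone_smod ?V 0 (k, x)) = unit_gen cone_smod ?V 0 (k - 1, bd cell_cplx k x)"
    using comp_bd_unit_gen[OF smodule_cone has_id_cone u1 smodule_cell xc] by simp
  have v: "comp_bd cone_smod ?V 0 k (gen cone_smod ?V 0 (k, line a) vertex_pair) =
      (if k = 2 then gen cone_smod ?V 0 (1, line a) vertex_pair else 0)" if k: "k = 1 \<or> k = 2"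
  proof -
    note g = is_gen_vertex_pair[OF k, of a]
    have e: "comp_bd cone_smod ?V 0 k (gen cone_smod ?V 0 (k, line a) vertex_pair) =
        gen cone_smod ?V 0 (happ (- 1) (bd (cpx cone_smod 2)) (k, line a)) vertex_pair"
      using comp_bd_cycles[OF smodule_cone smodule_cell g, of k] by (simp add: bd_cell numeral_2_eq_2)
    have g1: "is_gen cone_smod ?V 0 (happ (- 1) (bd (cpx cone_smod 2)) (k, line a)) vertex_pair"
      using is_gen_bd_head[OF smodule_cone g] by (simp add: numeral_2_eq_2)
    show ?thesis
    proof (cases "k = 2")
      case True
      then show ?thesis unfolding e by (simp add: happ_def bd_cone)
    next
      case False
      have "snd (happ (- 1) (bd (cpx cone_smod 2)) (k, line a)) = 0"
        unfolding happ_simps fst_conv snd_conv bd_cone using False by (intro if_not_P) simp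
      from gen_zero_head[OF g1 this] show ?thesis unfolding e using False by simp
    qed
  qed
  have "bd (schur cone_smod cell_cplx) k (cell_dec k x) = comp_bd cone_smod ?V 0 k (cell_dec k x)" by simp
  also have "\<dots> = unit_gen cone_smod ?V 0 (k - 1, bd cell_cplx k x) +
      (if k = 2 then gen cone_smod ?V 0 (1, line a) vertex_pair else 0)"
  proof (cases "k = 1 \<or> k = 2")
    case True
    have "cell_dec k x = unit_gen cone_smod ?V 0 (k, x) + gen cone_smod ?V 0 (k, line a) vertex_pair"
      using x True a by (simp add: cell_dec_def)
    then show ?thesis
      using lin_on_addD[OF l unit_gen_in[OF has_id_cone xc] vertex_pair_in[OF True]] u v[OF True] by (simp only:)
  next
    case False
    then have "cell_dec k x = unit_gen cone_smod ?V 0 (k, x)" using x by (simp add: cell_dec_def)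
    then show ?thesis using u False by simp
  qed
  also have "\<dots> = cell_dec (k - 1) (bd cell_cplx k x)"
  proof (cases "k = 2")
    case True
    then show ?thesis using d by (simp add: a bd_cell cell_dec_def)
  next
    case False
    have "bd cell_cplx k x = 0" unfolding a bd_cell using False by (rule if_not_P)
    moreover have "unit_gen cone_smod ?V 0 (k - 1, 0) = 0" by (rule unit_gen_0[OF has_id_cone]) (simp add: chain_complex_cell)
    moreover have "cell_dec (k - 1) 0 = 0"
      by (rule lin_on_zero[OF linmap_lin_on[OF linmap_cell_dec] fv.subspace_0[OF chain_complex_subspace[OF chain_complex_cell]]])
    ultimately show ?thesis using False by simp
  qed
  finally show "bd (schur cone_smod cell_cplx) k (cell_dec k x) = cell_dec (k - 1) (bd cell_cplx k x)" .
qed (rule gmap_cell_dec)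

lemma smap_at0_schur:
  "gmap 0 V (schur M W) f \<Longrightarrow> smap 0 (ar0 V) (M \<circ>\<^sub>S ar0 W) (at0 f)"
  using smap_at0[of V "schur M W" f] by (simp add: composite_ar0[symmetric])

lemma cproj_unit_gen:
  assumes "x \<in> grd V k"
  shows "cproj cone_cooperad V k (unit_gen cone_smod (ar0 V) 0 (k, x)) = x"
proof -
  have f: "is_form cone_smod (ar0 V) 0 (\<lambda>c xs. (if length xs = 1 then scl (counit cone_cooperad 1 c) (snd (fst (hd xs))) else 0) z)" for z
    using is_form_single[OF smodule_cone hlin_counit_cone[of _ 1] trivial_action_ar0, where n = 0 and z = z]
    by (auto simp: scl_apply if_distrib[of "\<lambda>f. f z"] cong: if_cong)
  have g: "is_gen cone_smod (ar0 V) 0 id_op [((k, x), [0..<0])]" by (rule is_gen_unit[OF has_id_cone]) (simp add: assms)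
  show ?thesis unfolding cproj_def
    using ext_gen[where g = "\<lambda>c xs. if length xs = 1 then scl (counit cone_cooperad 1 c) (snd (fst (hd xs))) else 0", OF g _ f, of k]
    by (simp add: counit_cone)
qed

lemma cproj_long:
  assumes "is_gen cone_smod (ar0 V) 0 p xs" "length xs \<noteq> 1" "fst p + sum_list (degs xs) = k"
  shows "cproj cone_cooperad V k (gen cone_smod (ar0 V) 0 p xs) = 0"
proof -
  have f: "is_form cone_smod (ar0 V) 0 (\<lambda>c xs. (if length xs = 1 then scl (counit cone_cooperad 1 c) (snd (fst (hd xs))) else 0) z)" for z
    using is_form_single[OF smodule_cone hlin_counit_cone[of _ 1] trivial_action_ar0, where n = 0 and z = z]
    by (auto simp: scl_apply if_distrib[of "\<lambda>f. f z"] cong: if_cong)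
  show ?thesis unfolding cproj_def
    using ext_gen[where g = "\<lambda>c xs. if length xs = 1 then scl (counit cone_cooperad 1 c) (snd (fst (hd xs))) else 0", OF assms(1,3) f]
      assms(2) by simp
qed

lemma lin_on_cproj: "lin_on (cspace cone_smod (ar0 V) 0 k) (cproj cone_cooperad V k)"
  unfolding cproj_def by (simp add: lin_on_ext)

text \<open>The vertex \<open>e\<close> is primitive, so coassociativity reduces to the same identity as for \<open>C\<close> itself.\<close>

lemma is_cog_cell: "is_cog cone_cooperad (cell_cog :: (nat, 'x, 'k::field) cog)"
  unfolding is_cog_def Let_def cone_cooperad_simps
proof (intro conjI allI ballI; (simp only: cell_cog_def cog.simps)?)
  show "chain_complex cell_cplx" by (rule chain_complex_cell)
  show "chain_map cell_cplx (schur cone_smod cell_cplx) cell_dec" by (rule chain_map_cell_dec)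
  fix k and x :: "'x \<Rightarrow> 'k" assume x: "x \<in> grd cell_cplx k"
  then obtain a where a: "x = line a" by (auto simp: grd_cell split: if_splits intro: that[of 0])
  have xc: "x \<in> grd (cpx cell 0) k" using x by simp
  let ?M = "cone_smod :: (nat, 'k) smod" and ?V = "cell :: ('x, 'k) smod"
  let ?u = "unit_gen ?M ?V 0 (k, x)" and ?g = "gen ?M ?V 0 (k, line a) vertex_pair"
  have uin: "?u \<in> cspace ?M ?V 0 k" by (rule unit_gen_in[OF has_id_cone xc])
  show "cproj cone_cooperad cell_cplx k (cell_dec k x) = x"
  proof (cases "k = 1 \<or> k = 2")
    case True
    have "cproj cone_cooperad cell_cplx k ?g = 0"
      by (rule cproj_long[OF is_gen_vertex_pair[OF True]]) simp_all
    moreover have "cell_dec k x = ?u + ?g" using x True a by (simp add: cell_dec_def)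
    ultimately show ?thesis
      using lin_on_addD[OF lin_on_cproj uin vertex_pair_in[OF True]] cproj_unit_gen[OF x] by (simp only: add_0_right)
  next
    case False
    then have "cell_dec k x = ?u" using x by (simp add: cell_dec_def)
    then show ?thesis using cproj_unit_gen[OF x] by simp
  qed
  let ?A = "\<lambda>u. assoc ?M ?M ?V 0 k (schur_l 0 ?M (?M \<circ>\<^sub>S ?M) cell_cplx cone_dec k u)"
  let ?C = "\<lambda>u. cmap ?M ?V ?M (?M \<circ>\<^sub>S ?V) 0 (sid ?M) (at0 cell_dec) 0 k u"
  note s = smap_sid[OF smodule_cone] and c = smap_at0_schur[OF gmap_cell_dec]
  have linC: "lin_on (cspace ?M ?V 0 k) ?C" by (rule lin_on_cmap)
  note linA = cone_decompose_lin[OF smodule_cell, of 0 k]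
  have gu: "is_gen ?M ?V 0 id_op [((k, x), [0..<0])]" by (rule is_gen_unit[OF has_id_cone]) (simp add: x)
  have at0: "at0 cell_dec 0 = cell_dec" by (simp add: at0_def)
  have Cu: "?C ?u = unit_gen ?M (?M \<circ>\<^sub>S ?V) 0 (k, cell_dec k x)"
    using cmap_gen[OF s c gu, of k] happ_sid[of ?M 1 id_op] by (simp add: happ_def grd_cone at0)
  have Au: "?A ?u = unit_gen ?M (?M \<circ>\<^sub>S ?V) 0 (k, ?u)"
    using cone_decompose_single[OF smodule_cell gu, of k] by simp
  show "?A (cell_dec k x) = ?C (cell_dec k x)"
  proof (cases "k = 1 \<or> k = 2")
    case True
    have g: "is_gen ?M ?V 0 (k, line a) vertex_pair" by (rule is_gen_vertex_pair[OF True])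
    have gin: "?g \<in> cspace ?M ?V 0 k" by (rule vertex_pair_in[OF True])
    have e: "cell_dec k x = ?u + ?g" using x True a by (simp add: cell_dec_def)
    have d1: "cell_dec 0 (line 1 :: 'x \<Rightarrow> 'k) = unit_gen ?M ?V 0 id_op" by (simp add: cell_dec_def grd_cell)
    let ?uu = "[((0, unit_gen ?M ?V 0 id_op), []), ((0, unit_gen ?M ?V 0 id_op), [])] ::
      ((int \<times> ((nat, 'x, 'k) form \<Rightarrow> 'k)) \<times> nat list) list"
    have na: "nested_arg ?M ?V (k, line a) vertex_pair = ((k, ?g), [0..<0])"
      by (simp add: nested_arg_def consecutive_def)
    have k0: "k + fst (id_op :: ('x, 'k) hvec) + fst (id_op :: ('x, 'k) hvec) = k" by simp
    have Ag: "?A ?g = unit_gen ?M (?M \<circ>\<^sub>S ?V) 0 (k, ?g) + gen ?M (?M \<circ>\<^sub>S ?V) 0 (k, line a) ?uu"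
      unfolding cone_decompose_pair[OF smodule_cell g k0] na by (simp del: plus_fun_apply)
    have Cg: "?C ?g = gen ?M (?M \<circ>\<^sub>S ?V) 0 (k, line a) ?uu"
      using cmap_gen[OF s c g, of k] happ_sid[of ?M 2 "(k, line a)"] True d1 by (simp add: happ_def at0 numeral_2_eq_2 grd_cone)
    have "?A (?u + ?g) = unit_gen ?M (?M \<circ>\<^sub>S ?V) 0 (k, ?u) + (unit_gen ?M (?M \<circ>\<^sub>S ?V) 0 (k, ?g) + gen ?M (?M \<circ>\<^sub>S ?V) 0 (k, line a) ?uu)"
      using lin_on_addD[OF linA uin gin] Au Ag by (simp only:)
    also have "\<dots> = unit_gen ?M (?M \<circ>\<^sub>S ?V) 0 (k, ?u + ?g) + gen ?M (?M \<circ>\<^sub>S ?V) 0 (k, line a) ?uu"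
      using unit_gen_add[OF has_id_cone, of ?u "?M \<circ>\<^sub>S ?V" 0 k ?g] uin gin by (simp add: add.assoc del: plus_fun_apply)
    also have "\<dots> = ?C (?u + ?g)"
      using lin_on_addD[OF linC uin gin] Cu Cg e by (simp only:)
    finally show ?thesis unfolding e .
  next
    case False
    then have "cell_dec k x = ?u" using x by (simp add: cell_dec_def)
    then show ?thesis using Au Cu by simp
  qed
qed


section \<open>The algebra\<close>

definition pair_cplx :: "('x, 'k::field) cplx" where
  "pair_cplx = line_cplx (\<lambda>k. k = 0 \<or> k = 2) (\<lambda>_. False)"

lemma chain_complex_pair: "chain_complex pair_cplx"
  unfolding pair_cplx_def by (rule chain_complex_line_cplx) (simp add: line_differential_def)

lemma grd_pair: "grd pair_cplx k = (if k = 0 \<or> k = 2 then range line else {0})"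
  by (simp add: pair_cplx_def grd_line_cplx)

abbreviation "pair_mod \<equiv> ar0 pair_cplx"

lemma smodule_pair: "smodule pair_mod"
  by (rule smodule_ar0[OF chain_complex_pair])

lemma bd_pair: "bd (cpx pair_mod n) k x = 0"
  by (simp add: ar0_def pair_cplx_def line_cplx_def zero_cplx_def)

text \<open>The coefficient of \<open>(h; a, a)\<close> in a generator of \<open>C(A)\<close>.\<close>

definition psi_coeff :: "(nat, 'k::field) hvec \<Rightarrow> (('x, 'k) hvec \<times> nat list) list \<Rightarrow> 'k" where
  "psi_coeff p xs = (if length xs = 2 \<and> fst p = 2 \<and> fst (fst (xs ! 0)) = 0 \<and> fst (fst (xs ! 1)) = 0
     then snd p undefined * snd (fst (xs ! 0)) undefined * snd (fst (xs ! 1)) undefined else 0)"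

text \<open>Symmetry holds without signs, because the coefficient is supported on arguments of degree 0.\<close>

lemma is_form_psi: "is_form cone_smod (ar0 V) 0 (\<lambda>p xs. psi_coeff p xs * c)"
proof (rule is_formI, goal_cases)
  case (1 k x y qs)
  then show ?case by (simp add: psi_coeff_def algebra_simps)
next
  case (2 k x a qs)
  then show ?case by (simp add: psi_coeff_def scl_apply)
next
  case (3 p qs i k x y B)
  show ?case
  proof (cases "length qs = 2")
    case True
    then obtain q1 q2 where "qs = [q1, q2]" by (auto simp: numeral_2_eq_2 length_Suc_conv)
    then show ?thesis using 3 by (auto simp: psi_coeff_def less_Suc_eq numeral_2_eq_2 algebra_simps)
  qed (simp add: psi_coeff_def)
next
  case (4 p qs i k x a B)
  show ?case
  proof (cases "length qs = 2")
    case True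
    then obtain q1 q2 where "qs = [q1, q2]" by (auto simp: numeral_2_eq_2 length_Suc_conv)
    then show ?thesis using 4 by (auto simp: psi_coeff_def less_Suc_eq numeral_2_eq_2 scl_apply)
  qed (simp add: psi_coeff_def)
next
  case (5 p qs \<sigma>)
  have p: "act cone_smod (length qs) \<sigma> (fst p) (snd p) = snd p"
    using is_gen_mem(1)[OF 5(1)] by (simp add: mem_def trivial_actionD[OF trivial_cone])
  show ?case
  proof (cases "length qs = 2")
    case True
    then obtain q1 q2 where q: "qs = [q1, q2]" by (auto simp: numeral_2_eq_2 length_Suc_conv)
    have \<sigma>: "\<sigma> permutes {..<2}" using 5(2) True by simp
    have lt: "\<sigma> 0 < 2" "\<sigma> 1 < 2" using permutes_nat_less[OF \<sigma>] by auto
    moreover have "\<sigma> 0 \<noteq> \<sigma> 1" using permutes_inj[OF \<sigma>] by (metis injD zero_neq_one)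
    ultimately have "\<sigma> 0 = 0 \<and> \<sigma> 1 = 1 \<or> \<sigma> 0 = 1 \<and> \<sigma> 1 = 0" by auto
    then have "permute_list \<sigma> qs = [q1, q2] \<or> permute_list \<sigma> qs = [q2, q1]"
      by (auto simp: q permute_list_def numeral_2_eq_2)
    then have m: "psi_coeff p (permute_list \<sigma> qs) = psi_coeff p qs"
      by (auto simp: q psi_coeff_def)
    show ?thesis
    proof (cases "fst (fst q1) = 0 \<and> fst (fst q2) = 0")
      case True
      have "koszul_sign (degs qs) (map \<sigma> [0..<length qs]) = (1 :: 'a)"
        by (rule koszul_sign_even) (use True lt in \<open>auto simp: q less_Suc_eq numeral_2_eq_2\<close>)
      then show ?thesis using m p by (simp add: happ_def)
    next
      case False
      then have "psi_coeff p qs = 0" by (auto simp: q psi_coeff_def)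
      then show ?thesis using m p by (simp add: happ_def)
    qed
  qed (simp add: psi_coeff_def)
next
  case (6 p qs i q B \<sigma>)
  have q: "act (ar0 V) (length B) \<sigma> (fst q) (snd q) = snd q"
    using is_gen_mem(2)[OF 6(1,2)] 6(3) by (simp add: mem_def trivial_actionD[OF trivial_action_ar0])
  have "map fst (qs[i := (happ 0 (act (ar0 V) (length B) \<sigma>) q, permute_list \<sigma> B)]) = map fst qs"
    using 6(2,3) q by (simp add: map_update list_update_same_conv happ_def)
  then have "length qs = 2 \<longrightarrow> fst (qs[i := (happ 0 (act (ar0 V) (length B) \<sigma>) q, permute_list \<sigma> B)] ! j) = fst (qs ! j)" if "j < 2" for j
    using that by (metis length_list_update nth_map)
  from this[of 0] this[of 1] show ?case
    by (cases "length qs = 2") (simp_all add: psi_coeff_def)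
qed

text \<open>The endomorphism of \<open>C(A)\<close> with \<open>(h; a, a) \<mapsto> (id; a')\<close> that vanishes on all other generators.\<close>

definition psi :: "int \<Rightarrow> ((nat, 'x, 'k::field) form \<Rightarrow> 'k) \<Rightarrow> (nat, 'x, 'k) form \<Rightarrow> 'k" where
  "psi k = ext (cspace cone_smod pair_mod 0 k) (\<lambda>p xs. scl (psi_coeff p xs) (unit_gen cone_smod pair_mod 0 (2, line 1)))"

lemma is_form_psi_gen: "is_form cone_smod pair_mod 0 (\<lambda>p xs. scl (psi_coeff p xs) w z)"
  using is_form_psi by (simp add: scl_apply)

lemma psi_gen: "is_gen cone_smod pair_mod 0 p xs \<Longrightarrow> fst p + sum_list (degs xs) = k \<Longrightarrow>
    psi k (gen cone_smod pair_mod 0 p xs) = scl (psi_coeff p xs) (unit_gen cone_smod pair_mod 0 (2, line 1))"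
  unfolding psi_def by (rule ext_gen) (simp_all add: is_form_psi_gen)

lemma is_gen_pair_top: "is_gen cone_smod pair_mod 0 id_op [((2, line 1), [0..<0])]"
  by (rule is_gen_unit[OF has_id_cone]) (simp add: grd_pair)

lemma pair_top_in: "unit_gen cone_smod pair_mod 0 (2, line 1) \<in> cspace cone_smod pair_mod 0 2"
  by (rule gen_in[OF is_gen_pair_top]) simp

lemma psi_coeff_degree:
  assumes "psi_coeff p xs \<noteq> 0" shows "fst p + sum_list (degs xs) = 2"
proof -
  have c: "length xs = 2" "fst p = 2" "fst (fst (xs ! 0)) = 0" "fst (fst (xs ! 1)) = 0"
    using assms unfolding psi_coeff_def by (auto split: if_splits)
  then obtain x y where "xs = [x, y]" by (auto simp: numeral_2_eq_2 length_Suc_conv)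
  then show ?thesis using c by simp
qed

lemma linmap_psi: "linmap (cspace cone_smod pair_mod 0 k) (cspace cone_smod pair_mod 0 k)
    (psi k :: ((nat, 'x, 'k::field) form \<Rightarrow> 'k) \<Rightarrow> (nat, 'x, 'k) form \<Rightarrow> 'k)"
  unfolding psi_def
proof (rule linmap_ext[OF subspace_cspace is_form_psi_gen])
  fix p :: "(nat, 'k) hvec" and xs :: "(('x, 'k) hvec \<times> nat list) list"
  assume k: "fst p + sum_list (degs xs) = k"
  show "scl (psi_coeff p xs) (unit_gen cone_smod pair_mod 0 (2, line 1)) \<in> cspace cone_smod pair_mod 0 k"
  proof (cases "psi_coeff p xs = 0")
    case False
    then show ?thesis using fv.subspace_scale[OF subspace_cspace pair_top_in] psi_coeff_degree[of p xs] k by metis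
  next
    case True
    then show ?thesis by (simp add: fv.subspace_0[OF subspace_cspace])
  qed
qed

lemma gmap_psi: "gmap 0 (schur cone_smod pair_cplx) (schur cone_smod pair_cplx) psi"
  by (simp add: gmap_def linmap_psi)

text \<open>No boundary involves \<open>(h; a, a)\<close>, as \<open>C(2)\<close> vanishes in degree 3, and \<open>a'\<close> is a cycle.\<close>

lemma chain_map_psi:
  "chain_map (schur cone_smod pair_cplx) (schur cone_smod (pair_cplx :: ('x, 'k::field) cplx)) psi"
  unfolding chain_map_def
proof (intro conjI allI ballI)
  fix k and u :: "(nat, 'x, 'k) form \<Rightarrow> 'k" assume "u \<in> grd (schur cone_smod pair_cplx) k"
  then have u: "u \<in> cspace cone_smod pair_mod 0 k" by simp
  note lb = linmap_comp_bd[OF smodule_cone smodule_pair]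
  have "comp_bd cone_smod pair_mod 0 k (psi k u) = psi (k - 1) (comp_bd cone_smod pair_mod 0 k u)"
  proof (rule cspace_eqI_nonzero[OF u])
    show "lin_on (cspace cone_smod pair_mod 0 k) (\<lambda>u. comp_bd cone_smod pair_mod 0 k (psi k u))"
      by (rule lin_on_compose[OF linmap_lin_on[OF linmap_psi] linmap_in[OF linmap_psi] linmap_lin_on[OF lb]])
    show "lin_on (cspace cone_smod pair_mod 0 k) (\<lambda>u. psi (k - 1) (comp_bd cone_smod pair_mod 0 k u))"
      by (rule lin_on_compose[OF linmap_lin_on[OF lb] linmap_in[OF lb] linmap_lin_on[OF linmap_psi]])
    fix p and xs :: "(('x, 'k) hvec \<times> nat list) list"
    assume g: "is_gen cone_smod pair_mod 0 p xs" and k: "fst p + sum_list (degs xs) = k" and nz: "snd p \<noteq> 0"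
    let ?c = "psi_coeff p xs" and ?t = "unit_gen cone_smod (pair_mod :: ('x, 'k) smod) 0 (2, line 1)"
    let ?p = "happ (- 1) (bd (cpx cone_smod (length xs))) p"
    have "comp_bd cone_smod pair_mod 0 2 ?t = gen cone_smod pair_mod 0 (happ (- 1) (bd (cpx cone_smod 1)) id_op) [((2, line 1 :: 'x \<Rightarrow> 'k), [0..<0])]"
      using comp_bd_cycles[OF smodule_cone smodule_pair is_gen_pair_top, of 2] by (simp add: bd_pair[of 0, simplified])
    also have "\<dots> = 0"
    proof (rule gen_zero_head)
      show "is_gen cone_smod pair_mod 0 (happ (- 1) (bd (cpx cone_smod 1)) id_op) [((2, line 1 :: 'x \<Rightarrow> 'k), [0..<0])]"
        using is_gen_bd_head[OF smodule_cone is_gen_pair_top] by simp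
      show "snd (happ (- 1) (bd (cpx cone_smod 1)) id_op) = 0"
        unfolding happ_simps fst_conv snd_conv bd_cone by (rule if_not_P) simp
    qed
    finally have t: "comp_bd cone_smod pair_mod 0 2 ?t = 0" .
    have lhs: "comp_bd cone_smod pair_mod 0 k (scl ?c ?t) = 0"
    proof (cases "?c = 0")
      case True
      have "comp_bd cone_smod pair_mod 0 k 0 = 0" unfolding comp_bd_def by (rule ext_0)
      then show ?thesis using True by simp
    next
      case False
      have "k = 2" using False psi_coeff_degree[of p xs] k by simp
      have "?t \<in> cspace cone_smod pair_mod 0 2" by (rule pair_top_in)
      from lin_on_sclD[OF linmap_lin_on[OF lb] this, of ?c] \<open>k = 2\<close> show ?thesis unfolding t by simp
    qed
    have "fst p \<noteq> 3" using g nz by (cases rule: cone_nonzero) auto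
    then have c0: "psi_coeff ?p xs = 0" by (simp add: psi_coeff_def)
    have g1: "is_gen cone_smod pair_mod 0 ?p xs" by (rule is_gen_bd_head[OF smodule_cone g])
    have "psi (k - 1) (gen cone_smod pair_mod 0 ?p xs) = 0"
      using psi_gen[OF g1, of "k - 1"] k c0 by simp
    then show "comp_bd cone_smod pair_mod 0 k (psi k (gen cone_smod pair_mod 0 p xs)) =
        psi (k - 1) (comp_bd cone_smod pair_mod 0 k (gen cone_smod pair_mod 0 p xs))"
      unfolding psi_gen[OF g k] lhs comp_bd_cycles[OF smodule_cone smodule_pair g k bd_pair] by (rule sym)
  qed
  then show "bd (schur cone_smod pair_cplx) k (psi k u) = psi (k - 1) (bd (schur cone_smod pair_cplx) k u)" by simp
qed (rule gmap_psi)

section \<open>The two \<open>\<infinity>\<close>-morphisms\<close>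

abbreviation cone_bar :: "(nat, 'x, 'k::field) alg \<Rightarrow> (nat, (nat, 'x, 'k) form, 'k) cog" where
  "cone_bar \<equiv> bar cone_cooperad unit_operad zero_map"

abbreviation cone_cobar :: "(nat, 'x, 'k::field) cog \<Rightarrow> (nat, (nat, 'x, 'k) form, 'k) alg" where
  "cone_cobar \<equiv> cobar cone_cooperad unit_operad zero_map"

abbreviation pair_alg :: "(nat, 'x, 'k::field) alg" where
  "pair_alg \<equiv> unit_alg pair_cplx"

lemma acpx_pair_alg [simp]: "acpx (unit_alg V) = V"
  by (simp add: unit_alg_def)

lemma ccpx_cell_cog [simp]: "ccpx cell_cog = cell_cplx"
  by (simp add: cell_cog_def)

lemma ccpx_bar_pair: "ccpx (cone_bar pair_alg) = schur cone_smod pair_cplx"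
  using bar_zero[of pair_alg] by (simp add: chain_complex_pair)

lemma acpx_cobar_cell: "acpx (cone_cobar cell_cog) = schur unit_smod cell_cplx"
  using cobar_zero[of cell_cog] by (simp add: chain_complex_cell)

lemma psi_single: "is_gen cone_smod pair_mod 0 p [(q, B)] \<Longrightarrow> fst p + fst q = k \<Longrightarrow> psi k (gen cone_smod pair_mod 0 p [(q, B)]) = 0"
  using psi_gen[of p "[(q, B)]" k] by (simp add: psi_coeff_def)

text \<open>
  The image of \<open>\<psi>\<close> consists of the primitive elements \<open>(id; x)\<close>, and \<open>\<psi>\<close> kills all of them.  In the
  decomposition \<open>(id; (h; a, a)) + (h; (id; a), (id; a))\<close> the second summand is therefore sent to 0,
  and the first to \<open>(id; (id; a'))\<close>, the decomposition of the image.
\<close>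

lemma cog_mor_psi: "cog_mor cone_cooperad (cone_bar pair_alg) (cone_bar (pair_alg :: (nat, 'x, 'k::field) alg)) psi"
  unfolding cog_mor_def ccpx_bar_pair cdec_bar cone_cooperad_simps acpx_pair_alg
proof (intro conjI allI ballI)
  show "chain_map (schur cone_smod pair_cplx) (schur cone_smod (pair_cplx :: ('x, 'k) cplx)) psi" by (rule chain_map_psi)
  let ?M = "cone_smod :: (nat, 'k) smod" and ?V = "pair_mod :: ('x, 'k) smod"
  fix k and u :: "(nat, 'x, 'k) form \<Rightarrow> 'k" assume "u \<in> grd (schur cone_smod pair_cplx) k"
  then have u: "u \<in> cspace ?M ?V 0 k" by simp
  let ?A = "\<lambda>u. assoc ?M ?M ?V 0 k (schur_l 0 ?M (?M \<circ>\<^sub>S ?M) pair_cplx cone_dec k u)"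
  let ?C = "\<lambda>u. cmap ?M (?M \<circ>\<^sub>S ?V) ?M (?M \<circ>\<^sub>S ?V) 0 (sid ?M) (at0 psi) 0 k u"
  note linA = cone_decompose_lin[OF smodule_pair, of 0 k]
  have linC: "lin_on (cspace ?M (?M \<circ>\<^sub>S ?V) 0 k) ?C" by (rule lin_on_cmap)
  have psim: "smap 0 (?M \<circ>\<^sub>S ?V) (?M \<circ>\<^sub>S ?V) (at0 psi)"
    using smap_at0[OF gmap_psi] by (simp add: composite_ar0[symmetric])
  note s = smap_sid[OF smodule_cone]
  have at0: "at0 psi 0 = psi" by (simp add: at0_def)
  have Ain: "?A u \<in> cspace ?M (?M \<circ>\<^sub>S ?V) 0 k" if "u \<in> cspace ?M ?V 0 k" for u
    by (rule linmap_in[OF linmap_assoc[OF smodule_cone smodule_pair]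
          linmap_in[OF linmap_cmap[OF smap_cone_dec smap_sid[OF smodule_pair], unfolded add_0_right] that]])
  have A0: "?A 0 = 0" by (rule lin_on_zero[OF linA fv.subspace_0[OF subspace_cspace]])
  let ?top = "unit_gen ?M ?V 0 (2, line 1)"
  have Ag: "?A (psi k u) = ?C (?A u)"
  proof (rule cspace_eqI_nonzero[OF u])
    show "lin_on (cspace ?M ?V 0 k) (\<lambda>u. ?A (psi k u))"
      by (rule lin_on_compose[OF linmap_lin_on[OF linmap_psi] linmap_in[OF linmap_psi] linA])
    show "lin_on (cspace ?M ?V 0 k) (\<lambda>u. ?C (?A u))"
      by (rule lin_on_compose[OF linA Ain linC])
    fix p and xs :: "(('x, 'k) hvec \<times> nat list) list"
    assume g: "is_gen ?M ?V 0 p xs" and k: "fst p + sum_list (degs xs) = k" and nz: "snd p \<noteq> 0"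
    from g nz show "?A (psi k (gen ?M ?V 0 p xs)) = ?C (?A (gen ?M ?V 0 p xs))"
    proof (cases rule: cone_nonzero)
      case (one a q B)
      note g1 = g[unfolded one]
      have kq: "fst q = k" using k one by simp
      have B: "B = []" using single_label[OF g1] by simp
      let ?w = "gen ?M ?V 0 (0, line a) [(q, [0..<0])]"
      have gw: "is_gen ?M ?V 0 (0, line a) [(q, [0..<0])]" using g1 B by simp
      have p0: "psi k ?w = 0" by (rule psi_single[OF gw]) (simp add: kq)
      have w: "?w \<in> cspace ?M ?V 0 k" by (rule gen_in[OF gw]) (simp add: kq)
      have g2: "is_gen ?M (?M \<circ>\<^sub>S ?V) 0 id_op [((k, ?w), [0..<0])]"
        by (rule is_gen_unit[OF has_id_cone]) (use w in simp)
      have "?A (gen ?M ?V 0 p xs) = unit_gen ?M (?M \<circ>\<^sub>S ?V) 0 (k, ?w)"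
        unfolding one using cone_decompose_single[OF smodule_pair g1 kq] B by simp
      moreover have "?C (unit_gen ?M (?M \<circ>\<^sub>S ?V) 0 (k, ?w)) = 0"
      proof -
        have "?C (unit_gen ?M (?M \<circ>\<^sub>S ?V) 0 (k, ?w)) =
            gen ?M (?M \<circ>\<^sub>S ?V) 0 (happ 0 (sid ?M 1) id_op) [(happ 0 (at0 psi 0) (k, ?w), [0..<0])]"
          using cmap_gen[OF s psim g2, of k] by simp
        also have "\<dots> = 0"
        proof (rule gen_zero_arg)
          show "is_gen ?M (?M \<circ>\<^sub>S ?V) 0 (happ 0 (sid ?M 1) id_op) [(happ 0 (at0 psi 0) (k, ?w), [0..<0])]"
            using is_gen_cmap[OF g2 s psim] by simp
          show "(0 :: nat) < length [(happ 0 (at0 psi 0) (k, ?w), [0..<0])]" by simp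
          show "snd (fst ([(happ 0 (at0 psi 0) (k, ?w), [0..<0])] ! 0)) = 0"
            by (simp only: nth_Cons_0 fst_conv happ_simps snd_conv at0 p0)
        qed
        finally show ?thesis .
      qed
      moreover have "psi k (gen ?M ?V 0 p xs) = 0" unfolding one by (rule psi_single[OF g1]) (simp add: kq)
      ultimately show ?thesis using A0 by (simp only:)
    next
      case (two j a q1 B1 q2 B2)
      note g1 = g[unfolded two(1,3)]
      have kq: "j + fst q1 + fst q2 = k" using k two by simp
      have B: "B1 = []" "B2 = []" using g1 unfolding is_gen_def by auto
      let ?u1 = "unit_gen ?M ?V 0 q1" and ?u2 = "unit_gen ?M ?V 0 q2"
      let ?w = "gen ?M ?V 0 (j, line a) [(q1, []), (q2, [])]"
      let ?c = "psi_coeff p xs"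
      have gw: "is_gen ?M ?V 0 (j, line a) [(q1, []), (q2, [])]" using g1 B by simp
      have w: "?w \<in> cspace ?M ?V 0 k" by (rule gen_in[OF gw]) (use kq in simp)
      have q: "mem (cpx ?V 0) q1" "mem (cpx ?V 0) q2"
        using is_gen_mem(2)[OF g1, of 0] is_gen_mem(2)[OF g1, of 1] B by simp_all
      have gq1: "is_gen ?M ?V 0 id_op [(q1, [0..<0])]" by (rule is_gen_unit[OF has_id_cone q(1)])
      have gq2: "is_gen ?M ?V 0 id_op [(q2, [0..<0])]" by (rule is_gen_unit[OF has_id_cone q(2)])
      have uin: "?u1 \<in> cspace ?M ?V 0 (fst q1)" "?u2 \<in> cspace ?M ?V 0 (fst q2)"
        by (rule gen_in[OF gq1], simp, rule gen_in[OF gq2], simp)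
      let ?ws = "[((fst q1, ?u1), []), ((fst q2, ?u2), [])] :: ((int \<times> ((nat, 'x, 'k) form \<Rightarrow> 'k)) \<times> nat list) list"
      let ?P = "gen ?M (?M \<circ>\<^sub>S ?V) 0 (j, line a) ?ws"
      have na: "nested_arg ?M ?V (j, line a) [(q1, []), (q2, [])] = ((k, ?w), [0..<0])"
        using kq by (simp add: nested_arg_def consecutive_def)
      have Aw: "?A (gen ?M ?V 0 p xs) = unit_gen ?M (?M \<circ>\<^sub>S ?V) 0 (k, ?w) + ?P"
        unfolding two(1,3) cone_decompose_pair[OF smodule_pair g1 kq] unfolding B na by (simp del: plus_fun_apply)
      have gP: "is_gen ?M (?M \<circ>\<^sub>S ?V) 0 (j, line a) ?ws"
        using gw uin by (simp add: is_gen_def)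
      have gu: "is_gen ?M (?M \<circ>\<^sub>S ?V) 0 id_op [((k, ?w), [0..<0])]"
        by (rule is_gen_unit[OF has_id_cone]) (use w in simp)
      have pw: "psi k ?w = scl ?c ?top"
        using psi_gen[OF gw, of k] kq B unfolding two(1,3) by simp
      have Cu: "?C (unit_gen ?M (?M \<circ>\<^sub>S ?V) 0 (k, ?w)) = unit_gen ?M (?M \<circ>\<^sub>S ?V) 0 (k, scl ?c ?top)"
        using cmap_gen[OF s psim gu, of k] happ_sid[of ?M 1 id_op] pw by (simp add: happ_def grd_cone at0)
      have CP: "?C ?P = 0"
      proof -
        have "?C ?P = gen ?M (?M \<circ>\<^sub>S ?V) 0 (happ 0 (sid ?M 2) (j, line a)) (map_args (at0 psi) ?ws)"
          using cmap_gen[OF s psim gP, of k] kq by (simp add: numeral_2_eq_2)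
        also have "\<dots> = 0"
        proof (rule gen_zero_arg)
          show "is_gen ?M (?M \<circ>\<^sub>S ?V) 0 (happ 0 (sid ?M 2) (j, line a)) (map_args (at0 psi) ?ws)"
            using is_gen_cmap[OF gP s psim] by (simp add: numeral_2_eq_2)
          show "(0 :: nat) < length (map_args (at0 psi) ?ws)" by simp
          have "psi (fst q1) ?u1 = 0" by (rule psi_single[OF gq1]) simp
          then show "snd (fst (map_args (at0 psi) ?ws ! 0)) = 0"
            by (simp only: list.map prod.case nth_Cons_0 fst_conv happ_simps snd_conv list.size at0)
        qed
        finally show ?thesis .
      qed
      have "?C (?A (gen ?M ?V 0 p xs)) = unit_gen ?M (?M \<circ>\<^sub>S ?V) 0 (k, scl ?c ?top)"
      proof -
        have "unit_gen ?M (?M \<circ>\<^sub>S ?V) 0 (k, ?w) \<in> cspace ?M (?M \<circ>\<^sub>S ?V) 0 k" by (rule gen_in[OF gu]) simp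
        moreover have "?P \<in> cspace ?M (?M \<circ>\<^sub>S ?V) 0 k" by (rule gen_in[OF gP]) (use kq in simp)
        ultimately show ?thesis unfolding Aw using lin_on_addD[OF linC] Cu CP by (simp only: add_0_right)
      qed
      moreover have "?A (psi k (gen ?M ?V 0 p xs)) = unit_gen ?M (?M \<circ>\<^sub>S ?V) 0 (k, scl ?c ?top)"
      proof (cases "?c = 0")
        case True
        have "unit_gen ?M (?M \<circ>\<^sub>S ?V) 0 (k, 0) = 0"
          using gen_zero_arg[OF is_gen_unit[OF has_id_cone, of "?M \<circ>\<^sub>S ?V" 0 "(k, 0)"], of 0]
            fv.subspace_0[OF subspace_cspace, of ?M ?V 0 k] by (simp del: zero_fun_apply)
        then show ?thesis unfolding psi_gen[OF g k] True using A0 by (simp only: fv.scale_zero_left)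
      next
        case False
        have k2: "k = 2" using psi_coeff_degree[OF False] k by simp
        have t: "?top \<in> cspace ?M ?V 0 2" by (rule pair_top_in)
        have gt: "is_gen ?M ?V 0 (0, line 1) [((2, line 1), [])]" using is_gen_pair_top by simp
        have "?A ?top = unit_gen ?M (?M \<circ>\<^sub>S ?V) 0 (2, ?top)"
          using cone_decompose_single[OF smodule_pair gt, of 2] k2 by simp
        moreover have "unit_gen ?M (?M \<circ>\<^sub>S ?V) 0 (2, scl ?c ?top) = scl ?c (unit_gen ?M (?M \<circ>\<^sub>S ?V) 0 (2, ?top))"
          by (rule unit_gen_scl[OF has_id_cone]) (use t in simp)
        ultimately show ?thesis unfolding psi_gen[OF g k]
          using lin_on_sclD[OF linA, of ?top ?c] t k2 by (simp only:)
      qed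
      ultimately show ?thesis by (simp only:)
    qed
  qed
  show "?A (psi k u) = schur_r ?M (schur ?M pair_cplx) (schur ?M pair_cplx) psi k (?A u)"
    using Ag by (simp only: composite_ar0[symmetric])
qed

lemma schur_r_idmap_cell: "schur_r unit_smod cell_cplx cell_cplx (idmap cell_cplx) = idmap (schur unit_smod cell_cplx)"
  by (rule schur_r_idmap[OF smodule_unit chain_complex_cell])

lemma schur_r_idmap_pair: "schur_r cone_smod pair_cplx pair_cplx (idmap pair_cplx) = idmap (schur cone_smod pair_cplx)"
  by (rule schur_r_idmap[OF smodule_cone chain_complex_pair])

lemma chain_complex_bar_pair: "chain_complex (schur cone_smod pair_cplx)"
  by (rule chain_complex_composite_cycles[OF smodule_cone smodule_pair bd_pair])

lemma cog_mor_idmap_bar: "cog_mor cone_cooperad (cone_bar pair_alg) (cone_bar pair_alg) (idmap (schur cone_smod pair_cplx))"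
  unfolding cog_mor_def ccpx_bar_pair cdec_bar cone_cooperad_simps acpx_pair_alg
    schur_r_idmap[OF smodule_cone chain_complex_bar_pair]
proof (intro conjI allI ballI)
  show "chain_map (schur cone_smod pair_cplx) (schur cone_smod pair_cplx) (idmap (schur cone_smod pair_cplx))"
    by (rule chain_map_idmap[OF chain_complex_bar_pair])
  fix k u assume u: "u \<in> grd (schur cone_smod pair_cplx) k"
  let ?A = "\<lambda>u. assoc cone_smod cone_smod pair_mod 0 k (schur_l 0 cone_smod (cone_smod \<circ>\<^sub>S cone_smod) pair_cplx cone_dec k u)"
  have u': "u \<in> cspace cone_smod pair_mod 0 k" using u by simp
  have "?A u \<in> cspace cone_smod (cone_smod \<circ>\<^sub>S pair_mod) 0 k"
    by (rule linmap_in[OF linmap_assoc[OF smodule_cone smodule_pair]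
          linmap_in[OF linmap_cmap[OF smap_cone_dec smap_sid[OF smodule_pair], unfolded add_0_right] u']])
  then have "?A u \<in> grd (schur cone_smod (schur cone_smod pair_cplx)) k"
    by (simp only: grd_composite composite_ar0[symmetric])
  then show "?A (idmap (schur cone_smod pair_cplx) k u) = idmap (schur cone_smod (schur cone_smod pair_cplx)) k (?A u)"
    using u by (simp only: idmap_def if_True)
qed

lemma cog_mor_idmap_cell: "cog_mor cone_cooperad cell_cog (cell_cog :: (nat, 'x, 'k::field) cog) (idmap cell_cplx)"
  unfolding cog_mor_def cone_cooperad_simps ccpx_cell_cog schur_r_idmap[OF smodule_cone chain_complex_cell]
proof (intro conjI allI ballI)
  show "chain_map cell_cplx (cell_cplx :: ('x, 'k) cplx) (idmap cell_cplx)" by (rule chain_map_idmap[OF chain_complex_cell])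
  fix k and x :: "'x \<Rightarrow> 'k" assume x: "x \<in> grd cell_cplx k"
  then show "cdec cell_cog k (idmap cell_cplx k x) = idmap (schur cone_smod cell_cplx) k (cdec cell_cog k x)"
    using linmap_in[OF linmap_cell_dec x] by (simp add: cell_cog_def idmap_def)
qed

lemma alg_mor_idmap_pair: "alg_mor unit_operad pair_alg (pair_alg :: (nat, 'x, 'k::field) alg) (idmap pair_cplx)"
proof -
  let ?I = "unit_smod :: (nat, 'k) smod" and ?W = "pair_cplx :: ('x, 'k) cplx"
  have o: "opm unit_operad = unit_smod" by (simp add: unit_operad_def)
  have "idmap ?W k (unit_mul (ar0 ?W) 0 k u) = unit_mul (ar0 ?W) 0 k (idmap (schur ?I ?W) k u)"
    if "u \<in> cspace ?I (ar0 ?W) 0 k" for k u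
    using linmap_in[OF linmap_unit_mul[OF smodule_pair trivial_action_ar0] that] that by (simp add: idmap_def)
  then show ?thesis
    unfolding alg_mor_def o acpx_pair_alg schur_r_idmap[OF smodule_unit chain_complex_pair]
    using chain_map_idmap[OF chain_complex_pair] by (simp add: unit_alg_def)
qed

definition scale_map :: "'k::field \<Rightarrow> ('x, 'k) cplx \<Rightarrow> int \<Rightarrow> ('x \<Rightarrow> 'k) \<Rightarrow> 'x \<Rightarrow> 'k" where
  "scale_map a V k x = (if x \<in> grd V k then scl a x else 0)"

lemma chain_map_scale:
  assumes V: "chain_complex V" shows "chain_map V V (scale_map a V)"
proof -
  note sp = chain_complex_subspace[OF V] and b = chain_complex_bd[OF V]
  have "bd V k x \<in> grd V (k - 1)" "bd V k (scl a x) = scl a (bd V k x)" if "x \<in> grd V k" for k x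
    using gmap_in[OF b that] gmap_scl[OF b that] by simp_all
  then show ?thesis
    unfolding chain_map_def gmap_def linmap_def
    by (auto simp: scale_map_def fv.subspace_scale[OF sp] fv.subspace_add[OF sp] fv.scale_right_distrib mult.commute
      simp del: plus_fun_apply)
qed

text \<open>
  Multiplication by \<open>a\<close> is compatible with the free multiplication.  For \<open>a \<noteq> 1\<close> it does not respect
  the decomposition of \<open>D\<close>, where \<open>(h; e, e)\<close> would be multiplied by \<open>a\<^sup>2\<close>, so this \<open>\<infinity>\<close>-morphism is not
  strict.
\<close>

lemma alg_mor_scale:
  assumes a: "(a :: 'k::field) \<noteq> 0"
  shows "alg_mor unit_operad (cone_cobar cell_cog) (cone_cobar (cell_cog :: (nat, 'x, 'k) cog)) (scale_map a (schur unit_smod cell_cplx))"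
proof -
  let ?I = "unit_smod :: (nat, 'k) smod"
  let ?X = "schur ?I (cell_cplx :: ('x, 'k) cplx)"
  let ?\<Phi> = "scale_map a ?X"
  have o: "opm unit_operad = ?I" by (simp add: unit_operad_def)
  have X: "chain_complex ?X" by (rule chain_complex_unit_composite[OF smodule_cell trivial_action_ar0])
  have s: "smap 0 (ar0 ?X) (ar0 ?X) (at0 ?\<Phi>)" by (rule smap_at0[OF chain_map_gmap[OF chain_map_scale[OF X]]])
  have "?\<Phi> k (free_mul unit_operad cell_cplx k u) = free_mul unit_operad cell_cplx k (schur_r ?I ?X ?X ?\<Phi> k u)"
    if u: "u \<in> cspace ?I (ar0 ?X) 0 k" for k u
  proof -
    obtain w where w: "w \<in> grd (cpx (ar0 ?X) 0) k" "u = unit_gen ?I (ar0 ?X) 0 (k, w)"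
      using cspace_unitE[OF smodule_ar0[OF X] trivial_action_ar0 u] .
    have g: "is_gen ?I (ar0 ?X) 0 id_op [((k, w), [0..<0])]"
      by (rule is_gen_unit[OF has_id_unit]) (use w in simp)
    have "schur_r ?I ?X ?X ?\<Phi> k u = unit_gen ?I (ar0 ?X) 0 (k, scl a w)"
      unfolding w(2) using cmap_gen[OF smap_sid[OF smodule_unit] s g, of k] happ_sid[of ?I 1 id_op] w(1)
      by (simp add: happ_def grd_unit at0_def scale_map_def)
    also have "\<dots> = scl a u" unfolding w(2) by (rule unit_gen_scl[OF has_id_unit w(1)])
    finally have "schur_r ?I ?X ?X ?\<Phi> k u = scl a u" .
    moreover have "free_mul unit_operad cell_cplx k u \<in> grd ?X k" using free_mul_in[OF chain_complex_cell] by simp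
    ultimately show ?thesis using free_mul_scl[OF a, of cell_cplx k u] by (simp only: scale_map_def if_True)
  qed
  then show ?thesis
    unfolding alg_mor_def o acpx_cobar_cell amul_cobar ccpx_cell_cog
    using chain_map_scale[OF X] by simp
qed

lemma scale_map_one: "scale_map 1 V = idmap V"
  by (auto simp: scale_map_def idmap_def fun_eq_iff)

section \<open>The action of one or two maps of degree zero\<close>

lemma is_form_restrict:
  assumes "is_form M N n \<phi>"
  shows "is_form M N n (\<lambda>p qs. if length qs = m then \<phi> p qs else 0)"
  unfolding is_form_def
proof (intro allI impI, goal_cases)
  case (1 p qs)
  show ?case
    using assms[unfolded is_form_def, rule_format, OF 1] by (cases "length qs = m") (simp_all add: hlin_def)
qed

lemma is_form_diff:
  assumes "is_form M N n \<phi>" "is_form M N n \<psi>"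
  shows "is_form M N n (\<lambda>p qs. \<phi> p qs - \<psi> p qs)"
  unfolding is_form_def
proof (intro allI impI, goal_cases)
  case (1 p qs)
  show ?case
    using assms[unfolded is_form_def, rule_format, OF 1] by (simp add: hlin_def algebra_simps)
qed

lemma permutations_two: "{\<sigma>. \<sigma> permutes {..<Suc (Suc 0)}} = {id, Transposition.transpose 0 (Suc 0)}"
proof -
  have "{..<Suc (Suc 0)} = {0, Suc 0}" by auto
  then show ?thesis using permutes_doubleton_iff[of _ 0 "Suc 0"] by auto
qed

lemma is_gen_ar0_labels: "is_gen M (ar0 V) 0 p xs \<Longrightarrow> x \<in> set xs \<Longrightarrow> snd x = []"
  unfolding is_gen_def by auto

lemma gmap_sum:
  assumes W: "chain_complex W" and f: "gmap 0 V W f" "gmap 0 V W g"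
  shows "gmap 0 V W (\<lambda>k x. f k x + g k x)"
  using f unfolding gmap_def linmap_def
  by (auto simp: fv.subspace_add[OF chain_complex_subspace[OF W]] fv.scale_right_distrib algebra_simps simp del: plus_fun_apply)

abbreviation map_tens :: "(int \<Rightarrow> ('x \<Rightarrow> 'k) \<Rightarrow> 'y \<Rightarrow> 'k) \<Rightarrow>
    (('x, 'k) hvec \<times> nat list) list \<Rightarrow> (('y, 'k) hvec \<times> nat list) list" where
  "map_tens f xs \<equiv> map (\<lambda>q. (happ 0 f (fst q), [])) xs"

lemma map_args_at0:
  assumes "is_gen M (ar0 V) 0 p xs" shows "map_args (at0 f) xs = map_tens f xs"
  using is_gen_ar0_labels[OF assms] by (auto simp: at0_def)

lemma is_form_tens:
  assumes M: "smodule M" and V: "chain_complex V" and f: "gmap 0 V W f" and z: "is_form M (ar0 W) 0 z"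
  shows "is_form M (ar0 V) 0 (\<lambda>p xs. z p (map_tens f xs))"
proof (rule is_form_cong[OF M smodule_ar0[OF V] is_form_cmap[OF smap_sid[OF M] smap_at0[OF f] z]])
  fix p xs assume g: "is_gen M (ar0 V) 0 p xs"
  show "z p (map_tens f xs) = z (happ 0 (sid M (length xs)) p) (map_args (at0 f) xs)"
    by (simp only: happ_sid[OF is_gen_mem(1)[OF g]] map_args_at0[OF g])
qed

lemma is_gen_tens:
  assumes M: "smodule M" and f: "gmap 0 V W f" and g: "is_gen M (ar0 V) 0 p xs"
  shows "is_gen M (ar0 W) 0 p (map_tens f xs)"
  using is_gen_cmap[OF g smap_sid[OF M] smap_at0[OF f]] unfolding happ_sid[OF is_gen_mem(1)[OF g]] map_args_at0[OF g] .

lemma F_act_one: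
  assumes M: "smodule M" and V: "chain_complex V" and f: "gmap 0 V W (cur a)"
    and g: "is_gen M (ar0 V) 0 p [(x, [])]" and k: "fst p + fst x = k"
  shows "F_act M V W [(0, a)] k (gen M (ar0 V) 0 p [(x, [])]) = tens M W p [happ 0 (cur a) x]"
proof -
  let ?h = "\<lambda>p xs. if length xs = 1 then gen M (ar0 W) 0 p (map_tens (cur a) xs) else 0"
  have h: "F_act M V W [(0, a)] k = ext (cspace M (ar0 V) 0 k) ?h"
    unfolding F_act_def grd_composite
  proof (rule arg_cong[of _ _ "ext _"], intro ext)
    fix p xs y
    have "{\<sigma>. \<sigma> permutes {..<Suc 0}} = {id}" using permutes_1 permutes_id by blast
    then show "(let n = length [(0, a)] in if length xs = n
        then \<Sum>\<sigma> | \<sigma> permutes {..<n}. scl (ksgn (fst p * sum_list (map fst [(0, a)])) * koszul_sign (map fst [(0, a)]) (map \<sigma> [0..<n]) *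
            ksgn (\<Sum>i<n. fst (fst (xs ! i)) * (\<Sum>j\<in>{i<..<n}. fst ([(0, a)] ! \<sigma> j))))
         (tens M W p (map (\<lambda>i. happ (fst ([(0, a)] ! \<sigma> i)) (cur (snd ([(0, a)] ! \<sigma> i))) (fst (xs ! i))) [0..<n]))
       else 0) y = ?h p xs y"
      by (auto simp: length_Suc_conv koszul_sign_sorted)
  qed
  have "is_form M (ar0 V) 0 (\<lambda>p xs. ?h p xs z)" for z
  proof -
    have "is_form M (ar0 V) 0 (\<lambda>p xs. gen M (ar0 W) 0 p (map_tens (cur a) xs) z)"
      by (rule is_form_gen) (rule is_form_tens[OF M V f])
    from is_form_restrict[OF this, of 1] show ?thesis by (simp add: if_distrib[of "\<lambda>f. f z"] cong: if_cong)
  qed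
  from ext_gen[OF g _ this, of k] show ?thesis unfolding h using k by simp
qed

text \<open>The defining sum has two terms, for the identity and the transposition.\<close>

lemma F_act_pair:
  "F_act M V W [(i, a), (j, b)] k = ext (cspace M (ar0 V) 0 k) (\<lambda>p xs. if length xs = 2
    then scl (ksgn (fst p * (i + j)) * ksgn (fst (fst (xs ! 0)) * j))
        (tens M W p [happ i (cur a) (fst (xs ! 0)), happ j (cur b) (fst (xs ! 1))]) +
      scl (ksgn (fst p * (i + j)) * koszul_sign [i, j] [1, 0] * ksgn (fst (fst (xs ! 0)) * i))
        (tens M W p [happ j (cur b) (fst (xs ! 0)), happ i (cur a) (fst (xs ! 1))]) else 0)"
  unfolding F_act_def grd_composite
proof (rule arg_cong[of _ _ "ext _"], intro ext)
  fix p :: "int \<times> ('a \<Rightarrow> 'b)" and xs :: "((int \<times> ('c \<Rightarrow> 'b)) \<times> nat list) list" and y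
  have ne: "id \<noteq> Transposition.transpose 0 (Suc 0)" by (metis id_apply transpose_apply_first n_not_Suc_n)
  have iv: "{0<..<Suc (Suc 0)} = {Suc 0}" "{Suc 0<..<Suc (Suc 0)} = {}" by auto
  show "(let n = length [(i, a), (j, b)] in if length xs = n
      then \<Sum>\<sigma> | \<sigma> permutes {..<n}. scl (ksgn (fst p * sum_list (map fst [(i, a), (j, b)])) * koszul_sign (map fst [(i, a), (j, b)]) (map \<sigma> [0..<n]) *
          ksgn (\<Sum>l<n. fst (fst (xs ! l)) * (\<Sum>m\<in>{l<..<n}. fst ([(i, a), (j, b)] ! \<sigma> m))))
       (tens M W p (map (\<lambda>l. happ (fst ([(i, a), (j, b)] ! \<sigma> l)) (cur (snd ([(i, a), (j, b)] ! \<sigma> l))) (fst (xs ! l))) [0..<n]))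
     else 0) y = (if length xs = 2
    then scl (ksgn (fst p * (i + j)) * ksgn (fst (fst (xs ! 0)) * j))
        (tens M W p [happ i (cur a) (fst (xs ! 0)), happ j (cur b) (fst (xs ! 1))]) +
      scl (ksgn (fst p * (i + j)) * koszul_sign [i, j] [1, 0] * ksgn (fst (fst (xs ! 0)) * i))
        (tens M W p [happ j (cur b) (fst (xs ! 0)), happ i (cur a) (fst (xs ! 1))]) else 0) y"
    using ne by (simp add: permutations_two koszul_sign_sorted numeral_2_eq_2 iv)
qed

text \<open>
  For maps of degree 0 all signs are 1.  The bilinear expression in \<open>f\<close> and \<open>g\<close> is obtained by polarization
  from the maps \<open>M(f)\<close>, which are known to pull forms back to forms.
\<close>

lemma F_act_two:
  fixes M :: "('a, 'b::field) smod"
  assumes M: "smodule M" and V: "chain_complex V" and W: "chain_complex W"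
    and f: "gmap 0 V W (cur a)" "gmap 0 V W (cur b)"
    and g: "is_gen M (ar0 V) 0 p [(x, []), (y, [])]" and k: "fst p + fst x + fst y = k"
  shows "F_act M V W [(0, a), (0, b)] k (gen M (ar0 V) 0 p [(x, []), (y, [])]) =
    tens M W p [happ 0 (cur a) x, happ 0 (cur b) y] + tens M W p [happ 0 (cur b) x, happ 0 (cur a) y]"
proof -
  let ?h = "\<lambda>p xs. if length xs = 2 then tens M W p [happ 0 (cur a) (fst (xs ! 0)), happ 0 (cur b) (fst (xs ! 1))] +
    tens M W p [happ 0 (cur b) (fst (xs ! 0)), happ 0 (cur a) (fst (xs ! 1))] else 0"
  have h: "F_act M V W [(0, a), (0, b)] k = ext (cspace M (ar0 V) 0 k) ?h"
  proof -
    have "koszul_sign [0, 0] [1, 0] = (1 :: 'b)" by (rule koszul_sign_even) auto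
    then show ?thesis unfolding F_act_pair by (simp only: add_0_right mult_zero_right ksgn_0 mult_1 fv.scale_one)
  qed
  have form: "is_form M (ar0 V) 0 (\<lambda>p xs. ?h p xs z)" for z
  proof (cases "is_form M (ar0 W) 0 z")
    case False
    then show ?thesis by (simp add: gen_def if_distrib[of "\<lambda>f. f z"] cong: if_cong)
  next
    case True
    let ?s = "\<lambda>k x. cur a k x + cur b k x"
    note T = is_form_tens[OF M V _ True]
    have "is_form M (ar0 V) 0 (\<lambda>p xs. if length xs = 2
      then z p (map_tens ?s xs) - z p (map_tens (cur a) xs) - z p (map_tens (cur b) xs) else 0)"
      by (intro is_form_restrict is_form_diff T gmap_sum W f)
    then show ?thesis
    proof (rule is_form_cong[OF M smodule_ar0[OF V]])
      fix p xs assume g: "is_gen M (ar0 V) 0 p xs"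
      show "?h p xs z = (if length xs = 2
        then z p (map_tens ?s xs) - z p (map_tens (cur a) xs) - z p (map_tens (cur b) xs) else 0)"
      proof (cases "length xs = 2")
        case True
        then obtain i x j y where xs: "xs = [((i, x), []), ((j, y), [])]"
        proof -
          obtain q r where xs: "xs = [q, r]" using True by (auto simp: numeral_2_eq_2 length_Suc_conv)
          then have "snd q = []" "snd r = []" using is_gen_ar0_labels[OF g] by simp_all
          then show thesis using that[of "fst (fst q)" "snd (fst q)" "fst (fst r)" "snd (fst r)"] xs
            by (cases q, cases r) simp
        qed
        note S = is_gen_tens[OF M gmap_sum[OF W f] g, unfolded xs]
        have xy: "x \<in> grd V i" "y \<in> grd V j"
          using is_gen_mem(2)[OF g, of 0] is_gen_mem(2)[OF g, of 1] unfolding xs by simp_all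
        have gs: "is_gen M (ar0 W) 0 p [((i, u), []), ((j, v), [])]" if "u \<in> grd W i" "v \<in> grd W j" for u v
          using g that unfolding xs is_gen_def by auto
        note in1 = gmap_in[OF f(1) xy(1)] gmap_in[OF f(2) xy(1)] gmap_in[OF f(1) xy(2)] gmap_in[OF f(2) xy(2)]
        note in2 = in1[unfolded add_0_right]
        have A: "z p [((i, u + v), []), ((j, w), [])] = z p [((i, u), []), ((j, w), [])] + z p [((i, v), []), ((j, w), [])]"
          if "u \<in> grd W i" "v \<in> grd W i" "w \<in> grd W j" for u v w
          using form_add_arg[OF \<open>is_form M (ar0 W) 0 z\<close> gs[OF that(1,3)], of 0 i u "[]" v] that by simp
        have B: "z p [((i, w), []), ((j, u + v), [])] = z p [((i, w), []), ((j, u), [])] + z p [((i, w), []), ((j, v), [])]"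
          if "u \<in> grd W j" "v \<in> grd W j" "w \<in> grd W i" for u v w
          using form_add_arg[OF \<open>is_form M (ar0 W) 0 z\<close> gs[OF that(3,1)], of 1 j u "[]" v] that by simp
        have s: "cur a i x + cur b i x \<in> grd W i"
          by (rule fv.subspace_add[OF chain_complex_subspace[OF W] in2(1,2)])
        show ?thesis
          unfolding xs using in2 s by (simp add: happ_def A B gen_form[OF \<open>is_form M (ar0 W) 0 z\<close>] del: plus_fun_apply)
             (simp add: gen_form[OF \<open>is_form M (ar0 W) 0 z\<close>])
      qed simp
    qed
  qed
  show ?thesis unfolding h
    using ext_gen[where g = ?h and k = k, OF g _ form] k by (simp del: plus_fun_apply)
qed


section \<open>The two projections\<close>

lemma lin_on_F_act: "lin_on (cspace M (ar0 V) 0 k) (F_act M V W fs k)"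
  unfolding F_act_def grd_composite by (rule lin_on_ext)

lemma F_act_other:
  assumes "length fs \<noteq> length xs"
  shows "F_act M V W fs k (gen M (ar0 V) 0 p xs) = 0"
  unfolding F_act_def grd_composite using assms by (auto simp: ext_def gen_def fun_eq_iff Let_def)

abbreviation cell_pair_hom :: "(int \<times> ('x \<Rightarrow> 'k) \<times> 'x, 'k::field) cplx" where
  "cell_pair_hom \<equiv> hom_cplx cell_cplx pair_cplx"

lemma grd_hom: "f \<in> grd (hom_cplx V W) r \<longleftrightarrow> gmap r V W (cur f)"
  by (simp add: hom_cplx_def)

text \<open>The projections of \<open>hom\<^sub>l(\<Phi>, 1)\<close> and of \<open>hom\<^sub>r(1, \<Psi>)\<close>, for \<open>\<Phi>\<close> the multiplication by 2 and \<open>\<Psi>\<close> the map \<open>\<psi>\<close>.\<close>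

definition proj_l :: "(int \<times> ('x \<Rightarrow> 'k) \<times> 'x, 'k::field) hvec list \<Rightarrow> int \<times> ('x \<Rightarrow> 'k) \<times> 'x \<Rightarrow> 'k" where
  "proj_l fs = (let r = sum_list (map fst fs) in
     uncur (\<lambda>k x. idmap pair_cplx (k + r) (amul pair_alg (k + r) (F_act unit_smod cell_cplx pair_cplx fs k
       (scale_map 2 (schur unit_smod cell_cplx) k (tens unit_smod cell_cplx (0, line 1) [(k, x)]))))))"

definition proj_r :: "(int \<times> ('x \<Rightarrow> 'k) \<times> 'x, 'k::field) hvec list \<Rightarrow> int \<times> ('x \<Rightarrow> 'k) \<times> 'x \<Rightarrow> 'k" where
  "proj_r fs = (let r = sum_list (map fst fs) in
     uncur (\<lambda>k x. cproj cone_cooperad pair_cplx (k + r) (psi (k + r) (F_act cone_smod cell_cplx pair_cplx fs k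
       (cell_dec k (idmap cell_cplx k x))))))"

text \<open>
  Only total degree 0 is considered, since this is the degree of the element on which the two
  composites are compared; a list with one entry then has an entry of degree 0.
\<close>

lemma proj_l:
  fixes ys :: "(int \<times> ('x \<Rightarrow> 'k) \<times> 'x, 'k::field) hvec list"
  assumes ys: "\<forall>f\<in>set ys. mem cell_pair_hom f" "sum_list (map fst ys) = 0" and x: "x \<in> grd cell_cplx k"
  shows "proj_l ys (k, x, y) = (if length ys = 1 then 2 * snd (hd ys) (k, x, y) else 0)"
proof -
  let ?I = "unit_smod :: (nat, 'k) smod" and ?D = "cell_cplx :: ('x, 'k) cplx" and ?A = "pair_cplx :: ('x, 'k) cplx"
  let ?u = "gen ?I (ar0 ?D) 0 (0, line 1) [((k, x), [])]"
  have g: "is_gen ?I (ar0 ?D) 0 (0, line 1) [((k, x), [])]"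
    using is_gen_unit[OF has_id_unit, of "ar0 ?D" 0 "(k, x)"] x by simp
  have u: "?u \<in> cspace ?I (ar0 ?D) 0 k" by (rule gen_in[OF g]) simp
  have F: "F_act ?I ?D ?A ys k (scl 2 ?u) = scl 2 (F_act ?I ?D ?A ys k ?u)"
    by (rule lin_on_sclD[OF lin_on_F_act u])
  have U: "lin_on (cspace ?I (ar0 ?A) 0 k) (unit_mul (ar0 ?A) 0 k)"
    by (rule linmap_lin_on[OF linmap_unit_mul[OF smodule_pair trivial_action_ar0]])
  have P: "proj_l ys (k, x, y) = idmap ?A k (unit_mul (ar0 ?A) 0 k (F_act ?I ?D ?A ys k (scl 2 ?u))) y"
    using u by (simp add: proj_l_def ys(2) uncur_def unit_alg_def scale_map_def)
  show ?thesis
  proof (cases "length ys = 1")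
    case True
    then obtain f where f: "ys = [(0, f)]" using ys(2) by (auto simp: length_Suc_conv)
    have gm: "gmap 0 ?D ?A (cur f)" using ys(1) by (simp add: f grd_hom)
    let ?v = "gen ?I (ar0 ?A) 0 (0, line 1) [((k, cur f k x), [])]"
    have fx: "cur f k x \<in> grd ?A k" using gmap_in[OF gm x] by simp
    have v: "?v \<in> cspace ?I (ar0 ?A) 0 k"
      using unit_gen_in[OF has_id_unit, of "cur f k x" "ar0 ?A" 0 k] fx by simp
    have "F_act ?I ?D ?A ys k ?u = ?v"
      unfolding f using F_act_one[OF smodule_unit chain_complex_cell gm g] by (simp add: happ_def)
    moreover have "unit_mul (ar0 ?A) 0 k (scl 2 ?v) = scl 2 (cur f k x)"
      using lin_on_sclD[OF U v] unit_mul_unit_gen[OF trivial_action_ar0, of "cur f k x" ?A 0 k] fx by simp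
    moreover have "scl 2 (cur f k x) \<in> grd ?A k"
      by (rule fv.subspace_scale[OF chain_complex_subspace[OF chain_complex_pair] fx])
    ultimately have "proj_l ys (k, x, y) = scl 2 (cur f k x) y"
      unfolding P F by (simp only: idmap_def if_True)
    then show ?thesis by (simp add: f cur_def scl_apply)
  next
    case False
    then have "F_act ?I ?D ?A ys k ?u = 0" by (intro F_act_other) simp
    moreover have "unit_mul (ar0 ?A) 0 k 0 = 0" by (rule lin_on_zero[OF U fv.subspace_0[OF subspace_cspace]])
    ultimately have "proj_l ys (k, x, y) = idmap ?A k 0 y" unfolding P F by (simp only: fv.scale_zero_right)
    then show ?thesis using False by (simp add: idmap_def)
  qed
qed

text \<open>The coordinates of \<open>hom(D, A)\<close> that record the coefficient of \<open>f(e)\<close> and of \<open>f(d)\<close> at \<open>undefined\<close>.\<close>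

abbreviation vertex_coord :: "int \<times> ('x \<Rightarrow> 'k::field) \<times> 'x" where "vertex_coord \<equiv> (0, line 1, undefined)"
abbreviation face_coord :: "int \<times> ('x \<Rightarrow> 'k::field) \<times> 'x" where "face_coord \<equiv> (2, line 1, undefined)"

lemma hom_degree:
  assumes "f \<in> grd cell_pair_hom r" "r \<noteq> 0" "r \<noteq> 2" shows "cur f 0 (line 1) = 0"
  using gmap_in[of r cell_cplx pair_cplx "cur f" "line 1" 0] assms by (simp add: grd_hom grd_cell grd_pair)

lemma psi_zeroI:
  assumes "\<And>c. w (\<lambda>p xs. psi_coeff p xs * c) = 0"
  shows "psi k w = 0"
  using assms by (simp add: psi_def ext_def fun_eq_iff scl_apply)

lemma cproj_0: "cproj cone_cooperad V k 0 = 0"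
  by (rule lin_on_zero[OF lin_on_cproj fv.subspace_0[OF subspace_cspace]])

text \<open>
  Of the decomposition \<open>(id; d) + (h; e, e)\<close>, only the second summand can produce an element
  \<open>(h; a, a)\<close>, and only from two maps of degree 0; the factor 2 is due to the two orders of the maps.
\<close>

lemma proj_r:
  fixes ys :: "(int \<times> ('x \<Rightarrow> 'k) \<times> 'x, 'k::field) hvec list"
  assumes ys: "\<forall>f\<in>set ys. mem cell_pair_hom f" "sum_list (map fst ys) = 0"
  shows "proj_r ys face_coord = (if length ys = 2 then 2 * snd (ys ! 0) vertex_coord * snd (ys ! 1) vertex_coord else 0)"
proof -
  let ?C = "cone_smod :: (nat, 'k) smod" and ?D = "cell_cplx :: ('x, 'k) cplx" and ?A = "pair_cplx :: ('x, 'k) cplx"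
  let ?u = "gen ?C (ar0 ?D) 0 (0, line 1) [((2, line 1), [])]"
  let ?v = "gen ?C (ar0 ?D) 0 (2, line 1) vertex_pair"
  let ?F = "F_act ?C ?D ?A ys 2"
  have u: "?u \<in> cspace ?C (ar0 ?D) 0 2" using unit_gen_in[OF has_id_cone, of "line 1" "ar0 ?D" 0 2] by (simp add: grd_cell)
  have v: "?v \<in> cspace ?C (ar0 ?D) 0 2" by (rule vertex_pair_in) simp
  have F: "?F (?u + ?v) = ?F ?u + ?F ?v" by (rule lin_on_addD[OF lin_on_F_act u v])
  have P: "proj_r ys face_coord = cproj cone_cooperad ?A 2 (psi 2 (?F ?u + ?F ?v)) undefined"
    using F by (simp add: proj_r_def ys(2) uncur_def idmap_def grd_cell cell_dec_def del: plus_fun_apply)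
  have coeff_form: "is_form ?C (ar0 ?A) 0 (\<lambda>p xs. psi_coeff p xs * c)" for c by (rule is_form_psi)
  show ?thesis
  proof (cases "length ys = 2 \<and> fst (ys ! 0) = 0 \<and> fst (ys ! 1) = 0")
    case True
    then obtain a b where ab: "ys = [(0, a), (0, b)]"
      by (cases ys; cases "tl ys") (auto simp: numeral_2_eq_2 length_Suc_conv)
    have gm: "gmap 0 ?D ?A (cur a)" "gmap 0 ?D ?A (cur b)" using ys(1) by (simp_all add: ab grd_hom)
    have "cur f 0 (line 1) = line (f vertex_coord)" if gf: "gmap 0 ?D ?A (cur f)" for f
    proof -
      have "cur f 0 (line 1) \<in> range line"
        using gmap_in[OF gf, of "line 1" 0] by (simp add: grd_cell grd_pair)
      then obtain s where s: "cur f 0 (line 1) = line s" by blast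
      then have "s = f vertex_coord" by (metis cur_def line_undefined)
      then show ?thesis using s by simp
    qed
    then have l: "cur a 0 (line 1) = line (a vertex_coord)" "cur b 0 (line 1) = line (b vertex_coord)" using gm by auto
    let ?w = "\<lambda>s t. gen ?C (ar0 ?A) 0 (2, line 1) [((0, line s), []), ((0, line t), [])]"
    let ?top = "unit_gen ?C (ar0 ?A) 0 (2, line 1)"
    have gw: "is_gen ?C (ar0 ?A) 0 (2, line 1) [((0, line s), []), ((0, line t), [])]" for s t
      by (simp add: is_gen_def grd_cone grd_pair)
    have w: "?w s t \<in> cspace ?C (ar0 ?A) 0 2" for s t by (rule gen_in[OF gw]) simp
    have pw: "psi 2 (?w s t) = scl (s * t) ?top" for s t
      using psi_gen[where k = 2, OF gw] by (simp add: psi_coeff_def)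
    have Fu: "?F ?u = 0" by (rule F_act_other) (simp add: ab)
    have Fv: "?F ?v = ?w (a vertex_coord) (b vertex_coord) + ?w (b vertex_coord) (a vertex_coord)"
      unfolding ab using F_act_two[OF smodule_cone chain_complex_cell chain_complex_pair gm is_gen_vertex_pair, of 2 1 2]
      by (simp add: happ_def l del: plus_fun_apply)
    have "psi 2 (?F ?u + ?F ?v) = scl (2 * a vertex_coord * b vertex_coord) ?top"
      unfolding Fu Fv add_0_left lin_on_addD[OF linmap_lin_on[OF linmap_psi] w w] pw
      by (simp add: fv.scale_left_distrib[symmetric] algebra_simps del: plus_fun_apply)
    moreover have "cproj cone_cooperad ?A 2 (scl c ?top) = line c" for c
      using lin_on_sclD[OF lin_on_cproj, of ?top ?A 2 c] pair_top_in cproj_unit_gen[of "line 1" ?A 2]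
      by (simp add: grd_pair line_scl)
    ultimately show ?thesis unfolding P by (simp add: ab)
  next
    case False
    \<comment> \<open>In the remaining cases the values below vanish at the forms at which \<open>psi\<close> evaluates them, so it is immaterial whether the maps are well defined on generators.\<close>
    have "?F ?u (\<lambda>p xs. psi_coeff p xs * c) = 0" for c
    proof (cases "length ys = 1")
      case True
      then obtain f where f: "ys = [(0, f)]" using ys(2) by (auto simp: length_Suc_conv)
      have gm: "gmap 0 ?D ?A (cur f)" using ys(1) by (simp add: f grd_hom)
      have "is_gen ?C (ar0 ?D) 0 (0, line 1) [((2, line 1), [])]"
        using is_gen_unit[OF has_id_cone, of "ar0 ?D" 0 "(2, line 1)"] by (simp add: grd_cell)
      then show ?thesis
        unfolding f F_act_one[OF smodule_cone chain_complex_cell gm, of "(0, line 1)" "(2, line 1)" 2, simplified]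
        using gen_form[OF coeff_form] F_act_one[OF smodule_cone chain_complex_cell gm, of "(0, line 1)" "(2, line 1)" 2]
        by (simp add: psi_coeff_def)
    next
      case False
      then have "?F ?u = 0" by (intro F_act_other) simp
      then show ?thesis by (simp only: zero_fun_apply)
    qed
    moreover have "?F ?v (\<lambda>p xs. psi_coeff p xs * c) = 0" for c
    proof (cases "length ys = 2")
      case True
      then obtain i a j b where ab: "ys = [(i, a), (j, b)]" by (auto simp: numeral_2_eq_2 length_Suc_conv)
      have ij: "i \<noteq> 0" "j \<noteq> 0" using ys(2) False by (auto simp: ab)
      show ?thesis
        unfolding ab F_act_pair using ij
        by (simp add: ext_def gen_def scl_apply psi_coeff_def is_form_psi[unfolded psi_coeff_def])
    next
      case False
      then have "?F ?v = 0" by (intro F_act_other) simp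
      then show ?thesis by (simp only: zero_fun_apply)
    qed
    ultimately have "psi 2 (?F ?u + ?F ?v) = 0" by (intro psi_zeroI) simp
    then have "proj_r ys face_coord = 0" unfolding P by (simp only: cproj_0 zero_fun_apply)
    moreover have "2 * snd (ys ! 0) vertex_coord * snd (ys ! 1) vertex_coord = 0" if l2: "length ys = 2"
    proof -
      obtain i a j b where ab: "ys = [(i, a), (j, b)]" using l2 by (auto simp: numeral_2_eq_2 length_Suc_conv)
      have m: "a \<in> grd cell_pair_hom i" "b \<in> grd cell_pair_hom j" using ys(1) by (simp_all add: ab)
      have "i \<noteq> 0 \<and> i \<noteq> 2 \<or> j \<noteq> 0 \<and> j \<noteq> 2" using ys(2) False by (auto simp: ab)
      then have "cur a 0 (line 1) = 0 \<or> cur b 0 (line 1) = 0" using hom_degree m by blast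
      then have "a vertex_coord = 0 \<or> b vertex_coord = 0" by (auto simp: cur_def dest: fun_cong)
      then show ?thesis by (auto simp: ab)
    qed
    ultimately show ?thesis by simp
  qed
qed

section \<open>Symmetric powers\<close>

abbreviation sym_args :: "('x, 'k) cplx \<Rightarrow> ('x, 'k) hvec list \<Rightarrow> bool" where
  "sym_args V xs \<equiv> xs \<noteq> [] \<and> (\<forall>x\<in>set xs. mem V x)"

lemma subspace_sym_space: "fv.subspace (sym_space V k)"
  by (simp add: sym_space_def)

lemma sym_in: "sym_args V xs \<Longrightarrow> sum_list (map fst xs) = k \<Longrightarrow> sym V xs \<in> sym_space V k"
  unfolding sym_space_def by (intro fv.span_base) blast

lemma lin_on_sym_ext: "lin_on (sym_space V k) (sym_ext (sym_space V k) h)"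
  using subspace_sym_space[of V k] by (auto simp: lin_on_def sym_ext_def fv.subspace_def fun_eq_iff scl_def)

lemma lin_on_coordinate: "lin_on U f \<Longrightarrow> lin_on U (\<lambda>u _. f u z)"
  by (simp add: lin_on_def fun_eq_iff scl_def)

lemma sym_space_eqI:
  assumes u: "u \<in> sym_space V k" and f: "lin_on (sym_space V k) f" and g: "lin_on (sym_space V k) g"
    and eq: "\<And>xs. sym_args V xs \<Longrightarrow> sum_list (map fst xs) = k \<Longrightarrow> f (sym V xs) = g (sym V xs)"
  shows "f u = g u"
proof -
  have "u \<in> sym_space V k \<and> f u = g u"
    using u unfolding sym_space_def
  proof (induction rule: fv.span_induct_alt)
    case base
    have "0 \<in> sym_space V k" by (rule fv.subspace_0[OF subspace_sym_space])
    then have "0 \<in> sym_space V k \<and> f 0 = g 0" using lin_on_zero[OF f] lin_on_zero[OF g] by metis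
    then show ?case unfolding sym_space_def .
  next
    case (step c x y)
    from step(1) obtain xs where x: "x = sym V xs" "sym_args V xs" "sum_list (map fst xs) = k" by blast
    have xi: "x \<in> sym_space V k" unfolding x(1) by (rule sym_in[OF x(2,3)])
    have y: "y \<in> sym_space V k" "f y = g y" using step(2) by (simp_all add: sym_space_def)
    have cx: "scl c x \<in> sym_space V k" by (rule fv.subspace_scale[OF subspace_sym_space xi])
    have "f (scl c x + y) = g (scl c x + y)"
      unfolding lin_on_addD[OF f cx y(1)] lin_on_addD[OF g cx y(1)] lin_on_sclD[OF f xi] lin_on_sclD[OF g xi]
      using eq[OF x(2,3)] y(2) x(1) by (simp only:)
    then have "scl c x + y \<in> sym_space V k \<and> f (scl c x + y) = g (scl c x + y)"
      using fv.subspace_add[OF subspace_sym_space cx y(1)] by blast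
    then show ?case unfolding sym_space_def .
  qed
  then show ?thesis by blast
qed

lemma is_sform_cong:
  assumes V: "\<And>k. fv.subspace (grd V k)" and \<psi>: "is_sform V \<psi>" and eq: "\<And>xs. sym_args V xs \<Longrightarrow> \<phi> xs = \<psi> xs"
  shows "is_sform V \<phi>"
  unfolding is_sform_def
proof (intro allI impI conjI)
  fix xs assume xs: "sym_args V xs"
  note F = \<psi>[unfolded is_sform_def, rule_format, OF xs]
  have up: "\<phi> (xs[i := x]) = \<psi> (xs[i := x])" if "mem V x" for i x
    by (rule eq) (use xs that set_update_subset_insert[of xs i x] in auto)
  show "hlin V (\<lambda>x. \<phi> (xs[i := x]))" if i: "i < length xs" for i
    using F[THEN conjunct1, rule_format, OF i] fv.subspace_add[OF V] fv.subspace_scale[OF V]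
    by (simp add: hlin_def up del: plus_fun_apply)
  fix \<sigma> assume \<sigma>: "\<sigma> permutes {..<length xs}"
  have "\<phi> (permute_list \<sigma> xs) = \<psi> (permute_list \<sigma> xs)"
  proof (rule eq)
    have "length (permute_list \<sigma> xs) \<noteq> 0" using xs by simp
    then show "sym_args V (permute_list \<sigma> xs)" using xs \<sigma> by (metis length_0_conv set_permute_list)
  qed
  then show "\<phi> (permute_list \<sigma> xs) = koszul_sign (map fst xs) (map \<sigma> [0..<length xs]) * \<phi> xs"
    using F[THEN conjunct2, rule_format, OF \<sigma>] eq[OF xs] by simp
qed

lemma is_sform_single: "is_sform V (\<lambda>xs. if length xs = 1 then snd (hd xs) z else 0)"
  unfolding is_sform_def
proof (intro allI impI conjI)
  fix xs :: "('a, 'b) hvec list"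
  show "hlin V (\<lambda>x. if length (xs[i := x]) = 1 then snd (hd (xs[i := x])) z else 0)" if "i < length xs" for i
    using that by (cases "length xs = 1") (auto simp: hlin_def scl_apply length_Suc_conv)
  fix \<sigma> assume \<sigma>: "\<sigma> permutes {..<length xs}"
  show "(if length (permute_list \<sigma> xs) = 1 then snd (hd (permute_list \<sigma> xs)) z else 0) =
    koszul_sign (map fst xs) (map \<sigma> [0..<length xs]) * (if length xs = 1 then snd (hd xs) z else 0)"
    using \<sigma> permutes_1[of \<sigma>] by (auto simp: koszul_sign_sorted)
qed

text \<open>
  The square of a coordinate, as a form.  The factor \<open>1 + ksgn\<close> symmetrizes it, and makes it vanish on
  pairs of odd elements.
\<close>

lemma is_sform_pair:
  "is_sform V (\<lambda>xs. if length xs = 2 then (1 + ksgn (fst (xs ! 0) * fst (xs ! 1))) * snd (xs ! 0) z * snd (xs ! 1) z else 0)"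
  unfolding is_sform_def
proof (intro allI impI conjI)
  let ?q = "\<lambda>xs. if length xs = 2 then (1 + ksgn (fst (xs ! 0) * fst (xs ! 1))) * snd (xs ! 0) z * snd (xs ! 1) z else 0"
  fix xs :: "('a, 'b) hvec list"
  show "hlin V (\<lambda>x. ?q (xs[i := x]))" if "i < length xs" for i
  proof (cases "length xs = 2")
    case True
    then obtain a b where "xs = [a, b]" by (auto simp: numeral_2_eq_2 length_Suc_conv)
    then show ?thesis using that by (cases i) (simp_all add: hlin_def scl_apply algebra_simps)
  qed (simp add: hlin_def)
  fix \<sigma> assume \<sigma>: "\<sigma> permutes {..<length xs}"
  show "?q (permute_list \<sigma> xs) = koszul_sign (map fst xs) (map \<sigma> [0..<length xs]) * ?q xs"
  proof (cases "length xs = 2")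
    case True
    then obtain a b where xs: "xs = [a, b]" by (auto simp: numeral_2_eq_2 length_Suc_conv)
    have "\<sigma> \<in> {id, Transposition.transpose 0 (Suc 0)}" using \<sigma> permutations_two by (auto simp: xs)
    moreover have "koszul_sign [fst a, fst b] [Suc 0, 0] = (ksgn (fst a * fst b) :: 'b)"
      by (simp add: koszul_sign_def mult.commute)
    ultimately show ?thesis
      by (auto simp: xs permute_list_def koszul_sign_sorted ksgn_def mult.commute)
  qed simp
qed

lemma sym_ext_sym:
  assumes "sym_args V xs" "sum_list (map fst xs) = k" "is_sform V (\<lambda>xs. h xs z)"
  shows "sym_ext (sym_space V k) h (sym V xs) z = h xs z"
  using sym_in[OF assms(1,2)] assms(3) by (simp add: sym_ext_def sym_def)

lemma sym_proj_sym:
  assumes "sym_args V xs" "sum_list (map fst xs) = k"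
  shows "sym_proj V k (sym V xs) z = (if length xs = 1 then snd (hd xs) z else 0)"
  unfolding sym_proj_def using sym_ext_sym[OF assms, of "\<lambda>xs. if length xs = 1 then snd (hd xs) else 0" z]
    is_sform_single[of V z] by (simp add: if_distrib[of "\<lambda>f. f z"] cong: if_cong)

lemma lin_on_sym_proj: "lin_on (sym_space V k) (sym_proj V k)"
  unfolding sym_proj_def by (rule lin_on_sym_ext)

lemma sym_proj_eval:
  assumes "u \<in> sym_space V k"
  shows "sym_proj V k u z = u (\<lambda>xs. if length xs = 1 then snd (hd xs) z else 0)"
  using assms by (simp add: sym_proj_def sym_ext_def if_distrib[of "\<lambda>f. f z"] cong: if_cong)

text \<open>Only a list of length 2 splits into two lists of length 1, and in two ways.\<close>

lemma sum_proper_splits: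
  assumes "\<And>S. S \<subseteq> {..<n} \<Longrightarrow> card S \<noteq> 1 \<or> n \<noteq> 2 \<Longrightarrow> F S = (0 :: 'k::field)"
  shows "(\<Sum>S\<in>Pow {..<n} - {{}, {..<n}}. F S) = (if n = (2::nat) then F {0} + F {1} else 0)"
proof (cases "n = 2")
  case True
  have "Pow {..<2::nat} - {{}, {..<2}} = {{0}, {1}}"
    by (auto simp: numeral_2_eq_2 lessThan_Suc Pow_insert)
  then show ?thesis by (simp add: True)
next
  case False
  then show ?thesis using assms by (auto intro!: sum.neutral)
qed

lemma valid_nths:
  assumes "\<forall>x\<in>set xs. mem V x" "S \<subseteq> {..<length xs}" "S \<noteq> {}" "S \<noteq> {..<length xs}"
  shows "sym_args V (nths xs S)" "sym_args V (nths xs (- S))"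
proof -
  have "{i. i < length xs \<and> i \<in> S} \<noteq> {}" "{i. i < length xs \<and> i \<in> - S} \<noteq> {}" using assms(2-4) by auto
  then have "length (nths xs S) \<noteq> 0" "length (nths xs (- S)) \<noteq> 0" by (simp_all add: length_nths)
  then show "sym_args V (nths xs S)" "sym_args V (nths xs (- S))"
    using assms(1) set_nths_subset[of xs] by auto
qed

lemma unsh_sign_pair:
  "unsh_sign [x, y] {0} = 1" "unsh_sign [x, y] {Suc 0} = ksgn (fst x * fst y)"
  by (simp_all add: unsh_sign_def koszul_sign_def mult.commute)

text \<open>The coordinate \<open>z\<close> of the projection to \<open>V\<close>, as a form.\<close>

abbreviation coordinate :: "'x \<Rightarrow> ('x, 'k::field) hvec list \<Rightarrow> 'k" where
  "coordinate z \<equiv> \<lambda>xs. if length xs = 1 then snd (hd xs) z else 0"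

lemma sum_splits_coordinate:
  fixes xs :: "('x, 'k::field) hvec list"
  assumes xs: "\<forall>x\<in>set xs. mem V x" "xs \<noteq> []"
    and t: "\<And>ys. sym_args V ys \<Longrightarrow> set ys \<subseteq> set xs \<Longrightarrow> t ys = coordinate z ys"
  shows "(\<Sum>S\<in>Pow {..<length xs} - {{}, {..<length xs}}. unsh_sign xs S * t (nths xs S) * t (nths xs (- S))) =
    (if length xs = 2 then (1 + ksgn (fst (xs ! 0) * fst (xs ! 1))) * snd (xs ! 0) z * snd (xs ! 1) z else 0)"
proof -
  have "(\<Sum>S\<in>Pow {..<length xs} - {{}, {..<length xs}}. unsh_sign xs S * t (nths xs S) * t (nths xs (- S))) =
    (\<Sum>S\<in>Pow {..<length xs} - {{}, {..<length xs}}. unsh_sign xs S * (coordinate z (nths xs S)) * (coordinate z (nths xs (- S))))"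
  proof (rule sum.cong[OF refl])
    fix S assume S: "S \<in> Pow {..<length xs} - {{}, {..<length xs}}"
    then have "sym_args V (nths xs S)" "sym_args V (nths xs (- S))" using valid_nths[OF xs(1), of S] by auto
    then show "unsh_sign xs S * t (nths xs S) * t (nths xs (- S)) =
      unsh_sign xs S * (coordinate z (nths xs S)) * (coordinate z (nths xs (- S)))"
      using t set_nths_subset[of xs] by simp
  qed
  also have "\<dots> = (if length xs = 2 then unsh_sign xs {0} * (coordinate z (nths xs {0})) * (coordinate z (nths xs (- {0}))) +
    unsh_sign xs {1} * (coordinate z (nths xs {1})) * (coordinate z (nths xs (- {1}))) else 0)"
  proof (rule sum_proper_splits)
    fix S :: "nat set" assume S: "S \<subseteq> {..<length xs}" and n: "card S \<noteq> 1 \<or> length xs \<noteq> 2"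
    have l: "length (nths xs S) = card S" "length (nths xs (- S)) = length xs - card S"
    proof -
      have "{i. i < length xs \<and> i \<in> S} = S" "{i. i < length xs \<and> i \<in> - S} = {..<length xs} - S" using S by auto
      then show "length (nths xs S) = card S" "length (nths xs (- S)) = length xs - card S"
        using S finite_subset[OF S] by (simp_all add: length_nths card_Diff_subset)
    qed
    then show "unsh_sign xs S * (coordinate z (nths xs S)) * (coordinate z (nths xs (- S))) = 0"
      using n by auto
  qed
  also have "\<dots> = (if length xs = 2 then (1 + ksgn (fst (xs ! 0) * fst (xs ! 1))) * snd (xs ! 0) z * snd (xs ! 1) z else 0)"
  proof (cases "length xs = 2")
    case True
    then obtain x y where "xs = [x, y]" by (auto simp: numeral_2_eq_2 length_Suc_conv)
    then show ?thesis by (simp add: unsh_sign_pair nths_Cons algebra_simps)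
  qed simp
  finally show ?thesis .
qed

text \<open>
  The reduced coproduct, evaluated at a pair of coordinates, is the form \<open>is_sform_pair\<close>.  This expresses
  a quadratic function of the linear parts by a linear functional on the symmetric powers.
\<close>

lemma unshuffle_coordinate:
  assumes V: "\<And>k. fv.subspace (grd V k)" and u: "u \<in> sym_space V k" and V': "V = lcpx g"
  shows "unshuffle V (idmap (lie_bar g)) k u (coordinate z, coordinate z) =
    u (\<lambda>xs. if length xs = 2 then (1 + ksgn (fst (xs ! 0) * fst (xs ! 1))) * snd (xs ! 0) z * snd (xs ! 1) z else 0)" (is "_ = u ?q")
proof -
  let ?c = "coordinate z"
  let ?K = "\<lambda>xs. \<Sum>S\<in>Pow {..<length xs} - {{}, {..<length xs}}. unsh_sign xs S *
       idmap (lie_bar g) (sum_list (map fst (nths xs S))) (sym V (nths xs S)) ?c *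
       idmap (lie_bar g) (sum_list (map fst (nths xs (- S)))) (sym V (nths xs (- S))) ?c"
  have t: "idmap (lie_bar g) (sum_list (map fst ys)) (sym V ys) ?c = ?c ys" if "sym_args V ys" for ys
    using sym_in[OF that refl] is_sform_single[of V z] by (simp add: idmap_def lie_bar_def V'[symmetric] sym_def)
  have K: "?K xs = ?q xs" if "sym_args V xs" for xs
    by (rule sum_splits_coordinate[where t = "\<lambda>ys. idmap (lie_bar g) (sum_list (map fst ys)) (sym V ys) ?c"])
      (use that t in auto)
  have form: "is_sform V ?K" by (rule is_sform_cong[OF V is_sform_pair K])
  have "(\<lambda>_ :: unit. u ?K) = (\<lambda>_. u ?q)"
  proof (rule sym_space_eqI[OF u])
    show "lin_on (sym_space V k) (\<lambda>u _. u ?K)" "lin_on (sym_space V k) (\<lambda>u _. u ?q)"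
      by (rule lin_on_coordinate[OF lin_on_id])+
    fix xs assume xs: "sym_args V xs"
    show "(\<lambda>_ :: unit. sym V xs ?K) = (\<lambda>_. sym V xs ?q)"
      using K[OF xs] form is_sform_pair[of V z] unfolding sym_def by (simp only: if_True)
  qed
  from fun_cong[where x = "()", OF this] show ?thesis using u by (simp add: unshuffle_def sym_ext_def)
qed

lemma subspace_hom:
  fixes V :: "('b, 'c::field) cplx" and W :: "('a, 'c) cplx"
  assumes W: "chain_complex W" shows "fv.subspace (grd (hom_cplx V W) r)"
  unfolding fv.subspace_def grd_hom
proof (intro conjI ballI allI)
  note sp = chain_complex_subspace[OF W]
  have cur: "cur (f + g) k x = cur f k x + cur g k x" "cur (scl c f) k x = scl c (cur f k x)" "cur 0 k x = 0"
    for f g :: "int \<times> ('b \<Rightarrow> 'c) \<times> 'a \<Rightarrow> 'c" and c k x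
    by (auto simp: cur_def fun_eq_iff scl_def)
  show "gmap r V W (cur 0)"
    using fv.subspace_0[OF sp] by (simp add: gmap_def linmap_def cur)
  fix f assume f: "f \<in> grd (hom_cplx V W) r"
  show "gmap r V W (cur (scl c f))" for c
    using f fv.subspace_scale[OF sp] unfolding grd_hom gmap_def linmap_def
    by (simp add: cur fv.scale_right_distrib mult.commute del: plus_fun_apply zero_fun_apply)
  fix g assume g: "g \<in> grd (hom_cplx V W) r"
  show "gmap r V W (cur (f + g))"
    using f g fv.subspace_add[OF sp] unfolding grd_hom gmap_def linmap_def
    by (simp add: cur fv.scale_right_distrib del: plus_fun_apply zero_fun_apply)
qed

lemma lcpx_hom_alpha: "lcpx (hom_alpha C P \<alpha> D A) = hom_cplx (ccpx D) (acpx A)"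
  by (simp add: hom_alpha_def Let_def)

abbreviation cell_pair_linf :: "(int \<times> ('x \<Rightarrow> 'k) \<times> 'x, 'k::field) linf" where
  "cell_pair_linf \<equiv> hom_alpha cone_cooperad unit_operad zero_map cell_cog pair_alg"

lemma lcpx_hom_obj: "lcpx cell_pair_linf = cell_pair_hom"
  by (simp add: lcpx_hom_alpha)

lemma linf_mor_in: "linf_mor g h T \<Longrightarrow> u \<in> sym_space (lcpx g) k \<Longrightarrow> T k u \<in> sym_space (lcpx h) k"
  using linmap_in[of _ "grd (lie_bar h) k" "T k" u] by (force simp: linf_mor_def chain_map_def gmap_def lie_bar_def)

lemma linf_mor_lin: "linf_mor g h T \<Longrightarrow> lin_on (sym_space (lcpx g) k) (T k)"
  by (auto simp: linf_mor_def chain_map_def gmap_def lie_bar_def intro!: linmap_lin_on)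

text \<open>
  The element is the square of the map \<open>f\<close> with \<open>f(e) = a\<close>.  As \<open>T\<close> is linear, the projection of
  \<open>T (T' u)\<close> is twice that of \<open>T' u\<close>, which is \<open>q(f, f) = 2\<close>.  The projection of \<open>T' v\<close> is, at the
  face, the value of the reduced coproduct of \<open>v\<close> at two coordinates.  For \<open>v = T u\<close> this can be computed
  from \<open>u\<close>, because \<open>T\<close> is a morphism of coalgebras.  This gives \<open>4 q(f, f) = 8\<close>, without
  determining \<open>T u\<close> itself.
\<close>

lemma projections_do_not_commute:
  fixes T T' :: "int \<Rightarrow> (((int \<times> ('x \<Rightarrow> 'k) \<times> 'x, 'k::field_char_0) hvec list \<Rightarrow> 'k) \<Rightarrow> 'k) \<Rightarrow>
    ((int \<times> ('x \<Rightarrow> 'k) \<times> 'x, 'k) hvec list \<Rightarrow> 'k) \<Rightarrow> 'k"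
  assumes T: "linf_mor_by cell_pair_linf cell_pair_linf proj_l T" and T': "linf_mor_by cell_pair_linf cell_pair_linf proj_r T'"
  shows "\<exists>u. T 0 (T' 0 u) \<noteq> T' 0 (T 0 u)"
proof -
  let ?H = "cell_pair_hom :: (int \<times> ('x \<Rightarrow> 'k) \<times> 'x, 'k) cplx" and ?vertex_coord = "vertex_coord :: int \<times> ('x \<Rightarrow> 'k) \<times> 'x"
    and ?face_coord = "face_coord :: int \<times> ('x \<Rightarrow> 'k) \<times> 'x"
  have sub: "fv.subspace (grd ?H k)" for k by (rule subspace_hom[OF chain_complex_pair])
  have m: "linf_mor cell_pair_linf cell_pair_linf T" "linf_mor cell_pair_linf cell_pair_linf T'" using T T' by (simp_all add: linf_mor_by_def)
  note Tin = linf_mor_in[OF m(1), unfolded lcpx_hom_obj] and T'in = linf_mor_in[OF m(2), unfolded lcpx_hom_obj]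
  note Tlin = linf_mor_lin[OF m(1), unfolded lcpx_hom_obj] and T'lin = linf_mor_lin[OF m(2), unfolded lcpx_hom_obj]
  have Tsym: "sym_proj ?H 0 (T 0 (sym ?H xs)) = proj_l xs" "sym_proj ?H 0 (T' 0 (sym ?H xs)) = proj_r xs"
    if "sym_args ?H xs" "sum_list (map fst xs) = 0" for xs
    using T[unfolded linf_mor_by_def lcpx_hom_obj Let_def, THEN conjunct2, rule_format, OF that(1)]
      T'[unfolded linf_mor_by_def lcpx_hom_obj Let_def, THEN conjunct2, rule_format, OF that(1)] that(2)
    by simp_all
  have L: "sym_proj ?H 0 (T 0 v) z = 2 * sym_proj ?H 0 v z" if v: "v \<in> sym_space ?H 0" and z: "z = ?vertex_coord \<or> z = ?face_coord" for v z
  proof -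
    have "(\<lambda>_ :: unit. sym_proj ?H 0 (T 0 v) z) = (\<lambda>_. scl 2 (sym_proj ?H 0 v) z)"
    proof (rule sym_space_eqI[OF v])
      show "lin_on (sym_space ?H 0) (\<lambda>v _. sym_proj ?H 0 (T 0 v) z)"
        by (rule lin_on_coordinate[OF lin_on_compose[OF Tlin Tin lin_on_sym_proj]])
      show "lin_on (sym_space ?H 0) (\<lambda>v _. scl 2 (sym_proj ?H 0 v) z)"
        by (rule lin_on_coordinate[OF lin_on_scl[OF lin_on_sym_proj]])
      fix xs assume xs: "sym_args ?H xs" "sum_list (map fst xs) = 0"
      have "proj_l xs z = 2 * sym_proj ?H 0 (sym ?H xs) z"
        using proj_l[of xs "line 1" 0 undefined] proj_l[of xs "line 1" 2 undefined] xs z sym_proj_sym[OF xs, of z]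
        by (auto simp: grd_cell)
      then show "(\<lambda>_ :: unit. sym_proj ?H 0 (T 0 (sym ?H xs)) z) = (\<lambda>_. scl 2 (sym_proj ?H 0 (sym ?H xs)) z)"
        by (simp add: Tsym(1)[OF xs] scl_apply)
    qed
    from fun_cong[where x = "()", OF this] show ?thesis by (simp add: scl_apply)
  qed
  let ?q = "\<lambda>xs. if length xs = 2 then (1 + ksgn (fst (xs ! 0) * fst (xs ! 1))) * snd (xs ! 0) ?vertex_coord * snd (xs ! 1) ?vertex_coord else 0"
  have R: "sym_proj ?H 0 (T' 0 v) ?face_coord = v ?q" if v: "v \<in> sym_space ?H 0" for v
  proof -
    have "(\<lambda>_ :: unit. sym_proj ?H 0 (T' 0 v) ?face_coord) = (\<lambda>_. v ?q)"
    proof (rule sym_space_eqI[OF v])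
      show "lin_on (sym_space ?H 0) (\<lambda>v _. sym_proj ?H 0 (T' 0 v) ?face_coord)"
        by (rule lin_on_coordinate[OF lin_on_compose[OF T'lin T'in lin_on_sym_proj]])
      show "lin_on (sym_space ?H 0) (\<lambda>v _. v ?q)"
        by (rule lin_on_coordinate[OF lin_on_id])
      fix xs assume xs: "sym_args ?H xs" "sum_list (map fst xs) = 0"
      have "proj_r xs ?face_coord = ?q xs"
      proof (cases "length xs = 2")
        case True
        then obtain i a j b where ab: "xs = [(i, a), (j, b)]" by (auto simp: numeral_2_eq_2 length_Suc_conv)
        have h: "a \<in> grd ?H i" "b \<in> grd ?H j" using xs(1) by (simp_all add: ab)
        have "a ?vertex_coord = 0 \<or> even i"
        proof (cases "i = 0 \<or> i = 2")
          case False
          then have "cur a 0 (line 1) undefined = 0" using hom_degree[OF h(1)] by simp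
          then show ?thesis by (simp add: cur_def)
        qed auto
        then show ?thesis using proj_r[of xs] xs by (auto simp: ab ksgn_def)
      next
        case False
        then show ?thesis using proj_r[of xs] xs by simp
      qed
      moreover have "sym ?H xs ?q = ?q xs" using is_sform_pair[of ?H ?vertex_coord] by (simp only: sym_def if_True)
      ultimately show "(\<lambda>_ :: unit. sym_proj ?H 0 (T' 0 (sym ?H xs)) ?face_coord) = (\<lambda>_. sym ?H xs ?q)"
        by (simp only: Tsym(2)[OF xs])
    qed
    from fun_cong[where x = "()", OF this] show ?thesis .
  qed
  define f :: "(int \<times> ('x \<Rightarrow> 'k) \<times> 'x, 'k) hvec" where
    "f = (0, uncur (\<lambda>k x. if k = 0 \<and> x \<in> range line then x else 0))"
  have f: "mem ?H f" "fst f = 0" "snd f ?vertex_coord = 1"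
  proof -
    have "gmap 0 cell_cplx pair_cplx (\<lambda>k x. if k = 0 \<and> x \<in> range line then x else 0 :: 'x \<Rightarrow> 'k)"
      using fv.subspace_add[OF subspace_range_line] fv.subspace_scale[OF subspace_range_line]
      by (auto simp: gmap_def linmap_def grd_cell grd_pair line_scl simp del: plus_fun_apply)
    then show "mem ?H f" by (simp add: f_def grd_hom cur_def uncur_def)
  qed (simp_all add: f_def uncur_def)
  let ?u = "sym ?H [f, f]"
  have u: "?u \<in> sym_space ?H 0" by (rule sym_in) (simp_all add: f)
  have f1: "sym_args ?H [f]" "sum_list (map fst [f]) = 0" and f2: "sym_args ?H [f, f]" "sum_list (map fst [f, f]) = 0"
    using f by simp_all
  have "sym_proj ?H 0 (T 0 (T' 0 ?u)) ?face_coord = 4"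
    using L[OF T'in[OF u], of ?face_coord] Tsym(2)[OF f2] proj_r[of "[f, f]"] f by simp
  moreover have "sym_proj ?H 0 (T' 0 (T 0 ?u)) ?face_coord = unshuffle ?H T 0 ?u (coordinate ?vertex_coord, coordinate ?vertex_coord)"
    using R[OF Tin[OF u]] unshuffle_coordinate[OF sub Tin[OF u] lcpx_hom_obj[symmetric], of ?vertex_coord] m(1) u
    by (simp add: linf_mor_def lie_bar_def lcpx_hom_obj)
  \<comment> \<open>The value is 0 if the sum over the splittings is not a form; both values are different from 4.\<close>
  moreover have "unshuffle ?H T 0 ?u (coordinate ?vertex_coord, coordinate ?vertex_coord) \<in> {0, 8}"
  proof -
    have "T 0 (sym ?H [f]) (coordinate ?vertex_coord) = 2"
      using L[OF sym_in[OF f1], of ?vertex_coord] sym_proj_eval[OF Tin[OF sym_in[OF f1]], of ?vertex_coord] sym_proj_sym[OF f1, of ?vertex_coord] f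
      by simp
    then have t: "T (sum_list (map fst [f])) (sym ?H [f]) (coordinate ?vertex_coord) = 2" using f by simp
    let ?U = "\<lambda>xs. \<Sum>S\<in>Pow {..<length xs} - {{}, {..<length xs}}. unsh_sign xs S *
       T (sum_list (map fst (nths xs S))) (sym ?H (nths xs S)) (coordinate ?vertex_coord) *
       T (sum_list (map fst (nths xs (- S)))) (sym ?H (nths xs (- S))) (coordinate ?vertex_coord)"
    have "Pow {..<Suc (Suc 0)} - {{}, {..<Suc (Suc 0)}} = {{0}, {Suc 0}}" by (auto simp: lessThan_Suc Pow_insert)
    then have "?U [f, f] = 8" using f(2) t by (simp add: unsh_sign_pair nths_Cons)
    then show ?thesis using u by (simp add: unshuffle_def sym_ext_def sym_def)
  qed
  ultimately have "sym_proj ?H 0 (T 0 (T' 0 ?u)) ?face_coord \<noteq> sym_proj ?H 0 (T' 0 (T 0 ?u)) ?face_coord" by auto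
  then have "T 0 (T' 0 ?u) \<noteq> T' 0 (T 0 ?u)" by metis
  then show ?thesis by blast
qed

lemma unit_operad_simps: "opm unit_operad = unit_smod" "opid unit_operad = line 1"
  by (simp_all add: unit_operad_def)

lemma is_hom_l_proj_l:
  "is_hom_l cone_cooperad unit_operad zero_map cell_cog cell_cog pair_alg pair_alg
    (scale_map 2 (schur unit_smod cell_cplx)) (idmap pair_cplx) T \<longleftrightarrow> linf_mor_by cell_pair_linf cell_pair_linf proj_l T"
  by (simp add: is_hom_l_def proj_l_def[abs_def] unit_operad_simps)

lemma cdec_cell_cog: "cdec cell_cog = cell_dec"
  by (simp add: cell_cog_def)

lemma is_hom_r_proj_r:
  "is_hom_r cone_cooperad unit_operad zero_map cell_cog cell_cog pair_alg pair_alg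
    (idmap cell_cplx) psi T \<longleftrightarrow> linf_mor_by cell_pair_linf cell_pair_linf proj_r T"
  by (simp add: is_hom_r_def proj_r_def[abs_def] cdec_cell_cog)

lemma idmap_gmap:
  assumes f: "gmap 0 V W f" and V: "chain_complex V" and W: "chain_complex W"
  shows "(\<lambda>k u. idmap W k (f k u)) = f" "(\<lambda>k u. f k (idmap V k u)) = f"
proof -
  have out: "f k u = 0" if "u \<notin> grd V k" for k u using f that by (simp add: gmap_def linmap_def)
  have 0: "f k 0 = 0" for k
    using gmap_scl[OF f fv.subspace_0[OF chain_complex_subspace[OF V]], of k 0] by simp
  have "f k u \<in> grd W k" for k u
    using gmap_in[OF f, of u k] out[of u k] fv.subspace_0[OF chain_complex_subspace[OF W]] by (cases "u \<in> grd V k") simp_all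
  then show "(\<lambda>k u. idmap W k (f k u)) = f" by (simp add: idmap_def)
  show "(\<lambda>k u. f k (idmap V k u)) = f"
    using out 0 by (intro ext) (simp add: idmap_def)
qed

text \<open>
  The arrows \<open>(\<Phi>, 1)\<close> and \<open>(1, \<Psi>)\<close> lie in the two subcategories on which the bifunctor is prescribed,
  as identities are strict, and they commute.
\<close>

theorem theorem6p6:
  shows "\<exists>(C :: (nat, 'k::field_char_0) cooperad) (P :: (nat, 'k) operad) \<alpha>.
    is_cooperad C \<and> is_operad P \<and> koszul_morphism C P \<alpha> \<and>
    \<not> (\<exists>(Ho :: (nat, 'u::infinite, 'k) cog \<times> (nat, 'u, 'k) alg \<Rightarrow> (int \<times> ('u \<Rightarrow> 'k) \<times> 'u, 'k) linf) Ha.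
        is_functor (source_cat C P \<alpha>) linf_cat Ho Ha \<and>
        restricts_to_l C P \<alpha> Ho Ha \<and> restricts_to_r C P \<alpha> Ho Ha)"
proof (intro exI[of _ cone_cooperad] exI[of _ unit_operad] exI[of _ zero_map] conjI notI; (elim exE conjE)?)
  show "is_cooperad (cone_cooperad :: (nat, 'k) cooperad)" by (rule is_cooperad_cone)
  show "is_operad (unit_operad :: (nat, 'k) operad)" by (rule is_operad_unit)
  show "koszul_morphism (cone_cooperad :: (nat, 'k) cooperad) unit_operad zero_map" by (rule koszul_morphism_zero)
  fix Ho :: "(nat, 'u, 'k) cog \<times> (nat, 'u, 'k) alg \<Rightarrow> (int \<times> ('u \<Rightarrow> 'k) \<times> 'u, 'k) linf" and Ha
  assume F: "is_functor (source_cat cone_cooperad unit_operad zero_map) linf_cat Ho Ha"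
    and l: "restricts_to_l cone_cooperad unit_operad zero_map Ho Ha"
    and r: "restricts_to_r cone_cooperad unit_operad zero_map Ho Ha"
  let ?D = "cell_cog :: (nat, 'u, 'k) cog" and ?A = "pair_alg :: (nat, 'u, 'k) alg"
  let ?ID = "schur (unit_smod :: (nat, 'k) smod) (cell_cplx :: ('u, 'k) cplx)"
  let ?CA = "schur (cone_smod :: (nat, 'k) smod) (pair_cplx :: ('u, 'k) cplx)"
  let ?\<Phi> = "scale_map 2 ?ID"
  have D: "is_cog cone_cooperad ?D" by (rule is_cog_cell)
  have A: "is_alg unit_operad ?A" by (rule is_alg_unit[OF chain_complex_pair])
  have two: "(2 :: 'k) \<noteq> 0" by simp
  have ID: "chain_complex ?ID" by (rule chain_complex_unit_composite[OF smodule_cell trivial_action_ar0])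
  have CA: "chain_complex ?CA" by (rule chain_complex_bar_pair)
  have arr_\<Phi>: "?\<Phi> \<in> arr (inf_cog_cat cone_cooperad unit_operad zero_map) ?D ?D"
    "idmap ?ID \<in> arr (inf_cog_cat cone_cooperad unit_operad zero_map) ?D ?D"
    using alg_mor_scale[OF two] alg_mor_scale[of "1 :: 'k"] by (simp_all add: inf_cog_cat_def scale_map_one)
  have arr_\<Psi>: "psi \<in> arr (inf_alg_cat cone_cooperad unit_operad zero_map) ?A ?A"
    "idmap ?CA \<in> arr (inf_alg_cat cone_cooperad unit_operad zero_map) ?A ?A"
    using cog_mor_psi cog_mor_idmap_bar by (simp_all add: inf_alg_cat_def)
  let ?X = "(?D, ?A)"
  let ?T = "Ha ?X ?X (?\<Phi>, idmap ?CA)" and ?T' = "Ha ?X ?X (idmap ?ID, psi)"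
  have "is_hom_l cone_cooperad unit_operad zero_map ?D ?D ?A ?A ?\<Phi> (idmap pair_cplx)
      (Ha ?X ?X (?\<Phi>, schur_r (com cone_cooperad) (acpx ?A) (acpx ?A) (idmap pair_cplx)))"
    using l D A arr_\<Phi>(1) alg_mor_idmap_pair unfolding restricts_to_l_def by blast
  then have T: "linf_mor_by cell_pair_linf cell_pair_linf proj_l ?T"
    by (simp only: cone_cooperad_simps acpx_pair_alg schur_r_idmap_pair is_hom_l_proj_l)
  have "is_hom_r cone_cooperad unit_operad zero_map ?D ?D ?A ?A (idmap cell_cplx) psi
      (Ha ?X ?X (schur_r (opm unit_operad) (ccpx ?D) (ccpx ?D) (idmap cell_cplx), psi))"
    using r D A arr_\<Psi>(1) cog_mor_idmap_cell unfolding restricts_to_r_def by blast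
  then have T': "linf_mor_by cell_pair_linf cell_pair_linf proj_r ?T'"
    by (simp only: unit_operad_simps ccpx_cell_cog schur_r_idmap_cell is_hom_r_proj_r)
  have X: "?X \<in> ob (source_cat cone_cooperad unit_operad zero_map)"
    using D A by (simp add: source_cat_def prod_cat_def op_cat_def inf_cog_cat_def inf_alg_cat_def)
  have arrs: "(?\<Phi>, idmap ?CA) \<in> arr (source_cat cone_cooperad unit_operad zero_map) ?X ?X"
    "(idmap ?ID, psi) \<in> arr (source_cat cone_cooperad unit_operad zero_map) ?X ?X"
    using arr_\<Phi> arr_\<Psi> by (simp_all add: source_cat_def prod_cat_def op_cat_def)
  let ?c = "cmp (source_cat cone_cooperad unit_operad zero_map) :: _ \<Rightarrow> _ \<Rightarrow>
    (int \<Rightarrow> ((nat, 'u, 'k) form \<Rightarrow> 'k) \<Rightarrow> (nat, 'u, 'k) form \<Rightarrow> 'k) \<times> (int \<Rightarrow> ((nat, 'u, 'k) form \<Rightarrow> 'k) \<Rightarrow> (nat, 'u, 'k) form \<Rightarrow> 'k)"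
  have commute: "?c (?\<Phi>, idmap ?CA) (idmap ?ID, psi) = ?c (idmap ?ID, psi) (?\<Phi>, idmap ?CA)"
    by (simp only: source_cat_def prod_cat_def op_cat_def inf_cog_cat_def inf_alg_cat_def cat.simps fst_conv snd_conv
        idmap_gmap[OF chain_map_gmap[OF chain_map_scale[OF ID]] ID ID] idmap_gmap[OF gmap_psi CA CA])
  have Ha_cmp: "Ha ?X ?X (?c g f) = (\<lambda>k u. Ha ?X ?X g k (Ha ?X ?X f k u))"
    if "f \<in> arr (source_cat cone_cooperad unit_operad zero_map) ?X ?X"
      "g \<in> arr (source_cat cone_cooperad unit_operad zero_map) ?X ?X" for f g
    using F X that by (simp add: is_functor_def linf_cat_def)
  have "(\<lambda>k u. ?T k (?T' k u)) = (\<lambda>k u. ?T' k (?T k u))"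
    by (rule box_equals[OF arg_cong[where f = "Ha ?X ?X", OF commute] Ha_cmp[OF arrs(2) arrs(1)] Ha_cmp[OF arrs(1) arrs(2)]])
  from fun_cong[OF fun_cong[OF this, of 0]] have "?T 0 (?T' 0 u) = ?T' 0 (?T 0 u)" for u .
  then show False using projections_do_not_commute[OF T T'] by blast
qed

end
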